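(* Let $k>0$, let $\tilde m_1,\tilde m_2$ be sequences of generalized moments, and let $P(\lambda,\zeta)$ be a polynomial of two variables of order $p$ with respect to $\lambda$. Assume that the formal solution $\hat u\in\mathcal{O}[[t]]$ of the Cauchy problem $$(\mathrm{I})\quad P(\partial_{\tilde m_1,t},\partial_{\tilde m_2,z})u=0,\qquad \partial^l_{\tilde m_1,t}u(0,z)=\varphi_l(z)\in\mathcal{O}(D),\quad l=0,\dots,p-1,$$ is $k$-summable with singular directions $d_1,\dots,d_n$, $0\le d_1<\dots<d_n<2\pi$, and that $\tilde m=m\Gamma_{1/k}$ is a sequence of generalized moments of order $1/k$ (with $m$ preserving summability). Then $v=\hat{\mathcal{B}}_{\tilde m,t}\hat u\in\mathcal{O}(D\times D)$ is a holomorphic solution of the Cauchy problem $$P(\partial_{\tilde m\tilde m_1,t},\partial_{\tilde m_2,z})v=0,\qquad \partial^l_{\tilde m\tilde m_1,t}v(0,z)=\varphi_l(z),\quad l=0,\dots,p-1.$$ Moreover, from $v$ one obtains a family of $n$ actual solutions $\{u_1,\dots,u_n\}$ of (I), where $$u_j(t,z)=u^\theta(t,z)=\mathcal{L}_{\tilde m,\theta}v(t,z)\quad\text{for }\theta\in(d_{j-1},d_j),\quad j=1,\dots,n,\qquad d_0:=d_n-2\pi,$$ and $u_j\in\mathcal{O}(G_j\times D)$, where $G_j=G_j\big(\frac{d_{j-1}+d_j}{2},\frac{\pi}{k}+d_j-d_{j-1}\big)$ is a sectorial region of opening $\frac{\pi}{k}+d_j-d_{j-1}>0$ and bisecting direction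 $\frac{d_{j-1}+d_j}{2}$. Furthermore, the jump for $\hat u$ across the singular direction $d_j$ ($j=1,\dots,n$) is given by $$J_{L_{d_j},k}\hat u(t,0)=u^{d_j^+}(t,0)-u^{d_j^-}(t,0)=\left[\frac{1}{2\pi i}\oint_{\tilde\gamma_{s,d_j}}\frac{v(\zeta,0)}{\zeta}e_m\Big(\frac{s}{\zeta}\Big)\,d\zeta\right]_{d_j}\left[\frac{k(s/t)^ke^{-(s/t)^k}}{s}\right].$$
   Context: All sequences are sequences of positive real numbers with zeroth term $1$; products and inverses are termwise; $\Gamma_s=(\Gamma(1+sn))_{n\ge0}$, $s\ge0$. Spaces. $D_r=\{|z|<r\}$; $D$ is such a disc with unspecified radius (may change between occurrences). $\mathcal{O}_r$ is the Banach space of functions holomorphic on $D_r$ and continuous on $\overline D_r$, with sup norm; $\mathcal{O}$ means $\mathcal{O}_r$ with unspecified $r>0$. $S_d(\alpha)=\{re^{i\phi}:r>0,|\phi-d|<\alpha/2\}$ in the universal covering $\widetilde{\mathbb{C}}$ of $\mathbb{C}\setminus\{0\}$; $S_d$ is such a sector with unspecified opening; $\hat S_d=S_d\cup D$. $\mathcal{O}^k(\hat S_d,\mathbb{E})$: $\mathbb{E}$-valued holomorphic functions $f$ on $\hat S_d=S_d(\alpha)\cup D_r$ such that for all $\tilde\alpha<\alpha$, $\tilde r<r$ there are $A,B>0$ with $\|f(t)\|<Ae^{B|t|^k}$ on $S_d(\tilde\alpha)\cup D_{\tilde r}$. A sectorial region $G=G(d,\alpha)$ of opening $\alpha$ and bisecting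 direction $d$ is a set $G\subseteq S_d(\alpha)$ (an open connected set) such that for every $\beta\in(0,\alpha)$ there is $\rho>0$ with $\{re^{i\phi}:0<r<\rho,|\phi-d|<\beta/2\}\subseteq G$. Operators. $\hat{\mathcal{B}}_{m,t}(\sum a_nt^n)=\sum\frac{a_n}{m(n)}t^n$; $\partial_{m,t}(\sum a_nt^n)=\sum\frac{m(n+1)}{m(n)}a_{n+1}t^n$; similarly in $z$. Summability. $\hat u\in\mathbb{E}[[t]]$ is $k$-summable in direction $d$ ($\hat u\in\mathbb{E}\{t\}_{k,d}$) if $\hat{\mathcal{B}}_{\Gamma_{1/k},t}\hat u\in\mathcal{O}^k(\hat S_d,\mathbb{E})$ for some disc-sector $\hat S_d$. Its $k$-sum is $u^d=\mathcal{S}_{k,d}\hat u=\mathcal{L}_{\Gamma_{1/k},\theta}\hat{\mathcal{B}}_{\Gamma_{1/k},t}\hat u$ for $\theta$ close to $d$, where $(\mathcal{L}_{\Gamma_{1/k},\theta}g)(t)=\int_{e^{i\theta}\mathbb{R}_+}g(s)e^{-(s/t)^k}k(s/t)^k\frac{ds}{s}$. $\hat u$ is $k$-summable with singular directions $d_1,\dots,d_n$ if it is $k$-summable in all directions except exactly $d_1,\dots,d_n$ (modulo $2\pi$). A sequence $m$ preserves summability if for every $k>0$, $d\in\mathbb{R}$, complex Banach space $\mathbb{E}$ and $\hat u\in\mathbb{E}[[t]]$: $\hat u\in\mathbb{E}\{t\}_{k,d}\iff\hat{\mathcal{B}}_{m,t}\hat u\in\mathbb{E}\{t\}_{k,d}$;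 every such $m$ satisfies $a^n\le m(n)\le A^n$ for some $a,A>0$. A sequence of generalized moments of order $s\ge0$ is a sequence $m\Gamma_s$ with $m$ preserving summability. Kernel and Laplace-like operator. $e_m(z)=\sum_{n\ge0}m(n)z^n$; for $m$ preserving summability it is holomorphic on $D_{1/A}$ and extends holomorphically to $D_{1/A}\cup(\mathbb{C}\setminus\mathbb{R}_+)$. $\mathcal{L}_{\tilde m,\theta}=\mathcal{L}_{\Gamma_{1/k},\theta}\circ\mathcal{B}_{m^{-1}}$, where for $g(s)=\sum g_ns^n$ in $\mathcal{O}^k(\hat S_\theta,\mathbb{E})$ the function $\mathcal{B}_{m^{-1}}g$ is the analytic continuation to $S_\theta$ of $\sum m(n)g_ns^n$ (operators act in the variable $t$, resp. $s$, with $z$ as a parameter). Actual solution. $u\in\mathcal{O}(G,\mathcal{O})$, $G$ a sectorial region, is an actual solution of (I) if $P(\partial_{\tilde m_1,t},\partial_{\tilde m_2,z})u=0$ and $\lim_{t\to0,\,t\in G}\partial_t^lu(t,z)=\frac{l!}{\tilde m_1(l)}\varphi_l(z)$ for $l=0,\dots,p-1$. Here the moment derivative in $t$ of a $k$-sum is understood by $\partial_{\tilde m_1,t}(\mathcal{S}_{k,\theta}\hat f)=\mathcal{S}_{k,\theta}(\partial_{\tilde m_1,t}\hat f)$. Jumps and hyperfunctions. $L_d=\{t\in\widetilde{\mathbb{C}}:\arg t=d\}$. $d^+$ (resp. $d^-$) is a direction close to $d$ and greater (resp. less) than $d$; $J_{L_d,k}\hat u=u^{d^+}-u^{d^-}$,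 considered for $t$ with $|\arg t-d|<\frac{\pi}{2k}$ and $|t|$ sufficiently small. For $g\in\mathcal{O}^k(D\cup(S_d\setminus L_d))$ (holomorphic and of exponential growth of order at most $k$ in closed subsectors on each side of $L_d$), $[g(s)]_d$ denotes its class modulo $\mathcal{O}^k(\hat S_d)$, acting by $[g(s)]_d[\varphi(s)]=\int_{\gamma_d}g(s)\varphi(s)\,ds$, where $\gamma_d$ runs along the half-line from $e^{id^-}\infty$ to $0$ and then from $0$ to $e^{id^+}\infty$. The contour $\tilde\gamma_{s,d}$ (for $s\in D\cup(S_d\setminus L_d)$) is a positively oriented closed contour in $D\cup(S_d\setminus L_d)$ surrounding the segment $[0,As]$, so that $s/\zeta\in D_{1/A}\cup(\mathbb{C}\setminus\mathbb{R}_+)$ for every $\zeta$ on it. *)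

theory Defs
  imports "HOL-Complex_Analysis.Complex_Analysis"
begin

text \<open>
  The space of functions holomorphic on a disc depends on the radius, so Banach spaces are given by a
  carrier. A vector space is a linear subspace of a function space \<open>'i \<Rightarrow> complex\<close> with pointwise
  operations (every complex vector space has this form, by taking coordinates in a Hamel basis);
  the norm is arbitrary. Nothing is required of the norm outside the carrier.
\<close>

record 'i cspace =
  carr :: "('i \<Rightarrow> complex) set"
  nrm :: "('i \<Rightarrow> complex) \<Rightarrow> real"

definition complex_banach :: "'i cspace \<Rightarrow> bool" where
  "complex_banach E \<longleftrightarrow>
     (\<lambda>i. 0) \<in> carr E \<and>
     (\<forall>x\<in>carr E. \<forall>y\<in>carr E. (\<lambda>i. x i + y i) \<in> carr E) \<and>
     (\<forall>c. \<forall>x\<in>carr E. (\<lambda>i. c * x i) \<in> carr E) \<and>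
     (\<forall>x\<in>carr E. nrm E x \<ge> 0 \<and> (nrm E x = 0 \<longrightarrow> x = (\<lambda>i. 0))) \<and>
     (\<forall>c. \<forall>x\<in>carr E. nrm E (\<lambda>i. c * x i) = cmod c * nrm E x) \<and>
     (\<forall>x\<in>carr E. \<forall>y\<in>carr E. nrm E (\<lambda>i. x i + y i) \<le> nrm E x + nrm E y) \<and>
     (\<forall>X. (\<forall>n. X n \<in> carr E) \<and>
          (\<forall>\<epsilon>>0. \<exists>N. \<forall>a\<ge>N. \<forall>b\<ge>N. nrm E (\<lambda>i. X a i - X b i) < \<epsilon>) \<longrightarrow>
          (\<exists>x\<in>carr E. (\<lambda>n. nrm E (\<lambda>i. X n i - x i)) \<longlonglongrightarrow> 0))"

definition esums :: "'i cspace \<Rightarrow> (nat \<Rightarrow> 'i \<Rightarrow> complex) \<Rightarrow> complex \<Rightarrow> ('i \<Rightarrow> complex) \<Rightarrow> bool" where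
  "esums E a t x \<longleftrightarrow> (\<lambda>N. nrm E (\<lambda>i. (\<Sum>n<N. t ^ n * a n i) - x i)) \<longlonglongrightarrow> 0"

definition eholomorphic :: "'i cspace \<Rightarrow> complex set \<Rightarrow> (complex \<Rightarrow> 'i \<Rightarrow> complex) \<Rightarrow> bool" where
  "eholomorphic E U f \<longleftrightarrow>
     (\<forall>t\<in>U. f t \<in> carr E \<and>
        (\<exists>D\<in>carr E. ((\<lambda>h. nrm E (\<lambda>i. (f (t + h) i - f t i) / h - D i)) \<longlongrightarrow> 0) (at 0)))"

text \<open>
  The space of functions holomorphic on the open disc of radius \<open>r\<close> and continuous on the closed one;
  they are extended by zero so that equality of elements is equality of functions.
\<close>

definition O_space :: "real \<Rightarrow> complex cspace" where
  "O_space r =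
     \<lparr>carr = {f. continuous_on (cball 0 r) f \<and> f holomorphic_on ball 0 r \<and> (\<forall>z. z \<notin> cball 0 r \<longrightarrow> f z = 0)},
      nrm = (\<lambda>f. SUP z\<in>cball 0 r. cmod (f z))\<rparr>"

definition holomorphic2_on :: "(complex \<times> complex \<Rightarrow> complex) \<Rightarrow> (complex \<times> complex) set \<Rightarrow> bool" where
  "holomorphic2_on f S \<longleftrightarrow>
     (\<forall>x\<in>S. \<exists>a b. (f has_derivative (\<lambda>(h1, h2). a * h1 + b * h2)) (at x))"

definition sector :: "real \<Rightarrow> real \<Rightarrow> complex set" where
  "sector d \<alpha> = {of_real x * cis \<phi> | x \<phi>. 0 < x \<and> \<bar>\<phi> - d\<bar> < \<alpha> / 2}"

definition disc_sector :: "real \<Rightarrow> real \<Rightarrow> real \<Rightarrow> complex set" where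
  "disc_sector d \<alpha> r = sector d \<alpha> \<union> ball 0 r"

definition Ok :: "'i cspace \<Rightarrow> real \<Rightarrow> real \<Rightarrow> real \<Rightarrow> real \<Rightarrow> (complex \<Rightarrow> 'i \<Rightarrow> complex) \<Rightarrow> bool" where
  "Ok E k d \<alpha> r f \<longleftrightarrow>
     eholomorphic E (disc_sector d \<alpha> r) f \<and>
     (\<forall>\<alpha>'\<in>{0<..<\<alpha>}. \<forall>r'\<in>{0<..<r}. \<exists>A>0. \<exists>B>0. \<forall>t\<in>disc_sector d \<alpha>' r'.
        nrm E (f t) < A * exp (B * cmod t powr k))"

text \<open>
  \<open>sector_cont E d b g\<close>: the power series with coefficients \<open>b\<close> converges near 0, and its sum extends
  to the holomorphic function \<open>g\<close> on some disc-sector in direction \<open>d\<close>. Openings up to \<open>2 * pi\<close>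
  suffice because the opening is only required to exist, so this sector lies in the complex plane.
\<close>

definition sector_cont :: "'i cspace \<Rightarrow> real \<Rightarrow> (nat \<Rightarrow> 'i \<Rightarrow> complex) \<Rightarrow> (complex \<Rightarrow> 'i \<Rightarrow> complex) \<Rightarrow> bool" where
  "sector_cont E d b g \<longleftrightarrow>
     (\<exists>\<alpha> r. 0 < \<alpha> \<and> \<alpha> \<le> 2 * pi \<and> 0 < r \<and> eholomorphic E (disc_sector d \<alpha> r) g \<and>
        (\<exists>\<rho>>0. \<forall>t\<in>ball 0 \<rho>. esums E b t (g t)))"

definition sector_cont_Ok :: "'i cspace \<Rightarrow> real \<Rightarrow> real \<Rightarrow> (nat \<Rightarrow> 'i \<Rightarrow> complex) \<Rightarrow> (complex \<Rightarrow> 'i \<Rightarrow> complex) \<Rightarrow> bool" where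
  "sector_cont_Ok E k d b g \<longleftrightarrow>
     (\<exists>\<alpha> r. 0 < \<alpha> \<and> \<alpha> \<le> 2 * pi \<and> 0 < r \<and> Ok E k d \<alpha> r g \<and>
        (\<exists>\<rho>>0. \<forall>t\<in>ball 0 \<rho>. esums E b t (g t)))"

definition Gamma_seq :: "real \<Rightarrow> nat \<Rightarrow> real" where
  "Gamma_seq s n = Gamma (1 + s * real n)"

definition borel_transform :: "(nat \<Rightarrow> real) \<Rightarrow> (nat \<Rightarrow> 'i \<Rightarrow> complex) \<Rightarrow> nat \<Rightarrow> 'i \<Rightarrow> complex" where
  "borel_transform m u n = (\<lambda>i. u n i / of_real (m n))"

definition moment_deriv_t :: "(nat \<Rightarrow> real) \<Rightarrow> (nat \<Rightarrow> 'i \<Rightarrow> complex) \<Rightarrow> nat \<Rightarrow> 'i \<Rightarrow> complex" where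
  "moment_deriv_t m u n = (\<lambda>i. of_real (m (Suc n) / m n) * u (Suc n) i)"

definition moment_deriv_z :: "(nat \<Rightarrow> real) \<Rightarrow> complex fps \<Rightarrow> complex fps" where
  "moment_deriv_z m f = Abs_fps (\<lambda>n. of_real (m (Suc n) / m n) * fps_nth f (Suc n))"

definition k_summable :: "'i cspace \<Rightarrow> real \<Rightarrow> real \<Rightarrow> (nat \<Rightarrow> 'i \<Rightarrow> complex) \<Rightarrow> bool" where
  "k_summable E k d u \<longleftrightarrow>
     (\<forall>n. u n \<in> carr E) \<and> (\<exists>g. sector_cont_Ok E k d (borel_transform (Gamma_seq (1 / k)) u) g)"

definition k_summable_singular ::
    "'i cspace \<Rightarrow> real \<Rightarrow> real set \<Rightarrow> (nat \<Rightarrow> 'i \<Rightarrow> complex) \<Rightarrow> bool" where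
  "k_summable_singular E k S u \<longleftrightarrow>
     (\<forall>\<theta>. k_summable E k \<theta> u \<longleftrightarrow> \<not> (\<exists>d\<in>S. \<exists>q::int. \<theta> = d + 2 * pi * of_int q))"

text \<open>
  Quantifying over Banach spaces inside \<open>complex \<Rightarrow> complex\<close> is no restriction: summability of a
  series with values in an arbitrary Banach space is decided in the closed linear span of its
  coefficients, which is separable, has a Hamel basis of at most continuum cardinality, and is
  therefore a space of (finitely supported) coordinate functions on \<open>complex\<close>.
\<close>

definition preserves_summability :: "(nat \<Rightarrow> real) \<Rightarrow> bool" where
  "preserves_summability m \<longleftrightarrow>
     (\<forall>n. 0 < m n) \<and> m 0 = 1 \<and>
     (\<forall>k>0. \<forall>d. \<forall>E :: complex cspace. complex_banach E \<longrightarrow>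
        (\<forall>u. (\<forall>n. u n \<in> carr E) \<longrightarrow>
           (k_summable E k d u \<longleftrightarrow> k_summable E k d (borel_transform m u))))"

definition generalized_moments :: "real \<Rightarrow> (nat \<Rightarrow> real) \<Rightarrow> bool" where
  "generalized_moments s mt \<longleftrightarrow>
     0 \<le> s \<and> (\<exists>m. preserves_summability m \<and> mt = (\<lambda>n. m n * Gamma_seq s n))"

text \<open>
  \<open>P :: complex poly poly\<close> is a polynomial in \<open>\<lambda>\<close> (outer variable) whose coefficients are polynomials
  in \<open>\<zeta>\<close>. In \<open>apply_P\<close>, \<open>w i\<close> is the \<open>i\<close>-th \<open>t\<close>-moment derivative (one coefficient in \<open>t\<close>, or the
  value at one point \<open>t\<close>), a function of \<open>z\<close> holomorphic near 0. The result is a germ in \<open>z\<close>, and is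
  given by its Taylor series: the moment derivative in \<open>z\<close> may shrink the disc of convergence.
\<close>

definition apply_P :: "complex poly poly \<Rightarrow> (nat \<Rightarrow> real) \<Rightarrow> (nat \<Rightarrow> complex \<Rightarrow> complex) \<Rightarrow> complex fps" where
  "apply_P P m2 w =
     (\<Sum>i\<le>degree P. \<Sum>j\<le>degree (coeff P i).
        fps_const (coeff (coeff P i) j) * (moment_deriv_z m2 ^^ j) (fps_expansion (w i) 0))"

definition formal_solution ::
    "real \<Rightarrow> complex poly poly \<Rightarrow> (nat \<Rightarrow> real) \<Rightarrow> (nat \<Rightarrow> real) \<Rightarrow> (nat \<Rightarrow> complex \<Rightarrow> complex) \<Rightarrow>
     (nat \<Rightarrow> complex \<Rightarrow> complex) \<Rightarrow> bool" where
  "formal_solution r P m1 m2 \<phi> u \<longleftrightarrow>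
     (\<forall>n. u n \<in> carr (O_space r)) \<and>
     (\<forall>n. apply_P P m2 (\<lambda>i. (moment_deriv_t m1 ^^ i) u n) = 0) \<and>
     (\<forall>l<degree P. \<forall>z\<in>ball 0 r. (moment_deriv_t m1 ^^ l) u 0 z = \<phi> l z)"

text \<open>
  A point \<open>t\<close> of the universal covering of the punctured plane is represented by its logarithm
  \<open>\<tau>\<close>: \<open>t = exp \<tau>\<close>, \<open>\<bar>t\<bar> = exp (Re \<tau>)\<close>, \<open>arg t = Im \<tau>\<close>, \<open>t\<^sup>k = exp (k * \<tau>)\<close>. This is a global
  holomorphic chart, in which \<open>d/dt\<close> is \<open>exp (-\<tau>) * d/d\<tau>\<close>.
\<close>

definition has_ray_integral :: "real \<Rightarrow> (complex \<Rightarrow> complex) \<Rightarrow> complex \<Rightarrow> bool" where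
  "has_ray_integral \<theta> F I \<longleftrightarrow>
     set_integrable lborel {0<..} (\<lambda>x. F (of_real (ln x) + \<i> * of_real \<theta>) * cis \<theta>) \<and>
     (LINT x:{0<..}|lborel. F (of_real (ln x) + \<i> * of_real \<theta>) * cis \<theta>) = I"

text \<open>The function \<open>k (s/t)\<^sup>k exp (-(s/t)\<^sup>k) / s\<close> of \<open>s = exp \<sigma>\<close>, with \<open>t = exp \<tau>\<close>.\<close>

definition laplace_kernel :: "real \<Rightarrow> complex \<Rightarrow> complex \<Rightarrow> complex" where
  "laplace_kernel k \<tau> \<sigma> =
     of_real k * exp (of_real k * (\<sigma> - \<tau>)) * exp (- exp (of_real k * (\<sigma> - \<tau>))) / exp \<sigma>"

text \<open>
  \<open>has_k_sum r k \<theta> u \<tau> z I\<close>: the \<open>k\<close>-sum of \<open>u\<close> in direction \<open>\<theta>\<close>, computed by the Laplace integral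
  along \<open>arg s = \<theta>\<close>, converges at \<open>(exp \<tau>, z)\<close> and has the value \<open>I\<close> there.
\<close>

definition has_k_sum ::
    "real \<Rightarrow> real \<Rightarrow> real \<Rightarrow> (nat \<Rightarrow> complex \<Rightarrow> complex) \<Rightarrow> complex \<Rightarrow> complex \<Rightarrow> complex \<Rightarrow> bool" where
  "has_k_sum r k \<theta> u \<tau> z I \<longleftrightarrow>
     (\<exists>g. sector_cont_Ok (O_space r) k \<theta> (borel_transform (Gamma_seq (1 / k)) u) g \<and>
          has_ray_integral \<theta> (\<lambda>\<sigma>. g (exp \<sigma>) z * laplace_kernel k \<tau> \<sigma>) I)"

text \<open>
  The operator belonging to \<open>m * Gamma_seq (1/k)\<close>, applied in direction \<open>\<theta>\<close> to the function with
  Taylor coefficients \<open>b\<close>: here \<open>f\<close> is the continuation of the series with coefficients \<open>m n * b n\<close>.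
\<close>

definition has_laplace_like ::
    "real \<Rightarrow> real \<Rightarrow> (nat \<Rightarrow> real) \<Rightarrow> real \<Rightarrow> (nat \<Rightarrow> complex \<Rightarrow> complex) \<Rightarrow> complex \<Rightarrow> complex \<Rightarrow> complex \<Rightarrow> bool" where
  "has_laplace_like r k m \<theta> b \<tau> z I \<longleftrightarrow>
     (\<exists>g. sector_cont_Ok (O_space r) k \<theta> b g) \<and>
     (\<exists>f. sector_cont (O_space r) \<theta> (\<lambda>n x. of_real (m n) * b n x) f \<and>
          has_ray_integral \<theta> (\<lambda>\<sigma>. f (exp \<sigma>) z * laplace_kernel k \<tau> \<sigma>) I)"

definition small_sector :: "real \<Rightarrow> real \<Rightarrow> real \<Rightarrow> complex set" where
  "small_sector d \<beta> \<rho> = {\<tau>. exp (Re \<tau>) < \<rho> \<and> \<bar>Im \<tau> - d\<bar> < \<beta> / 2}"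

definition sectorial_region :: "real \<Rightarrow> real \<Rightarrow> complex set \<Rightarrow> bool" where
  "sectorial_region d \<alpha> G \<longleftrightarrow>
     open G \<and> connected G \<and> G \<subseteq> {\<tau>. \<bar>Im \<tau> - d\<bar> < \<alpha> / 2} \<and>
     (\<forall>\<beta>\<in>{0<..<\<alpha>}. \<exists>\<rho>>0. small_sector d \<beta> \<rho> \<subseteq> G)"

definition is_k_sum_on ::
    "real \<Rightarrow> real \<Rightarrow> real set \<Rightarrow> complex set \<Rightarrow> (nat \<Rightarrow> complex \<Rightarrow> complex) \<Rightarrow> (complex \<Rightarrow> complex \<Rightarrow> complex) \<Rightarrow> bool" where
  "is_k_sum_on r k \<Theta> G f u \<longleftrightarrow>
     (\<forall>n. f n \<in> carr (O_space r)) \<and> eholomorphic (O_space r) G u \<and>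
     (\<forall>\<theta>\<in>\<Theta>. \<forall>\<beta>\<in>{0<..<pi / k}. \<exists>\<rho>>0. \<forall>\<tau>\<in>small_sector \<theta> \<beta> \<rho>.
        \<tau> \<in> G \<and> (\<forall>z\<in>cball 0 r. has_k_sum r k \<theta> f \<tau> z (u \<tau> z)))"

text \<open>The moment derivative in \<open>t\<close> of the \<open>k\<close>-sum of \<open>f\<close> is the \<open>k\<close>-sum of the moment derivative of \<open>f\<close>.\<close>

definition k_sum_moment_deriv ::
    "real \<Rightarrow> real \<Rightarrow> real set \<Rightarrow> complex set \<Rightarrow> (nat \<Rightarrow> real) \<Rightarrow>
     (complex \<Rightarrow> complex \<Rightarrow> complex) \<Rightarrow> (complex \<Rightarrow> complex \<Rightarrow> complex) \<Rightarrow> bool" where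
  "k_sum_moment_deriv r k \<Theta> G m u w \<longleftrightarrow>
     (\<exists>f. is_k_sum_on r k \<Theta> G f u \<and> is_k_sum_on r k \<Theta> G (moment_deriv_t m f) w)"

definition cover_deriv :: "(complex \<Rightarrow> complex) \<Rightarrow> complex \<Rightarrow> complex" where
  "cover_deriv f \<tau> = exp (- \<tau>) * deriv f \<tau>"

text \<open>
  \<open>\<Theta>\<close> is the set of directions in which \<open>u\<close> is understood as a \<open>k\<close>-sum; \<open>W i\<close> is the \<open>i\<close>-th moment
  derivative of \<open>u\<close> with respect to \<open>t\<close>. The filter describes \<open>t \<longlongrightarrow> 0\<close> within \<open>G\<close>.
\<close>

definition actual_solution ::
    "real \<Rightarrow> real \<Rightarrow> real set \<Rightarrow> complex poly poly \<Rightarrow> (nat \<Rightarrow> real) \<Rightarrow> (nat \<Rightarrow> real) \<Rightarrow>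
     (nat \<Rightarrow> complex \<Rightarrow> complex) \<Rightarrow> complex set \<Rightarrow> (complex \<Rightarrow> complex \<Rightarrow> complex) \<Rightarrow> bool" where
  "actual_solution r k \<Theta> P m1 m2 \<phi> G u \<longleftrightarrow>
     eholomorphic (O_space r) G u \<and>
     (\<exists>W. W 0 = u \<and>
        (\<forall>i<degree P. k_sum_moment_deriv r k \<Theta> G m1 (W i) (W (Suc i))) \<and>
        (\<forall>\<tau>\<in>G. apply_P P m2 (\<lambda>i. W i \<tau>) = 0)) \<and>
     (\<forall>l<degree P.
        uniform_limit (ball 0 r) (\<lambda>\<tau> z. (cover_deriv ^^ l) (\<lambda>\<tau>'. u \<tau>' z) \<tau>)
          (\<lambda>z. of_real (fact l / m1 l) * \<phi> l z)
          (inf (filtercomap Re at_bot) (principal G)))"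

definition slit_domain :: "real \<Rightarrow> real \<Rightarrow> real \<Rightarrow> complex set" where
  "slit_domain d \<alpha> r = ball 0 r \<union> (sector d \<alpha> - {of_real x * cis d | x. 0 < x})"

definition slit_Ok :: "real \<Rightarrow> real \<Rightarrow> real \<Rightarrow> real \<Rightarrow> (complex \<Rightarrow> complex) \<Rightarrow> bool" where
  "slit_Ok k d \<alpha> r g \<longleftrightarrow>
     g holomorphic_on slit_domain d \<alpha> r \<and>
     (\<forall>a b. a \<le> b \<and> {a..b} \<subseteq> {d - \<alpha> / 2<..<d + \<alpha> / 2} - {d} \<longrightarrow>
        (\<exists>A>0. \<exists>B>0. \<forall>\<phi>\<in>{a..b}. \<forall>x>0. cmod (g (of_real x * cis \<phi>)) < A * exp (B * x powr k)))"

definition scalar_Ok :: "real \<Rightarrow> real \<Rightarrow> real \<Rightarrow> real \<Rightarrow> (complex \<Rightarrow> complex) \<Rightarrow> bool" where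
  "scalar_Ok k d \<alpha> r f \<longleftrightarrow>
     f holomorphic_on disc_sector d \<alpha> r \<and>
     (\<forall>\<alpha>'\<in>{0<..<\<alpha>}. \<forall>r'\<in>{0<..<r}. \<exists>A>0. \<exists>B>0. \<forall>t\<in>disc_sector d \<alpha>' r'.
        cmod (f t) < A * exp (B * cmod t powr k))"

definition hyper_class :: "real \<Rightarrow> real \<Rightarrow> (complex \<Rightarrow> complex) \<Rightarrow> (complex \<Rightarrow> complex) set" where
  "hyper_class k d g =
     {h. \<exists>\<alpha> r. 0 < \<alpha> \<and> \<alpha> \<le> 2 * pi \<and> 0 < r \<and> slit_Ok k d \<alpha> r h \<and>
           (\<exists>f. scalar_Ok k d \<alpha> r f \<and> (\<forall>s\<in>slit_domain d \<alpha> r. h s - g s = f s))}"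

text \<open>
  The integral of \<open>h * \<phi>\<close> along the path from infinity to 0 in direction \<open>dm\<close> and from 0 to infinity
  in direction \<open>dp\<close>; the test function \<open>\<phi>\<close> is given in the logarithmic coordinate.
\<close>

definition has_hyper_action ::
    "real \<Rightarrow> real \<Rightarrow> (complex \<Rightarrow> complex) \<Rightarrow> (complex \<Rightarrow> complex) \<Rightarrow> complex \<Rightarrow> bool" where
  "has_hyper_action dm dp h \<phi> I \<longleftrightarrow>
     (\<exists>a b. has_ray_integral dm (\<lambda>\<sigma>. h (exp \<sigma>) * \<phi> \<sigma>) a \<and>
            has_ray_integral dp (\<lambda>\<sigma>. h (exp \<sigma>) * \<phi> \<sigma>) b \<and> I = b - a)"

definition has_jump ::
    "real \<Rightarrow> real \<Rightarrow> real \<Rightarrow> real \<Rightarrow> (nat \<Rightarrow> complex \<Rightarrow> complex) \<Rightarrow> complex \<Rightarrow> complex \<Rightarrow> complex \<Rightarrow> bool" where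
  "has_jump r k dm dp u \<tau> z I \<longleftrightarrow>
     (\<exists>a b. has_k_sum r k dm u \<tau> z a \<and> has_k_sum r k dp u \<tau> z b \<and> I = b - a)"

text \<open>
  The function \<open>e\<^sub>m\<close>, the sum of \<open>m n * z ^ n\<close>, extended to the disc of radius \<open>1 / A\<close> and the plane
  without the nonnegative reals; \<open>A\<close> is any constant with \<open>m n \<le> A ^ n\<close>. The extension is unique on
  this connected set.
\<close>

definition kernel_dom :: "real \<Rightarrow> complex set" where
  "kernel_dom A = ball 0 (1 / A) \<union> - \<real>\<^sub>\<ge>\<^sub>0"

definition e_kernel :: "(nat \<Rightarrow> real) \<Rightarrow> real \<Rightarrow> complex \<Rightarrow> complex" where
  "e_kernel m A = (SOME e. e holomorphic_on kernel_dom A \<and>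
     (\<forall>z\<in>ball 0 (1 / A). (\<lambda>n. of_real (m n) * z ^ n) sums e z))"

definition surrounding_contour :: "complex set \<Rightarrow> real \<Rightarrow> complex \<Rightarrow> (real \<Rightarrow> complex) \<Rightarrow> bool" where
  "surrounding_contour U A s \<gamma> \<longleftrightarrow>
     valid_path \<gamma> \<and> simple_path \<gamma> \<and> pathfinish \<gamma> = pathstart \<gamma> \<and>
     path_image \<gamma> \<subseteq> U - closed_segment 0 (of_real A * s) \<and>
     (\<forall>w\<in>closed_segment 0 (of_real A * s). winding_number \<gamma> w = 1)"

end

theory Submission
  imports Defs
begin

text \<open>
  Summability is a property of the Borel transform alone: it must converge near \<open>0\<close> and continue to a sector
  with exponential growth of order \<open>k\<close> (\<open>sectorial_sum\<close>). Since \<open>m\<close> preserves summability, the transforms by \<open>\<Gamma>\<^sub>1\<^sub>/\<^sub>k\<close> and by \<open>m \<Gamma>\<^sub>1\<^sub>/\<^sub>k\<close> both continue in every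
  direction that is not singular. In particular the second one, \<open>v\<close>, is holomorphic near \<open>0\<close>, and it
  solves the transformed problem because the Borel transform intertwines \<open>\<partial>\<^sub>t\<close> for \<open>m\<^sub>1\<close> with \<open>\<partial>\<^sub>t\<close> for the
  product sequence, coefficient by coefficient.

  Between two neighbouring singular directions \<open>L\<close> and \<open>R\<close> the continuations fit together to one function on the
  sector \<open>L < arg s < R\<close> of the universal covering (\<open>strip_sum_exists\<close>). In the coordinate \<open>\<sigma> = ln s\<close> the
  sector is a strip, rotations and dilations of the ray of integration are translations, and Cauchy's
  theorem for the Laplace integral becomes the remark that a holomorphic function invariant under real
  translations is constant (\<open>ray_integral_rotation\<close>). So the Laplace integrals along all rays between \<open>L\<close> and
  \<open>R\<close> agree where they converge, and together they define the \<open>k\<close>-sum on a region of opening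
  \<open>R - L + pi / k\<close>. To see that it is an actual solution, three facts are needed. The moment
  derivatives of \<open>u\<close> are summable again (\<open>k_summable_moment_deriv\<close>): a quotient of Gamma values is a polynomial
  in \<open>n\<close> times a Beta integral, hence acts on functions as an Euler operator followed by an average of
  dilations, and a general moment sequence is conjugate to a Gamma sequence. The equation, which holds for
  the coefficients, passes to the Borel transforms by the identity theorem and from there to the sums by linearity of
  the integral (\<open>strip_equation\<close>, \<open>ksum_equation\<close>). The initial conditions follow from the
  asymptotic expansion of the sum (\<open>ksum_derivatives\<close>), uniformly once the region is thin
  enough near its boundary directions (\<open>actual_solution_between\<close>).

  For the jump, the contour integral against the kernel \<open>e\<^sub>m\<close> multiplies the \<open>n\<close>-th Taylor coefficient
  by \<open>m n\<close> (\<open>contour_integral_multiplier\<close>), and this turns \<open>v\<close> back into the \<open>\<Gamma>\<^sub>1\<^sub>/\<^sub>k\<close>-Borel transform of \<open>u\<close>, on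
  both sides of the singular ray. The difference of the two Laplace integrals is then the jump by
  definition, and changing the representative of the hyperfunction adds a function holomorphic across
  the ray, whose contributions cancel (\<open>jump_formula\<close>). The kernel itself continues to the plane without
  the nonnegative reals because \<open>m\<close> preserves the summability of the series with coefficients \<open>n!\<close>, whose
  Borel transform is the geometric series (\<open>e_kernel_continuation\<close>).
\<close>

section \<open>Functions holomorphic on a disc and continuous on its closure\<close>

lemma inverse_mult_eq_divide: "inverse h * a = a / (h::complex)"
  by (simp add: field_simps)

lemma carr_O_space:
  "f \<in> carr (O_space r) \<longleftrightarrow> continuous_on (cball 0 r) f \<and> f holomorphic_on ball 0 r \<and> (\<forall>z. z \<notin> cball 0 r \<longrightarrow> f z = 0)"
  by (simp add: O_space_def)

lemma norm_le_nrm_O_space: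
  assumes "f \<in> carr (O_space r)" "z \<in> cball 0 r"
  shows "cmod (f z) \<le> nrm (O_space r) f"
proof -
  have "compact ((\<lambda>z. cmod (f z)) ` cball 0 r)"
    using assms(1) by (intro compact_continuous_image continuous_intros) (auto simp: carr_O_space)
  then have "bdd_above ((\<lambda>z. cmod (f z)) ` cball 0 r)"
    by (intro bounded_imp_bdd_above compact_imp_bounded)
  then show ?thesis
    unfolding O_space_def using assms(2) by (auto intro!: cSUP_upper)
qed

lemma nrm_O_space_le:
  assumes "0 \<le> r" "\<And>z. z \<in> cball 0 r \<Longrightarrow> cmod (f z) \<le> c"
  shows "nrm (O_space r) f \<le> c"
  unfolding O_space_def using assms by (auto intro!: cSUP_least)

lemma nrm_O_space_nonneg:
  assumes "0 \<le> r" "f \<in> carr (O_space r)"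
  shows "0 \<le> nrm (O_space r) f"
  using norm_le_nrm_O_space[OF assms(2), of 0] assms(1) by (auto intro: order_trans[OF norm_ge_zero])

lemma O_space_zero: "(\<lambda>z. 0) \<in> carr (O_space r)"
  by (simp add: carr_O_space)

lemma O_space_add: "f \<in> carr (O_space r) \<Longrightarrow> g \<in> carr (O_space r) \<Longrightarrow> (\<lambda>z. f z + g z) \<in> carr (O_space r)"
  by (auto simp: carr_O_space intro!: continuous_intros holomorphic_intros)

lemma O_space_diff: "f \<in> carr (O_space r) \<Longrightarrow> g \<in> carr (O_space r) \<Longrightarrow> (\<lambda>z. f z - g z) \<in> carr (O_space r)"
  by (auto simp: carr_O_space intro!: continuous_intros holomorphic_intros)

lemma O_space_scale: "f \<in> carr (O_space r) \<Longrightarrow> (\<lambda>z. c * f z) \<in> carr (O_space r)"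
  by (auto simp: carr_O_space intro!: continuous_intros holomorphic_intros)

lemma O_space_sum:
  "(\<And>i. i \<in> I \<Longrightarrow> f i \<in> carr (O_space r)) \<Longrightarrow> (\<lambda>z. \<Sum>i\<in>I. f i z) \<in> carr (O_space r)"
  by (induction I rule: infinite_finite_induct) (auto simp: O_space_zero O_space_add)

lemma uniform_limit_in_O_space:
  assumes "eventually (\<lambda>n. f n \<in> carr (O_space r)) F" "F \<noteq> bot"
    and "uniform_limit (cball 0 r) f g F" "\<And>z. z \<notin> cball 0 r \<Longrightarrow> g z = 0"
  shows "g \<in> carr (O_space r)"
proof -
  have "\<forall>\<^sub>F n in F. continuous_on (cball 0 r) (f n) \<and> f n holomorphic_on ball 0 r"
    using assms(1) by eventually_elim (auto simp: carr_O_space)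
  from holomorphic_uniform_limit[OF this assms(3,2)] show ?thesis
    using assms(4) by (auto simp: carr_O_space)
qed

lemma nrm_O_space_scale:
  assumes "0 \<le> r" "f \<in> carr (O_space r)"
  shows "nrm (O_space r) (\<lambda>z. c * f z) = cmod c * nrm (O_space r) f"
proof (cases "c = 0")
  case True
  have "nrm (O_space r) (\<lambda>z. 0) = 0"
    using nrm_O_space_le[of r "\<lambda>z. 0" 0] nrm_O_space_nonneg[of r "\<lambda>z. 0"] assms(1) by (simp add: O_space_zero)
  with True show ?thesis by simp
next
  case False
  have le: "nrm (O_space r) (\<lambda>z. a * h z) \<le> cmod a * nrm (O_space r) h" if "h \<in> carr (O_space r)" for a h
    using assms(1) that by (intro nrm_O_space_le) (auto simp: norm_mult intro!: mult_left_mono norm_le_nrm_O_space)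
  have "nrm (O_space r) (\<lambda>z. inverse c * (c * f z)) \<le> cmod (inverse c) * nrm (O_space r) (\<lambda>z. c * f z)"
    by (intro le O_space_scale assms)
  then have "cmod c * nrm (O_space r) f \<le> nrm (O_space r) (\<lambda>z. c * f z)"
    using False by (simp add: norm_inverse norm_divide field_simps)
  with le[OF assms(2), of c] show ?thesis by simp
qed

lemma complex_banach_O_space:
  assumes r: "0 < r"
  shows "complex_banach (O_space r)"
proof -
  have r0: "0 \<le> r" using r by simp
  have zero: "x = (\<lambda>i. 0)" if "x \<in> carr (O_space r)" "nrm (O_space r) x = 0" for x
  proof
    fix z show "x z = 0"
      using norm_le_nrm_O_space[OF that(1), of z] that by (cases "z \<in> cball 0 r") (auto simp: carr_O_space)
  qed
  have triangle: "nrm (O_space r) (\<lambda>i. x i + y i) \<le> nrm (O_space r) x + nrm (O_space r) y"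
    if "x \<in> carr (O_space r)" "y \<in> carr (O_space r)" for x y
    using r0 that by (intro nrm_O_space_le norm_triangle_le add_mono norm_le_nrm_O_space) auto
  have complete: "\<exists>x\<in>carr (O_space r). (\<lambda>n. nrm (O_space r) (\<lambda>i. X n i - x i)) \<longlonglongrightarrow> 0"
    if X: "\<And>n. X n \<in> carr (O_space r)"
      and C: "\<And>\<epsilon>. \<epsilon> > 0 \<Longrightarrow> \<exists>N. \<forall>a\<ge>N. \<forall>b\<ge>N. nrm (O_space r) (\<lambda>i. X a i - X b i) < \<epsilon>" for X
  proof -
    have "uniformly_Cauchy_on (cball 0 r) X"
      unfolding uniformly_Cauchy_on_def
    proof (intro allI impI)
      fix e :: real assume "e > 0"
      with C obtain N where N: "\<forall>a\<ge>N. \<forall>b\<ge>N. nrm (O_space r) (\<lambda>i. X a i - X b i) < e" by blast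
      show "\<exists>M. \<forall>x\<in>cball 0 r. \<forall>m\<ge>M. \<forall>n\<ge>M. dist (X m x) (X n x) < e"
      proof (intro exI[of _ N] ballI allI impI)
        fix x a b assume "x \<in> cball (0::complex) r" "N \<le> a" "N \<le> b"
        then show "dist (X a x) (X b x) < e"
          using N norm_le_nrm_O_space[OF O_space_diff[OF X[of a] X[of b]], of x]
          by (auto simp: dist_norm intro: le_less_trans)
      qed
    qed
    then obtain l where l: "uniform_limit (cball 0 r) X l sequentially"
      using Cauchy_uniformly_convergent uniformly_convergent_on_def by blast
    define x where "x z = (if z \<in> cball 0 r then l z else 0)" for z
    have lx: "uniform_limit (cball 0 r) X x sequentially"
      using l by (rule uniform_limit_cong'[THEN iffD1, rotated -1]) (auto simp: x_def)
    have x: "x \<in> carr (O_space r)"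
      using X lx by (intro uniform_limit_in_O_space[OF _ _ lx]) (auto simp: x_def)
    have "(\<lambda>n. nrm (O_space r) (\<lambda>i. X n i - x i)) \<longlonglongrightarrow> 0"
    proof (rule LIMSEQ_I)
      fix e :: real assume e: "e > 0"
      then have "\<forall>\<^sub>F n in sequentially. \<forall>z\<in>cball 0 r. dist (X n z) (x z) < e / 2"
        using lx by (auto simp: uniform_limit_iff dest: spec[of _ "e/2"])
      then obtain N where N: "\<forall>n\<ge>N. \<forall>z\<in>cball 0 r. dist (X n z) (x z) < e / 2"
        by (auto simp: eventually_sequentially)
      show "\<exists>no. \<forall>n\<ge>no. norm (nrm (O_space r) (\<lambda>i. X n i - x i) - 0) < e"
      proof (intro exI allI impI)
        fix n assume n: "n \<ge> N"
        have "nrm (O_space r) (\<lambda>i. X n i - x i) \<le> e / 2"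
          using N n r0 by (intro nrm_O_space_le) (auto simp: dist_norm intro: less_imp_le)
        then show "norm (nrm (O_space r) (\<lambda>i. X n i - x i) - 0) < e"
          using e nrm_O_space_nonneg[OF r0 O_space_diff[OF X x]] by auto
      qed
    qed
    with x show ?thesis by blast
  qed
  show ?thesis
    unfolding complex_banach_def
    using zero triangle complete r0
    by (auto simp: O_space_zero O_space_add O_space_scale nrm_O_space_nonneg nrm_O_space_scale)
qed

text \<open>
  A family of functions of one complex variable that is bounded on a common disc has difference
  quotients converging uniformly over the family. This is what makes pointwise holomorphy in \<open>t\<close>
  together with a locally uniform bound sufficient for holomorphy with values in a sup-norm space.
\<close>

lemma difference_quotient_bound:
  assumes f: "f holomorphic_on ball t \<rho>" and M: "\<And>w. w \<in> ball t \<rho> \<Longrightarrow> cmod (f w) \<le> M"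
    and "0 < \<rho>" "h \<noteq> 0" "cmod h < \<rho> / 4"
  shows "cmod ((f (t + h) - f t) / h - deriv f t) \<le> 32 * M / \<rho>\<^sup>2 * cmod h"
proof -
  have M0: "0 \<le> M" using M[of t] \<open>0 < \<rho>\<close> norm_ge_zero[of "f t"] by (simp del: norm_ge_zero)
  let ?S = "ball t (\<rho> / 4)"
  have B: "cmod ((deriv ^^ 2) f x) \<le> 32 * M / \<rho>\<^sup>2" if "x \<in> ?S" for x
  proof -
    have sub: "cball x (\<rho> / 4) \<subseteq> ball t \<rho>"
    proof
      fix y assume "y \<in> cball x (\<rho> / 4)"
      with that have "dist t y < \<rho> / 4 + \<rho> / 4"
        using dist_triangle[of t y x] by auto
      then show "y \<in> ball t \<rho>" using \<open>0 < \<rho>\<close> by auto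
    qed
    have "cmod ((deriv ^^ 2) f x) \<le> fact 2 * M / (\<rho> / 4) ^ 2"
    proof (rule Cauchy_inequality)
      show "f holomorphic_on ball x (\<rho> / 4)"
        using sub f by (meson ball_subset_cball holomorphic_on_subset)
      show "continuous_on (cball x (\<rho> / 4)) f"
        using sub f by (meson holomorphic_on_imp_continuous_on holomorphic_on_subset)
      show "cmod (f y) \<le> M" if "cmod (x - y) = \<rho> / 4" for y
        using sub that by (intro M) (auto simp: dist_norm subset_iff)
    qed (use \<open>0 < \<rho>\<close> in auto)
    also have "\<dots> = 32 * M / \<rho>\<^sup>2" by (simp add: field_simps power2_eq_square)
    finally show ?thesis .
  qed
  have D: "((deriv ^^ i) f has_field_derivative (deriv ^^ Suc i) f x) (at x within ?S)" if "x \<in> ?S" for i x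
  proof -
    have "(deriv ^^ i) f holomorphic_on ball t \<rho>"
      by (rule holomorphic_higher_deriv[OF f]) auto
    moreover have "x \<in> ball t \<rho>" using that \<open>0 < \<rho>\<close> by auto
    ultimately show ?thesis
      by (simp add: holomorphic_derivI[OF _ open_ball] has_field_derivative_at_within)
  qed
  have "cmod ((deriv ^^ 0) f (t + h) - (\<Sum>i\<le>1. (deriv ^^ i) f t * ((t + h) - t) ^ i / fact i))
        \<le> 32 * M / \<rho>\<^sup>2 * cmod ((t + h) - t) ^ Suc 1 / fact 1"
    by (rule complex_Taylor[of ?S]) (use D B assms in \<open>auto simp: dist_norm numeral_2_eq_2\<close>)
  then have "cmod (f (t + h) - f t - deriv f t * h) \<le> 32 * M / \<rho>\<^sup>2 * (cmod h)\<^sup>2"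
    by (simp add: power2_eq_square algebra_simps)
  moreover have "(f (t + h) - f t) / h - deriv f t = (f (t + h) - f t - deriv f t * h) / h"
    using \<open>h \<noteq> 0\<close> by (simp add: field_simps)
  ultimately show ?thesis
    using \<open>h \<noteq> 0\<close> by (simp add: norm_divide divide_le_eq power2_eq_square mult.assoc)
qed

lemma eholomorphic_carr: "eholomorphic E U f \<Longrightarrow> t \<in> U \<Longrightarrow> f t \<in> carr E"
  by (auto simp: eholomorphic_def)

lemma eholomorphic_subset: "eholomorphic E U f \<Longrightarrow> V \<subseteq> U \<Longrightarrow> eholomorphic E V f"
  by (auto simp: eholomorphic_def)

text \<open>
  A linear functional on the space that is bounded by the norm (evaluation at a point, a Taylor
  coefficient) turns a holomorphic vector-valued function into a holomorphic scalar function.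
\<close>

lemma eholomorphic_functional:
  assumes f: "eholomorphic (O_space r) U f" and r: "0 \<le> r" and U: "open U" and t: "t \<in> U"
    and diff: "\<And>x y. x \<in> carr (O_space r) \<Longrightarrow> y \<in> carr (O_space r) \<Longrightarrow> T (\<lambda>i. x i - y i) = T x - T y"
    and scale: "\<And>c x. x \<in> carr (O_space r) \<Longrightarrow> T (\<lambda>i. c * x i) = c * T x"
    and bound: "\<And>x. x \<in> carr (O_space r) \<Longrightarrow> cmod (T x) \<le> C * nrm (O_space r) x"
  shows "\<exists>D\<in>carr (O_space r). ((\<lambda>h. nrm (O_space r) (\<lambda>i. (f (t + h) i - f t i) / h - D i)) \<longlongrightarrow> 0) (at 0) \<and>
           ((\<lambda>t. T (f t)) has_field_derivative T D) (at t)"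
proof -
  from f t obtain D where D: "D \<in> carr (O_space r)"
    "((\<lambda>h. nrm (O_space r) (\<lambda>i. (f (t + h) i - f t i) / h - D i)) \<longlongrightarrow> 0) (at 0)"
    unfolding eholomorphic_def by blast
  have ev: "eventually (\<lambda>h. t + h \<in> U) (at 0)"
  proof -
    have "((\<lambda>h. t + h) \<longlongrightarrow> t + 0) (at 0)" by (intro tendsto_intros)
    then show ?thesis using U t by (simp add: topological_tendstoD)
  qed
  have "((\<lambda>h. (T (f (t + h)) - T (f t)) / h) \<longlongrightarrow> T D) (at 0)"
  proof (rule Lim_transform_bound[THEN LIM_zero_cancel, rotated -1])
    show "((\<lambda>h. C * nrm (O_space r) (\<lambda>i. (f (t + h) i - f t i) / h - D i)) \<longlongrightarrow> 0) (at 0)"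
      using tendsto_mult_right_zero[OF D(2), of C] by simp
    show "\<forall>\<^sub>F h in at 0. cmod ((T (f (t + h)) - T (f t)) / h - T D)
        \<le> norm (C * nrm (O_space r) (\<lambda>i. (f (t + h) i - f t i) / h - D i))"
      using ev
    proof eventually_elim
      case (elim h)
      have c: "f (t + h) \<in> carr (O_space r)" "f t \<in> carr (O_space r)"
        using f t elim by (auto intro: eholomorphic_carr)
      let ?q = "\<lambda>i. inverse h * (f (t + h) i - f t i)"
      have q: "?q \<in> carr (O_space r)" by (intro O_space_scale O_space_diff c)
      have "T (\<lambda>i. ?q i - D i) = (T (f (t + h)) - T (f t)) / h - T D"
        unfolding diff[OF q D(1)] scale[OF O_space_diff[OF c]] diff[OF c] by (simp add: inverse_mult_eq_divide)
      moreover have "cmod (T (\<lambda>i. ?q i - D i)) \<le> C * nrm (O_space r) (\<lambda>i. ?q i - D i)"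
        by (intro bound O_space_diff q D(1))
      ultimately show ?case by (simp add: inverse_mult_eq_divide)
    qed
  qed
  then have "((\<lambda>t. T (f t)) has_field_derivative T D) (at t)"
    by (simp add: DERIV_def)
  with D show ?thesis by blast
qed

lemma eholomorphic_functional_holomorphic:
  assumes "eholomorphic (O_space r) U f" "0 \<le> r" "open U"
    and "\<And>x y. x \<in> carr (O_space r) \<Longrightarrow> y \<in> carr (O_space r) \<Longrightarrow> T (\<lambda>i. x i - y i) = T x - T y"
    and "\<And>c x. x \<in> carr (O_space r) \<Longrightarrow> T (\<lambda>i. c * x i) = c * T x"
    and "\<And>x. x \<in> carr (O_space r) \<Longrightarrow> cmod (T x) \<le> C * nrm (O_space r) x"
  shows "(\<lambda>t. T (f t)) holomorphic_on U"
proof -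
  have "\<exists>D. ((\<lambda>t. T (f t)) has_field_derivative D) (at t)" if "t \<in> U" for t
    using eholomorphic_functional[OF assms(1-3) that, of T C] assms(4-6) by blast
  then show ?thesis using \<open>open U\<close> by (auto simp: holomorphic_on_open)
qed

lemma eholomorphic_pointwise:
  assumes "eholomorphic (O_space r) U f" "0 \<le> r" "open U"
  shows "(\<lambda>t. f t z) holomorphic_on U"
proof (cases "z \<in> cball 0 r")
  case True
  show ?thesis
    by (rule eholomorphic_functional_holomorphic[OF assms, of "\<lambda>x. x z" 1])
       (use norm_le_nrm_O_space True in auto)
next
  case False
  have "f t z = 0" if "t \<in> U" for t
    using eholomorphic_carr[OF assms(1) that] False by (auto simp: carr_O_space)
  then show ?thesis by (intro holomorphic_transform[OF holomorphic_on_const[of 0]]) auto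
qed

lemma eholomorphic_deriv:
  assumes f: "eholomorphic (O_space r) U f" and r: "0 \<le> r" and U: "open U" and t: "t \<in> U"
  shows "(\<lambda>z. deriv (\<lambda>t. f t z) t) \<in> carr (O_space r)"
    and "((\<lambda>h. nrm (O_space r) (\<lambda>z. (f (t + h) z - f t z) / h - deriv (\<lambda>t. f t z) t)) \<longlongrightarrow> 0) (at 0)"
proof -
  from f t obtain D where D: "D \<in> carr (O_space r)"
    "((\<lambda>h. nrm (O_space r) (\<lambda>i. (f (t + h) i - f t i) / h - D i)) \<longlongrightarrow> 0) (at 0)"
    unfolding eholomorphic_def by blast
  have "deriv (\<lambda>t. f t z) t = D z" for z
  proof (cases "z \<in> cball 0 r")
    case True
    obtain D' where D': "D' \<in> carr (O_space r)"
       "((\<lambda>h. nrm (O_space r) (\<lambda>i. (f (t + h) i - f t i) / h - D' i)) \<longlongrightarrow> 0) (at 0)"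
       "((\<lambda>t. f t z) has_field_derivative D' z) (at t)"
      using eholomorphic_functional[OF f r U t, of "\<lambda>x. x z" 1] norm_le_nrm_O_space True by auto
    have ev: "eventually (\<lambda>h. t + h \<in> U) (at 0)"
    proof -
      have "((\<lambda>h. t + h) \<longlongrightarrow> t + 0) (at 0)" by (intro tendsto_intros)
      then show ?thesis using U t by (simp add: topological_tendstoD)
    qed
    have "((\<lambda>h. (f (t + h) z - f t z) / h) \<longlongrightarrow> D z) (at 0)"
    proof (rule Lim_transform_bound[THEN LIM_zero_cancel, OF _ D(2)])
      show "\<forall>\<^sub>F h in at 0. cmod ((f (t + h) z - f t z) / h - D z)
         \<le> norm (nrm (O_space r) (\<lambda>i. (f (t + h) i - f t i) / h - D i))"
        using ev
      proof eventually_elim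
        case (elim h)
        have "(\<lambda>i. inverse h * (f (t + h) i - f t i) - D i) \<in> carr (O_space r)"
          using f t elim D(1) by (intro O_space_diff O_space_scale) (auto intro: eholomorphic_carr)
        from norm_le_nrm_O_space[OF this True] show ?case by (simp add: inverse_mult_eq_divide)
      qed
    qed
    moreover have "((\<lambda>h. (f (t + h) z - f t z) / h) \<longlongrightarrow> D' z) (at 0)"
      using D'(3) by (simp add: DERIV_def)
    ultimately have "D z = D' z" by (rule tendsto_unique[rotated]) simp
    with D'(3) show ?thesis by (simp add: DERIV_imp_deriv)
  next
    case False
    have "deriv (\<lambda>t. f t z) t = deriv (\<lambda>t. 0) t"
    proof (rule deriv_cong_ev)
      show "\<forall>\<^sub>F x in nhds t. f x z = 0"
        using eventually_nhds_in_open[OF U t]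
      proof eventually_elim
        case (elim x)
        then show ?case using eholomorphic_carr[OF f, of x] False by (auto simp: carr_O_space)
      qed
    qed simp
    with False D(1) show ?thesis by (auto simp: carr_O_space)
  qed
  then have eq: "(\<lambda>z. deriv (\<lambda>t. f t z) t) = D" by auto
  show "(\<lambda>z. deriv (\<lambda>t. f t z) t) \<in> carr (O_space r)" using eq D by simp
  show "((\<lambda>h. nrm (O_space r) (\<lambda>z. (f (t + h) z - f t z) / h - deriv (\<lambda>t. f t z) t)) \<longlongrightarrow> 0) (at 0)"
    using eq D by (simp add: fun_eq_iff)
qed

lemma eholomorphicI:
  assumes r: "0 \<le> r" and U: "open U"
    and carr: "\<And>t. t \<in> U \<Longrightarrow> f t \<in> carr (O_space r)"
    and hol: "\<And>z. z \<in> cball 0 r \<Longrightarrow> (\<lambda>t. f t z) holomorphic_on U"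
    and bdd: "\<And>t. t \<in> U \<Longrightarrow> \<exists>\<rho>>0. \<exists>M. \<forall>t'\<in>ball t \<rho>. \<forall>z\<in>cball 0 r. cmod (f t' z) \<le> M"
  shows "eholomorphic (O_space r) U f"
  unfolding eholomorphic_def
proof (intro ballI conjI carr)
  fix t assume t: "t \<in> U"
  from bdd[OF t] obtain \<rho>1 M where \<rho>1: "\<rho>1 > 0" and M: "\<And>t' z. t' \<in> ball t \<rho>1 \<Longrightarrow> z \<in> cball 0 r \<Longrightarrow> cmod (f t' z) \<le> M"
    by blast
  from U t obtain \<rho>2 where \<rho>2: "\<rho>2 > 0" "ball t \<rho>2 \<subseteq> U" by (meson open_contains_ball)
  define \<rho> where "\<rho> = min \<rho>1 \<rho>2"
  have \<rho>: "\<rho> > 0" "ball t \<rho> \<subseteq> U" "ball t \<rho> \<subseteq> ball t \<rho>1" using \<rho>1 \<rho>2 by (auto simp: \<rho>_def)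
  define D where "D z = (if z \<in> cball 0 r then deriv (\<lambda>t. f t z) t else 0)" for z
  have M0: "0 \<le> M" using M[of t 0] \<rho>1 r norm_ge_zero[of "f t 0"] by (simp del: norm_ge_zero)
  have q: "cmod ((f (t + h) z - f t z) / h - D z) \<le> 32 * M / \<rho>\<^sup>2 * cmod h"
    if "h \<noteq> 0" "cmod h < \<rho> / 4" "z \<in> cball 0 r" for h z
  proof -
    have "cmod (((\<lambda>t. f t z) (t + h) - (\<lambda>t. f t z) t) / h - deriv (\<lambda>t. f t z) t) \<le> 32 * M / \<rho>\<^sup>2 * cmod h"
      by (rule difference_quotient_bound)
         (use \<rho> that hol[OF that(3)] M in \<open>auto intro: holomorphic_on_subset\<close>)
    then show ?thesis using that by (simp add: D_def)
  qed
  have ev: "\<forall>\<^sub>F h in at (0::complex). h \<noteq> 0 \<and> cmod h < \<rho> / 4"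
    unfolding eventually_at using \<rho>(1) by (intro exI[of _ "\<rho>/4"]) (auto simp: dist_norm)
  have small: "((\<lambda>h. 32 * M / \<rho>\<^sup>2 * cmod h) \<longlongrightarrow> 0) (at 0)"
    by (rule tendsto_eq_intros refl | simp)+
  have Dc: "D \<in> carr (O_space r)"
  proof (rule uniform_limit_in_O_space[where F = "at 0" and f = "\<lambda>h z. inverse h * (f (t + h) z - f t z)"])
    show "\<forall>\<^sub>F h in at 0. (\<lambda>z. inverse h * (f (t + h) z - f t z)) \<in> carr (O_space r)"
      using ev
    proof eventually_elim
      case (elim h)
      then have "t + h \<in> U" using \<rho> by (auto simp: dist_norm subset_iff)
      then show ?case using t by (intro O_space_scale O_space_diff carr)
    qed
    show "uniform_limit (cball 0 r) (\<lambda>h z. inverse h * (f (t + h) z - f t z)) D (at 0)"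
      unfolding uniform_limit_iff
    proof (intro allI impI)
      fix e :: real assume "e > 0"
      then have "\<forall>\<^sub>F h in at (0::complex). 32 * M / \<rho>\<^sup>2 * cmod h < e"
        using small order_tendstoD(2) by fastforce
      with ev show "\<forall>\<^sub>F h in at 0. \<forall>x\<in>cball 0 r. dist (inverse h * (f (t + h) x - f t x)) (D x) < e"
      proof eventually_elim
        case (elim h)
        show ?case
        proof
          fix x :: complex assume "x \<in> cball 0 r"
          with q[of h x] elim show "dist (inverse h * (f (t + h) x - f t x)) (D x) < e"
            by (simp only: dist_norm inverse_mult_eq_divide) (meson le_less_trans)
        qed
      qed
    qed
  qed (auto simp: D_def)
  have "((\<lambda>h. nrm (O_space r) (\<lambda>i. (f (t + h) i - f t i) / h - D i)) \<longlongrightarrow> 0) (at 0)"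
  proof (rule Lim_transform_bound[OF _ small])
    show "\<forall>\<^sub>F h in at 0. norm (nrm (O_space r) (\<lambda>i. (f (t + h) i - f t i) / h - D i)) \<le> norm (32 * M / \<rho>\<^sup>2 * cmod h)"
      using ev
    proof eventually_elim
      case (elim h)
      then have "t + h \<in> U" using \<rho> by (auto simp: dist_norm subset_iff)
      then have "(\<lambda>i. inverse h * (f (t + h) i - f t i) - D i) \<in> carr (O_space r)"
        using t by (intro O_space_scale O_space_diff carr Dc)
      then have "0 \<le> nrm (O_space r) (\<lambda>i. (f (t + h) i - f t i) / h - D i)"
        using nrm_O_space_nonneg[OF r] by (simp add: inverse_mult_eq_divide)
      moreover have "nrm (O_space r) (\<lambda>i. (f (t + h) i - f t i) / h - D i) \<le> 32 * M / \<rho>\<^sup>2 * cmod h"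
        using q elim by (intro nrm_O_space_le[OF r]) auto
      ultimately show ?case by (simp only: real_norm_def)
    qed
  qed
  with Dc show "\<exists>D\<in>carr (O_space r). ((\<lambda>h. nrm (O_space r) (\<lambda>i. (f (t + h) i - f t i) / h - D i)) \<longlongrightarrow> 0) (at 0)"
    by blast
qed

text \<open>
  The increment is split into a step in \<open>t\<close> at fixed \<open>z\<close>, controlled uniformly in \<open>z\<close> by the sup norm, and a
  step in \<open>z\<close> at the base point; the \<open>t\<close>-derivative is continuous in \<open>z\<close> because it lies in the space.
\<close>

lemma eholomorphic_imp_holomorphic2:
  assumes f: "eholomorphic (O_space r) U f" and r: "0 \<le> r" and U: "open U"
  shows "holomorphic2_on (\<lambda>(t, z). f t z) (U \<times> ball 0 r)"
  unfolding holomorphic2_on_def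
proof (intro ballI, clarify)
  fix t z assume t: "t \<in> U" and z: "z \<in> ball (0::complex) r"
  define D where "D z = deriv (\<lambda>t. f t z) t" for z
  note D = eholomorphic_deriv[OF f r U t, folded D_def]
  define b where "b = deriv (f t) z"
  have ftc: "f t \<in> carr (O_space r)" using f t by (rule eholomorphic_carr)
  have fb: "(f t has_field_derivative b) (at z)"
    using ftc z unfolding b_def by (auto simp: carr_O_space intro!: holomorphic_derivI)
  have Dcont: "continuous (at z) D"
    using D(1) z by (auto simp: carr_O_space dest!: holomorphic_on_imp_continuous_on simp: continuous_on_eq_continuous_at)
  have "((\<lambda>(t, z). f t z) has_derivative (\<lambda>(h1, h2). D z * h1 + b * h2)) (at (t, z))"
    unfolding has_derivative_at_within
  proof (intro conjI)
    show "bounded_linear (\<lambda>(h1, h2). D z * h1 + b * h2)"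
      unfolding case_prod_beta
      by (intro bounded_linear_add bounded_linear_compose[OF bounded_linear_mult_right] bounded_linear_fst bounded_linear_snd)
    show "((\<lambda>y. ((case y of (t, z) \<Rightarrow> f t z) - (case (t, z) of (t, z) \<Rightarrow> f t z) - (case y - (t, z) of (h1, h2) \<Rightarrow> D z * h1 + b * h2)) /\<^sub>R norm (y - (t, z))) \<longlongrightarrow> 0) (at (t, z))"
      unfolding tendsto_iff
    proof (intro allI impI)
      fix e :: real assume e: "e > 0"
      define e' where "e' = e / 4"
      have e': "e' > 0" using e by (simp add: e'_def)
      have "\<forall>\<^sub>F h in at 0. nrm (O_space r) (\<lambda>z. (f (t + h) z - f t z) / h - D z) < e'"
        using order_tendstoD(2)[OF D(2) e'] .
      then obtain \<delta>1 where \<delta>1: "\<delta>1 > 0" "\<And>h. h \<noteq> 0 \<Longrightarrow> cmod h < \<delta>1 \<Longrightarrow> nrm (O_space r) (\<lambda>z. (f (t + h) z - f t z) / h - D z) < e'"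
        unfolding eventually_at by (auto simp: dist_norm)
      obtain \<delta>2 where \<delta>2: "\<delta>2 > 0" "\<And>w. cmod (w - z) < \<delta>2 \<Longrightarrow> cmod (D w - D z) < e'"
        using Dcont e' by (auto simp: continuous_at_eps_delta dist_norm)
      have "(f t has_derivative (*) b) (at z)" using fb by (simp add: has_field_derivative_def)
      then obtain \<delta>3 where \<delta>3: "\<delta>3 > 0" "\<And>w. cmod (w - z) < \<delta>3 \<Longrightarrow> cmod (f t w - f t z - b * (w - z)) \<le> e' * cmod (w - z)"
        unfolding has_derivative_at_alt using e' by metis
      obtain \<delta>4 where \<delta>4: "\<delta>4 > 0" "ball t \<delta>4 \<subseteq> U" using U t by (meson open_contains_ball)
      obtain \<delta>5 where \<delta>5: "\<delta>5 > 0" "ball z \<delta>5 \<subseteq> ball 0 r" using z by (meson open_ball open_contains_ball)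
      define \<delta> where "\<delta> = Min {\<delta>1, \<delta>2, \<delta>3, \<delta>4, \<delta>5}"
      have \<delta>: "\<delta> > 0" "\<delta> \<le> \<delta>1" "\<delta> \<le> \<delta>2" "\<delta> \<le> \<delta>3" "\<delta> \<le> \<delta>4" "\<delta> \<le> \<delta>5"
        using \<delta>1 \<delta>2 \<delta>3 \<delta>4 \<delta>5 by (auto simp: \<delta>_def)
      have main: "cmod (f t' w - f t z - (D z * (t' - t) + b * (w - z))) \<le> 3 * e' * norm ((t', w) - (t, z))"
        if d: "dist (t', w) (t, z) < \<delta>" for t' w
      proof -
        let ?N = "norm ((t', w) - (t, z))"
        have h1: "cmod (t' - t) \<le> ?N" using norm_fst_le[of "t' - t" "w - z"] by simp
        have h2: "cmod (w - z) \<le> ?N" using norm_snd_le[of "w - z" "t' - t"] by simp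
        have N: "?N < \<delta>" using d by (simp add: dist_norm)
        have w: "w \<in> cball 0 r"
          using \<delta>5 \<delta> N h2 by (auto simp: subset_iff dist_norm norm_minus_commute intro!: less_imp_le)
        have t': "t' \<in> U" using \<delta>4 \<delta> N h1 by (auto simp: subset_iff dist_norm norm_minus_commute)
        have a1: "cmod (f t' w - f t w - D w * (t' - t)) \<le> e' * ?N"
        proof (cases "t' = t")
          case True then show ?thesis using e' by simp
        next
          case False
          let ?q = "\<lambda>z. inverse (t' - t) * (f (t + (t' - t)) z - f t z) - D z"
          have "?q \<in> carr (O_space r)"
            using t' f ftc D(1) by (intro O_space_diff O_space_scale) (auto intro: eholomorphic_carr)
          from norm_le_nrm_O_space[OF this w]
          have "cmod ((f t' w - f t w) / (t' - t) - D w) \<le> e'"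
            using \<delta>1(2)[of "t' - t"] False \<delta> N h1 by (simp add: inverse_mult_eq_divide)
          moreover have "f t' w - f t w - D w * (t' - t) = ((f t' w - f t w) / (t' - t) - D w) * (t' - t)"
            using False by (simp add: field_simps)
          ultimately show ?thesis using h1 e' by (auto simp: norm_mult intro!: mult_mono)
        qed
        have a2: "cmod ((D w - D z) * (t' - t)) \<le> e' * ?N"
          using \<delta>2(2)[of w] \<delta> N h2 h1 e' unfolding norm_mult by (intro mult_mono) auto
        have "cmod (f t w - f t z - b * (w - z)) \<le> e' * cmod (w - z)"
          using \<delta>3(2)[of w] \<delta> N h2 by auto
        also have "\<dots> \<le> e' * ?N" using h2 e' by (intro mult_left_mono) auto
        finally have a3: "cmod (f t w - f t z - b * (w - z)) \<le> e' * ?N" .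
        have "f t' w - f t z - (D z * (t' - t) + b * (w - z)) =
           (f t' w - f t w - D w * (t' - t)) + (D w - D z) * (t' - t) + (f t w - f t z - b * (w - z))"
          by (simp add: algebra_simps)
        also have "cmod \<dots> \<le> e' * ?N + e' * ?N + e' * ?N"
          by (intro norm_triangle_le add_mono a1 a2 a3)
        finally show ?thesis by simp
      qed
      have quotient_less: "dist (x /\<^sub>R norm ((t', w) - (t, z))) 0 < e"
        if "cmod x \<le> 3 * e' * norm ((t', w) - (t, z))" "norm ((t', w) - (t, z)) > 0" for x t' w
      proof -
        have "3 * e' * norm ((t', w) - (t, z)) < e * norm ((t', w) - (t, z))"
          using that(2) e by (intro mult_strict_right_mono) (auto simp: e'_def)
        with that(1) have "cmod x < e * norm ((t', w) - (t, z))" by linarith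
        with that(2) show ?thesis by (simp add: field_simps)
      qed
      show "\<forall>\<^sub>F x in at (t, z). dist (((case x of (t, z) \<Rightarrow> f t z) - (case (t, z) of (t, z) \<Rightarrow> f t z) - (case x - (t, z) of (h1, h2) \<Rightarrow> D z * h1 + b * h2)) /\<^sub>R norm (x - (t, z))) 0 < e"
        unfolding eventually_at
      proof (intro exI[of _ \<delta>] conjI ballI impI \<delta>(1))
        fix x assume x: "x \<noteq> (t, z) \<and> dist x (t, z) < \<delta>"
        obtain t' w where x_eq: "x = (t', w)" by (cases x)
        have "norm ((t', w) - (t, z)) > 0" using x by (simp add: x_eq zero_prod_def)
        from quotient_less[OF main this] x
        show "dist (((case x of (t, z) \<Rightarrow> f t z) - (case (t, z) of (t, z) \<Rightarrow> f t z) - (case x - (t, z) of (h1, h2) \<Rightarrow> D z * h1 + b * h2)) /\<^sub>R norm (x - (t, z))) 0 < e"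
          by (simp add: x_eq)
      qed
    qed
  qed
  then show "\<exists>a b. ((\<lambda>(t, z). f t z) has_derivative (\<lambda>(h1, h2). a * h1 + b * h2)) (at (t, z))" by blast
qed

section \<open>Sectors and functions of exponential growth on them\<close>

definition radial :: "complex set \<Rightarrow> bool" where
  "radial S \<longleftrightarrow> (\<forall>t\<in>S. \<forall>c\<in>{0..1}. of_real c * t \<in> S)"

lemma radial_connected: "radial S \<Longrightarrow> connected S"
proof (cases "S = {}")
  case False
  assume S: "radial S"
  from False obtain t where "t \<in> S" by auto
  with S have "of_real 0 * t \<in> S" unfolding radial_def by fastforce
  then have 0: "0 \<in> S" by simp
  have "closed_segment 0 t \<subseteq> S" if "t \<in> S" for t
    using S that by (auto simp: radial_def closed_segment_def scaleR_conv_of_real)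
  with 0 have "starlike S" unfolding starlike_def by blast
  then show ?thesis by (rule starlike_imp_connected)
qed simp

lemma radial_Int: "radial S \<Longrightarrow> radial T \<Longrightarrow> radial (S \<inter> T)"
  by (auto simp: radial_def)

lemma radial_ball: "radial (ball 0 R)"
  unfolding radial_def
proof (intro ballI)
  fix t c assume "t \<in> ball (0::complex) R" "c \<in> {0..1::real}"
  then show "of_real c * t \<in> ball 0 R"
    by (simp add: norm_mult) (metis le_less_trans mult_left_le_one_le norm_ge_zero)
qed

text \<open>
  On sets that are star-shaped with respect to the origin, analytic continuation of a power series
  is unambiguous even between different sets, because the intersection is star-shaped again.
\<close>

lemma radial_continuation_unique:
  assumes "open S" "radial S" "open T" "radial T" "f holomorphic_on S" "g holomorphic_on T"
    and "f has_fps_expansion F" "g has_fps_expansion F" "t \<in> S" "t \<in> T"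
  shows "f t = g t"
proof -
  have "of_real 0 * t \<in> S \<inter> T" using assms unfolding radial_def by fastforce
  then have 0: "0 \<in> S \<inter> T" by simp
  have "\<forall>\<^sub>F x in nhds 0. f x = g x \<and> x \<in> S \<inter> T"
  proof -
    have "\<forall>\<^sub>F x in nhds 0. eval_fps F x = f x" "\<forall>\<^sub>F x in nhds 0. eval_fps F x = g x"
      using assms by (auto simp: has_fps_expansion_def)
    moreover have "\<forall>\<^sub>F x in nhds 0. x \<in> S \<inter> T"
      using assms 0 by (intro eventually_nhds_in_open) auto
    ultimately show ?thesis by eventually_elim auto
  qed
  then obtain U where U: "open U" "0 \<in> U" "\<And>x. x \<in> U \<Longrightarrow> f x = g x" "U \<subseteq> S \<inter> T"
    unfolding eventually_nhds by blast
  show ?thesis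
    using U assms
    by (intro analytic_continuation_open[of U "S \<inter> T" f g t] radial_connected radial_Int)
       (auto intro: holomorphic_on_subset)
qed

lemma sector_eq_exp: "sector d \<alpha> = exp ` {\<sigma>. \<bar>Im \<sigma> - d\<bar> < \<alpha> / 2}"
proof (intro equalityI subsetI)
  fix t assume "t \<in> sector d \<alpha>"
  then obtain x \<phi> where t: "t = of_real x * cis \<phi>" "0 < x" "\<bar>\<phi> - d\<bar> < \<alpha> / 2" by (auto simp: sector_def)
  have "t = exp (Complex (ln x) \<phi>)" using t by (simp add: exp_eq_polar exp_of_real[symmetric])
  then show "t \<in> exp ` {\<sigma>. \<bar>Im \<sigma> - d\<bar> < \<alpha> / 2}" using t by (intro image_eqI) auto
next
  fix t assume "t \<in> exp ` {\<sigma>. \<bar>Im \<sigma> - d\<bar> < \<alpha> / 2}"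
  then obtain \<sigma> where "t = exp \<sigma>" "\<bar>Im \<sigma> - d\<bar> < \<alpha> / 2" by auto
  then show "t \<in> sector d \<alpha>"
    unfolding sector_def by (intro CollectI exI[of _ "exp (Re \<sigma>)"] exI[of _ "Im \<sigma>"]) (simp add: exp_eq_polar)
qed

lemma open_exp_image: "open S \<Longrightarrow> open (exp ` (S :: complex set))"
proof -
  assume S: "open S"
  have "\<exists>T. open T \<and> x \<in> T \<and> T \<subseteq> exp ` S" if x: "x \<in> exp ` S" for x
  proof -
    from x obtain w where w: "w \<in> S" "x = exp w" by auto
    from S w obtain e where e: "e > 0" "ball w e \<subseteq> S" by (meson open_contains_ball)
    have "open (exp ` ball w e)"
    proof (rule open_mapping_thm[of exp UNIV])
      show "\<not> (exp :: complex \<Rightarrow> complex) constant_on UNIV"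
        by (auto simp: constant_on_def) (metis exp_zero exp_pi_i one_neq_neg_one)
    qed (use \<open>e > 0\<close> in \<open>auto intro: holomorphic_intros\<close>)
    then show ?thesis using e w by (intro exI[of _ "exp ` ball w e"]) auto
  qed
  then show ?thesis by (subst open_subopen) blast
qed

lemma open_strip_abs: "open {\<sigma>. \<bar>Im \<sigma> - d\<bar> < a}"
  by (intro open_Collect_less continuous_intros)

lemma open_strip_between: "open {\<sigma>. a < Im \<sigma> \<and> Im \<sigma> < b}"
  by (intro open_Collect_conj open_Collect_less continuous_intros)

lemma convex_strip_between: "convex {\<sigma>. a < Im \<sigma> \<and> Im \<sigma> < b}"
proof -
  have "{\<sigma>. a < Im \<sigma> \<and> Im \<sigma> < b} = {\<sigma>. Im \<sigma> > a} \<inter> {\<sigma>. Im \<sigma> < b}" by auto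
  then show ?thesis by (simp add: convex_Int convex_halfspace_Im_gt convex_halfspace_Im_lt)
qed

lemma open_sector: "open (sector d \<alpha>)"
  unfolding sector_eq_exp by (intro open_exp_image open_strip_abs)

lemma open_disc_sector: "open (disc_sector d \<alpha> R)"
  unfolding disc_sector_def by (intro open_Un open_sector open_ball)

lemma radial_disc_sector: "0 < R \<Longrightarrow> radial (disc_sector d \<alpha> R)"
  unfolding radial_def
proof (intro ballI)
  fix t c assume R: "0 < R" and t: "t \<in> disc_sector d \<alpha> R" and c: "c \<in> {0..1::real}"
  show "of_real c * t \<in> disc_sector d \<alpha> R"
  proof (cases "t \<in> ball 0 R \<or> c = 0")
    case True
    then show ?thesis using R c radial_ball[of R] by (auto simp: disc_sector_def radial_def)
  next
    case False
    with t obtain x \<phi> where "t = of_real x * cis \<phi>" "0 < x" "\<bar>\<phi> - d\<bar> < \<alpha> / 2"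
      by (auto simp: sector_def disc_sector_def)
    then have "of_real c * t \<in> sector d \<alpha>"
      unfolding sector_def using c False
      by (intro CollectI exI[of _ "c * x"] exI[of _ \<phi>]) (auto intro: mult_pos_pos)
    then show ?thesis by (simp add: disc_sector_def)
  qed
qed

lemma sector_mono: "\<alpha> \<le> \<alpha>' \<Longrightarrow> sector d \<alpha> \<subseteq> sector d \<alpha>'"
  by (fastforce simp: sector_def)

lemma disc_sector_mono: "\<alpha> \<le> \<alpha>' \<Longrightarrow> R \<le> R' \<Longrightarrow> disc_sector d \<alpha> R \<subseteq> disc_sector d \<alpha>' R'"
  using sector_mono[of \<alpha> \<alpha>' d] by (auto simp: disc_sector_def)

lemma exp_in_disc_sector: "\<bar>Im \<sigma> - d\<bar> < \<alpha> / 2 \<Longrightarrow> exp \<sigma> \<in> disc_sector d \<alpha> R"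
  unfolding disc_sector_def sector_eq_exp by blast

text \<open>
  The working form of summability: \<open>g\<close> is the sum of the series with coefficients \<open>b\<close>, it is
  holomorphic on one disc-sector, and one exponential bound holds on all of it. Passing to a smaller
  disc-sector makes the bound global and uniform in \<open>z\<close>.
\<close>

definition sectorial_sum ::
    "real \<Rightarrow> real \<Rightarrow> real \<Rightarrow> real \<Rightarrow> real \<Rightarrow> (nat \<Rightarrow> complex \<Rightarrow> complex) \<Rightarrow> (complex \<Rightarrow> complex \<Rightarrow> complex) \<Rightarrow> bool" where
  "sectorial_sum r k d \<alpha> R b g \<longleftrightarrow>
     0 < \<alpha> \<and> \<alpha> \<le> 2 * pi \<and> 0 < R \<and> eholomorphic (O_space r) (disc_sector d \<alpha> R) g \<and>
     (\<exists>A>0. \<exists>B>0. \<forall>t\<in>disc_sector d \<alpha> R. \<forall>z\<in>cball 0 r. cmod (g t z) \<le> A * exp (B * cmod t powr k)) \<and>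
     (\<forall>z\<in>cball 0 r. (\<lambda>t. g t z) has_fps_expansion Abs_fps (\<lambda>n. b n z))"

lemma tendsto_nrm_O_space:
  assumes "0 \<le> r" "\<And>n. X n \<in> carr (O_space r)" "x \<in> carr (O_space r)"
    and "uniform_limit (cball 0 r) X x sequentially"
  shows "(\<lambda>n. nrm (O_space r) (\<lambda>i. X n i - x i)) \<longlonglongrightarrow> 0"
proof (rule LIMSEQ_I)
  fix e :: real assume e: "e > 0"
  then have "\<forall>\<^sub>F n in sequentially. \<forall>z\<in>cball 0 r. dist (X n z) (x z) < e / 2"
    using assms(4) by (auto simp: uniform_limit_iff dest: spec[of _ "e/2"])
  then obtain N where N: "\<forall>n\<ge>N. \<forall>z\<in>cball 0 r. dist (X n z) (x z) < e / 2"
    by (auto simp: eventually_sequentially)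
  show "\<exists>no. \<forall>n\<ge>no. norm (nrm (O_space r) (\<lambda>i. X n i - x i) - 0) < e"
  proof (intro exI allI impI)
    fix n assume n: "n \<ge> N"
    have "nrm (O_space r) (\<lambda>i. X n i - x i) \<le> e / 2"
      using N n assms(1) by (intro nrm_O_space_le) (auto simp: dist_norm intro: less_imp_le)
    then show "norm (nrm (O_space r) (\<lambda>i. X n i - x i) - 0) < e"
      using e nrm_O_space_nonneg[OF assms(1) O_space_diff[OF assms(2,3)]] by auto
  qed
qed

lemma coefficient_bound:
  assumes "f has_fps_expansion F" "f holomorphic_on ball 0 R" "0 < \<rho>" "\<rho> < R"
    and "\<And>t. cmod t = \<rho> \<Longrightarrow> cmod (f t) \<le> M"
  shows "cmod (fps_nth F n) \<le> M / \<rho> ^ n"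
proof -
  have "cmod ((deriv ^^ n) f 0) \<le> fact n * M / \<rho> ^ n"
    using assms by (intro Cauchy_inequality)
      (auto intro: holomorphic_on_subset intro!: holomorphic_on_imp_continuous_on)
  moreover have "fps_nth F n = (deriv ^^ n) f 0 / fact n"
    using assms(1) by (simp add: fps_nth_fps_expansion)
  ultimately show ?thesis by (simp add: norm_divide divide_le_eq) (simp add: mult.commute)
qed

lemma sectorial_sum_carr_near_0: "sectorial_sum r k d \<alpha> R b g \<Longrightarrow> t \<in> ball 0 R \<Longrightarrow> g t \<in> carr (O_space r)"
  by (auto simp: sectorial_sum_def disc_sector_def intro: eholomorphic_carr)

lemma sectorial_sum_sums:
  assumes "sectorial_sum r k d \<alpha> R b g" "0 \<le> r" "t \<in> ball 0 R" "z \<in> cball 0 r"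
  shows "(\<lambda>n. b n z * t ^ n) sums g t z"
proof -
  have "(\<lambda>t. g t z) holomorphic_on disc_sector d \<alpha> R"
    using assms by (intro eholomorphic_pointwise open_disc_sector) (auto simp: sectorial_sum_def)
  then have "(\<lambda>t. g t z) holomorphic_on eball 0 (ereal R)"
    by (rule holomorphic_on_subset) (auto simp: disc_sector_def)
  from has_fps_expansion_imp_sums_complex[OF _ this, of "Abs_fps (\<lambda>n. b n z)" t] assms
  show ?thesis by (auto simp: sectorial_sum_def)
qed

lemma sectorial_sum_coefficient_bound:
  assumes S: "sectorial_sum r k d \<alpha> R b g" and r: "0 \<le> r"
  shows "\<exists>M\<ge>0. \<forall>n. \<forall>z\<in>cball 0 r. cmod (b n z) \<le> M / (R / 2) ^ n"
proof -
  have R: "0 < R" using S by (simp add: sectorial_sum_def)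
  from S obtain A B where AB: "A > 0" "B > 0"
    and gb: "\<And>t z. t \<in> disc_sector d \<alpha> R \<Longrightarrow> z \<in> cball 0 r \<Longrightarrow> cmod (g t z) \<le> A * exp (B * cmod t powr k)"
    unfolding sectorial_sum_def by blast
  define M where "M = A * exp (B * (R / 2) powr k)"
  have M: "0 \<le> M" using AB by (simp add: M_def)
  have bb: "cmod (b n z) \<le> M / (R / 2) ^ n" if z: "z \<in> cball 0 r" for n z
  proof -
    have "cmod (fps_nth (Abs_fps (\<lambda>n. b n z)) n) \<le> M / (R / 2) ^ n"
    proof (rule coefficient_bound[of "\<lambda>t. g t z" _ R])
      show "(\<lambda>t. g t z) has_fps_expansion Abs_fps (\<lambda>n. b n z)" using S z by (auto simp: sectorial_sum_def)
      have "(\<lambda>t. g t z) holomorphic_on disc_sector d \<alpha> R"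
        using S r by (intro eholomorphic_pointwise open_disc_sector) (auto simp: sectorial_sum_def)
      then show "(\<lambda>t. g t z) holomorphic_on ball 0 R"
        by (rule holomorphic_on_subset) (auto simp: disc_sector_def)
      show "cmod (g t z) \<le> M" if "cmod t = R / 2" for t
        using gb[of t z] that z R by (auto simp: disc_sector_def M_def)
    qed (use R in auto)
    then show ?thesis by simp
  qed
  with M show ?thesis by blast
qed

lemma sectorial_sum_uniform_limit:
  assumes S: "sectorial_sum r k d \<alpha> R b g" and r: "0 \<le> r" and t: "t \<in> ball 0 (R / 4)"
  shows "uniform_limit (cball 0 r) (\<lambda>N z. \<Sum>n<N. t ^ n * b n z) (g t) sequentially"
proof -
  have R: "0 < R" using S by (simp add: sectorial_sum_def)
  obtain M where bb: "\<And>n z. z \<in> cball 0 r \<Longrightarrow> cmod (b n z) \<le> M / (R / 2) ^ n"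
    using sectorial_sum_coefficient_bound[OF S r] by blast
  have "uniform_limit (cball 0 r) (\<lambda>N z. \<Sum>n<N. t ^ n * b n z) (\<lambda>z. suminf (\<lambda>n. t ^ n * b n z)) sequentially"
  proof (rule Weierstrass_m_test)
    show "summable (\<lambda>n. M * (1/2) ^ n)" by (intro summable_mult summable_geometric) auto
    show "cmod (t ^ n * b n z) \<le> M * (1/2) ^ n" if "z \<in> cball 0 r" for n z
    proof -
      have "cmod (t ^ n * b n z) \<le> (R/4) ^ n * (M / (R / 2) ^ n)"
        unfolding norm_mult norm_power using t bb[OF that] R by (intro mult_mono power_mono) auto
      also have "\<dots> = M * ((R/4) / (R/2)) ^ n" by (simp only: power_divide times_divide_eq_right mult.commute)
      also have "(R/4) / (R/2) = 1/2" using R by simp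
      finally show ?thesis .
    qed
  qed
  moreover have "suminf (\<lambda>n. t ^ n * b n z) = g t z" if "z \<in> cball 0 r" for z
    using sectorial_sum_sums[OF S r _ that, of t] t R by (simp add: sums_iff mult.commute)
  ultimately show ?thesis
    by (subst uniform_limit_cong'[where g = "\<lambda>N z. \<Sum>n<N. t ^ n * b n z"]) auto
qed

lemma sectorial_sum_imp_sector_cont_Ok:
  assumes S: "sectorial_sum r k d \<alpha> R b g" and r: "0 \<le> r" and k: "0 < k"
    and b: "\<And>n. b n \<in> carr (O_space r)"
  shows "sector_cont_Ok (O_space r) k d b g"
proof -
  have R: "0 < R" using S by (simp add: sectorial_sum_def)
  from S obtain A B where AB: "A > 0" "B > 0"
    and gb: "\<And>t z. t \<in> disc_sector d \<alpha> R \<Longrightarrow> z \<in> cball 0 r \<Longrightarrow> cmod (g t z) \<le> A * exp (B * cmod t powr k)"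
    unfolding sectorial_sum_def by blast
  have "Ok (O_space r) k d \<alpha> R g"
    unfolding Ok_def
  proof (intro conjI ballI)
    show "eholomorphic (O_space r) (disc_sector d \<alpha> R) g" using S by (simp add: sectorial_sum_def)
    fix \<alpha>' r' assume "\<alpha>' \<in> {0<..<\<alpha>}" "r' \<in> {0<..<R}"
    then have sub: "disc_sector d \<alpha>' r' \<subseteq> disc_sector d \<alpha> R" by (intro disc_sector_mono) auto
    show "\<exists>A>0. \<exists>B>0. \<forall>t\<in>disc_sector d \<alpha>' r'. nrm (O_space r) (g t) < A * exp (B * cmod t powr k)"
    proof (rule exI[of _ "A + 1"], rule conjI, use AB in simp, rule exI[of _ B], intro conjI ballI)
      fix t assume "t \<in> disc_sector d \<alpha>' r'"
      then have "nrm (O_space r) (g t) \<le> A * exp (B * cmod t powr k)"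
        using sub gb by (intro nrm_O_space_le r) auto
      also have "\<dots> < (A + 1) * exp (B * cmod t powr k)" by (simp add: algebra_simps)
      finally show "nrm (O_space r) (g t) < (A + 1) * exp (B * cmod t powr k)" .
    qed (use AB in simp)
  qed
  moreover have "\<forall>t\<in>ball 0 (R/4). esums (O_space r) b t (g t)"
    unfolding esums_def
  proof (intro ballI tendsto_nrm_O_space r O_space_sum O_space_scale b)
    fix t assume "t \<in> ball (0::complex) (R/4)"
    then show "g t \<in> carr (O_space r)" using S R by (intro sectorial_sum_carr_near_0[OF S]) auto
  qed (use sectorial_sum_uniform_limit[OF S r] in auto)
  ultimately show ?thesis
    unfolding sector_cont_Ok_def using S R
    by (intro exI[of _ \<alpha>] exI[of _ R]) (auto simp: sectorial_sum_def intro!: exI[of _ "R/4"])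
qed

lemma esums_pointwise:
  assumes "esums (O_space r) b t x" "\<And>n. b n \<in> carr (O_space r)" "x \<in> carr (O_space r)" "z \<in> cball 0 r"
  shows "(\<lambda>n. b n z * t ^ n) sums x z"
  unfolding sums_def
proof (rule Lim_transform_bound[THEN LIM_zero_cancel])
  show "((\<lambda>N. nrm (O_space r) (\<lambda>i. (\<Sum>n<N. t ^ n * b n i) - x i)) \<longlongrightarrow> 0) sequentially"
    using assms(1) by (simp add: esums_def)
  show "\<forall>\<^sub>F N in sequentially. norm ((\<Sum>n<N. b n z * t ^ n) - x z)
         \<le> norm (nrm (O_space r) (\<lambda>i. (\<Sum>n<N. t ^ n * b n i) - x i))"
  proof (intro always_eventually allI)
    fix N
    have "(\<lambda>i. (\<Sum>n<N. t ^ n * b n i) - x i) \<in> carr (O_space r)"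
      by (intro O_space_diff O_space_sum O_space_scale assms)
    from norm_le_nrm_O_space[OF this assms(4)]
    show "norm ((\<Sum>n<N. b n z * t ^ n) - x z) \<le> norm (nrm (O_space r) (\<lambda>i. (\<Sum>n<N. t ^ n * b n i) - x i))"
      by (simp add: mult.commute)
  qed
qed

lemma sector_cont_Ok_imp_sectorial_sum:
  assumes S: "sector_cont_Ok (O_space r) k d b g" and r: "0 \<le> r"
    and b: "\<And>n. b n \<in> carr (O_space r)"
  shows "\<exists>\<alpha> R. sectorial_sum r k d \<alpha> R b g"
proof -
  from S obtain \<alpha> R \<rho> where 1: "0 < \<alpha>" "\<alpha> \<le> 2 * pi" "0 < R" "Ok (O_space r) k d \<alpha> R g"
    "\<rho> > 0" "\<And>t. t \<in> ball 0 \<rho> \<Longrightarrow> esums (O_space r) b t (g t)"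
    unfolding sector_cont_Ok_def by blast
  have sub: "disc_sector d (\<alpha>/2) (R/2) \<subseteq> disc_sector d \<alpha> R" using 1 by (intro disc_sector_mono) auto
  have hol: "eholomorphic (O_space r) (disc_sector d \<alpha> R) g" using 1 by (simp add: Ok_def)
  from 1(4) have "\<exists>A>0. \<exists>B>0. \<forall>t\<in>disc_sector d (\<alpha>/2) (R/2). nrm (O_space r) (g t) < A * exp (B * cmod t powr k)"
    unfolding Ok_def using 1 by (auto dest!: bspec[of _ _ "\<alpha>/2"] bspec[of _ _ "R/2"])
  then obtain A B where AB: "A > 0" "B > 0"
    "\<And>t. t \<in> disc_sector d (\<alpha>/2) (R/2) \<Longrightarrow> nrm (O_space r) (g t) < A * exp (B * cmod t powr k)"
    by blast
  have "cmod (g t z) \<le> A * exp (B * cmod t powr k)" if "t \<in> disc_sector d (\<alpha>/2) (R/2)" "z \<in> cball 0 r" for t z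
  proof -
    have "cmod (g t z) \<le> nrm (O_space r) (g t)"
      using that hol sub by (intro norm_le_nrm_O_space) (auto intro: eholomorphic_carr)
    with AB(3)[OF that(1)] show ?thesis by simp
  qed
  moreover have "(\<lambda>t. g t z) has_fps_expansion Abs_fps (\<lambda>n. b n z)" if z: "z \<in> cball 0 r" for z
  proof (rule has_fps_expansionI)
    have "\<forall>\<^sub>F u in nhds (0::complex). u \<in> ball 0 (min \<rho> R)" using 1 by (intro eventually_nhds_in_open) auto
    then show "\<forall>\<^sub>F u in nhds 0. (\<lambda>n. fps_nth (Abs_fps (\<lambda>n. b n z)) n * u ^ n) sums g u z"
    proof eventually_elim
      case (elim u)
      then have "u \<in> disc_sector d \<alpha> R" by (auto simp: disc_sector_def)
      with elim show ?case
        using esums_pointwise[OF 1(6) b _ z, of u] eholomorphic_carr[OF hol, of u] by simp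
    qed
  qed
  ultimately have "sectorial_sum r k d (\<alpha>/2) (R/2) b g"
    unfolding sectorial_sum_def using 1 AB(1,2) hol sub
    by (intro conjI exI[of _ A] exI[of _ B]) (auto intro: eholomorphic_subset)
  then show ?thesis by blast
qed

lemma sectorial_sum_unique:
  assumes "sectorial_sum r k d \<alpha> R b g" "sectorial_sum r k' d' \<alpha>' R' b g'" "0 \<le> r"
    and "t \<in> disc_sector d \<alpha> R" "t \<in> disc_sector d' \<alpha>' R'"
  shows "g t = g' t"
proof
  fix z
  show "g t z = g' t z"
  proof (cases "z \<in> cball 0 r")
    case True
    show ?thesis
      by (rule radial_continuation_unique[of "disc_sector d \<alpha> R" "disc_sector d' \<alpha>' R'" "\<lambda>t. g t z" "\<lambda>t. g' t z"])
         (use assms True in \<open>auto simp: sectorial_sum_def open_disc_sector radial_disc_sector intro!: eholomorphic_pointwise\<close>)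
  next
    case False
    have "g t \<in> carr (O_space r)" "g' t \<in> carr (O_space r)"
      using assms by (auto simp: sectorial_sum_def intro: eholomorphic_carr)
    with False show ?thesis by (auto simp: carr_O_space)
  qed
qed

section \<open>Integrals depending holomorphically on a parameter\<close>

text \<open>
  Local integrable bounds on the integrands alone. Cauchy's estimate turns them into bounds on all
  derivatives, so the class is stable under differentiation in the parameter and no bound on a
  derivative has ever to be verified by hand.
\<close>

definition locally_dominated :: "complex set \<Rightarrow> (real \<Rightarrow> complex \<Rightarrow> complex) \<Rightarrow> bool" where
  "locally_dominated S f \<longleftrightarrow>
     open S \<and> (\<forall>x. f x holomorphic_on S) \<and> (\<forall>z\<in>S. (\<lambda>x. f x z) \<in> borel_measurable lborel) \<and>
     (\<forall>z\<in>S. \<exists>\<rho>>0. \<exists>w. ball z \<rho> \<subseteq> S \<and> integrable lborel w \<and> (\<forall>x. \<forall>z'\<in>ball z \<rho>. cmod (f x z') \<le> w x))"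

lemma locally_dominated_integrable:
  assumes "locally_dominated S f" "z \<in> S"
  shows "integrable lborel (\<lambda>x. f x z)"
proof -
  have "\<exists>\<rho>>0. \<exists>w. ball z \<rho> \<subseteq> S \<and> integrable lborel w \<and> (\<forall>x. \<forall>z'\<in>ball z \<rho>. cmod (f x z') \<le> w x)"
    using assms by (simp add: locally_dominated_def)
  then obtain \<rho> w where w: "\<rho> > 0" "integrable lborel w" "\<And>x z'. z' \<in> ball z \<rho> \<Longrightarrow> cmod (f x z') \<le> w x"
    by blast
  have le: "norm (f x z) \<le> norm (w x)" for x
    using w(3)[of z x] w(1) by simp
  have "(\<lambda>x. f x z) \<in> borel_measurable lborel"
    using assms unfolding locally_dominated_def by blast
  from Bochner_Integration.integrable_bound[OF w(2) this AE_I2[OF le]] show ?thesis .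
qed

lemma locally_dominated_deriv:
  assumes f: "locally_dominated S f"
  shows "locally_dominated S (\<lambda>x. deriv (f x))"
    and "z \<in> S \<Longrightarrow> ((\<lambda>z. \<integral>x. f x z \<partial>lborel) has_field_derivative (\<integral>x. deriv (f x) z \<partial>lborel)) (at z)"
proof -
  have S: "open S" and hol: "\<And>x. f x holomorphic_on S"
    and meas: "\<And>z. z \<in> S \<Longrightarrow> (\<lambda>x. f x z) \<in> borel_measurable lborel"
    using f unfolding locally_dominated_def by blast+
  have quot: "\<exists>\<rho>>0. \<exists>w. ball z \<rho> \<subseteq> S \<and> integrable lborel w \<and>
       (\<forall>x. \<forall>z'\<in>ball z \<rho>. cmod (f x z') \<le> w x) \<and>
       (\<forall>x h. h \<noteq> 0 \<and> cmod h < \<rho> / 4 \<longrightarrow> cmod ((f x (z + h) - f x z) / h - deriv (f x) z) \<le> 32 * w x / \<rho>\<^sup>2 * cmod h)"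
    if z: "z \<in> S" for z
  proof -
    have "\<exists>\<rho>>0. \<exists>w. ball z \<rho> \<subseteq> S \<and> integrable lborel w \<and> (\<forall>x. \<forall>z'\<in>ball z \<rho>. cmod (f x z') \<le> w x)"
      using f z by (simp add: locally_dominated_def)
    then obtain \<rho> w where w: "\<rho> > 0" "ball z \<rho> \<subseteq> S" "integrable lborel w" "\<And>x z'. z' \<in> ball z \<rho> \<Longrightarrow> cmod (f x z') \<le> w x"
      by blast
    have "cmod ((f x (z + h) - f x z) / h - deriv (f x) z) \<le> 32 * w x / \<rho>\<^sup>2 * cmod h"
      if "h \<noteq> 0" "cmod h < \<rho> / 4" for x h
      using w that hol[of x] by (intro difference_quotient_bound) (auto intro: holomorphic_on_subset)
    with w show ?thesis by blast
  qed
  have dmeas: "(\<lambda>x. deriv (f x) z) \<in> borel_measurable lborel" if z: "z \<in> S" for z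
  proof -
    from quot[OF z] obtain \<rho> w where w: "\<rho> > 0" "ball z \<rho> \<subseteq> S"
      "\<And>x h. h \<noteq> 0 \<Longrightarrow> cmod h < \<rho> / 4 \<Longrightarrow> cmod ((f x (z + h) - f x z) / h - deriv (f x) z) \<le> 32 * w x / \<rho>\<^sup>2 * cmod h"
      by blast
    define h where "h n = complex_of_real (\<rho> / 8 * inverse (real (Suc n)))" for n
    have h: "h n \<noteq> 0" "cmod (h n) < \<rho> / 4" for n
    proof -
      show "h n \<noteq> 0" using w(1) by (simp add: h_def del: of_nat_Suc)
      have "\<rho> / 8 * inverse (real (Suc n)) \<le> \<rho> / 8 * 1"
        using w(1) by (intro mult_left_mono) (auto simp: field_simps)
      then show "cmod (h n) < \<rho> / 4" using w(1) unfolding h_def norm_of_real by (simp add: abs_mult)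
    qed
    have hlim: "h \<longlonglongrightarrow> 0"
      unfolding h_def using tendsto_of_real[OF tendsto_mult_right_zero[OF LIMSEQ_inverse_real_of_nat, of "\<rho>/8"], where 'a = complex]
      by (simp only: of_real_0)
    show ?thesis
    proof (rule borel_measurable_LIMSEQ_metric)
      show "(\<lambda>x. (f x (z + h i) - f x z) / h i) \<in> borel_measurable lborel" for i
      proof -
        have "z + h i \<in> S" using w h(2)[of i] by (auto simp: subset_iff dist_norm)
        then show ?thesis using meas[of z] meas[of "z + h i"] z by measurable
      qed
      show "(\<lambda>i. (f x (z + h i) - f x z) / h i) \<longlonglongrightarrow> deriv (f x) z" for x
      proof (rule Lim_transform_bound[THEN LIM_zero_cancel])
        show "\<forall>\<^sub>F i in sequentially. norm ((f x (z + h i) - f x z) / h i - deriv (f x) z) \<le> norm (32 * w x / \<rho>\<^sup>2 * cmod (h i))"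
          unfolding real_norm_def
          by (intro always_eventually allI order_trans[OF w(3)[OF h] abs_ge_self])
        show "(\<lambda>i. 32 * w x / \<rho>\<^sup>2 * cmod (h i)) \<longlonglongrightarrow> 0"
          using tendsto_mult_right_zero[OF tendsto_norm_zero[OF hlim]] .
      qed
    qed
  qed
  have dom: "\<exists>\<rho>>0. \<exists>w. ball z \<rho> \<subseteq> S \<and> integrable lborel w \<and> (\<forall>x. \<forall>z'\<in>ball z \<rho>. cmod (deriv (f x) z') \<le> w x)"
    if z: "z \<in> S" for z
  proof -
    from quot[OF z] obtain \<rho> w where w: "\<rho> > 0" "ball z \<rho> \<subseteq> S" "integrable lborel w"
      "\<And>x z'. z' \<in> ball z \<rho> \<Longrightarrow> cmod (f x z') \<le> w x" by blast
    have "cmod (deriv (f x) z') \<le> w x / (\<rho>/2)" if z': "z' \<in> ball z (\<rho>/4)" for x z'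
    proof -
      have sub: "cball z' (\<rho>/2) \<subseteq> ball z \<rho>"
      proof
        fix y assume "y \<in> cball z' (\<rho>/2)"
        then have "dist z y < \<rho>" using z' w(1) dist_triangle[of z y z'] by auto
        then show "y \<in> ball z \<rho>" by simp
      qed
      have "cmod ((deriv ^^ 1) (f x) z') \<le> fact 1 * w x / (\<rho>/2) ^ 1"
      proof (rule Cauchy_inequality)
        show "f x holomorphic_on ball z' (\<rho>/2)" "continuous_on (cball z' (\<rho>/2)) (f x)"
          using sub w(2) hol[of x]
          by (meson ball_subset_cball holomorphic_on_subset holomorphic_on_imp_continuous_on order_trans)+
        show "cmod (f x y) \<le> w x" if "cmod (z' - y) = \<rho>/2" for y
          using that sub by (intro w(4)) (auto simp: dist_norm)
      qed (use w in auto)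
      then show ?thesis by simp
    qed
    moreover have "ball z (\<rho>/4) \<subseteq> S"
      using w(1,2) subset_ball[of "\<rho>/4" \<rho> z] by auto
    moreover have "integrable lborel (\<lambda>x. w x / (\<rho>/2))" using w(3) by simp
    ultimately show ?thesis using w(1)
      by (intro exI[of _ "\<rho>/4"] conjI exI[of _ "\<lambda>x. w x / (\<rho>/2)"]) auto
  qed
  show L: "locally_dominated S (\<lambda>x. deriv (f x))"
    unfolding locally_dominated_def
    by (intro conjI allI ballI holomorphic_deriv S hol dmeas dom)
  show "((\<lambda>z. \<integral>x. f x z \<partial>lborel) has_field_derivative (\<integral>x. deriv (f x) z \<partial>lborel)) (at z)" if z: "z \<in> S"
  proof -
    from quot[OF z] obtain \<rho> w where w: "\<rho> > 0" "ball z \<rho> \<subseteq> S" "integrable lborel w"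
      "\<And>x h. h \<noteq> 0 \<Longrightarrow> cmod h < \<rho> / 4 \<Longrightarrow> cmod ((f x (z + h) - f x z) / h - deriv (f x) z) \<le> 32 * w x / \<rho>\<^sup>2 * cmod h"
      by blast
    have ev: "\<forall>\<^sub>F h in at (0::complex). h \<noteq> 0 \<and> cmod h < \<rho> / 4"
      unfolding eventually_at using w(1) by (intro exI[of _ "\<rho>/4"]) (auto simp: dist_norm)
    let ?W = "\<integral>x. w x \<partial>lborel"
    show ?thesis
      unfolding DERIV_def
    proof (rule Lim_transform_bound[THEN LIM_zero_cancel])
      show "((\<lambda>h. 32 * ?W / \<rho>\<^sup>2 * cmod h) \<longlongrightarrow> 0) (at 0)"
        by (rule tendsto_eq_intros refl | simp)+
      show "\<forall>\<^sub>F h in at 0. norm (((\<integral>x. f x (z + h) \<partial>lborel) - (\<integral>x. f x z \<partial>lborel)) / h - (\<integral>x. deriv (f x) z \<partial>lborel))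
              \<le> norm (32 * ?W / \<rho>\<^sup>2 * cmod h)"
        using ev
      proof eventually_elim
        case (elim h)
        then have zh: "z + h \<in> S" using w by (auto simp: subset_iff dist_norm)
        note I = locally_dominated_integrable[OF f zh] locally_dominated_integrable[OF f z]
                 locally_dominated_integrable[OF L z]
        have "((\<integral>x. f x (z + h) \<partial>lborel) - (\<integral>x. f x z \<partial>lborel)) / h - (\<integral>x. deriv (f x) z \<partial>lborel)
              = (\<integral>x. (f x (z + h) - f x z) / h - deriv (f x) z \<partial>lborel)"
          using I by simp
        also have "norm \<dots> \<le> (\<integral>x. 32 * w x / \<rho>\<^sup>2 * cmod h \<partial>lborel)"
        proof (rule Bochner_Integration.integral_norm_bound_integral)
          show "integrable lborel (\<lambda>x. (f x (z + h) - f x z) / h - deriv (f x) z)" using I by auto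
          show "integrable lborel (\<lambda>x. 32 * w x / \<rho>\<^sup>2 * cmod h)" using w(3) by auto
        qed (use w(4) elim in auto)
        also have "\<dots> = 32 * ?W / \<rho>\<^sup>2 * cmod h" using w(3) by simp
        also have "\<dots> \<le> norm (32 * ?W / \<rho>\<^sup>2 * cmod h)" by (simp only: real_norm_def abs_ge_self)
        finally show ?case .
      qed
    qed
  qed
qed

lemma locally_dominated_deriv_n: "locally_dominated S f \<Longrightarrow> locally_dominated S (\<lambda>x. (deriv ^^ n) (f x))"
proof (induction n)
  case (Suc n)
  from locally_dominated_deriv(1)[OF Suc.IH[OF Suc.prems]] show ?case by simp
qed simp

lemma holomorphic_integral:
  "locally_dominated S f \<Longrightarrow> (\<lambda>z. \<integral>x. f x z \<partial>lborel) holomorphic_on S"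
  using locally_dominated_deriv(2)[of S f] unfolding holomorphic_on_def field_differentiable_def
  by (meson has_field_derivative_at_within)

lemma deriv_n_integral:
  assumes f: "locally_dominated S f" and z: "z \<in> S"
  shows "(deriv ^^ n) (\<lambda>z. \<integral>x. f x z \<partial>lborel) z = (\<integral>x. (deriv ^^ n) (f x) z \<partial>lborel)"
  using z
proof (induction n arbitrary: z)
  case (Suc n)
  have S: "open S" using f by (simp add: locally_dominated_def)
  have "(deriv ^^ Suc n) (\<lambda>z. \<integral>x. f x z \<partial>lborel) z = deriv (\<lambda>z. \<integral>x. (deriv ^^ n) (f x) z \<partial>lborel) z"
    unfolding funpow.simps comp_apply
  proof (rule deriv_cong_ev[OF _ refl])
    show "\<forall>\<^sub>F x in nhds z. (deriv ^^ n) (\<lambda>z. LINT x|lborel. f x z) x = (LINT xa|lborel. (deriv ^^ n) (f xa) x)"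
      using eventually_nhds_in_open[OF S Suc.prems] by eventually_elim (rule Suc.IH)
  qed
  also have "\<dots> = (\<integral>x. deriv ((deriv ^^ n) (f x)) z \<partial>lborel)"
    by (intro DERIV_imp_deriv locally_dominated_deriv(2)[OF locally_dominated_deriv_n[OF f] Suc.prems])
  finally show ?case by simp
qed simp

text \<open>
  Dominated convergence gives continuity up to the boundary circle, where holomorphy says nothing.
\<close>

lemma integral_in_O_space:
  assumes F: "\<And>x. F x \<in> carr (O_space r)" and meas: "\<And>z. z \<in> cball 0 r \<Longrightarrow> (\<lambda>x. F x z) \<in> borel_measurable lborel"
    and w: "integrable lborel w" "\<And>x z. z \<in> cball 0 r \<Longrightarrow> cmod (F x z) \<le> w x"
  shows "(\<lambda>z. \<integral>x. F x z \<partial>lborel) \<in> carr (O_space r)"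
    and "locally_dominated (ball 0 r) F"
proof -
  show L: "locally_dominated (ball 0 r) F"
    unfolding locally_dominated_def
  proof (intro conjI allI ballI)
    fix z :: complex assume "z \<in> ball 0 r"
    then obtain \<rho> where \<rho>: "\<rho> > 0" "ball z \<rho> \<subseteq> ball 0 r" by (meson open_ball open_contains_ball)
    show "\<exists>\<rho>>0. \<exists>w. ball z \<rho> \<subseteq> ball 0 r \<and> integrable lborel w \<and> (\<forall>x. \<forall>z'\<in>ball z \<rho>. cmod (F x z') \<le> w x)"
      using w(1) \<rho> by (intro exI[of _ \<rho>] conjI exI[of _ w] allI ballI w(2)) (use \<rho>(2) ball_subset_cball in blast)+
    show "(\<lambda>x. F x z) \<in> borel_measurable lborel" using \<open>z \<in> ball 0 r\<close> by (intro meas) auto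
  qed (use F in \<open>auto simp: carr_O_space\<close>)
  have "continuous_on (cball 0 r) (\<lambda>z. \<integral>x. F x z \<partial>lborel)"
    unfolding continuous_on_sequentially
  proof (intro allI ballI impI, elim conjE)
    fix X a assume a: "a \<in> cball (0::complex) r" and X: "\<forall>n. X n \<in> cball 0 r" "X \<longlonglongrightarrow> a"
    have "(\<lambda>n. \<integral>x. F x (X n) \<partial>lborel) \<longlonglongrightarrow> (\<integral>x. F x a \<partial>lborel)"
    proof (rule integral_dominated_convergence[where w = w])
      have "(\<lambda>n. F x (X n)) \<longlonglongrightarrow> F x a" for x
      proof -
        have "continuous_on (cball 0 r) (F x)" using F by (auto simp: carr_O_space)
        then show ?thesis
          by (rule continuous_on_tendsto_compose[OF _ X(2) a]) (use X(1) in simp)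
      qed
      then show "AE x in lborel. (\<lambda>n. F x (X n)) \<longlonglongrightarrow> F x a" by simp
    qed (use a X w meas in auto)
    then show "((\<lambda>z. \<integral>x. F x z \<partial>lborel) \<circ> X) \<longlonglongrightarrow> (\<integral>x. F x a \<partial>lborel)" by (simp add: comp_def)
  qed
  moreover have "(\<integral>x. F x z \<partial>lborel) = 0" if "z \<notin> cball 0 r" for z
  proof -
    have "F x z = 0" for x using F[of x] that by (auto simp: carr_O_space)
    then show ?thesis by simp
  qed
  ultimately show "(\<lambda>z. \<integral>x. F x z \<partial>lborel) \<in> carr (O_space r)"
    using holomorphic_integral[OF L] by (auto simp: carr_O_space)
qed

section \<open>Moment derivatives of summable series\<close>

lemma sectorial_sumI:
  assumes "0 < \<alpha>" "\<alpha> \<le> 2 * pi" "0 < R" and r: "0 \<le> r" and k: "0 < k"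
    and carr: "\<And>t. t \<in> disc_sector d \<alpha> R \<Longrightarrow> g t \<in> carr (O_space r)"
    and hol: "\<And>z. z \<in> cball 0 r \<Longrightarrow> (\<lambda>t. g t z) holomorphic_on disc_sector d \<alpha> R"
    and AB: "0 < A" "0 < B"
    and gb: "\<And>t z. t \<in> disc_sector d \<alpha> R \<Longrightarrow> z \<in> cball 0 r \<Longrightarrow> cmod (g t z) \<le> A * exp (B * cmod t powr k)"
    and fps: "\<And>z. z \<in> cball 0 r \<Longrightarrow> (\<lambda>t. g t z) has_fps_expansion Abs_fps (\<lambda>n. b n z)"
  shows "sectorial_sum r k d \<alpha> R b g"
proof -
  have "eholomorphic (O_space r) (disc_sector d \<alpha> R) g"
  proof (rule eholomorphicI[OF r open_disc_sector carr hol])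
    fix t assume t: "t \<in> disc_sector d \<alpha> R"
    then obtain \<rho> where \<rho>: "\<rho> > 0" "ball t \<rho> \<subseteq> disc_sector d \<alpha> R"
      using open_disc_sector open_contains_ball by blast
    have "cmod (g t' z) \<le> A * exp (B * (cmod t + \<rho>) powr k)" if "t' \<in> ball t \<rho>" "z \<in> cball 0 r" for t' z
    proof -
      have "cmod t' \<le> cmod t + \<rho>" using that(1) norm_triangle_sub[of t' t] by (simp add: dist_norm norm_minus_commute)
      then have "cmod t' powr k \<le> (cmod t + \<rho>) powr k" using k by (intro powr_mono2) auto
      then have "A * exp (B * cmod t' powr k) \<le> A * exp (B * (cmod t + \<rho>) powr k)" using AB by simp
      moreover have "t' \<in> disc_sector d \<alpha> R" using \<rho> that by blast
      ultimately show ?thesis using gb that(2) order_trans by blast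
    qed
    with \<rho>(1) show "\<exists>\<rho>>0. \<exists>M. \<forall>t'\<in>ball t \<rho>. \<forall>z\<in>cball 0 r. cmod (g t' z) \<le> M" by blast
  qed
  then show ?thesis
    unfolding sectorial_sum_def using assms(1-3) AB gb fps by blast
qed

lemma sectorial_sum_E:
  assumes "sectorial_sum r k d \<alpha> R b g" and r: "0 \<le> r"
  obtains A B where "0 < \<alpha>" "\<alpha> \<le> 2 * pi" "0 < R" "0 < A" "0 < B"
    "eholomorphic (O_space r) (disc_sector d \<alpha> R) g"
    "\<And>t. t \<in> disc_sector d \<alpha> R \<Longrightarrow> g t \<in> carr (O_space r)"
    "\<And>z. (\<lambda>t. g t z) holomorphic_on disc_sector d \<alpha> R"
    "\<And>t z. t \<in> disc_sector d \<alpha> R \<Longrightarrow> z \<in> cball 0 r \<Longrightarrow> cmod (g t z) \<le> A * exp (B * cmod t powr k)"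
    "\<And>z. z \<in> cball 0 r \<Longrightarrow> (\<lambda>t. g t z) has_fps_expansion Abs_fps (\<lambda>n. b n z)"
    "\<And>z. z \<in> cball 0 r \<Longrightarrow> g 0 z = b 0 z"
proof -
  from assms(1) have S: "0 < \<alpha>" "\<alpha> \<le> 2 * pi" "0 < R" and e: "eholomorphic (O_space r) (disc_sector d \<alpha> R) g"
    and fps: "\<And>z. z \<in> cball 0 r \<Longrightarrow> (\<lambda>t. g t z) has_fps_expansion Abs_fps (\<lambda>n. b n z)"
    unfolding sectorial_sum_def by blast+
  from assms(1) obtain A B where AB: "0 < A" "0 < B"
    "\<And>t z. t \<in> disc_sector d \<alpha> R \<Longrightarrow> z \<in> cball 0 r \<Longrightarrow> cmod (g t z) \<le> A * exp (B * cmod t powr k)"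
    unfolding sectorial_sum_def by blast
  have "g 0 z = b 0 z" if "z \<in> cball 0 r" for z
    using has_fps_expansion_imp_0_eq_fps_nth_0[OF fps[OF that]] by simp
  then show thesis
    using that[OF S AB(1,2) e eholomorphic_carr[OF e] eholomorphic_pointwise[OF e r open_disc_sector] AB(3) fps] by blast
qed

text \<open>
  The shifted series has the sum \<open>(g t - g 0) / t\<close>. Division by \<open>t\<close> is harmless away from the origin, and the
  maximum principle carries the bound from the circle \<open>\<bar>t\<bar> = R / 2\<close> into its interior.
\<close>

lemma sectorial_sum_shift:
  assumes S: "sectorial_sum r k d \<alpha> R b g" and r: "0 \<le> r" and k: "0 < k"
    and b: "\<And>n. b n \<in> carr (O_space r)"
  shows "\<exists>g'. sectorial_sum r k d \<alpha> R (\<lambda>n. b (Suc n)) g'"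
proof -
  from sectorial_sum_E[OF S r] obtain A B where 1: "0 < \<alpha>" "\<alpha> \<le> 2 * pi" "0 < R" "0 < A" "0 < B"
    and carr: "\<And>t. t \<in> disc_sector d \<alpha> R \<Longrightarrow> g t \<in> carr (O_space r)"
    and hol: "\<And>z. (\<lambda>t. g t z) holomorphic_on disc_sector d \<alpha> R"
    and gb: "\<And>t z. t \<in> disc_sector d \<alpha> R \<Longrightarrow> z \<in> cball 0 r \<Longrightarrow> cmod (g t z) \<le> A * exp (B * cmod t powr k)"
    and fps: "\<And>z. z \<in> cball 0 r \<Longrightarrow> (\<lambda>t. g t z) has_fps_expansion Abs_fps (\<lambda>n. b n z)"
    and g0: "\<And>z. z \<in> cball 0 r \<Longrightarrow> g 0 z = b 0 z"
    by metis
  define h where "h t z = (if t = 0 then b 1 z else inverse t * (g t z - b 0 z))" for t z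
  define A' where "A' = 4 * A / R * exp (B * (R / 2) powr k)"
  have 0: "0 \<in> disc_sector d \<alpha> R" using 1 by (simp add: disc_sector_def)
  have hol': "(\<lambda>t. h t z) holomorphic_on disc_sector d \<alpha> R" if z: "z \<in> cball 0 r" for z
  proof -
    have "deriv (\<lambda>t. g t z) 0 = b 1 z"
      using fps_nth_fps_expansion[OF fps[OF z], of 1] by simp
    then have "h t z = (if t = 0 then deriv (\<lambda>t. g t z) 0 else (g t z - g 0 z) / (t - 0))" for t
      using g0[OF z] by (simp add: h_def inverse_mult_eq_divide)
    then show ?thesis using pole_lemma_open[OF hol open_disc_sector, of 0 z] by simp
  qed
  have far: "cmod (h t z) \<le> 4 * A / R * exp (B * cmod t powr k)"
    if t: "t \<in> disc_sector d \<alpha> R" "R / 2 \<le> cmod t" and z: "z \<in> cball 0 r" for t z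
  proof -
    have t0: "t \<noteq> 0" using t 1 by auto
    have "cmod (g 0 z) \<le> A * exp (B * cmod 0 powr k)" by (rule gb[OF 0 z])
    then have "cmod (b 0 z) \<le> A" using g0[OF z] by simp
    also have "A \<le> A * exp (B * cmod t powr k)" using 1 by simp
    finally have "cmod (g t z - b 0 z) \<le> 2 * (A * exp (B * cmod t powr k))"
      using gb[OF t(1) z] norm_triangle_ineq4[of "g t z" "b 0 z"] by linarith
    moreover have "cmod (inverse t) \<le> 2 / R" using t(2) 1(3) t0 le_imp_inverse_le[of "R/2" "cmod t"] by (simp add: norm_inverse)
    ultimately have "cmod (inverse t) * cmod (g t z - b 0 z) \<le> (2 / R) * (2 * (A * exp (B * cmod t powr k)))"
      using 1 by (intro mult_mono) auto
    also have "\<dots> = 4 * A / R * exp (B * cmod t powr k)" by simp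
    finally show ?thesis using t0 by (simp add: h_def norm_mult)
  qed
  have near: "cmod (h t z) \<le> A'" if t: "cmod t \<le> R / 2" and z: "z \<in> cball 0 r" for t z
  proof (rule maximum_modulus_frontier[of "\<lambda>t. h t z" "cball 0 (R/2)"])
    have sub: "cball 0 (R/2) \<subseteq> disc_sector d \<alpha> R" using 1 by (auto simp: disc_sector_def)
    show "(\<lambda>t. h t z) holomorphic_on interior (cball 0 (R/2))"
      using sub interior_subset by (blast intro: holomorphic_on_subset[OF hol'[OF z]])
    show "continuous_on (closure (cball 0 (R/2))) (\<lambda>t. h t z)"
      using sub by (auto intro!: holomorphic_on_imp_continuous_on holomorphic_on_subset[OF hol'[OF z]])
    show "cmod (h w z) \<le> A'" if "w \<in> frontier (cball 0 (R/2))" for w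
      using that far[of w z] sub z 1 by (auto simp: A'_def subset_iff)
  qed (use t in auto)
  have "sectorial_sum r k d \<alpha> R (\<lambda>n. b (Suc n)) h"
  proof (rule sectorial_sumI[OF 1(1,2,3) r k])
    show "h t \<in> carr (O_space r)" if "t \<in> disc_sector d \<alpha> R" for t
    proof (cases "t = 0")
      case True
      then have "h t = b 1" by (auto simp: h_def)
      then show ?thesis using b by simp
    next
      case False
      then have "h t = (\<lambda>z. inverse t * (g t z - b 0 z))" by (auto simp: h_def)
      then show ?thesis using carr[OF that] b by (auto intro!: O_space_scale O_space_diff)
    qed
    show "0 < A'" using 1 by (simp add: A'_def)
    show "cmod (h t z) \<le> A' * exp (B * cmod t powr k)" if t: "t \<in> disc_sector d \<alpha> R" and z: "z \<in> cball 0 r" for t z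
    proof (cases "cmod t \<le> R / 2")
      case True
      have "0 \<le> A'" using 1 by (simp add: A'_def)
      then have "A' * 1 \<le> A' * exp (B * cmod t powr k)" using 1 by (intro mult_left_mono) auto
      then have "A' \<le> A' * exp (B * cmod t powr k)" by simp
      with near[OF True z] show ?thesis by linarith
    next
      case False
      have "4 * A / R * 1 \<le> A'" unfolding A'_def using 1 by (intro mult_left_mono) auto
      then have "4 * A / R \<le> A'" by simp
      then have "4 * A / R * exp (B * cmod t powr k) \<le> A' * exp (B * cmod t powr k)" by (intro mult_right_mono) auto
      with far[OF t _ z] False show ?thesis by linarith
    qed
    show "(\<lambda>t. h t z) has_fps_expansion Abs_fps (\<lambda>n. b (Suc n) z)" if z: "z \<in> cball 0 r" for z
    proof (rule has_fps_expansionI)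
      have "\<forall>\<^sub>F u in nhds (0::complex). u \<in> ball 0 R" using 1 by (intro eventually_nhds_in_open) auto
      then show "\<forall>\<^sub>F u in nhds 0. (\<lambda>n. fps_nth (Abs_fps (\<lambda>n. b (Suc n) z)) n * u ^ n) sums h u z"
      proof eventually_elim
        case (elim u)
        show ?case
        proof (cases "u = 0")
          case True
          then show ?thesis using powser_sums_zero[of "\<lambda>n. b (Suc n) z"] by (simp add: h_def)
        next
          case False
          have "(\<lambda>n. b n z * u ^ n) sums g u z" by (rule sectorial_sum_sums[OF S r elim z])
          then have "(\<lambda>n. b (Suc n) z * u ^ Suc n) sums (g u z - b 0 z)"
            using sums_Suc_iff[of "\<lambda>n. b n z * u ^ n"] by simp
          from sums_mult[OF this, of "inverse u"] False show ?thesis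
            by (simp add: h_def field_simps)
        qed
      qed
    qed
  qed (use hol' 1 in auto)
  then show ?thesis by blast
qed

text \<open>
  The operator \<open>a * t * d/dt + c\<close>. In the logarithmic coordinate \<open>t d/dt\<close> is differentiation, and discs of a
  fixed radius keep \<open>\<bar>t\<bar>\<close> within a constant factor, so Cauchy's estimate keeps the exponential order.
\<close>

lemma sectorial_sum_euler:
  assumes S: "sectorial_sum r k d \<alpha> R b g" and r: "0 \<le> r" and k: "0 < k"
  shows "\<exists>g' \<alpha>' R'. sectorial_sum r k d \<alpha>' R' (\<lambda>n z. of_real (a * real n + c) * b n z) g'"
proof -
  from sectorial_sum_E[OF S r] obtain A B where 1: "0 < \<alpha>" "\<alpha> \<le> 2 * pi" "0 < R" "0 < A" "0 < B"
    and ehol: "eholomorphic (O_space r) (disc_sector d \<alpha> R) g"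
    and carr: "\<And>t. t \<in> disc_sector d \<alpha> R \<Longrightarrow> g t \<in> carr (O_space r)"
    and hol: "\<And>z. (\<lambda>t. g t z) holomorphic_on disc_sector d \<alpha> R"
    and gb: "\<And>t z. t \<in> disc_sector d \<alpha> R \<Longrightarrow> z \<in> cball 0 r \<Longrightarrow> cmod (g t z) \<le> A * exp (B * cmod t powr k)"
    and fps: "\<And>z. z \<in> cball 0 r \<Longrightarrow> (\<lambda>t. g t z) has_fps_expansion Abs_fps (\<lambda>n. b n z)"
    and g0: "\<And>z. z \<in> cball 0 r \<Longrightarrow> g 0 z = b 0 z"
    by metis
  define h where "h t z = of_real a * t * deriv (\<lambda>t. g t z) t + of_real c * g t z" for t z
  define \<eta> where "\<eta> = min (\<alpha> / 8) (ln 2 / 2)"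
  have \<eta>: "0 < \<eta>" "\<eta> < \<alpha> / 4" "\<eta> < ln 2" using 1 by (auto simp: \<eta>_def min_def)
  define B' where "B' = B * exp \<eta> powr k"
  have BB': "B \<le> B'" "0 < B'" using 1 \<eta>(1) k by (simp_all add: B'_def powr_def)
  have sub: "disc_sector d (\<alpha>/2) (R/2) \<subseteq> disc_sector d \<alpha> R" using 1 by (intro disc_sector_mono) auto
  have euler: "cmod (t * deriv (\<lambda>t. g t z) t) \<le> A / \<eta> * exp (B' * cmod t powr k)"
    if t: "t \<in> disc_sector d (\<alpha>/2) (R/2)" and z: "z \<in> cball 0 r" for t z
  proof (cases "t = 0")
    case True then show ?thesis using 1 \<eta> by simp
  next
    case False
    \<comment> \<open>A logarithm of \<open>t\<close> around which a disc of radius \<open>\<eta>\<close> is mapped into the larger disc-sector.\<close>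
    have "\<exists>\<sigma>. exp \<sigma> = t \<and> (\<bar>Im \<sigma> - d\<bar> < \<alpha> / 4 \<or> cmod t < R / 2)"
    proof (cases "t \<in> ball 0 (R/2)")
      case True with False show ?thesis by (intro exI[of _ "Ln t"]) auto
    next
      case False
      with t show ?thesis unfolding disc_sector_def sector_eq_exp by fastforce
    qed
    then obtain \<sigma> where \<sigma>: "exp \<sigma> = t" "\<bar>Im \<sigma> - d\<bar> < \<alpha> / 4 \<or> cmod t < R / 2" by blast
    have in_DS: "exp w \<in> disc_sector d \<alpha> R" "cmod (exp w) \<le> exp \<eta> * cmod t" if "w \<in> cball \<sigma> \<eta>" for w
    proof -
      have w: "cmod (w - \<sigma>) \<le> \<eta>" using that by (simp add: dist_norm norm_minus_commute)
      have im: "\<bar>Im w - Im \<sigma>\<bar> \<le> \<eta>" using order_trans[OF abs_Im_le_cmod w] by simp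
      have re: "\<bar>Re w - Re \<sigma>\<bar> \<le> \<eta>" using order_trans[OF abs_Re_le_cmod w] by simp
      have "exp (Re w) \<le> exp (\<eta> + Re \<sigma>)" using re by simp
      then show le: "cmod (exp w) \<le> exp \<eta> * cmod t" using \<sigma>(1) by (auto simp: exp_add)
      show "exp w \<in> disc_sector d \<alpha> R"
      proof (cases "\<bar>Im \<sigma> - d\<bar> < \<alpha> / 4")
        case True
        moreover have "\<bar>Im w - d\<bar> \<le> \<bar>Im w - Im \<sigma>\<bar> + \<bar>Im \<sigma> - d\<bar>" by arith
        ultimately show ?thesis using im \<eta> by (intro exp_in_disc_sector) linarith
      next
        case False
        with \<sigma> have "cmod t < R / 2" by auto
        moreover have "exp \<eta> < exp (ln 2)" using \<eta> by (subst exp_less_cancel_iff)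
        ultimately have "exp \<eta> * cmod t < 2 * (R / 2)" by (intro mult_strict_mono) auto
        with le show ?thesis by (auto simp: disc_sector_def)
      qed
    qed
    have d1: "((\<lambda>t. g t z) has_field_derivative deriv (\<lambda>t. g t z) t) (at t)"
      using t sub by (intro holomorphic_derivI[OF hol open_disc_sector]) auto
    have "((\<lambda>w. g (exp w) z) has_field_derivative deriv (\<lambda>t. g t z) t * exp \<sigma>) (at \<sigma>)"
      using d1 \<sigma>(1) by (intro DERIV_chain2[of "\<lambda>t. g t z"]) (auto intro!: derivative_eq_intros)
    then have deq: "deriv (\<lambda>w. g (exp w) z) \<sigma> = t * deriv (\<lambda>t. g t z) t"
      using \<sigma>(1) by (simp add: DERIV_imp_deriv mult.commute)
    have hol_exp: "(\<lambda>w. g (exp w) z) holomorphic_on cball \<sigma> \<eta>"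
      using in_DS(1) by (intro holomorphic_on_compose_gen[OF holomorphic_on_exp hol[of z], unfolded comp_def]) auto
    have "cmod ((deriv ^^ 1) (\<lambda>w. g (exp w) z) \<sigma>) \<le> fact 1 * (A * exp (B' * cmod t powr k)) / \<eta> ^ 1"
    proof (rule Cauchy_inequality)
      show "(\<lambda>w. g (exp w) z) holomorphic_on ball \<sigma> \<eta>" by (rule holomorphic_on_subset[OF hol_exp]) auto
      show "continuous_on (cball \<sigma> \<eta>) (\<lambda>w. g (exp w) z)" by (rule holomorphic_on_imp_continuous_on[OF hol_exp])
      show "cmod (g (exp w) z) \<le> A * exp (B' * cmod t powr k)" if "cmod (\<sigma> - w) = \<eta>" for w
      proof -
        have w: "w \<in> cball \<sigma> \<eta>" using that by (simp add: dist_norm)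
        have "cmod (exp w) powr k \<le> (exp \<eta> * cmod t) powr k" using in_DS(2)[OF w] k by (intro powr_mono2) auto
        also have "\<dots> = exp \<eta> powr k * cmod t powr k" by (simp add: powr_mult)
        finally have "B * cmod (exp w) powr k \<le> B' * cmod t powr k" using 1 by (simp add: B'_def mult.assoc)
        then have "A * exp (B * cmod (exp w) powr k) \<le> A * exp (B' * cmod t powr k)" using 1 by simp
        with gb[OF in_DS(1)[OF w] z] show ?thesis by linarith
      qed
    qed (use \<eta> in auto)
    then show ?thesis using deq by simp
  qed
  define A' where "A' = \<bar>a\<bar> * (A / \<eta>) + \<bar>c\<bar> * A + 1"
  have "sectorial_sum r k d (\<alpha>/2) (R/2) (\<lambda>n z. of_real (a * real n + c) * b n z) h"
  proof (rule sectorial_sumI[OF _ _ _ r k, where A = A' and B = B'])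
    show "h t \<in> carr (O_space r)" if "t \<in> disc_sector d (\<alpha>/2) (R/2)" for t
    proof -
      have t: "t \<in> disc_sector d \<alpha> R" using that sub by blast
      show ?thesis unfolding h_def
        by (intro O_space_add O_space_scale carr[OF t] eholomorphic_deriv(1)[OF ehol r open_disc_sector t])
    qed
    show "(\<lambda>t. h t z) holomorphic_on disc_sector d (\<alpha>/2) (R/2)" for z
      unfolding h_def
      by (intro holomorphic_intros holomorphic_deriv holomorphic_on_subset[OF hol sub] open_disc_sector)
    show "0 < A'" using 1 \<eta> by (simp add: A'_def add_nonneg_pos)
    show "cmod (h t z) \<le> A' * exp (B' * cmod t powr k)"
      if t: "t \<in> disc_sector d (\<alpha>/2) (R/2)" and z: "z \<in> cball 0 r" for t z
    proof -
      let ?E = "exp (B' * cmod t powr k)"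
      have "B * cmod t powr k \<le> B' * cmod t powr k" using BB' by (intro mult_right_mono) auto
      then have "A * exp (B * cmod t powr k) \<le> A * ?E" using 1 by simp
      with gb[of t z] t sub z have g1: "cmod (g t z) \<le> A * ?E" by fastforce
      have "cmod (h t z) \<le> \<bar>a\<bar> * cmod (t * deriv (\<lambda>t. g t z) t) + \<bar>c\<bar> * cmod (g t z)"
        unfolding h_def by (rule order_trans[OF norm_triangle_ineq]) (simp add: norm_mult mult.assoc)
      also have "\<dots> \<le> \<bar>a\<bar> * (A / \<eta> * ?E) + \<bar>c\<bar> * (A * ?E)"
        by (intro add_mono mult_left_mono euler[OF t z] g1) auto
      also have "\<dots> \<le> \<bar>a\<bar> * (A / \<eta> * ?E) + \<bar>c\<bar> * (A * ?E) + ?E" by simp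
      also have "\<dots> = A' * ?E" by (simp add: A'_def algebra_simps)
      finally show ?thesis .
    qed
    show "(\<lambda>t. h t z) has_fps_expansion Abs_fps (\<lambda>n. of_real (a * real n + c) * b n z)" if z: "z \<in> cball 0 r" for z
    proof -
      let ?F = "Abs_fps (\<lambda>n. b n z)"
      have "(\<lambda>t. h t z) has_fps_expansion fps_const (of_real a) * fps_X * fps_deriv ?F + fps_const (of_real c) * ?F"
        unfolding h_def by (intro fps_expansion_intros fps[OF z])
      also have "fps_const (of_real a) * fps_X * fps_deriv ?F + fps_const (of_real c) * ?F = Abs_fps (\<lambda>n. of_real (a * real n + c) * b n z)"
      proof (rule fps_ext)
        fix n show "fps_nth (fps_const (of_real a) * fps_X * fps_deriv ?F + fps_const (of_real c) * ?F) n
          = fps_nth (Abs_fps (\<lambda>n. of_real (a * real n + c) * b n z)) n"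
          by (cases n) (simp_all add: mult.assoc algebra_simps)
      qed
      finally show ?thesis .
    qed
  qed (use 1 BB' in auto)
  then show ?thesis by blast
qed

lemma sectorial_sum_pochhammer:
  assumes "sectorial_sum r k d \<alpha> R b g" and r: "0 \<le> r" and k: "0 < k"
  shows "\<exists>g' \<alpha>' R'. sectorial_sum r k d \<alpha>' R' (\<lambda>n z. of_real (pochhammer (1 + a * real n) N) * b n z) g'"
proof (induction N)
  case 0
  show ?case using assms(1) by auto
next
  case (Suc N)
  then obtain g' \<alpha>' R' where
    "sectorial_sum r k d \<alpha>' R' (\<lambda>n z. of_real (pochhammer (1 + a * real n) N) * b n z) g'" by blast
  from sectorial_sum_euler[OF this r k, of a "1 + real N"] obtain g' \<alpha>' R' where
    "sectorial_sum r k d \<alpha>' R' (\<lambda>n z. of_real (a * real n + (1 + real N)) * (of_real (pochhammer (1 + a * real n) N) * b n z)) g'"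
    by blast
  moreover have "of_real (a * real n + (1 + real N)) * (of_real (pochhammer (1 + a * real n) N) * y)
      = of_real (pochhammer (1 + a * real n) (Suc N)) * y" for n and y :: complex
    unfolding pochhammer_Suc of_real_mult by (simp add: algebra_simps)
  ultimately show ?case by (simp only:) blast
qed

text \<open>
  Averaging the dilations \<open>t \<mapsto> x\<^sup>a t\<close>, \<open>0 < x < 1\<close>, stays inside star-shaped domains and does not
  increase the growth; it multiplies the coefficients by the moments of the weight.
\<close>

lemma sectorial_sum_average:
  assumes S: "sectorial_sum r k d \<alpha> R b g" and r: "0 \<le> r" and k: "0 < k" and a: "0 \<le> a"
    and w: "integrable lborel w" "\<And>x. 0 \<le> w x" "\<And>x. x \<notin> {0<..<1} \<Longrightarrow> w x = 0"
  shows "\<exists>g'. sectorial_sum r k d \<alpha> R (\<lambda>n z. of_real (\<integral>x. w x * (x powr a) ^ n \<partial>lborel) * b n z) g'"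
proof -
  from sectorial_sum_E[OF S r] obtain A B where 1: "0 < \<alpha>" "\<alpha> \<le> 2 * pi" "0 < R" "0 < A" "0 < B"
    and carr: "\<And>t. t \<in> disc_sector d \<alpha> R \<Longrightarrow> g t \<in> carr (O_space r)"
    and hol: "\<And>z. (\<lambda>t. g t z) holomorphic_on disc_sector d \<alpha> R"
    and gb: "\<And>t z. t \<in> disc_sector d \<alpha> R \<Longrightarrow> z \<in> cball 0 r \<Longrightarrow> cmod (g t z) \<le> A * exp (B * cmod t powr k)"
    and fps: "\<And>z. z \<in> cball 0 r \<Longrightarrow> (\<lambda>t. g t z) has_fps_expansion Abs_fps (\<lambda>n. b n z)"
    by metis
  let ?DS = "disc_sector d \<alpha> R"
  have radial: "radial ?DS" by (rule radial_disc_sector[OF 1(3)])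
  define F where "F x t z = of_real (w x) * g (of_real (x powr a) * t) z" for x t z
  have xa: "x powr a \<in> {0..1}" if "x \<in> {0<..<1}" for x using that a by (auto intro: powr_le1)
  have inDS: "of_real (x powr a) * t \<in> ?DS" if "t \<in> ?DS" "x \<in> {0<..<1}" for x t
    using radial that(1) xa[OF that(2)] unfolding radial_def by blast
  have Fb: "cmod (F x t z) \<le> w x * (A * exp (B * cmod t powr k))" if t: "t \<in> ?DS" and z: "z \<in> cball 0 r" for x t z
  proof (cases "x \<in> {0<..<1}")
    case True
    have "cmod (of_real (x powr a) * t) \<le> cmod t"
      using xa[OF True] by (simp add: norm_mult mult_left_le_one_le)
    then have "cmod (of_real (x powr a) * t) powr k \<le> cmod t powr k" using k by (intro powr_mono2) auto
    then have "A * exp (B * cmod (of_real (x powr a) * t) powr k) \<le> A * exp (B * cmod t powr k)" using 1 by simp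
    with gb[OF inDS[OF t True] z] have "cmod (g (of_real (x powr a) * t) z) \<le> A * exp (B * cmod t powr k)" by linarith
    then show ?thesis unfolding F_def using w(2)[of x] by (simp add: norm_mult mult_left_mono)
  next
    case False then show ?thesis using w(3)[of x] by (simp add: F_def)
  qed
  have Fcarr: "F x t \<in> carr (O_space r)" if t: "t \<in> ?DS" for x t
  proof (cases "x \<in> {0<..<1}")
    case True
    then show ?thesis unfolding F_def by (intro O_space_scale carr inDS t)
  next
    case False
    then have "F x t = (\<lambda>z. 0)" using w(3)[of x] by (simp add: F_def fun_eq_iff)
    then show ?thesis using O_space_zero by simp
  qed
  have Fhol: "(\<lambda>t. F x t z) holomorphic_on ?DS" for x z
  proof (cases "x \<in> {0<..<1}")
    case True
    have "(\<lambda>t. g (of_real (x powr a) * t) z) holomorphic_on ?DS"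
      by (rule holomorphic_on_compose_gen[OF _ hol[of z], unfolded comp_def])
         (use inDS True in \<open>auto intro!: holomorphic_intros\<close>)
    then show ?thesis unfolding F_def by (intro holomorphic_intros)
  next
    case False
    then show ?thesis using w(3)[of x] by (simp add: F_def)
  qed
  have Fmeas: "(\<lambda>x. F x t z) \<in> borel_measurable lborel" if t: "t \<in> ?DS" for t z
  proof -
    have "continuous_on {0<..<1} (\<lambda>x. g (of_real (x powr a) * t) z)"
      by (rule continuous_on_compose2[OF holomorphic_on_imp_continuous_on[OF hol[of z]]])
         (use inDS t in \<open>auto intro!: continuous_intros\<close>)
    then have [measurable]: "(\<lambda>x. indicator {0<..<1} x *\<^sub>R g (of_real (x powr a) * t) z) \<in> borel_measurable borel"
      by (intro borel_measurable_continuous_on_indicator) auto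
    have [measurable]: "w \<in> borel_measurable borel" using w(1) by (auto dest: borel_measurable_integrable)
    have "F x t z = of_real (w x) * (indicator {0<..<1} x *\<^sub>R g (of_real (x powr a) * t) z)" for x
      using w(3)[of x] by (auto simp: F_def split: split_indicator)
    then have "(\<lambda>x. F x t z) = (\<lambda>x. of_real (w x) * (indicator {0<..<1} x *\<^sub>R g (of_real (x powr a) * t) z))" ..
    moreover have "(\<lambda>x. of_real (w x) * (indicator {0<..<1} x *\<^sub>R g (of_real (x powr a) * t) z)) \<in> borel_measurable borel"
      by measurable
    ultimately show ?thesis by (simp only: measurable_lborel2)
  qed
  define h where "h t z = (\<integral>x. F x t z \<partial>lborel)" for t z
  define W where "W = (\<integral>x. w x \<partial>lborel)"
  have W: "0 \<le> W" unfolding W_def using w(2) by (intro Bochner_Integration.integral_nonneg) auto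
  have dom: "locally_dominated ?DS (\<lambda>x t. F x t z)" if z: "z \<in> cball 0 r" for z
    unfolding locally_dominated_def
  proof (intro conjI allI ballI open_disc_sector Fhol Fmeas)
    fix t assume t: "t \<in> ?DS"
    then obtain \<rho> where \<rho>: "\<rho> > 0" "ball t \<rho> \<subseteq> ?DS"
      using open_disc_sector open_contains_ball by blast
    have "cmod (F x t' z) \<le> w x * (A * exp (B * (cmod t + \<rho>) powr k))" if t': "t' \<in> ball t \<rho>" for x t'
    proof -
      have "cmod t' \<le> cmod t + \<rho>" using t' norm_triangle_sub[of t' t] by (simp add: dist_norm norm_minus_commute)
      then have "cmod t' powr k \<le> (cmod t + \<rho>) powr k" using k by (intro powr_mono2) auto
      then have "w x * (A * exp (B * cmod t' powr k)) \<le> w x * (A * exp (B * (cmod t + \<rho>) powr k))"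
        using 1 w(2)[of x] by (intro mult_left_mono) auto
      moreover have "t' \<in> ?DS" using \<rho> t' by blast
      ultimately show ?thesis using Fb[OF _ z, of t' x] by linarith
    qed
    moreover have "integrable lborel (\<lambda>x. w x * (A * exp (B * (cmod t + \<rho>) powr k)))" using w(1) by simp
    ultimately show "\<exists>\<rho>>0. \<exists>w. ball t \<rho> \<subseteq> ?DS \<and> integrable lborel w \<and> (\<forall>x. \<forall>t'\<in>ball t \<rho>. cmod (F x t' z) \<le> w x)"
      using \<rho> by blast
  qed
  have "sectorial_sum r k d \<alpha> R (\<lambda>n z. of_real (\<integral>x. w x * (x powr a) ^ n \<partial>lborel) * b n z) h"
  proof (rule sectorial_sumI[OF 1(1,2,3) r k])
    show "h t \<in> carr (O_space r)" if t: "t \<in> ?DS" for t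
      unfolding h_def
    proof (rule integral_in_O_space(1))
      show "integrable lborel (\<lambda>x. w x * (A * exp (B * cmod t powr k)))" using w(1) by simp
    qed (use Fcarr Fmeas Fb t in auto)
    show "(\<lambda>t. h t z) holomorphic_on ?DS" if z: "z \<in> cball 0 r" for z
      unfolding h_def by (rule holomorphic_integral[OF dom[OF z]])
    show "cmod (h t z) \<le> (A * W + 1) * exp (B * cmod t powr k)" if t: "t \<in> ?DS" and z: "z \<in> cball 0 r" for t z
    proof -
      have "cmod (h t z) \<le> (\<integral>x. w x * (A * exp (B * cmod t powr k)) \<partial>lborel)"
        unfolding h_def
      proof (rule Bochner_Integration.integral_norm_bound_integral)
        show "integrable lborel (\<lambda>x. F x t z)" by (rule locally_dominated_integrable[OF dom[OF z] t])
      qed (use w(1) Fb[OF t z] in auto)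
      also have "\<dots> = W * (A * exp (B * cmod t powr k))" using w(1) by (simp add: W_def)
      also have "\<dots> \<le> (A * W + 1) * exp (B * cmod t powr k)" by (simp add: algebra_simps)
      finally show ?thesis .
    qed
    show "(\<lambda>t. h t z) has_fps_expansion Abs_fps (\<lambda>n. of_real (\<integral>x. w x * (x powr a) ^ n \<partial>lborel) * b n z)"
      if z: "z \<in> cball 0 r" for z
    proof -
      have 0: "0 \<in> ?DS" using 1 by (simp add: disc_sector_def)
      have "(\<lambda>t. h t z) has_fps_expansion fps_expansion (\<lambda>t. h t z) 0"
        using holomorphic_integral[OF dom[OF z]] 0
        by (intro has_fps_expansion_fps_expansion[of ?DS] open_disc_sector) (auto simp: h_def)
      also have "fps_expansion (\<lambda>t. h t z) 0 = Abs_fps (\<lambda>n. of_real (\<integral>x. w x * (x powr a) ^ n \<partial>lborel) * b n z)"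
      proof (rule fps_ext)
        fix n
        have bn: "b n z = (deriv ^^ n) (\<lambda>t. g t z) 0 / fact n"
          using fps_nth_fps_expansion[OF fps[OF z], of n] by simp
        have "(deriv ^^ n) (\<lambda>t. h t z) 0 = (\<integral>x. (deriv ^^ n) (\<lambda>t. F x t z) 0 \<partial>lborel)"
          unfolding h_def by (rule deriv_n_integral[OF dom[OF z] 0])
        also have "\<dots> = (\<integral>x. of_real (w x * (x powr a) ^ n) * (fact n * b n z) \<partial>lborel)"
        proof (rule Bochner_Integration.integral_cong[OF refl])
          fix x :: real
          show "(deriv ^^ n) (\<lambda>t. F x t z) 0 = of_real (w x * (x powr a) ^ n) * (fact n * b n z)"
          proof (cases "x \<in> {0<..<1}")
            case True
            have hol2: "(\<lambda>t. g (of_real (x powr a) * t) z) holomorphic_on ?DS"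
              by (rule holomorphic_on_compose_gen[OF _ hol[of z], unfolded comp_def])
                 (use inDS True in \<open>auto intro!: holomorphic_intros\<close>)
            have "(deriv ^^ n) (\<lambda>t. F x t z) 0 = of_real (w x) * (deriv ^^ n) (\<lambda>t. g (of_real (x powr a) * t) z) 0"
              unfolding F_def by (rule higher_deriv_cmult[OF hol2 0 open_disc_sector])
            also have "(deriv ^^ n) (\<lambda>t. g (of_real (x powr a) * t) z) 0
                = of_real (x powr a) ^ n * (deriv ^^ n) (\<lambda>t. g t z) (of_real (x powr a) * 0)"
              by (rule higher_deriv_compose_linear[OF hol open_disc_sector open_disc_sector 0]) (rule inDS[OF _ True])
            finally show ?thesis using bn by simp
          next
            case False
            then have "w x = 0" using w(3) by blast
            moreover have "(deriv ^^ n) (\<lambda>t. 0) (0::complex) = 0" by (cases n) auto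
            ultimately show ?thesis by (simp add: F_def)
          qed
        qed
        also have "\<dots> = of_real (\<integral>x. w x * (x powr a) ^ n \<partial>lborel) * (fact n * b n z)"
          by (simp only: integral_mult_left_zero integral_complex_of_real)
        finally show "fps_nth (fps_expansion (\<lambda>t. h t z) 0) n = fps_nth (Abs_fps (\<lambda>n. of_real (\<integral>x. w x * (x powr a) ^ n \<partial>lborel) * b n z)) n"
          by (simp add: fps_expansion_def)
      qed
      finally show ?thesis .
    qed
  qed (use 1 W in \<open>auto simp: add_nonneg_pos\<close>)
  then show ?thesis by blast
qed


text \<open>
  The ratio of Gamma values is a polynomial in \<open>n\<close> (a Pochhammer symbol of length \<open>N > a\<close>) times a Beta
  integral: the first factor is a composition of Euler operators, the second an average.
\<close>

lemma sectorial_sum_Gamma_ratio: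
  assumes S: "sectorial_sum r k d \<alpha> R b g" and r: "0 \<le> r" and k: "0 < k" and a: "0 \<le> a"
  shows "\<exists>g' \<alpha>' R'. sectorial_sum r k d \<alpha>' R'
           (\<lambda>n z. of_real (Gamma (1 + a * real n + a) / Gamma (1 + a * real n)) * b n z) g'"
proof -
  define N where "N = Suc (nat \<lfloor>a\<rfloor>)"
  have N: "a < real N" using a by (simp add: N_def) linarith
  define c where "c = Gamma (real N - a)"
  have c: "0 < c" using N by (simp add: c_def Gamma_real_pos)
  define w where "w x = indicator {0<..<1} x * (x powr a * (1 - x) powr (real N - a - 1)) / c" for x :: real
  have moment: "integrable lborel (\<lambda>x. w x * (x powr a) ^ n) \<and>
     (\<integral>x. w x * (x powr a) ^ n \<partial>lborel) = Gamma (1 + a * real n + a) / Gamma (1 + a * real n + real N)" for n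
  proof -
    define p where "p = 1 + a * real n + a"
    have p: "0 < p" using a by (simp add: p_def add_pos_nonneg)
    have eq: "w x * (x powr a) ^ n = (indicator {0..1} x *\<^sub>R (x powr (p - 1) * (1 - x) powr (real N - a - 1))) / c" for x
    proof (cases "x \<in> {0<..<1}")
      case True
      then have "(x powr a) ^ n = x powr (a * real n)" by (simp add: powr_powr flip: powr_realpow)
      then have "x powr a * (x powr a) ^ n = x powr (p - 1)" by (simp add: p_def powr_add add.commute)
      moreover have "w x * (x powr a) ^ n = (x powr a * (x powr a) ^ n) * (1 - x) powr (real N - a - 1) / c"
        using True by (simp add: w_def algebra_simps)
      ultimately show ?thesis using True by simp
    next
      case False
      then have "x = 0 \<or> x = 1 \<or> x \<notin> {0..1}" by auto
      then show ?thesis using False by (auto simp: w_def)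
    qed
    have int: "set_integrable lborel {0..1} (\<lambda>x. x powr (p - 1) * (1 - x) powr (real N - a - 1))"
      using p N by (intro integrable_Beta) auto
    have "(LINT x:{0..1}|lborel. x powr (p - 1) * (1 - x) powr (real N - a - 1)) = Beta p (real N - a)"
      using set_borel_integral_eq_integral(2)[OF int] has_integral_Beta_real[of p "real N - a"] p N
      by (simp add: integral_unique)
    then have "(\<integral>x. w x * (x powr a) ^ n \<partial>lborel) = Beta p (real N - a) / c"
      unfolding eq set_lebesgue_integral_def by simp
    also have "\<dots> = Gamma p / Gamma (1 + a * real n + real N)"
      using c unfolding Beta_def c_def by (simp add: p_def algebra_simps)
    finally show ?thesis using int unfolding eq set_integrable_def p_def by simp
  qed
  have "integrable lborel w" using moment[of 0] by simp
  moreover have "0 \<le> w x" for x using c by (simp add: w_def)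
  moreover have "w x = 0" if "x \<notin> {0<..<1}" for x using that by (simp add: w_def)
  ultimately obtain g1 where
    "sectorial_sum r k d \<alpha> R (\<lambda>n z. of_real (\<integral>x. w x * (x powr a) ^ n \<partial>lborel) * b n z) g1"
    using sectorial_sum_average[OF S r k a, of w] by blast
  from sectorial_sum_pochhammer[OF this r k, of a N] obtain g' \<alpha>' R' where
    g': "sectorial_sum r k d \<alpha>' R' (\<lambda>n z. of_real (pochhammer (1 + a * real n) N) *
        (of_real (\<integral>x. w x * (x powr a) ^ n \<partial>lborel) * b n z)) g'" by blast
  have "of_real (pochhammer (1 + a * real n) N) * (of_real (\<integral>x. w x * (x powr a) ^ n \<partial>lborel) * y)
      = of_real (Gamma (1 + a * real n + a) / Gamma (1 + a * real n)) * y" for n and y :: complex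
  proof -
    have pos: "0 < 1 + a * real n" using a by (simp add: add_pos_nonneg)
    then have "Gamma (1 + a * real n + real N) > 0" "1 + a * real n \<notin> \<int>\<^sub>\<le>\<^sub>0"
      by (auto intro!: Gamma_real_pos elim!: nonpos_Ints_cases)
    then have "pochhammer (1 + a * real n) N * (\<integral>x. w x * (x powr a) ^ n \<partial>lborel)
        = Gamma (1 + a * real n + a) / Gamma (1 + a * real n)"
      using conjunct2[OF moment[of n]] by (simp add: pochhammer_Gamma)
    then show ?thesis by (simp only: mult.assoc[symmetric] of_real_mult[symmetric])
  qed
  with g' show ?thesis by (simp only:) blast
qed

lemma Gamma_seq_pos: "0 \<le> s \<Longrightarrow> 0 < Gamma_seq s n"
  unfolding Gamma_seq_def by (intro Gamma_real_pos add_pos_nonneg) auto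

lemma Gamma_seq_0 [simp]: "Gamma_seq s 0 = 1"
  by (simp add: Gamma_seq_def)

lemma borel_transform_carr: "u n \<in> carr (O_space r) \<Longrightarrow> borel_transform m u n \<in> carr (O_space r)"
  unfolding borel_transform_def using O_space_scale[of "u n" r "inverse (of_real (m n))"]
  by (simp add: inverse_mult_eq_divide)

lemma k_summable_iff_sectorial_sum:
  assumes "0 \<le> r" "0 < k" "\<And>n. u n \<in> carr (O_space r)"
  shows "k_summable (O_space r) k d u \<longleftrightarrow>
    (\<exists>\<alpha> R g. sectorial_sum r k d \<alpha> R (borel_transform (Gamma_seq (1 / k)) u) g)"
proof -
  have c: "borel_transform m u n \<in> carr (O_space r)" for m n by (rule borel_transform_carr[OF assms(3)])
  show ?thesis
    unfolding k_summable_def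
    using sectorial_sum_imp_sector_cont_Ok[where b = "borel_transform (Gamma_seq (1 / k)) u", OF _ assms(1,2) c]
      sector_cont_Ok_imp_sectorial_sum[where b = "borel_transform (Gamma_seq (1 / k)) u", OF _ assms(1) c] assms(3)
    by blast
qed

text \<open>
  The shifted Borel transform of \<open>u\<close> differs from the Borel transform of the moment derivative by two
  quotients of Gamma values: one from the moments (parameter \<open>s\<close>), one from the Borel transform (\<open>1 / k\<close>).
\<close>

lemma k_summable_moment_deriv_Gamma:
  assumes u: "k_summable (O_space r) k d u" and r: "0 \<le> r" and k: "0 < k" and s: "0 \<le> s"
  shows "k_summable (O_space r) k d (moment_deriv_t (Gamma_seq s) u)"
proof -
  have uc: "u n \<in> carr (O_space r)" for n using u by (simp add: k_summable_def)
  have duc: "moment_deriv_t (Gamma_seq s) u n \<in> carr (O_space r)" for n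
    unfolding moment_deriv_t_def by (intro O_space_scale uc)
  let ?b = "borel_transform (Gamma_seq (1 / k)) u"
  have bc: "?b n \<in> carr (O_space r)" for n by (rule borel_transform_carr[OF uc])
  obtain \<alpha> R g where "sectorial_sum r k d \<alpha> R ?b g"
    using u k_summable_iff_sectorial_sum[of r k u d, OF r k uc] by blast
  then obtain g1 where "sectorial_sum r k d \<alpha> R (\<lambda>n. ?b (Suc n)) g1"
    using sectorial_sum_shift[where b = ?b, OF _ r k bc] by blast
  from sectorial_sum_Gamma_ratio[OF this r k, of "1/k"] obtain g2 \<alpha>2 R2 where
    "sectorial_sum r k d \<alpha>2 R2 (\<lambda>n z. of_real (Gamma (1 + 1/k * real n + 1/k) / Gamma (1 + 1/k * real n)) * ?b (Suc n) z) g2"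
    using k by auto
  from sectorial_sum_Gamma_ratio[OF this r k s] obtain g3 \<alpha>3 R3 where
    g3: "sectorial_sum r k d \<alpha>3 R3 (\<lambda>n z. of_real (Gamma (1 + s * real n + s) / Gamma (1 + s * real n)) *
      (of_real (Gamma (1 + 1/k * real n + 1/k) / Gamma (1 + 1/k * real n)) * ?b (Suc n) z)) g3"
    by blast
  have "(\<lambda>n z. of_real (Gamma (1 + s * real n + s) / Gamma (1 + s * real n)) *
      (of_real (Gamma (1 + 1/k * real n + 1/k) / Gamma (1 + 1/k * real n)) * ?b (Suc n) z))
     = borel_transform (Gamma_seq (1 / k)) (moment_deriv_t (Gamma_seq s) u)"
  proof (intro ext)
    fix n z
    have S: "Gamma (1 + a * real n + a) = Gamma_seq a (Suc n)" "Gamma (1 + a * real n) = Gamma_seq a n" for a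
      by (simp_all add: Gamma_seq_def algebra_simps)
    have "Gamma_seq (1/k) (Suc n) \<noteq> 0" using Gamma_seq_pos[of "1/k" "Suc n"] k by simp
    then show "of_real (Gamma (1 + s * real n + s) / Gamma (1 + s * real n)) *
      (of_real (Gamma (1 + 1/k * real n + 1/k) / Gamma (1 + 1/k * real n)) * ?b (Suc n) z)
       = borel_transform (Gamma_seq (1 / k)) (moment_deriv_t (Gamma_seq s) u) n z"
      unfolding S borel_transform_def moment_deriv_t_def by simp
  qed
  with g3 show ?thesis
    using k_summable_iff_sectorial_sum[of r k "moment_deriv_t (Gamma_seq s) u" d, OF r k duc] by auto
qed

text \<open>
  A sequence preserving summability conjugates one moment derivative into another:
  \<open>\<partial>\<^sub>m\<^sub>\<Gamma>\<close> is the Borel transform by \<open>m\<close> of \<open>\<partial>\<^sub>\<Gamma>\<close> of the inverse Borel transform by \<open>m\<close>.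
\<close>

lemma k_summable_moment_deriv:
  assumes m1: "generalized_moments s m1" and u: "k_summable (O_space r) k d u" and r: "0 < r" and k: "0 < k"
  shows "k_summable (O_space r) k d (moment_deriv_t m1 u)"
proof -
  from m1 obtain m where s: "0 \<le> s" and m: "preserves_summability m" and m1_eq: "m1 = (\<lambda>n. m n * Gamma_seq s n)"
    unfolding generalized_moments_def by blast
  have mpos: "0 < m n" for n using m by (simp add: preserves_summability_def)
  have pres: "k_summable (O_space r) k d u \<longleftrightarrow> k_summable (O_space r) k d (borel_transform m u)"
    if "\<And>n. u n \<in> carr (O_space r)" for u
    using m that complex_banach_O_space[OF r] k unfolding preserves_summability_def by blast
  have uc: "u n \<in> carr (O_space r)" for n using u by (simp add: k_summable_def)
  define u1 where "u1 n z = of_real (m n) * u n z" for n z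
  have u1c: "u1 n \<in> carr (O_space r)" for n unfolding u1_def by (intro O_space_scale uc)
  have "borel_transform m u1 = u"
  proof (intro ext)
    fix n z show "borel_transform m u1 n z = u n z" using mpos[of n] by (simp add: borel_transform_def u1_def)
  qed
  with pres[of u1, OF u1c] u have "k_summable (O_space r) k d u1" by simp
  then have "k_summable (O_space r) k d (moment_deriv_t (Gamma_seq s) u1)"
    using r k s by (intro k_summable_moment_deriv_Gamma) auto
  moreover have "moment_deriv_t (Gamma_seq s) u1 n \<in> carr (O_space r)" for n
    unfolding moment_deriv_t_def by (intro O_space_scale u1c)
  ultimately have "k_summable (O_space r) k d (borel_transform m (moment_deriv_t (Gamma_seq s) u1))"
    using pres[of "moment_deriv_t (Gamma_seq s) u1"] by blast
  also have "borel_transform m (moment_deriv_t (Gamma_seq s) u1) = moment_deriv_t m1 u"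
  proof (intro ext)
    fix n z
    show "borel_transform m (moment_deriv_t (Gamma_seq s) u1) n z = moment_deriv_t m1 u n z"
      using mpos[of n] by (simp add: borel_transform_def moment_deriv_t_def u1_def m1_eq mult.commute mult.left_commute)
  qed
  finally show ?thesis .
qed

section \<open>Gluing the sums over an interval of directions\<close>

text \<open>
  The sums in the directions between \<open>L\<close> and \<open>R\<close> are sheets of one function, which lives on a sector of the
  universal covering; in the logarithmic coordinate it is a function on the strip \<open>L < Im \<sigma> < R\<close>.
\<close>

definition strip :: "real \<Rightarrow> real \<Rightarrow> complex set" where
  "strip L R = {\<sigma>. L < Im \<sigma> \<and> Im \<sigma> < R}"

definition strip_sum ::
    "real \<Rightarrow> real \<Rightarrow> real \<Rightarrow> real \<Rightarrow> (nat \<Rightarrow> complex \<Rightarrow> complex) \<Rightarrow> (complex \<Rightarrow> complex \<Rightarrow> complex) \<Rightarrow> bool" where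
  "strip_sum r k L R b H \<longleftrightarrow>
     eholomorphic (O_space r) (strip L R) H \<and>
     (\<forall>x y. L < x \<and> y < R \<longrightarrow> (\<exists>A>0. \<exists>B>0. \<forall>\<sigma>. Im \<sigma> \<in> {x..y} \<longrightarrow>
        (\<forall>z\<in>cball 0 r. cmod (H \<sigma> z) \<le> A * exp (B * exp (k * Re \<sigma>))))) \<and>
     (\<exists>\<rho>>0. \<forall>\<sigma>\<in>strip L R. exp (Re \<sigma>) < \<rho> \<longrightarrow> (\<forall>z\<in>cball 0 r. (\<lambda>n. b n z * exp \<sigma> ^ n) sums H \<sigma> z)) \<and>
     (\<forall>\<theta>\<in>{L<..<R}. \<exists>\<alpha> \<rho> g. sectorial_sum r k \<theta> \<alpha> \<rho> b g \<and> (\<forall>\<sigma>\<in>strip L R. \<bar>Im \<sigma> - \<theta>\<bar> < \<alpha> / 2 \<longrightarrow> H \<sigma> = g (exp \<sigma>)))"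

lemma exp_powr_norm: "cmod (exp \<sigma>) powr k = exp (k * Re \<sigma>)"
  by (simp add: powr_def)

text \<open>
  The value over argument \<open>\<theta>\<close> is taken from the sum in direction \<open>\<theta>\<close>. Neighbouring sums agree because both continue
  the same power series, and a compact set of directions is covered by finitely many of them.
\<close>

lemma strip_sum_exists:
  assumes r: "0 \<le> r" and k: "0 < k"
    and S: "\<And>\<theta>. \<theta> \<in> {L<..<R} \<Longrightarrow> \<exists>\<alpha> \<rho> g. sectorial_sum r k \<theta> \<alpha> \<rho> b g" and LR: "L < R"
  shows "\<exists>H. strip_sum r k L R b H"
proof -
  have "\<forall>\<theta>. \<exists>\<alpha> \<rho> g. \<theta> \<in> {L<..<R} \<longrightarrow> sectorial_sum r k \<theta> \<alpha> \<rho> b g" using S by blast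
  then obtain \<alpha> \<rho> g where g: "\<And>\<theta>. \<theta> \<in> {L<..<R} \<Longrightarrow> sectorial_sum r k \<theta> (\<alpha> \<theta>) (\<rho> \<theta>) b (g \<theta>)"
    by metis
  have pos: "0 < \<alpha> \<theta>" "0 < \<rho> \<theta>" if "\<theta> \<in> {L<..<R}" for \<theta> using g[OF that] by (auto simp: sectorial_sum_def)
  define H where "H \<sigma> = g (Im \<sigma>) (exp \<sigma>)" for \<sigma>
  have loc: "H \<sigma> = g \<theta> (exp \<sigma>)" if "\<theta> \<in> {L<..<R}" "\<sigma> \<in> strip L R" "\<bar>Im \<sigma> - \<theta>\<bar> < \<alpha> \<theta> / 2" for \<sigma> \<theta>
  proof -
    have i: "Im \<sigma> \<in> {L<..<R}" using that(2) by (simp add: strip_def)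
    show ?thesis unfolding H_def
      by (rule sectorial_sum_unique[OF g[OF i] g[OF that(1)] r])
         (use that pos[OF i] in \<open>auto intro!: exp_in_disc_sector\<close>)
  qed
  have gb: "\<exists>A>0. \<exists>B>0. \<forall>\<sigma>\<in>strip L R. \<bar>Im \<sigma> - \<theta>\<bar> < \<alpha> \<theta> / 2 \<longrightarrow> (\<forall>z\<in>cball 0 r. cmod (H \<sigma> z) \<le> A * exp (B * exp (k * Re \<sigma>)))"
    if \<theta>: "\<theta> \<in> {L<..<R}" for \<theta>
  proof -
    from sectorial_sum_E[OF g[OF \<theta>] r] obtain A B where AB: "0 < A" "0 < B"
      "\<And>t z. t \<in> disc_sector \<theta> (\<alpha> \<theta>) (\<rho> \<theta>) \<Longrightarrow> z \<in> cball 0 r \<Longrightarrow> cmod (g \<theta> t z) \<le> A * exp (B * cmod t powr k)"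
      by metis
    have "cmod (H \<sigma> z) \<le> A * exp (B * exp (k * Re \<sigma>))"
      if "\<sigma> \<in> strip L R" "\<bar>Im \<sigma> - \<theta>\<bar> < \<alpha> \<theta> / 2" "z \<in> cball 0 r" for \<sigma> z
      using AB(3)[OF exp_in_disc_sector[OF that(2)] that(3)] loc[OF \<theta> that(1,2)] by (simp only: exp_powr_norm)
    with AB(1,2) show ?thesis by blast
  qed
  have "eholomorphic (O_space r) (strip L R) H"
  proof (rule eholomorphicI[OF r])
    show S: "open (strip L R)" unfolding strip_def by (rule open_strip_between)
    show "H \<sigma> \<in> carr (O_space r)" if "\<sigma> \<in> strip L R" for \<sigma>
    proof -
      have i: "Im \<sigma> \<in> {L<..<R}" using that by (simp add: strip_def)
      show ?thesis unfolding H_def using g[OF i] pos[OF i]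
        by (intro eholomorphic_carr[of _ "disc_sector (Im \<sigma>) (\<alpha> (Im \<sigma>)) (\<rho> (Im \<sigma>))"] exp_in_disc_sector)
           (auto simp: sectorial_sum_def)
    qed
    have nbh: "open (strip L R \<inter> {\<sigma>. \<bar>Im \<sigma> - \<theta>\<bar> < \<alpha> \<theta> / 2})" for \<theta>
      using S open_strip_abs by blast
    show "(\<lambda>\<sigma>. H \<sigma> z) holomorphic_on strip L R" if z: "z \<in> cball 0 r" for z
      unfolding holomorphic_on_open[OF S]
    proof
      fix \<sigma> assume \<sigma>: "\<sigma> \<in> strip L R"
      define \<theta> where "\<theta> = Im \<sigma>"
      have \<theta>: "\<theta> \<in> {L<..<R}" using \<sigma> by (simp add: strip_def \<theta>_def)
      let ?T = "strip L R \<inter> {\<sigma>. \<bar>Im \<sigma> - \<theta>\<bar> < \<alpha> \<theta> / 2}"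
      have "(\<lambda>t. g \<theta> t z) holomorphic_on disc_sector \<theta> (\<alpha> \<theta>) (\<rho> \<theta>)"
        using g[OF \<theta>] r by (intro eholomorphic_pointwise open_disc_sector) (auto simp: sectorial_sum_def)
      then have "(\<lambda>\<sigma>. g \<theta> (exp \<sigma>) z) holomorphic_on ?T"
        by (rule holomorphic_on_compose_gen[OF holomorphic_on_exp, unfolded comp_def]) (auto intro: exp_in_disc_sector)
      then have "(\<lambda>\<sigma>. H \<sigma> z) holomorphic_on ?T"
        by (rule holomorphic_transform) (use loc[OF \<theta>] in auto)
      moreover have "\<sigma> \<in> ?T" using \<sigma> pos[OF \<theta>] by (simp add: \<theta>_def)
      ultimately show "\<exists>f'. ((\<lambda>\<sigma>. H \<sigma> z) has_field_derivative f') (at \<sigma>)"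
        using holomorphic_derivI[OF _ nbh] by blast
    qed
    fix \<sigma> assume \<sigma>: "\<sigma> \<in> strip L R"
    define \<theta> where "\<theta> = Im \<sigma>"
    have \<theta>: "\<theta> \<in> {L<..<R}" using \<sigma> by (simp add: strip_def \<theta>_def)
    let ?T = "strip L R \<inter> {\<sigma>. \<bar>Im \<sigma> - \<theta>\<bar> < \<alpha> \<theta> / 2}"
    from gb[OF \<theta>] obtain A B where AB: "0 < A" "0 < B"
      "\<And>\<sigma> z. \<sigma> \<in> ?T \<Longrightarrow> z \<in> cball 0 r \<Longrightarrow> cmod (H \<sigma> z) \<le> A * exp (B * exp (k * Re \<sigma>))"
      by blast
    have "\<sigma> \<in> ?T" using \<sigma> pos[OF \<theta>] by (simp add: \<theta>_def)
    then obtain e where e: "e > 0" "ball \<sigma> e \<subseteq> ?T" using nbh open_contains_ball by blast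
    have "cmod (H s z) \<le> A * exp (B * exp (k * (Re \<sigma> + e)))" if s: "s \<in> ball \<sigma> e" "z \<in> cball 0 r" for s z
    proof -
      have "\<bar>Re s - Re \<sigma>\<bar> < e" using s abs_Re_le_cmod[of "s - \<sigma>"] by (simp add: dist_norm norm_minus_commute)
      then have "exp (k * Re s) \<le> exp (k * (Re \<sigma> + e))" using k by simp
      then have "A * exp (B * exp (k * Re s)) \<le> A * exp (B * exp (k * (Re \<sigma> + e)))" using AB by simp
      with AB(3)[of s z] s e show ?thesis by fastforce
    qed
    with e(1) show "\<exists>\<rho>>0. \<exists>M. \<forall>t'\<in>ball \<sigma> \<rho>. \<forall>z\<in>cball 0 r. cmod (H t' z) \<le> M" by blast
  qed
  moreover have "\<exists>A>0. \<exists>B>0. \<forall>\<sigma>. Im \<sigma> \<in> {x..y} \<longrightarrow> (\<forall>z\<in>cball 0 r. cmod (H \<sigma> z) \<le> A * exp (B * exp (k * Re \<sigma>)))"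
    if xy: "L < x" "y < R" for x y
  proof -
    from gb have "\<forall>\<theta>. \<exists>A B. \<theta> \<in> {L<..<R} \<longrightarrow> A > 0 \<and> B > 0 \<and> (\<forall>\<sigma>\<in>strip L R. \<bar>Im \<sigma> - \<theta>\<bar> < \<alpha> \<theta> / 2 \<longrightarrow>
        (\<forall>z\<in>cball 0 r. cmod (H \<sigma> z) \<le> A * exp (B * exp (k * Re \<sigma>))))" by blast
    then obtain A B where AB: "\<And>\<theta>. \<theta> \<in> {L<..<R} \<Longrightarrow> A \<theta> > 0" "\<And>\<theta>. \<theta> \<in> {L<..<R} \<Longrightarrow> B \<theta> > 0"
      and bound: "\<And>\<theta> \<sigma> z. \<theta> \<in> {L<..<R} \<Longrightarrow> \<sigma> \<in> strip L R \<Longrightarrow> \<bar>Im \<sigma> - \<theta>\<bar> < \<alpha> \<theta> / 2 \<Longrightarrow> z \<in> cball 0 r \<Longrightarrow>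
        cmod (H \<sigma> z) \<le> A \<theta> * exp (B \<theta> * exp (k * Re \<sigma>))" by metis
    have sub: "{x..y} \<subseteq> {L<..<R}" using xy by auto
    have cover: "{x..y} \<subseteq> (\<Union>\<theta>\<in>{x..y}. {\<theta> - \<alpha> \<theta> / 2<..<\<theta> + \<alpha> \<theta> / 2})"
    proof
      fix \<theta> assume "\<theta> \<in> {x..y}"
      with pos[of \<theta>] sub show "\<theta> \<in> (\<Union>\<theta>\<in>{x..y}. {\<theta> - \<alpha> \<theta> / 2<..<\<theta> + \<alpha> \<theta> / 2})" by fastforce
    qed
    obtain C where C: "C \<subseteq> {x..y}" "finite C" "{x..y} \<subseteq> (\<Union>\<theta>\<in>C. {\<theta> - \<alpha> \<theta> / 2<..<\<theta> + \<alpha> \<theta> / 2})"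
      using compactE_image[OF compact_Icc _ cover] by auto
    have CLR: "C \<subseteq> {L<..<R}" using C(1) sub by blast
    have nn: "A \<theta> \<ge> 0" "B \<theta> \<ge> 0" if "\<theta> \<in> C" for \<theta> using AB[of \<theta>] CLR that by (auto intro: less_imp_le)
    have "cmod (H \<sigma> z) \<le> (1 + sum A C) * exp ((1 + sum B C) * exp (k * Re \<sigma>))"
      if \<sigma>: "Im \<sigma> \<in> {x..y}" and z: "z \<in> cball 0 r" for \<sigma> z
    proof -
      from subsetD[OF C(3) \<sigma>] obtain \<theta> where "\<theta> \<in> C" "Im \<sigma> \<in> {\<theta> - \<alpha> \<theta> / 2<..<\<theta> + \<alpha> \<theta> / 2}" by blast
      then have \<theta>: "\<theta> \<in> C" "\<bar>Im \<sigma> - \<theta>\<bar> < \<alpha> \<theta> / 2" by (simp_all only: greaterThanLessThan_iff abs_less_iff) linarith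
      have 1: "A \<theta> \<le> 1 + sum A C" "B \<theta> \<le> 1 + sum B C"
        using member_le_sum[OF \<theta>(1), of A] member_le_sum[OF \<theta>(1), of B] nn C(2) by fastforce+
      have "\<sigma> \<in> strip L R" using \<sigma> xy by (simp add: strip_def)
      then have "cmod (H \<sigma> z) \<le> A \<theta> * exp (B \<theta> * exp (k * Re \<sigma>))" using \<theta> CLR z by (intro bound) auto
      also have "\<dots> \<le> (1 + sum A C) * exp ((1 + sum B C) * exp (k * Re \<sigma>))"
        using 1 nn[OF \<theta>(1)] by (intro mult_mono) (auto intro!: mult_right_mono)
      finally show ?thesis .
    qed
    moreover have "0 < 1 + sum A C" "0 < 1 + sum B C" using nn by (auto intro!: add_pos_nonneg sum_nonneg)
    ultimately show ?thesis by blast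
  qed
  moreover have "\<exists>\<rho>>0. \<forall>\<sigma>\<in>strip L R. exp (Re \<sigma>) < \<rho> \<longrightarrow> (\<forall>z\<in>cball 0 r. (\<lambda>n. b n z * exp \<sigma> ^ n) sums H \<sigma> z)"
  proof -
    define \<theta> where "\<theta> = (L + R) / 2"
    have \<theta>: "\<theta> \<in> {L<..<R}" using LR by (auto simp: \<theta>_def)
    have "(\<lambda>n. b n z * exp \<sigma> ^ n) sums H \<sigma> z" if \<sigma>: "\<sigma> \<in> strip L R" "exp (Re \<sigma>) < \<rho> \<theta>" and z: "z \<in> cball 0 r" for \<sigma> z
    proof -
      have i: "Im \<sigma> \<in> {L<..<R}" using \<sigma> by (simp add: strip_def)
      have "H \<sigma> = g \<theta> (exp \<sigma>)" unfolding H_def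
        by (rule sectorial_sum_unique[OF g[OF i] g[OF \<theta>] r])
           (use \<sigma> pos[OF i] in \<open>auto intro!: exp_in_disc_sector simp: disc_sector_def[of \<theta>]\<close>)
      then show ?thesis using sectorial_sum_sums[OF g[OF \<theta>] r _ z, of "exp \<sigma>"] \<sigma> by simp
    qed
    with pos(2)[OF \<theta>] show ?thesis by blast
  qed
  ultimately have "strip_sum r k L R b H"
    unfolding strip_sum_def using g loc by blast
  then show ?thesis by blast
qed

section \<open>Laplace integrals along rays\<close>

lemma has_ray_integral_unique: "has_ray_integral \<theta> F I \<Longrightarrow> has_ray_integral \<theta> F J \<Longrightarrow> I = J"
  by (auto simp: has_ray_integral_def)

lemma has_ray_integral_cong:
  assumes "\<And>\<sigma>. Im \<sigma> = \<theta> \<Longrightarrow> F \<sigma> = G \<sigma>"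
  shows "has_ray_integral \<theta> F I \<longleftrightarrow> has_ray_integral \<theta> G I"
proof -
  have "F (of_real (ln x) + \<i> * of_real \<theta>) = G (of_real (ln x) + \<i> * of_real \<theta>)" for x
    by (rule assms) simp
  then show ?thesis by (simp add: has_ray_integral_def)
qed

lemma has_ray_integral_add:
  "has_ray_integral \<theta> F I \<Longrightarrow> has_ray_integral \<theta> G J \<Longrightarrow> has_ray_integral \<theta> (\<lambda>\<sigma>. F \<sigma> + G \<sigma>) (I + J)"
  by (auto simp: has_ray_integral_def distrib_right intro!: set_integral_add)

lemma has_ray_integral_cmult:
  "has_ray_integral \<theta> F I \<Longrightarrow> has_ray_integral \<theta> (\<lambda>\<sigma>. c * F \<sigma>) (c * I)"
  by (auto simp: has_ray_integral_def mult.assoc)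

lemma has_ray_integral_0: "has_ray_integral \<theta> (\<lambda>\<sigma>. 0) 0"
  by (simp add: has_ray_integral_def set_integrable_def)

lemma has_ray_integral_sum:
  "(\<And>i. i \<in> X \<Longrightarrow> has_ray_integral \<theta> (F i) (I i)) \<Longrightarrow> has_ray_integral \<theta> (\<lambda>\<sigma>. \<Sum>i\<in>X. F i \<sigma>) (\<Sum>i\<in>X. I i)"
  by (induction X rule: infinite_finite_induct) (auto simp: has_ray_integral_0 has_ray_integral_add)

text \<open>
  The derivative of \<open>- exp (- c * x powr k) / (c * k)\<close> on the positive half-line: it dominates all Laplace
  integrands, and its integral is elementary.
\<close>

definition weight :: "real \<Rightarrow> real \<Rightarrow> real \<Rightarrow> real" where
  "weight k c x = indicator {0<..} x * (x powr (k - 1) * exp (- c * x powr k))"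

lemma weight_integral:
  assumes k: "0 < k" and c: "0 < c"
  shows "integrable lborel (weight k c)" "(\<integral>x. weight k c x \<partial>lborel) = 1 / (c * k)"
proof -
  define f where "f x = x powr (k - 1) * exp (- c * x powr k)" for x
  define F where "F x = - exp (- c * x powr k) / (c * k)" for x
  have D: "(F has_real_derivative f x) (at x)" if "0 < x" for x
    unfolding F_def f_def using that k c
    by (auto intro!: derivative_eq_intros simp: field_simps powr_diff)
  have "isCont f x" if "0 < x" for x
    unfolding f_def using that by (intro continuous_intros) auto
  moreover have "((F \<circ> real_of_ereal) \<longlongrightarrow> - 1 / (c * k)) (at_right 0)"
    unfolding zero_ereal_def ereal_tendsto_simps1 
  proof -
    have "((\<lambda>x. x powr k) \<longlongrightarrow> 0 powr k) (at_right (0::real))"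
      using k by (intro tendsto_powr2 tendsto_intros) (auto simp: eventually_at_right_less eventually_at_right[of 0 1] intro!: exI[of _ 1])
    then have "(F \<longlongrightarrow> - exp (- c * 0 powr k) / (c * k)) (at_right 0)" unfolding F_def using k c
      by (intro tendsto_intros) (auto intro: eventually_mono[OF eventually_at_right_less])
    then show "(F \<longlongrightarrow> - 1 / (c * k)) (at_right 0)" using k by simp
  qed
  moreover have "((F \<circ> real_of_ereal) \<longlongrightarrow> 0) (at_left \<infinity>)"
    unfolding ereal_tendsto_simps1 F_def using k c by real_asymp
  ultimately have I: "set_integrable lborel (einterval 0 \<infinity>) f" "(LBINT x=0..\<infinity>. f x) = 0 - (- 1 / (c * k))"
    using D interval_integral_FTC_nonneg[of 0 \<infinity> F f "- 1 / (c * k)" 0] by (auto simp: f_def)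
  have e: "einterval 0 \<infinity> = {0::real<..}" by (auto simp: einterval_def)
  have w: "weight k c = (\<lambda>x. indicator {0<..} x *\<^sub>R f x)" by (simp add: weight_def f_def fun_eq_iff)
  show "integrable lborel (weight k c)" using I(1) unfolding set_integrable_def w e .
  show "(\<integral>x. weight k c x \<partial>lborel) = 1 / (c * k)"
    using I(2) unfolding interval_lebesgue_integral_0_infty set_lebesgue_integral_def w by simp
qed

lemma weight_exp: "0 < x \<Longrightarrow> weight k c x = exp ((k - 1) * ln x) * exp (- c * exp (k * ln x))"
  by (simp add: weight_def powr_def)

text \<open>
  The integrand along the ray \<open>arg s = Im s\<close> for a complex shift in place of \<open>\<i> * \<theta>\<close>, so that the ray can be varied
  holomorphically.
\<close>

definition ray_integrand :: "(complex \<Rightarrow> complex) \<Rightarrow> complex \<Rightarrow> real \<Rightarrow> complex" where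
  "ray_integrand F s x = indicator {0<..} x *\<^sub>R (F (of_real (ln x) + s) * exp s)"

lemma has_ray_integral_iff:
  "has_ray_integral \<theta> F I \<longleftrightarrow> integrable lborel (ray_integrand F (\<i> * of_real \<theta>)) \<and> (\<integral>x. ray_integrand F (\<i> * of_real \<theta>) x \<partial>lborel) = I"
  unfolding has_ray_integral_def set_integrable_def set_lebesgue_integral_def ray_integrand_def
  by (simp add: cis_conv_exp)

lemma ray_integrand_measurable:
  assumes "continuous_on {\<sigma>. Im \<sigma> = Im s} F"
  shows "ray_integrand F s \<in> borel_measurable lborel"
proof -
  have "continuous_on {0<..} (\<lambda>x. F (of_real (ln x) + s) * exp s)"
    by (intro continuous_intros continuous_on_compose2[OF assms]) auto
  then have "(\<lambda>x. indicator {0<..} x *\<^sub>R (F (of_real (ln x) + s) * exp s)) \<in> borel_measurable borel"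
    by (intro borel_measurable_continuous_on_indicator) auto
  then show ?thesis by (simp add: ray_integrand_def[abs_def])
qed

lemma ray_integral_bound:
  assumes k: "0 < k" and c: "0 < c" and cont: "continuous_on {\<sigma>. Im \<sigma> = \<theta>} F"
    and bound: "\<And>\<sigma>. Im \<sigma> = \<theta> \<Longrightarrow> cmod (F \<sigma>) \<le> C * (exp ((k - 1) * Re \<sigma>) * exp (- c * exp (k * Re \<sigma>)))"
  shows "\<exists>I. has_ray_integral \<theta> F I \<and> cmod I \<le> C / (c * k)"
proof -
  let ?f = "ray_integrand F (\<i> * of_real \<theta>)"
  have le: "cmod (?f x) \<le> C * weight k c x" for x
  proof (cases "0 < x")
    case True
    then show ?thesis using bound[of "of_real (ln x) + \<i> * of_real \<theta>"]
      by (simp add: ray_integrand_def weight_exp norm_mult)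
  qed (simp add: ray_integrand_def weight_def)
  have I: "integrable lborel (\<lambda>x. C * weight k c x)" using weight_integral(1)[OF k c] by simp
  have f: "integrable lborel ?f"
  proof (rule Bochner_Integration.integrable_bound[OF I ray_integrand_measurable AE_I2])
    show "continuous_on {\<sigma>. Im \<sigma> = Im (\<i> * of_real \<theta>)} F" using cont by simp
    show "cmod (?f x) \<le> norm (C * weight k c x)" for x
      unfolding real_norm_def by (rule order_trans[OF le abs_ge_self])
  qed
  have "cmod (\<integral>x. ?f x \<partial>lborel) \<le> (\<integral>x. C * weight k c x \<partial>lborel)"
    by (rule Bochner_Integration.integral_norm_bound_integral[OF f I le])
  also have "\<dots> = C / (c * k)" using weight_integral[OF k c] by simp
  finally show ?thesis using f unfolding has_ray_integral_iff by blast
qed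

text \<open>
  Rotating the ray does not change the integral. As a function of the shift \<open>s\<close> in the logarithmic
  coordinate the integral is holomorphic; real shifts are dilations of the ray and leave it unchanged, so
  its derivative vanishes, and imaginary shifts, which are rotations, leave it unchanged as well.
\<close>

lemma ray_integral_rotation:
  assumes k: "0 < k" and c: "0 < c" and C: "0 \<le> C" and hol: "F holomorphic_on strip a b"
    and bound: "\<And>\<sigma>. \<sigma> \<in> strip a b \<Longrightarrow> cmod (F \<sigma>) \<le> C * (exp ((k - 1) * Re \<sigma>) * exp (- c * exp (k * Re \<sigma>)))"
    and \<theta>: "\<theta> \<in> {a<..<b}" "\<theta>' \<in> {a<..<b}" and I: "has_ray_integral \<theta> F I"
  shows "has_ray_integral \<theta>' F I"
proof -
  let ?S = "strip a b"
  have S: "open ?S" "convex ?S" unfolding strip_def by (rule open_strip_between convex_strip_between)+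
  have sh: "of_real h + s \<in> ?S" if "s \<in> ?S" for h s using that by (simp add: strip_def)
  define \<Phi> where "\<Phi> s = (\<integral>x. ray_integrand F s x \<partial>lborel)" for s
  have dom: "locally_dominated ?S (\<lambda>x s. ray_integrand F s x)"
    unfolding locally_dominated_def
  proof (intro conjI allI ballI S)
    show "(\<lambda>s. ray_integrand F s x) holomorphic_on ?S" for x
    proof -
      have "(\<lambda>s. F (of_real (ln x) + s)) holomorphic_on ?S"
        by (rule holomorphic_on_compose_gen[OF _ hol, unfolded comp_def]) (use sh in \<open>auto intro!: holomorphic_intros\<close>)
      then show ?thesis unfolding ray_integrand_def scaleR_conv_of_real by (intro holomorphic_intros)
    qed
    fix s assume s: "s \<in> ?S"
    show "ray_integrand F s \<in> borel_measurable lborel"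
      using s by (intro ray_integrand_measurable continuous_on_subset[OF holomorphic_on_imp_continuous_on[OF hol]])
        (auto simp: strip_def)
    from S(1) s obtain e where e: "e > 0" "ball s e \<subseteq> ?S" using open_contains_ball by blast
    define \<rho> where "\<rho> = min e 1"
    let ?w = "\<lambda>x. C * exp (k * (Re s + 1)) * weight k (c * exp (k * (Re s - 1))) x"
    have "cmod (ray_integrand F s' x) \<le> ?w x" if s': "s' \<in> ball s \<rho>" for s' x
    proof (cases "0 < x")
      case True
      have re: "\<bar>Re s' - Re s\<bar> < 1"
        using s' abs_Re_le_cmod[of "s' - s"] by (simp add: dist_norm norm_minus_commute \<rho>_def)
      have "s' \<in> ?S" using s' e by (auto simp: \<rho>_def)
      then have "cmod (F (of_real (ln x) + s')) \<le> C * (exp ((k - 1) * (ln x + Re s')) * exp (- c * exp (k * (ln x + Re s'))))"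
        using bound[OF sh, of s' "ln x"] by simp
      then have "cmod (ray_integrand F s' x) \<le> C * (exp ((k - 1) * (ln x + Re s')) * exp (- c * exp (k * (ln x + Re s')))) * exp (Re s')"
        using True by (simp add: ray_integrand_def norm_mult)
      also have "\<dots> = C * exp ((k - 1) * ln x) * (exp (k * Re s') * exp (- c * exp (k * Re s') * exp (k * ln x)))"
        by (simp add: algebra_simps flip: exp_add)
      also have "\<dots> \<le> C * exp ((k - 1) * ln x) * (exp (k * (Re s + 1)) * exp (- c * exp (k * (Re s - 1)) * exp (k * ln x)))"
      proof (intro mult_left_mono mult_mono)
        show "exp (k * Re s') \<le> exp (k * (Re s + 1))" using re k by simp
        have "c * exp (k * (Re s - 1)) * exp (k * ln x) \<le> c * exp (k * Re s') * exp (k * ln x)"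
          using re k c by (intro mult_right_mono mult_left_mono) auto
        then show "exp (- c * exp (k * Re s') * exp (k * ln x)) \<le> exp (- c * exp (k * (Re s - 1)) * exp (k * ln x))"
          by simp
      qed (use C in auto)
      also have "\<dots> = ?w x" using True by (simp add: weight_exp)
      finally show ?thesis .
    qed (simp add: ray_integrand_def weight_def)
    moreover have "integrable lborel ?w" using weight_integral(1)[OF k] c by simp
    moreover have "\<rho> > 0" "ball s \<rho> \<subseteq> ?S" using e by (auto simp: \<rho>_def)
    ultimately show "\<exists>\<rho>>0. \<exists>w. ball s \<rho> \<subseteq> ?S \<and> integrable lborel w \<and> (\<forall>x. \<forall>s'\<in>ball s \<rho>. cmod (ray_integrand F s' x) \<le> w x)"
      by blast
  qed
  \<comment> \<open>Substitution of \<open>exp h * x\<close> for \<open>x\<close>.\<close>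
  have shift: "\<Phi> (s + of_real h) = \<Phi> s" for s h
  proof -
    have "\<Phi> s = \<bar>exp h\<bar> *\<^sub>R (\<integral>x. ray_integrand F s (0 + exp h * x) \<partial>lborel)"
      unfolding \<Phi>_def by (rule lborel_integral_real_affine) simp
    also have "\<dots> = (\<integral>x. exp h *\<^sub>R ray_integrand F s (exp h * x) \<partial>lborel)" by simp
    also have "\<dots> = \<Phi> (s + of_real h)"
      unfolding \<Phi>_def
    proof (rule Bochner_Integration.integral_cong[OF refl])
      fix x :: real
      show "exp h *\<^sub>R ray_integrand F s (exp h * x) = ray_integrand F (s + of_real h) x"
        by (cases "0 < x")
           (auto simp: ray_integrand_def ln_mult zero_less_mult_iff exp_add exp_of_real scaleR_conv_of_real algebra_simps)
    qed
    finally show ?thesis by simp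
  qed
  have "(\<Phi> has_field_derivative 0) (at s within ?S)" if s: "s \<in> ?S" for s
  proof -
    from holomorphic_integral[OF dom] have "\<Phi> holomorphic_on ?S" by (simp add: \<Phi>_def[abs_def])
    then have d: "(\<Phi> has_field_derivative deriv \<Phi> s) (at s)" using S s by (intro holomorphic_derivI) auto
    then have "(\<lambda>h. (\<Phi> (s + h) - \<Phi> s) / h) \<midarrow>0\<rightarrow> deriv \<Phi> s" by (simp add: DERIV_def)
    moreover have "filterlim (\<lambda>n. of_real (inverse (real (Suc n)))) (at (0::complex)) sequentially"
      unfolding filterlim_at using tendsto_of_real[OF LIMSEQ_inverse_real_of_nat, where 'a = complex]
      by (auto simp del: of_nat_Suc intro!: always_eventually)
    ultimately have "(\<lambda>n. (\<Phi> (s + of_real (inverse (real (Suc n)))) - \<Phi> s) / of_real (inverse (real (Suc n)))) \<longlonglongrightarrow> deriv \<Phi> s"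
      by (rule filterlim_compose)
    then have "(\<lambda>n::nat. 0) \<longlonglongrightarrow> deriv \<Phi> s" by (simp only: shift diff_self div_0)
    then have "deriv \<Phi> s = 0" using LIMSEQ_unique tendsto_const by blast
    with d show ?thesis by (simp add: has_field_derivative_at_within)
  qed
  then obtain v where v: "\<And>s. s \<in> ?S \<Longrightarrow> \<Phi> s = v"
    using has_field_derivative_zero_constant[OF S(2), of \<Phi>] by blast
  have in_S: "\<i> * of_real \<theta> \<in> ?S" "\<i> * of_real \<theta>' \<in> ?S" using \<theta> by (auto simp: strip_def)
  show ?thesis
    using I v[OF in_S(1)] v[OF in_S(2)] locally_dominated_integrable[OF dom in_S(2)]
    unfolding has_ray_integral_iff \<Phi>_def by simp
qed

lemma exp_linear_le_exp_exp:
  assumes "0 < k" "0 < \<kappa>" "0 \<le> N"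
  shows "\<exists>M>0. \<forall>x::real. exp (N * x) \<le> M * exp (\<kappa> * exp (k * x))"
proof (cases "N = 0")
  case True
  then show ?thesis using assms by (intro exI[of _ 1]) auto
next
  case False
  define l where "l = ln (N / (k * \<kappa>))"
  have l: "exp (- l) = k * \<kappa> / N" using assms False by (simp add: l_def exp_minus)
  have "exp (N * x) \<le> exp (N / k * l) * exp (\<kappa> * exp (k * x))" for x
  proof -
    have "k * x - l \<le> exp (k * x - l)" using exp_ge_add_one_self[of "k * x - l"] by linarith
    also have "\<dots> = exp (k * x) * exp (- l)" by (simp flip: exp_add)
    finally have "k * x - l \<le> exp (k * x) * (k * \<kappa> / N)" unfolding l .
    then have "N / k * (k * x - l) \<le> N / k * (exp (k * x) * (k * \<kappa> / N))"
      using assms by (intro mult_left_mono) auto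
    also have "\<dots> = \<kappa> * exp (k * x)" using assms False by simp
    finally have "N * x \<le> N / k * l + \<kappa> * exp (k * x)" using assms by (simp add: right_diff_distrib)
    then show ?thesis by (simp flip: exp_add)
  qed
  then show ?thesis by (intro exI[of _ "exp (N / k * l)"]) auto
qed

text \<open>
  With \<open>y = Re \<sigma> - Re \<tau>\<close> and \<open>X = exp (k * y)\<close> the kernel decays like \<open>exp (- X * cos \<omega>)\<close>. Half of this
  exponent absorbs the growth of the integrand, which is where \<open>\<bar>t\<bar>\<close> has to be small, and a quarter
  absorbs a power of \<open>\<bar>s / t\<bar>\<close>.
\<close>

lemma laplace_kernel_bound:
  assumes k: "0 < k" and \<omega>: "\<omega> < pi / 2" and ang: "\<bar>k * (Im \<sigma> - Im \<tau>)\<bar> \<le> \<omega>"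
    and B: "B * exp (k * Re \<tau>) \<le> cos \<omega> / 2"
    and M: "\<And>x::real. exp (N * x) \<le> M * exp (cos \<omega> / 4 * exp (k * x))"
    and f: "cmod f \<le> A * (exp (N * Re \<sigma>) * exp (B * exp (k * Re \<sigma>)))" and A: "0 \<le> A"
  shows "cmod (f * laplace_kernel k \<tau> \<sigma>) \<le> A * M * k * exp (N * Re \<tau>) * exp (- (k * Re \<tau>)) *
           (exp ((k - 1) * Re \<sigma>) * exp (- (cos \<omega> / 4 * exp (- (k * Re \<tau>))) * exp (k * Re \<sigma>)))"
proof -
  define y where "y = Re \<sigma> - Re \<tau>"
  define X where "X = exp (k * y)"
  have M0: "0 \<le> M" using M[of 0] by (simp add: zero_le_mult_iff order_trans[OF zero_le_one])
     (metis exp_gt_zero mult_le_0_iff not_le order_less_le_trans zero_less_one less_eq_real_def)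
  have cos: "cos \<omega> \<le> cos (k * (Im \<sigma> - Im \<tau>))"
    using cos_monotone_0_pi_le[of "\<bar>k * (Im \<sigma> - Im \<tau>)\<bar>" \<omega>] ang \<omega> by simp
  have re: "X * cos \<omega> \<le> Re (exp (of_real k * (\<sigma> - \<tau>)))"
    using cos by (simp add: X_def y_def Re_exp)
  have K: "cmod (laplace_kernel k \<tau> \<sigma>) \<le> k * X * exp (- (X * cos \<omega>)) * exp (- Re \<sigma>)"
  proof -
    have "cmod (laplace_kernel k \<tau> \<sigma>) = k * X * exp (- Re (exp (of_real k * (\<sigma> - \<tau>)))) * exp (- Re \<sigma>)"
      using k by (simp add: laplace_kernel_def norm_mult norm_divide norm_inverse X_def y_def exp_minus divide_inverse)
    also have "\<dots> \<le> k * X * exp (- (X * cos \<omega>)) * exp (- Re \<sigma>)"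
      using re k by (intro mult_right_mono mult_left_mono) (auto simp: X_def)
    finally show ?thesis .
  qed
  have e1: "exp (N * Re \<sigma>) \<le> exp (N * Re \<tau>) * (M * exp (cos \<omega> / 4 * X))"
  proof -
    have "exp (N * Re \<sigma>) = exp (N * Re \<tau>) * exp (N * y)" by (simp add: y_def algebra_simps flip: exp_add)
    then show ?thesis using M[of y] by (simp add: X_def)
  qed
  have e2: "exp (B * exp (k * Re \<sigma>)) \<le> exp (cos \<omega> / 2 * X)"
  proof -
    have "B * exp (k * Re \<sigma>) = B * exp (k * Re \<tau>) * X" by (simp add: X_def y_def algebra_simps flip: exp_add)
    also have "\<dots> \<le> cos \<omega> / 2 * X" using B by (intro mult_right_mono) (auto simp: X_def)
    finally show ?thesis by simp
  qed
  have "cmod (f * laplace_kernel k \<tau> \<sigma>) \<le>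
      (A * ((exp (N * Re \<tau>) * (M * exp (cos \<omega> / 4 * X))) * exp (cos \<omega> / 2 * X))) * (k * X * exp (- (X * cos \<omega>)) * exp (- Re \<sigma>))"
    unfolding norm_mult
  proof (rule mult_mono[OF order_trans[OF f] K])
    show "A * (exp (N * Re \<sigma>) * exp (B * exp (k * Re \<sigma>))) \<le> A * ((exp (N * Re \<tau>) * (M * exp (cos \<omega> / 4 * X))) * exp (cos \<omega> / 2 * X))"
      using A M0 by (intro mult_left_mono mult_mono e1 e2) auto
  qed (use A M0 in auto)
  also have "\<dots> = A * M * k * exp (N * Re \<tau>) * (X * exp (- Re \<sigma>)) * exp (cos \<omega> / 4 * X + cos \<omega> / 2 * X - X * cos \<omega>)"
    unfolding diff_conv_add_uminus exp_add by (simp only: mult_ac)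
  also have "X * exp (- Re \<sigma>) = exp (- (k * Re \<tau>)) * exp ((k - 1) * Re \<sigma>)"
    by (simp add: X_def y_def algebra_simps flip: exp_add)
  also have "cos \<omega> / 4 * X + cos \<omega> / 2 * X - X * cos \<omega> = - (cos \<omega> / 4 * X)" by simp
  also have "cos \<omega> / 4 * X = cos \<omega> / 4 * exp (- (k * Re \<tau>)) * exp (k * Re \<sigma>)"
    by (simp add: X_def y_def algebra_simps flip: exp_add)
  finally show ?thesis by (simp add: mult.assoc)
qed

lemma laplace_kernel_holomorphic: "laplace_kernel k \<tau> holomorphic_on S"
  unfolding laplace_kernel_def[abs_def] by (intro holomorphic_intros) auto

lemma laplace_kernel_holomorphic_t: "(\<lambda>\<tau>. laplace_kernel k \<tau> \<sigma>) holomorphic_on S"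
  unfolding laplace_kernel_def[abs_def] by (intro holomorphic_intros) auto

text \<open>
  Existence, independence of the ray, and a bound by the power \<open>\<bar>t\<bar> ^ N\<close> under the corresponding bound on the
  integrand. With \<open>N = 0\<close> it compares directions of integration; with \<open>N > 0\<close> it bounds the remainder of the
  asymptotic expansion.
\<close>

lemma laplace_integral_exists:
  assumes k: "0 < k" and \<omega>: "\<omega> < pi / 2" and ab: "a < b"
    and ang: "\<And>\<theta>. \<theta> \<in> {a<..<b} \<Longrightarrow> \<bar>k * (\<theta> - Im \<tau>)\<bar> \<le> \<omega>"
    and B: "B * exp (k * Re \<tau>) \<le> cos \<omega> / 2"
    and M: "\<And>x::real. exp (N * x) \<le> M * exp (cos \<omega> / 4 * exp (k * x))"
    and f: "f holomorphic_on strip a b"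
    and fb: "\<And>\<sigma>. \<sigma> \<in> strip a b \<Longrightarrow> cmod (f \<sigma>) \<le> A * (exp (N * Re \<sigma>) * exp (B * exp (k * Re \<sigma>)))" and A: "0 \<le> A"
  shows "\<exists>I. (\<forall>\<theta>\<in>{a<..<b}. has_ray_integral \<theta> (\<lambda>\<sigma>. f \<sigma> * laplace_kernel k \<tau> \<sigma>) I) \<and>
             cmod I \<le> 4 * A * M / cos \<omega> * exp (N * Re \<tau>)"
proof -
  let ?F = "\<lambda>\<sigma>. f \<sigma> * laplace_kernel k \<tau> \<sigma>"
  define c where "c = cos \<omega> / 4 * exp (- (k * Re \<tau>))"
  define C where "C = A * M * k * exp (N * Re \<tau>) * exp (- (k * Re \<tau>))"
  have "0 \<le> \<omega>" using ang[of "(a + b) / 2"] ab abs_ge_zero[of "k * ((a + b) / 2 - Im \<tau>)"] by fastforce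
  then have cos: "0 < cos \<omega>" using \<omega> by (intro cos_gt_zero_pi) auto
  then have c: "0 < c" by (simp add: c_def)
  have "0 < M * exp (cos \<omega> / 4 * exp (k * 0))" using M[of 0] less_le_trans[OF exp_gt_zero] by blast
  then have M0: "0 < M" by (simp add: zero_less_mult_iff)
  then have C: "0 \<le> C" using A k by (simp add: C_def)
  have bound: "cmod (?F \<sigma>) \<le> C * (exp ((k - 1) * Re \<sigma>) * exp (- c * exp (k * Re \<sigma>)))" if "\<sigma> \<in> strip a b" for \<sigma>
    unfolding C_def c_def using that
    by (intro laplace_kernel_bound[OF k \<omega> ang B M fb A]) (auto simp: strip_def)
  have hol: "?F holomorphic_on strip a b"
    by (intro holomorphic_intros f laplace_kernel_holomorphic)
  define \<theta>0 where "\<theta>0 = (a + b) / 2"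
  have \<theta>0: "\<theta>0 \<in> {a<..<b}" using ab by (simp add: \<theta>0_def)
  have "\<exists>I. has_ray_integral \<theta>0 ?F I \<and> cmod I \<le> C / (c * k)"
  proof (rule ray_integral_bound[OF k c])
    show "continuous_on {\<sigma>. Im \<sigma> = \<theta>0} ?F"
      using \<theta>0 by (intro continuous_on_subset[OF holomorphic_on_imp_continuous_on[OF hol]]) (auto simp: strip_def)
  qed (use bound \<theta>0 in \<open>auto simp: strip_def\<close>)
  then obtain I where I: "has_ray_integral \<theta>0 ?F I" "cmod I \<le> C / (c * k)" by blast
  have "C / (c * k) = 4 * A * M / cos \<omega> * exp (N * Re \<tau>)"
    using k cos by (simp add: C_def c_def field_simps)
  moreover have "\<forall>\<theta>\<in>{a<..<b}. has_ray_integral \<theta> ?F I"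
    using ray_integral_rotation[OF k c C hol bound \<theta>0 _ I(1)] by blast
  ultimately show ?thesis using I(2) by metis
qed

text \<open>
  The Laplace transform of a power. Rotating the ray to the direction of \<open>t\<close> makes the integral real,
  where the substitution \<open>y = (s/t)\<^sup>k\<close> gives Euler's integral for Gamma.
\<close>

lemma laplace_moment:
  assumes k: "0 < k" and \<theta>: "\<bar>k * (\<theta> - Im \<tau>)\<bar> < pi / 2"
  shows "has_ray_integral \<theta> (\<lambda>\<sigma>. exp \<sigma> ^ n * laplace_kernel k \<tau> \<sigma>) (of_real (Gamma (1 + real n / k)) * exp \<tau> ^ n)"
proof -
  obtain \<omega> where \<omega>: "\<bar>k * (\<theta> - Im \<tau>)\<bar> < \<omega>" "\<omega> < pi / 2" using dense[OF \<theta>] by blast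
  have \<omega>0: "0 < \<omega>" using \<omega>(1) by (smt (verit) abs_ge_zero)
  then have cos: "0 < cos \<omega>" using \<omega> by (intro cos_gt_zero_pi) auto
  obtain M where M: "M > 0" "\<And>x. exp (real n * x) \<le> M * exp (cos \<omega> / 4 * exp (k * x))"
    using exp_linear_le_exp_exp[OF k, of "cos \<omega> / 4" "real n"] cos by auto
  let ?F = "\<lambda>\<sigma>. exp \<sigma> ^ n * laplace_kernel k \<tau> \<sigma>"
  let ?a = "Im \<tau> - \<omega> / k" and ?b = "Im \<tau> + \<omega> / k"
  have int: "\<bar>k * (x - Im \<tau>)\<bar> < \<omega> \<longleftrightarrow> x \<in> {?a<..<?b}" for x
    using k by (auto simp: abs_less_iff abs_mult field_simps)
  have "\<exists>I. (\<forall>\<theta>\<in>{?a<..<?b}. has_ray_integral \<theta> ?F I) \<and> cmod I \<le> 4 * 1 * M / cos \<omega> * exp (real n * Re \<tau>)"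
  proof (rule laplace_integral_exists[OF k \<omega>(2), where B = 0])
    show "?a < ?b" using k \<omega>0 by simp
    show "\<bar>k * (x - Im \<tau>)\<bar> \<le> \<omega>" if "x \<in> {?a<..<?b}" for x using int[of x] that by simp
    show "cmod (exp \<sigma> ^ n) \<le> 1 * (exp (real n * Re \<sigma>) * exp (0 * exp (k * Re \<sigma>)))" for \<sigma> :: complex
      by (simp add: norm_power exp_of_nat_mult)
  qed (use M cos in \<open>auto intro!: holomorphic_intros\<close>)
  then obtain I where I: "\<And>\<theta>. \<theta> \<in> {?a<..<?b} \<Longrightarrow> has_ray_integral \<theta> ?F I" by blast
  define T where "T = exp (Re \<tau>)"
  have T: "0 < T" by (simp add: T_def)
  define g where "g x = (x / T) powr k" for x
  define g' where "g' x = k * (x / T) powr k / x" for x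
  define f where "f y = T ^ n * (y powr (real n / k) * exp (- y))" for y
  let ?u = "exp (\<i> * of_real (Im \<tau>)) ^ n"
  have u: "cmod ?u = 1" by (simp add: norm_power)
  have eq: "ray_integrand ?F (\<i> * of_real (Im \<tau>)) x = ?u * of_real (indicator {0<..} x * (f (g x) * g' x))" for x
  proof (cases "0 < x")
    case True
    let ?s = "complex_of_real (ln x) + \<i> * of_real (Im \<tau>)"
    have e1: "exp (of_real k * (?s - \<tau>)) = of_real (g x)"
    proof -
      have "?s - \<tau> = of_real (ln x - Re \<tau>)" by (simp add: complex_eq_iff)
      then have "exp (of_real k * (?s - \<tau>)) = exp (of_real k * of_real (ln x - Re \<tau>))" by (simp only:)
      then have "exp (of_real k * (?s - \<tau>)) = of_real (exp (k * (ln x - Re \<tau>)))"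
        by (simp only: of_real_mult[symmetric] exp_of_real)
      moreover have "exp (k * (ln x - Re \<tau>)) = g x" using True T by (simp add: g_def powr_def ln_div T_def)
      ultimately show ?thesis by simp
    qed
    have e2: "exp ?s = of_real x * exp (\<i> * of_real (Im \<tau>))" using True by (simp add: exp_add exp_of_real)
    have gx: "g x powr (real n / k) = (x / T) ^ n"
      using True T k by (simp add: g_def powr_powr powr_realpow)
    have fg: "f (g x) * g' x = x ^ n * exp (- g x) * (k * g x / x)"
      unfolding f_def gx using T by (simp add: g'_def g_def power_divide)
    have "laplace_kernel k \<tau> ?s * exp (\<i> * of_real (Im \<tau>)) = of_real (exp (- g x) * (k * g x / x))"
      unfolding laplace_kernel_def e1 e2 using True by (simp add: exp_of_real[symmetric])
    then show ?thesis
      using True unfolding ray_integrand_def fg by (simp add: e2 power_mult_distrib mult.assoc)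
  qed (simp add: ray_integrand_def)
  have "Im \<tau> \<in> {?a<..<?b}" using int[of "Im \<tau>"] \<omega>0 by simp
  then have R: "integrable lborel (ray_integrand ?F (\<i> * of_real (Im \<tau>)))" "(\<integral>x. ray_integrand ?F (\<i> * of_real (Im \<tau>)) x \<partial>lborel) = I"
    using I unfolding has_ray_integral_iff by blast+
  have fg0: "0 \<le> f (g x) * g' x" if "0 < x" for x using that T k by (simp add: f_def g'_def)
  have "integrable lborel (\<lambda>x. cmod (ray_integrand ?F (\<i> * of_real (Im \<tau>)) x))" using R(1) by (rule integrable_norm)
  moreover have "cmod (ray_integrand ?F (\<i> * of_real (Im \<tau>)) x) = indicator {0<..} x *\<^sub>R (f (g x) * g' x)" for x
    unfolding eq norm_mult[of ?u] u using fg0[of x] by (cases "0 < x") (simp_all del: of_real_mult)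
  ultimately have set_int: "set_integrable lborel {0<..} (\<lambda>x. f (g x) * g' x)" unfolding set_integrable_def by simp
  have e: "einterval 0 \<infinity> = {0::real<..}" by (auto simp: einterval_def)
  have "(LBINT y=0..\<infinity>. f y) = (LBINT x=0..\<infinity>. f (g x) * g' x)"
  proof (rule interval_integral_substitution_nonneg(2))
    show "DERIV g x :> g' x" if "0 < ereal x" for x
      unfolding g_def g'_def using that T by (auto intro!: derivative_eq_intros simp: field_simps powr_diff)
    show "isCont f (g x)" if "0 < ereal x" for x
      unfolding f_def using that T by (intro continuous_intros) (auto simp: g_def)
    show "isCont g' x" if "0 < ereal x" for x
      unfolding g'_def using that T by (intro continuous_intros) auto
    show "((ereal \<circ> g \<circ> real_of_ereal) \<longlongrightarrow> 0) (at_right 0)"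
    proof -
      have "((\<lambda>x. (x / T) powr k) \<longlongrightarrow> (0 / T) powr k) (at_right (0::real))"
        using k T by (intro tendsto_powr2 tendsto_intros) (auto intro: eventually_mono[OF eventually_at_right_less])
      then have "((ereal \<circ> g) \<longlongrightarrow> ereal 0) (at_right 0)" unfolding comp_def g_def using k by (intro tendsto_ereal) simp
      then show ?thesis unfolding zero_ereal_def ereal_tendsto_simps1 .
    qed
    show "((ereal \<circ> g \<circ> real_of_ereal) \<longlongrightarrow> \<infinity>) (at_left \<infinity>)"
    proof -
      have "filterlim g at_top at_top" unfolding g_def using k T by real_asymp
      then have "((ereal \<circ> g) \<longlongrightarrow> \<infinity>) at_top" by (simp add: comp_def tendsto_PInfty_eq_at_top)
      then show ?thesis unfolding ereal_tendsto_simps1 .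
    qed
    show "set_integrable lborel (einterval 0 \<infinity>) (\<lambda>x. f (g x) * g' x)" unfolding e by (rule set_int)
    show "0 \<le> g' x" if "0 \<le> ereal x" for x unfolding g'_def using that k by simp
  qed (use T in \<open>auto simp: f_def\<close>)
  moreover have "(LBINT y=0..\<infinity>. f y) = T ^ n * Gamma (1 + real n / k)"
  proof -
    have h: "((\<lambda>y. f y) has_integral T ^ n * Gamma (1 + real n / k)) {0..}"
      using has_integral_mult_right[OF Gamma_integral_real[of "1 + real n / k"], of "T ^ n"] k
      by (simp add: f_def exp_minus divide_inverse add_pos_nonneg)
    have nn: "f y \<ge> 0" if "y \<ge> 0" for y using T by (simp add: f_def)
    have "f absolutely_integrable_on {0..}"
      using h nn by (intro nonnegative_absolutely_integrable_1) (auto simp: has_integral_integrable)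
    then have "integral {0..} f = (LINT y:{0..}|lebesgue. f y)" by (simp add: set_lebesgue_integral_eq_integral(2))
    also have "\<dots> = (LINT y:{0..}|lborel. f y)"
      unfolding set_lebesgue_integral_def
      by (rule integral_completion) (auto simp: f_def[abs_def])
    also have "\<dots> = (LINT y:{0<..}|lborel. f y)"
      unfolding set_lebesgue_integral_def
      by (intro integral_cong_AE) (auto simp: f_def[abs_def] split: split_indicator intro!: AE_mp[OF AE_lborel_singleton[of 0]])
    finally show ?thesis unfolding interval_lebesgue_integral_0_infty using h by (simp add: integral_unique)
  qed
  moreover have "I = ?u * of_real (LBINT x=0..\<infinity>. f (g x) * g' x)"
  proof -
    have "I = (\<integral>x. ?u * of_real (indicator {0<..} x * (f (g x) * g' x)) \<partial>lborel)" using R(2) unfolding eq by simp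
    also have "\<dots> = ?u * (\<integral>x. of_real (indicator {0<..} x * (f (g x) * g' x)) \<partial>lborel)"
      by (rule integral_mult_right_zero)
    also have "(\<integral>x. of_real (indicator {0<..} x * (f (g x) * g' x)) \<partial>lborel) = complex_of_real (\<integral>x. indicator {0<..} x * (f (g x) * g' x) \<partial>lborel)"
      by (rule integral_complex_of_real)
    finally show ?thesis unfolding interval_lebesgue_integral_0_infty set_lebesgue_integral_def by simp
  qed
  ultimately have "I = ?u * of_real (T ^ n * Gamma (1 + real n / k))" by simp
  also have "\<dots> = of_real (Gamma (1 + real n / k)) * (of_real T * exp (\<i> * of_real (Im \<tau>))) ^ n"
    by (simp add: power_mult_distrib)
  also have "of_real T * exp (\<i> * of_real (Im \<tau>)) = exp \<tau>"
    by (simp add: T_def exp_eq_polar[of \<tau>] cis_conv_exp)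
  finally show ?thesis using I[of \<theta>] int[of \<theta>] \<omega>(1) by blast
qed

lemma strip_sumD:
  assumes "strip_sum r k L R b H"
  shows "eholomorphic (O_space r) (strip L R) H"
    and "L < x \<Longrightarrow> y < R \<Longrightarrow> \<exists>A>0. \<exists>B>0. \<forall>\<sigma>. Im \<sigma> \<in> {x..y} \<longrightarrow> (\<forall>z\<in>cball 0 r. cmod (H \<sigma> z) \<le> A * exp (B * exp (k * Re \<sigma>)))"
    and "\<exists>\<rho>>0. \<forall>\<sigma>\<in>strip L R. exp (Re \<sigma>) < \<rho> \<longrightarrow> (\<forall>z\<in>cball 0 r. (\<lambda>n. b n z * exp \<sigma> ^ n) sums H \<sigma> z)"
    and "\<theta> \<in> {L<..<R} \<Longrightarrow> \<exists>\<alpha> \<rho> g. sectorial_sum r k \<theta> \<alpha> \<rho> b g \<and> (\<forall>\<sigma>\<in>strip L R. \<bar>Im \<sigma> - \<theta>\<bar> < \<alpha> / 2 \<longrightarrow> H \<sigma> = g (exp \<sigma>))"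
  using assms unfolding strip_sum_def by blast+

section \<open>Laplace integrals with values in the space of holomorphic functions\<close>

definition ray_bounded :: "real \<Rightarrow> real \<Rightarrow> real \<Rightarrow> real \<Rightarrow> real \<Rightarrow> (complex \<Rightarrow> complex \<Rightarrow> complex) \<Rightarrow> bool" where
  "ray_bounded r k \<theta> A B H \<longleftrightarrow>
     (\<forall>\<sigma>. Im \<sigma> = \<theta> \<longrightarrow> H \<sigma> \<in> carr (O_space r)) \<and> (\<forall>z. continuous_on {\<sigma>. Im \<sigma> = \<theta>} (\<lambda>\<sigma>. H \<sigma> z)) \<and>
     (\<forall>\<sigma>. Im \<sigma> = \<theta> \<longrightarrow> (\<forall>z\<in>cball 0 r. cmod (H \<sigma> z) \<le> A * exp (B * exp (k * Re \<sigma>))))"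

definition laplace :: "real \<Rightarrow> real \<Rightarrow> (complex \<Rightarrow> complex \<Rightarrow> complex) \<Rightarrow> complex \<Rightarrow> complex \<Rightarrow> complex" where
  "laplace k \<theta> H \<tau> z = (\<integral>x. ray_integrand (\<lambda>\<sigma>. H \<sigma> z * laplace_kernel k \<tau> \<sigma>) (\<i> * of_real \<theta>) x \<partial>lborel)"

text \<open>
  The points \<open>t\<close> at which the Laplace transform in direction \<open>\<theta>\<close> of a function bounded by \<open>A exp (B \<bar>s\<bar>\<^sup>k)\<close>
  converges with room to spare: \<open>Re (s / t)\<^sup>k \<ge> cos \<omega> * \<bar>s / t\<bar>\<^sup>k\<close>, and at most half of that is lost to growth.
\<close>

definition conv_region :: "real \<Rightarrow> real \<Rightarrow> real \<Rightarrow> real \<Rightarrow> complex set" where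
  "conv_region k \<theta> B \<omega> = {\<tau>. \<bar>k * (\<theta> - Im \<tau>)\<bar> < \<omega> \<and> B * exp (k * Re \<tau>) < cos \<omega> / 2}"

lemma open_conv_region: "open (conv_region k \<theta> B \<omega>)"
  unfolding conv_region_def by (intro open_Collect_conj open_Collect_less continuous_intros)

lemma conv_region_cos:
  assumes "\<omega> < pi / 2" "\<tau> \<in> conv_region k \<theta> B \<omega>"
  shows "0 < cos \<omega>"
proof -
  have "0 < \<omega>" using assms(2) unfolding conv_region_def using le_less_trans[OF abs_ge_zero] by blast
  then show ?thesis using assms(1) by (intro cos_gt_zero_pi) auto
qed

context
  fixes r k \<theta> A B \<omega> :: real and H :: "complex \<Rightarrow> complex \<Rightarrow> complex"
  assumes r: "0 < r" and k: "0 < k" and A: "0 \<le> A" and H: "ray_bounded r k \<theta> A B H" and \<omega>: "\<omega> < pi / 2"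
begin

lemma laplace_integrand_bound:
  assumes \<tau>: "\<tau> \<in> conv_region k \<theta> B \<omega>" and \<sigma>: "Im \<sigma> = \<theta>" and z: "z \<in> cball 0 r"
  shows "cmod (H \<sigma> z * laplace_kernel k \<tau> \<sigma>) \<le> A * k * exp (- (k * Re \<tau>)) *
           (exp ((k - 1) * Re \<sigma>) * exp (- (cos \<omega> / 4 * exp (- (k * Re \<tau>))) * exp (k * Re \<sigma>)))"
proof -
  have "cmod (H \<sigma> z * laplace_kernel k \<tau> \<sigma>) \<le> A * 1 * k * exp (0 * Re \<tau>) * exp (- (k * Re \<tau>)) *
           (exp ((k - 1) * Re \<sigma>) * exp (- (cos \<omega> / 4 * exp (- (k * Re \<tau>))) * exp (k * Re \<sigma>)))"
  proof (rule laplace_kernel_bound[OF k \<omega>, where B = B])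
    show "\<bar>k * (Im \<sigma> - Im \<tau>)\<bar> \<le> \<omega>" "B * exp (k * Re \<tau>) \<le> cos \<omega> / 2"
      using \<tau> \<sigma> by (auto simp: conv_region_def)
    show "exp (0 * x) \<le> 1 * exp (cos \<omega> / 4 * exp (k * x))" for x
      using conv_region_cos[OF \<omega> \<tau>] by simp
    show "cmod (H \<sigma> z) \<le> A * (exp (0 * Re \<sigma>) * exp (B * exp (k * Re \<sigma>)))"
      using H \<sigma> z by (simp add: ray_bounded_def)
  qed (rule A)
  then show ?thesis by simp
qed

lemma laplace_integrand_continuous: "continuous_on {\<sigma>. Im \<sigma> = \<theta>} (\<lambda>\<sigma>. H \<sigma> z * laplace_kernel k \<tau> \<sigma>)"
  using H by (intro continuous_on_mult holomorphic_on_imp_continuous_on[OF laplace_kernel_holomorphic]) (simp add: ray_bounded_def)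

lemma laplace_has_ray_integral:
  assumes \<tau>: "\<tau> \<in> conv_region k \<theta> B \<omega>" and z: "z \<in> cball 0 r"
  shows "has_ray_integral \<theta> (\<lambda>\<sigma>. H \<sigma> z * laplace_kernel k \<tau> \<sigma>) (laplace k \<theta> H \<tau> z)"
    and "cmod (laplace k \<theta> H \<tau> z) \<le> 4 * A / cos \<omega>"
proof -
  have c: "0 < cos \<omega> / 4 * exp (- (k * Re \<tau>))" using conv_region_cos[OF \<omega> \<tau>] by simp
  obtain I where I: "has_ray_integral \<theta> (\<lambda>\<sigma>. H \<sigma> z * laplace_kernel k \<tau> \<sigma>) I"
      "cmod I \<le> A * k * exp (- (k * Re \<tau>)) / (cos \<omega> / 4 * exp (- (k * Re \<tau>)) * k)"
    using ray_integral_bound[OF k c laplace_integrand_continuous laplace_integrand_bound[OF \<tau> _ z]] by blast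
  moreover have "laplace k \<theta> H \<tau> z = I" using I(1) unfolding has_ray_integral_iff laplace_def by blast
  ultimately show "has_ray_integral \<theta> (\<lambda>\<sigma>. H \<sigma> z * laplace_kernel k \<tau> \<sigma>) (laplace k \<theta> H \<tau> z)"
    "cmod (laplace k \<theta> H \<tau> z) \<le> 4 * A / cos \<omega>"
    using k by (simp_all add: field_simps)
qed

lemma laplace_integrand_carr:
  assumes \<tau>: "\<tau> \<in> conv_region k \<theta> B \<omega>"
  shows "laplace k \<theta> H \<tau> \<in> carr (O_space r)"
    and "locally_dominated (ball 0 r) (\<lambda>x z. ray_integrand (\<lambda>\<sigma>. H \<sigma> z * laplace_kernel k \<tau> \<sigma>) (\<i> * of_real \<theta>) x)"
proof -
  let ?F = "\<lambda>x z. ray_integrand (\<lambda>\<sigma>. H \<sigma> z * laplace_kernel k \<tau> \<sigma>) (\<i> * of_real \<theta>) x"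
  let ?c = "cos \<omega> / 4 * exp (- (k * Re \<tau>))"
  let ?w = "\<lambda>x. A * k * exp (- (k * Re \<tau>)) * weight k ?c x"
  have carr: "?F x \<in> carr (O_space r)" for x
  proof -
    let ?\<sigma> = "of_real (ln x) + \<i> * of_real \<theta>"
    have "H ?\<sigma> \<in> carr (O_space r)" using H by (simp add: ray_bounded_def)
    from O_space_scale[OF this, of "of_real (indicator {0<..} x) * laplace_kernel k \<tau> ?\<sigma> * exp (\<i> * of_real \<theta>)"]
    show ?thesis by (simp add: ray_integrand_def scaleR_conv_of_real mult_ac)
  qed
  have meas: "(\<lambda>x. ?F x z) \<in> borel_measurable lborel" for z
    by (rule ray_integrand_measurable) (use laplace_integrand_continuous[of z \<tau>] in simp)
  have bound: "cmod (?F x z) \<le> ?w x" if z: "z \<in> cball 0 r" for x z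
  proof (cases "0 < x")
    case True
    then show ?thesis using laplace_integrand_bound[OF \<tau> _ z, of "of_real (ln x) + \<i> * of_real \<theta>"]
      by (simp add: ray_integrand_def weight_exp norm_mult)
  qed (simp add: ray_integrand_def weight_def)
  have w: "integrable lborel ?w"
    using weight_integral(1)[OF k, of ?c] conv_region_cos[OF \<omega> \<tau>] by simp
  show "locally_dominated (ball 0 r) ?F" by (rule integral_in_O_space(2)[OF carr meas w bound])
  show "laplace k \<theta> H \<tau> \<in> carr (O_space r)"
    using integral_in_O_space(1)[OF carr meas w bound] by (simp add: laplace_def[abs_def])
qed

lemma laplace_eholomorphic: "eholomorphic (O_space r) (conv_region k \<theta> B \<omega>) (laplace k \<theta> H)"
proof (rule eholomorphicI[OF _ open_conv_region])
  show "laplace k \<theta> H \<tau> \<in> carr (O_space r)" if "\<tau> \<in> conv_region k \<theta> B \<omega>" for \<tau>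
    by (rule laplace_integrand_carr(1)[OF that])
  show "(\<lambda>\<tau>. laplace k \<theta> H \<tau> z) holomorphic_on conv_region k \<theta> B \<omega>" if z: "z \<in> cball 0 r" for z
    unfolding laplace_def
  proof (rule holomorphic_integral)
    let ?F = "\<lambda>x \<tau>. ray_integrand (\<lambda>\<sigma>. H \<sigma> z * laplace_kernel k \<tau> \<sigma>) (\<i> * of_real \<theta>) x"
    show "locally_dominated (conv_region k \<theta> B \<omega>) ?F"
      unfolding locally_dominated_def
    proof (intro conjI allI ballI open_conv_region)
      show "(\<lambda>\<tau>. ?F x \<tau>) holomorphic_on conv_region k \<theta> B \<omega>" for x
        unfolding ray_integrand_def scaleR_conv_of_real by (intro holomorphic_intros laplace_kernel_holomorphic_t)
      fix \<tau> assume \<tau>: "\<tau> \<in> conv_region k \<theta> B \<omega>"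
      show "(\<lambda>x. ?F x \<tau>) \<in> borel_measurable lborel"
        by (rule ray_integrand_measurable) (use laplace_integrand_continuous[of z \<tau>] in simp)
      from \<tau> obtain e where e: "e > 0" "ball \<tau> e \<subseteq> conv_region k \<theta> B \<omega>" using open_conv_region open_contains_ball by blast
      have cos: "0 < cos \<omega>" by (rule conv_region_cos[OF \<omega> \<tau>])
      let ?c = "cos \<omega> / 4 * exp (- (k * (Re \<tau> + e)))"
      let ?w = "\<lambda>x. A * k * exp (- (k * (Re \<tau> - e))) * weight k ?c x"
      have "cmod (?F x t) \<le> ?w x" if t: "t \<in> ball \<tau> e" for t x
      proof (cases "0 < x")
        case True
        have re: "\<bar>Re t - Re \<tau>\<bar> < e" using t abs_Re_le_cmod[of "t - \<tau>"] by (simp add: dist_norm norm_minus_commute)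
        have "cmod (?F x t) \<le> A * k * exp (- (k * Re t)) *
           (exp ((k - 1) * ln x) * exp (- (cos \<omega> / 4 * exp (- (k * Re t))) * exp (k * ln x)))"
          using laplace_integrand_bound[of t "of_real (ln x) + \<i> * of_real \<theta>" z] e(2) t z True
          by (auto simp: ray_integrand_def norm_mult subset_iff)
        also have "\<dots> \<le> A * k * exp (- (k * (Re \<tau> - e))) * (exp ((k - 1) * ln x) * exp (- ?c * exp (k * ln x)))"
        proof (intro mult_mono)
          show "exp (- (k * Re t)) \<le> exp (- (k * (Re \<tau> - e)))" using re k by simp
          have "?c * exp (k * ln x) \<le> cos \<omega> / 4 * exp (- (k * Re t)) * exp (k * ln x)"
            using re k cos by (intro mult_right_mono mult_left_mono) auto
          then show "exp (- (cos \<omega> / 4 * exp (- (k * Re t))) * exp (k * ln x)) \<le> exp (- ?c * exp (k * ln x))" by simp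
        qed (use A k in auto)
        also have "\<dots> = ?w x" using True by (simp only: weight_exp)
        finally show ?thesis .
      qed (simp add: ray_integrand_def weight_def)
      moreover have "integrable lborel ?w" using weight_integral(1)[OF k, of ?c] cos by simp
      ultimately show "\<exists>\<rho>>0. \<exists>w. ball \<tau> \<rho> \<subseteq> conv_region k \<theta> B \<omega> \<and> integrable lborel w \<and> (\<forall>x. \<forall>t\<in>ball \<tau> \<rho>. cmod (?F x t) \<le> w x)"
        using e by blast
    qed
  qed
  fix \<tau> assume \<tau>: "\<tau> \<in> conv_region k \<theta> B \<omega>"
  then obtain e where "e > 0" "ball \<tau> e \<subseteq> conv_region k \<theta> B \<omega>" using open_conv_region open_contains_ball by blast
  then show "\<exists>\<rho>>0. \<exists>M. \<forall>t\<in>ball \<tau> \<rho>. \<forall>z\<in>cball 0 r. cmod (laplace k \<theta> H t z) \<le> M"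
    using laplace_has_ray_integral(2) by blast
qed (use r in simp)

text \<open>
  Taylor coefficients in \<open>z\<close> commute with the Laplace integral; the equation is verified on them.
\<close>

lemma laplace_taylor:
  assumes \<tau>: "\<tau> \<in> conv_region k \<theta> B \<omega>"
  shows "has_ray_integral \<theta> (\<lambda>\<sigma>. (deriv ^^ n) (H \<sigma>) 0 * laplace_kernel k \<tau> \<sigma>) ((deriv ^^ n) (laplace k \<theta> H \<tau>) 0)"
proof -
  let ?F = "\<lambda>x z. ray_integrand (\<lambda>\<sigma>. H \<sigma> z * laplace_kernel k \<tau> \<sigma>) (\<i> * of_real \<theta>) x"
  note dom = laplace_integrand_carr(2)[OF \<tau>]
  have 0: "0 \<in> ball (0::complex) r" using r by simp
  have "(deriv ^^ n) (?F x) 0 = ray_integrand (\<lambda>\<sigma>. (deriv ^^ n) (H \<sigma>) 0 * laplace_kernel k \<tau> \<sigma>) (\<i> * of_real \<theta>) x" for x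
  proof -
    let ?\<sigma> = "of_real (ln x) + \<i> * of_real \<theta>"
    have "H ?\<sigma> \<in> carr (O_space r)" using H by (simp add: ray_bounded_def)
    then have "H ?\<sigma> holomorphic_on ball 0 r" by (simp add: carr_O_space)
    from higher_deriv_cmult[OF this 0 open_ball, of n "of_real (indicator {0<..} x) * laplace_kernel k \<tau> ?\<sigma> * exp (\<i> * of_real \<theta>)"]
    show ?thesis by (simp add: ray_integrand_def scaleR_conv_of_real mult_ac)
  qed
  then have eq: "(\<lambda>x. (deriv ^^ n) (?F x) 0) = ray_integrand (\<lambda>\<sigma>. (deriv ^^ n) (H \<sigma>) 0 * laplace_kernel k \<tau> \<sigma>) (\<i> * of_real \<theta>)" ..
  have L: "laplace k \<theta> H \<tau> = (\<lambda>z. \<integral>x. ?F x z \<partial>lborel)" by (rule ext) (rule laplace_def)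
  show ?thesis
    unfolding has_ray_integral_iff L deriv_n_integral[OF dom 0, of n] eq[symmetric]
    using locally_dominated_integrable[OF locally_dominated_deriv_n[OF dom, of n] 0] by blast
qed

end

lemma strip_sum_ray_bounded:
  assumes "strip_sum r k L R b H" "L < x" "y < R" and r: "0 \<le> r"
  shows "\<exists>A>0. \<exists>B>0. \<forall>\<theta>\<in>{x..y}. ray_bounded r k \<theta> A B H"
proof -
  from assms(1) have e: "eholomorphic (O_space r) (strip L R) H" by (simp add: strip_sum_def)
  have hol: "(\<lambda>\<sigma>. H \<sigma> z) holomorphic_on strip L R" for z
    by (rule eholomorphic_pointwise[OF e r]) (simp add: strip_def open_strip_between)
  from strip_sumD(2)[OF assms(1-3)] obtain A B where "A > 0" "B > 0"
    "\<And>\<sigma> z. Im \<sigma> \<in> {x..y} \<Longrightarrow> z \<in> cball 0 r \<Longrightarrow> cmod (H \<sigma> z) \<le> A * exp (B * exp (k * Re \<sigma>))"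
    by auto
  then show ?thesis
    unfolding ray_bounded_def using assms(2,3)
    by (intro exI[of _ A] conjI exI[of _ B] ballI allI impI eholomorphic_carr[OF e]
        continuous_on_subset[OF holomorphic_on_imp_continuous_on[OF hol]]) (auto simp: strip_def)
qed

lemma laplace_independent:
  assumes H: "strip_sum r k L R b H" and r: "0 < r" and k: "0 < k" and \<omega>: "\<omega> < pi / 2" and xy: "L < x" "y < R"
    and A: "0 \<le> A" and AB: "\<And>\<theta>. \<theta> \<in> {x..y} \<Longrightarrow> ray_bounded r k \<theta> A B H"
    and \<theta>: "\<theta> \<in> {x<..<y}" "\<theta>' \<in> {x<..<y}" "\<bar>k * (\<theta> - Im \<tau>)\<bar> < \<omega>" "\<bar>k * (\<theta>' - Im \<tau>)\<bar> < \<omega>"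
    and \<tau>: "B * exp (k * Re \<tau>) < cos \<omega> / 2"
  shows "laplace k \<theta> H \<tau> = laplace k \<theta>' H \<tau>"
proof
  fix z
  have conv: "\<tau> \<in> conv_region k \<theta> B \<omega>" "\<tau> \<in> conv_region k \<theta>' B \<omega>"
    using \<theta> \<tau> by (auto simp: conv_region_def)
  note AB' = AB[of \<theta>] AB[of \<theta>']
  show "laplace k \<theta> H \<tau> z = laplace k \<theta>' H \<tau> z"
  proof (cases "z \<in> cball 0 r")
    case z: True
    let ?a = "max x (Im \<tau> - \<omega> / k)" and ?b = "min y (Im \<tau> + \<omega> / k)"
    have int: "\<bar>k * (v - Im \<tau>)\<bar> < \<omega> \<longleftrightarrow> v \<in> {Im \<tau> - \<omega> / k<..<Im \<tau> + \<omega> / k}" for v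
      using k by (auto simp: abs_less_iff abs_mult field_simps)
    have in_ab: "\<theta> \<in> {?a<..<?b}" "\<theta>' \<in> {?a<..<?b}" using \<theta> int[of \<theta>] int[of \<theta>'] by auto
    have "\<exists>I. (\<forall>\<theta>\<in>{?a<..<?b}. has_ray_integral \<theta> (\<lambda>\<sigma>. H \<sigma> z * laplace_kernel k \<tau> \<sigma>) I) \<and>
             cmod I \<le> 4 * A * 1 / cos \<omega> * exp (0 * Re \<tau>)"
    proof (rule laplace_integral_exists[OF k \<omega>])
      show "\<bar>k * (v - Im \<tau>)\<bar> \<le> \<omega>" if "v \<in> {?a<..<?b}" for v using int[of v] that by auto
      have "(\<lambda>\<sigma>. H \<sigma> z) holomorphic_on strip L R"
        using H r by (intro eholomorphic_pointwise) (auto simp: strip_sum_def strip_def open_strip_between)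
      then show "(\<lambda>\<sigma>. H \<sigma> z) holomorphic_on strip ?a ?b"
        by (rule holomorphic_on_subset) (use xy in \<open>auto simp: strip_def\<close>)
      show "cmod (H \<sigma> z) \<le> A * (exp (0 * Re \<sigma>) * exp (B * exp (k * Re \<sigma>)))" if "\<sigma> \<in> strip ?a ?b" for \<sigma>
        using AB[of "Im \<sigma>"] that z by (simp add: strip_def ray_bounded_def)
      show "exp (0 * x) \<le> 1 * exp (cos \<omega> / 4 * exp (k * x))" for x
        using conv_region_cos[OF \<omega> conv(1)] by simp
    qed (use in_ab \<tau> A in auto)
    then show ?thesis
      using in_ab laplace_has_ray_integral(1)[OF r k A _ \<omega> _ z] AB' conv \<theta> has_ray_integral_unique
      by (metis greaterThanLessThan_iff atLeastAtMost_iff less_imp_le)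
  next
    case False
    have "laplace k \<theta> H \<tau> \<in> carr (O_space r)" "laplace k \<theta>' H \<tau> \<in> carr (O_space r)"
      using laplace_integrand_carr(1)[OF r k A _ \<omega>] AB' conv \<theta> by auto
    with False show ?thesis by (auto simp: carr_O_space)
  qed
qed

section \<open>The sum on a sectorial region\<close>

definition mid :: "real \<Rightarrow> real \<Rightarrow> real" where
  "mid L R = (L + R) / 2"

definition half_width :: "real \<Rightarrow> real \<Rightarrow> real \<Rightarrow> real" where
  "half_width k L R = (R - L) / 2 + pi / (2 * k)"

text \<open>
  A direction of integration for points \<open>t\<close> with \<open>arg t = x\<close>: the interval of arguments
  \<open>\<bar>x - mid\<bar> < half_width\<close> is compressed linearly onto the interval of regular directions \<open>(L, R)\<close>, which
  leaves \<open>\<bar>dir x - x\<bar> < pi / (2 * k)\<close>.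
\<close>

definition dir :: "real \<Rightarrow> real \<Rightarrow> real \<Rightarrow> real \<Rightarrow> real" where
  "dir k L R x = mid L R + (R - L) / 2 / half_width k L R * (x - mid L R)"

text \<open>
  The integral is taken along one ray for every \<open>t\<close>, moving with \<open>arg t\<close>; since it is locally independent of the ray,
  the result is holomorphic.
\<close>

definition ksum :: "real \<Rightarrow> real \<Rightarrow> real \<Rightarrow> (complex \<Rightarrow> complex \<Rightarrow> complex) \<Rightarrow> complex \<Rightarrow> complex \<Rightarrow> complex" where
  "ksum k L R H \<tau> = laplace k (dir k L R (Im \<tau>)) H \<tau>"

definition half_strip :: "real \<Rightarrow> real \<Rightarrow> real \<Rightarrow> complex set" where
  "half_strip c y \<rho> = {\<tau>. \<bar>Im \<tau> - c\<bar> < y \<and> Re \<tau> < \<rho>}"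

lemma open_half_strip: "open (half_strip c y \<rho>)"
  unfolding half_strip_def by (intro open_Collect_conj open_Collect_less continuous_intros)

lemma half_strip_mono: "y \<le> y' \<Longrightarrow> \<rho> \<le> \<rho>' \<Longrightarrow> half_strip c y \<rho> \<subseteq> half_strip c y' \<rho>'"
  by (auto simp: half_strip_def)

lemma eholomorphic_local:
  assumes "\<And>t. t \<in> U \<Longrightarrow> \<exists>V g. open V \<and> t \<in> V \<and> eholomorphic E V g \<and> (\<forall>s\<in>V. f s = g s)"
  shows "eholomorphic E U f"
  unfolding eholomorphic_def
proof
  fix t assume "t \<in> U"
  with assms obtain V g where V: "open V" "t \<in> V" "eholomorphic E V g" "\<And>s. s \<in> V \<Longrightarrow> f s = g s" by metis
  from V(2,3) obtain D where D: "g t \<in> carr E" "D \<in> carr E"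
    "((\<lambda>h. nrm E (\<lambda>i. (g (t + h) i - g t i) / h - D i)) \<longlongrightarrow> 0) (at 0)"
    unfolding eholomorphic_def by blast
  have "((\<lambda>h. t + h) \<longlongrightarrow> t + 0) (at 0)" by (intro tendsto_intros)
  then have "\<forall>\<^sub>F h in at 0. t + h \<in> V" using V by (simp add: topological_tendstoD)
  then have "\<forall>\<^sub>F h in at 0. nrm E (\<lambda>i. (g (t + h) i - g t i) / h - D i) = nrm E (\<lambda>i. (f (t + h) i - f t i) / h - D i)"
    by eventually_elim (simp add: V(2,4))
  from Lim_transform_eventually[OF D(3) this] D(1,2) V(2,4)
  show "f t \<in> carr E \<and> (\<exists>D\<in>carr E. ((\<lambda>h. nrm E (\<lambda>i. (f (t + h) i - f t i) / h - D i)) \<longlongrightarrow> 0) (at 0))"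
    by auto
qed

text \<open>
  Cauchy's estimate on discs of fixed radius in the logarithmic coordinate, where \<open>\<bar>t\<bar> ^ a\<close> varies by a bounded
  factor; each derivative costs a factor \<open>1 / \<bar>t\<bar>\<close> and a little of the half strip. The constant does not depend
  on the function, which makes the estimate uniform in \<open>z\<close>.
\<close>

lemma cover_deriv_bound_step:
  assumes y: "y < y'" "\<rho> < \<rho>'" and C: "0 \<le> C"
  shows "\<exists>C'\<ge>0. \<forall>V. V holomorphic_on half_strip c y' \<rho>' \<and> (\<forall>\<tau>\<in>half_strip c y' \<rho>'. cmod (V \<tau>) \<le> C * exp (a * Re \<tau>)) \<longrightarrow>
     cover_deriv V holomorphic_on half_strip c y \<rho> \<and>
     (\<forall>\<tau>\<in>half_strip c y \<rho>. cmod (cover_deriv V \<tau>) \<le> C' * exp ((a - 1) * Re \<tau>))"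
proof -
  define \<delta> where "\<delta> = min (y' - y) (\<rho>' - \<rho>) / 2"
  have \<delta>: "\<delta> > 0" "y + \<delta> < y'" "\<rho> + \<delta> < \<rho>'" using y by (auto simp: \<delta>_def min_def field_simps)
  have "cover_deriv V holomorphic_on half_strip c y \<rho> \<and>
     (\<forall>\<tau>\<in>half_strip c y \<rho>. cmod (cover_deriv V \<tau>) \<le> C * exp (\<bar>a\<bar> * \<delta>) / \<delta> * exp ((a - 1) * Re \<tau>))"
    if V: "V holomorphic_on half_strip c y' \<rho>'" "\<And>\<tau>. \<tau> \<in> half_strip c y' \<rho>' \<Longrightarrow> cmod (V \<tau>) \<le> C * exp (a * Re \<tau>)" for V
  proof
    have "deriv V holomorphic_on half_strip c y \<rho>"
      using V(1) y by (intro holomorphic_on_subset[OF holomorphic_deriv[OF V(1) open_half_strip]] half_strip_mono) auto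
    then show "cover_deriv V holomorphic_on half_strip c y \<rho>"
      unfolding cover_deriv_def[abs_def] by (intro holomorphic_on_mult holomorphic_on_exp' holomorphic_on_minus holomorphic_on_ident)
    show "\<forall>\<tau>\<in>half_strip c y \<rho>. cmod (cover_deriv V \<tau>) \<le> C * exp (\<bar>a\<bar> * \<delta>) / \<delta> * exp ((a - 1) * Re \<tau>)"
    proof
      fix \<tau> assume \<tau>: "\<tau> \<in> half_strip c y \<rho>"
      have near: "\<bar>Re s - Re \<tau>\<bar> \<le> \<delta>" "s \<in> half_strip c y' \<rho>'" if "s \<in> cball \<tau> \<delta>" for s
      proof -
        have s: "cmod (s - \<tau>) \<le> \<delta>" using that by (simp add: dist_norm norm_minus_commute)
        show re: "\<bar>Re s - Re \<tau>\<bar> \<le> \<delta>" using order_trans[OF abs_Re_le_cmod s] by simp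
        have im: "\<bar>Im s - Im \<tau>\<bar> \<le> \<delta>" using order_trans[OF abs_Im_le_cmod s] by simp
        have "\<bar>Im s - c\<bar> \<le> \<bar>Im s - Im \<tau>\<bar> + \<bar>Im \<tau> - c\<bar>" by arith
        then show "s \<in> half_strip c y' \<rho>'" using \<tau> re im \<delta> by (auto simp: half_strip_def)
      qed
      have sub: "cball \<tau> \<delta> \<subseteq> half_strip c y' \<rho>'" using near by blast
      have "cmod ((deriv ^^ 1) V \<tau>) \<le> fact 1 * (C * exp (\<bar>a\<bar> * \<delta>) * exp (a * Re \<tau>)) / \<delta> ^ 1"
      proof (rule Cauchy_inequality)
        show "V holomorphic_on ball \<tau> \<delta>" using sub by (intro holomorphic_on_subset[OF V(1)]) auto
        show "continuous_on (cball \<tau> \<delta>) V" by (rule holomorphic_on_imp_continuous_on[OF holomorphic_on_subset[OF V(1) sub]])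
        show "cmod (V s) \<le> C * exp (\<bar>a\<bar> * \<delta>) * exp (a * Re \<tau>)" if "cmod (\<tau> - s) = \<delta>" for s
        proof -
          have s: "s \<in> cball \<tau> \<delta>" using that by (simp add: dist_norm)
          have "a * (Re s - Re \<tau>) \<le> \<bar>a\<bar> * \<bar>Re s - Re \<tau>\<bar>"
            unfolding abs_mult[symmetric] by (rule abs_ge_self)
          also have "\<dots> \<le> \<bar>a\<bar> * \<delta>" by (rule mult_left_mono[OF near(1)[OF s] abs_ge_zero])
          finally have "a * Re s \<le> \<bar>a\<bar> * \<delta> + a * Re \<tau>" by (simp add: right_diff_distrib)
          then have "exp (a * Re s) \<le> exp (\<bar>a\<bar> * \<delta>) * exp (a * Re \<tau>)" by (simp flip: exp_add)
          from order_trans[OF V(2)[OF near(2)[OF s]] mult_left_mono[OF this C]]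
          show ?thesis by (simp only: mult.assoc)
        qed
      qed (rule \<delta>)
      then have "exp (- Re \<tau>) * cmod (deriv V \<tau>) \<le> exp (- Re \<tau>) * (C * exp (\<bar>a\<bar> * \<delta>) * exp (a * Re \<tau>) / \<delta>)"
        by (intro mult_left_mono) auto
      also have "\<dots> = C * exp (\<bar>a\<bar> * \<delta>) / \<delta> * (exp (- Re \<tau>) * exp (a * Re \<tau>))" by simp
      also have "exp (- Re \<tau>) * exp (a * Re \<tau>) = exp ((a - 1) * Re \<tau>)" by (simp add: algebra_simps flip: exp_add)
      finally show "cmod (cover_deriv V \<tau>) \<le> C * exp (\<bar>a\<bar> * \<delta>) / \<delta> * exp ((a - 1) * Re \<tau>)"
        by (simp add: cover_deriv_def norm_mult)
    qed
  qed
  moreover have "0 \<le> C * exp (\<bar>a\<bar> * \<delta>) / \<delta>" using C \<delta> by simp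
  ultimately show ?thesis by blast
qed

lemma cover_deriv_bound:
  assumes "y < y'" "\<rho> < \<rho>'" "0 \<le> C"
  shows "\<exists>C'\<ge>0. \<forall>V. V holomorphic_on half_strip c y' \<rho>' \<and> (\<forall>\<tau>\<in>half_strip c y' \<rho>'. cmod (V \<tau>) \<le> C * exp (a * Re \<tau>)) \<longrightarrow>
     (cover_deriv ^^ j) V holomorphic_on half_strip c y \<rho> \<and>
     (\<forall>\<tau>\<in>half_strip c y \<rho>. cmod ((cover_deriv ^^ j) V \<tau>) \<le> C' * exp ((a - real j) * Re \<tau>))"
  using assms
proof (induction j arbitrary: y \<rho>)
  case 0
  have "half_strip c y \<rho> \<subseteq> half_strip c y' \<rho>'" using 0 by (intro half_strip_mono) auto
  with 0(3) show ?case by (intro exI[of _ C]) (auto intro: holomorphic_on_subset)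
next
  case (Suc j)
  define y1 \<rho>1 where "y1 = (y + y') / 2" and "\<rho>1 = (\<rho> + \<rho>') / 2"
  have 1: "y < y1" "y1 < y'" "\<rho> < \<rho>1" "\<rho>1 < \<rho>'" using Suc.prems by (auto simp: y1_def \<rho>1_def)
  from Suc.IH[OF 1(2,4) Suc.prems(3)] obtain C1 where C1: "C1 \<ge> 0" and b1:
    "\<And>V. V holomorphic_on half_strip c y' \<rho>' \<and> (\<forall>\<tau>\<in>half_strip c y' \<rho>'. cmod (V \<tau>) \<le> C * exp (a * Re \<tau>)) \<Longrightarrow>
     (cover_deriv ^^ j) V holomorphic_on half_strip c y1 \<rho>1 \<and>
     (\<forall>\<tau>\<in>half_strip c y1 \<rho>1. cmod ((cover_deriv ^^ j) V \<tau>) \<le> C1 * exp ((a - real j) * Re \<tau>))" by blast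
  from cover_deriv_bound_step[OF 1(1,3) C1, of c "a - real j"] obtain C2 where C2: "C2 \<ge> 0" and b2:
    "\<And>V. V holomorphic_on half_strip c y1 \<rho>1 \<and> (\<forall>\<tau>\<in>half_strip c y1 \<rho>1. cmod (V \<tau>) \<le> C1 * exp ((a - real j) * Re \<tau>)) \<Longrightarrow>
     cover_deriv V holomorphic_on half_strip c y \<rho> \<and>
     (\<forall>\<tau>\<in>half_strip c y \<rho>. cmod (cover_deriv V \<tau>) \<le> C2 * exp ((a - real j - 1) * Re \<tau>))" by blast
  have e: "a - real j - 1 = a - real (Suc j)" by simp
  show ?case
  proof (intro exI[of _ C2] conjI allI impI C2)
    fix V assume V: "V holomorphic_on half_strip c y' \<rho>' \<and> (\<forall>\<tau>\<in>half_strip c y' \<rho>'. cmod (V \<tau>) \<le> C * exp (a * Re \<tau>))"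
    from b2[OF b1[OF V], unfolded e]
    show "(cover_deriv ^^ Suc j) V holomorphic_on half_strip c y \<rho>"
      "\<forall>\<tau>\<in>half_strip c y \<rho>. cmod ((cover_deriv ^^ Suc j) V \<tau>) \<le> C2 * exp ((a - real (Suc j)) * Re \<tau>)"
      by simp_all
  qed
qed

lemma cover_deriv_holomorphic: "f holomorphic_on S \<Longrightarrow> open S \<Longrightarrow> (cover_deriv ^^ j) f holomorphic_on S"
proof (induction j)
  case (Suc j)
  then have "deriv ((cover_deriv ^^ j) f) holomorphic_on S" by (intro holomorphic_deriv) auto
  then have "(\<lambda>\<tau>. exp (- \<tau>) * deriv ((cover_deriv ^^ j) f) \<tau>) holomorphic_on S"
    by (intro holomorphic_on_mult holomorphic_on_exp' holomorphic_on_minus holomorphic_on_ident)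
  also have "(\<lambda>\<tau>. exp (- \<tau>) * deriv ((cover_deriv ^^ j) f) \<tau>) = (cover_deriv ^^ Suc j) f"
    by (intro ext) (simp only: funpow.simps comp_apply cover_deriv_def[of "(cover_deriv ^^ j) f"])
  finally show ?case .
qed simp

lemma cover_deriv_add:
  assumes "f holomorphic_on S" "g holomorphic_on S" "open S" "\<tau> \<in> S" "\<And>\<tau>. \<tau> \<in> S \<Longrightarrow> h \<tau> = f \<tau> + g \<tau>"
  shows "(cover_deriv ^^ j) h \<tau> = (cover_deriv ^^ j) f \<tau> + (cover_deriv ^^ j) g \<tau>"
  using assms(4)
proof (induction j arbitrary: \<tau>)
  case 0 then show ?case using assms(5) by simp
next
  case (Suc j)
  let ?f = "(cover_deriv ^^ j) f" and ?g = "(cover_deriv ^^ j) g"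
  have "deriv ((cover_deriv ^^ j) h) \<tau> = deriv (\<lambda>\<tau>. ?f \<tau> + ?g \<tau>) \<tau>"
  proof (rule deriv_cong_ev[OF _ refl])
    show "\<forall>\<^sub>F x in nhds \<tau>. (cover_deriv ^^ j) h x = ?f x + ?g x"
      using eventually_nhds_in_open[OF assms(3) Suc.prems] by eventually_elim (rule Suc.IH)
  qed
  also have "\<dots> = deriv ?f \<tau> + deriv ?g \<tau>"
    using cover_deriv_holomorphic[OF assms(1,3), of j] cover_deriv_holomorphic[OF assms(2,3), of j] assms(3) Suc.prems
    by (intro deriv_add) (auto dest: holomorphic_on_imp_differentiable_at)
  finally show ?case
    by (simp only: funpow.simps comp_apply distrib_left cover_deriv_def[of "(cover_deriv ^^ j) h"]
        cover_deriv_def[of "(cover_deriv ^^ j) f"] cover_deriv_def[of "(cover_deriv ^^ j) g"])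
qed

lemma cover_deriv_poly: "(cover_deriv ^^ j) (\<lambda>\<tau>. poly p (exp \<tau>)) = (\<lambda>\<tau>. poly ((pderiv ^^ j) p) (exp \<tau>))"
proof (induction j)
  case (Suc j)
  have "deriv (\<lambda>\<tau>. poly q (exp \<tau>)) \<tau> = poly (pderiv q) (exp \<tau>) * exp \<tau>" for q and \<tau> :: complex
    by (intro DERIV_imp_deriv DERIV_chain2[OF poly_DERIV DERIV_exp])
  then show ?case
    unfolding funpow.simps comp_apply Suc.IH by (simp add: cover_deriv_def fun_eq_iff exp_minus)
qed simp

lemma cover_deriv_poly_degree_le:
  assumes "degree p \<le> l"
  shows "(cover_deriv ^^ l) (\<lambda>\<tau>. poly p (exp \<tau>)) \<tau> = fact l * coeff p l"
proof -
  have "(pderiv ^^ l) p = [:fact l * coeff p l:]"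
  proof (rule poly_eqI)
    fix m
    show "coeff ((pderiv ^^ l) p) m = coeff [:fact l * coeff p l:] m"
      using assms by (cases m) (simp_all add: coeff_higher_pderiv pochhammer_fact coeff_eq_0)
  qed
  then show ?thesis by (simp add: cover_deriv_poly)
qed

lemma norm_exp_power: "cmod (exp \<sigma> ^ n) = exp (real n * Re \<sigma>)"
  by (simp add: norm_power exp_of_nat_mult)

text \<open>Taylor's theorem on the whole of a strip: the growth bound takes over away from the origin.\<close>

lemma strip_sum_remainder:
  assumes H: "strip_sum r k L R b H" and LR: "L < R" and r: "0 \<le> r" and xy: "L < x" "y < R"
    and A: "0 \<le> A" "0 \<le> B" and AB: "\<And>\<sigma> z. Im \<sigma> \<in> {x..y} \<Longrightarrow> z \<in> cball 0 r \<Longrightarrow> cmod (H \<sigma> z) \<le> A * exp (B * exp (k * Re \<sigma>))"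
  shows "\<exists>A'\<ge>0. \<forall>\<sigma> z. Im \<sigma> \<in> {x..y} \<longrightarrow> z \<in> cball 0 r \<longrightarrow>
    cmod (H \<sigma> z - (\<Sum>n<N. b n z * exp \<sigma> ^ n)) \<le> A' * (exp (real N * Re \<sigma>) * exp (B * exp (k * Re \<sigma>)))"
proof -
  have "(L + R) / 2 \<in> {L<..<R}" using LR by auto
  from strip_sumD(4)[OF H this] obtain \<alpha> \<rho>1 g where g: "sectorial_sum r k ((L + R) / 2) \<alpha> \<rho>1 b g" by blast
  define s where "s = \<rho>1 / 2"
  have s: "0 < s" using g by (simp add: s_def sectorial_sum_def)
  obtain M where M: "M \<ge> 0" "\<And>n z. z \<in> cball 0 r \<Longrightarrow> cmod (b n z) \<le> M / s ^ n"
    using sectorial_sum_coefficient_bound[OF g r] by (auto simp: s_def)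
  obtain \<rho>0 where \<rho>0: "\<rho>0 > 0" "\<And>\<sigma> z. \<sigma> \<in> strip L R \<Longrightarrow> exp (Re \<sigma>) < \<rho>0 \<Longrightarrow> z \<in> cball 0 r \<Longrightarrow> (\<lambda>n. b n z * exp \<sigma> ^ n) sums H \<sigma> z"
    using strip_sumD(3)[OF H] by blast
  define q where "q = min (\<rho>0 / 2) (s / 2)"
  have q: "0 < q" "q < \<rho>0" "q \<le> s / 2" using \<rho>0(1) s by (auto simp: q_def)
  define A' where "A' = 2 * M / s ^ N + (A / q ^ N + (\<Sum>n<N. M / s ^ n / q ^ (N - n)))"
  have far0: "0 \<le> A / q ^ N + (\<Sum>n<N. M / s ^ n / q ^ (N - n))"
    using M(1) A s q by (intro add_nonneg_nonneg sum_nonneg) auto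
  have "cmod (H \<sigma> z - (\<Sum>n<N. b n z * exp \<sigma> ^ n)) \<le> A' * (exp (real N * Re \<sigma>) * exp (B * exp (k * Re \<sigma>)))"
    if \<sigma>: "Im \<sigma> \<in> {x..y}" and z: "z \<in> cball 0 r" for \<sigma> z
  proof -
    let ?t = "exp (Re \<sigma>)"
    let ?E = "exp (B * exp (k * Re \<sigma>))"
    have E1: "1 \<le> ?E" using A by simp
    have tN: "exp (real n * Re \<sigma>) = ?t ^ n" for n by (simp add: exp_of_nat_mult)
    show ?thesis
    proof (cases "?t \<le> q")
      case True
      have "(\<lambda>n. b n z * exp \<sigma> ^ n) sums H \<sigma> z" using \<sigma> xy True q z by (intro \<rho>0(2)) (auto simp: strip_def)
      then have 1: "(\<lambda>n. b (n + N) z * exp \<sigma> ^ (n + N)) sums (H \<sigma> z - (\<Sum>n<N. b n z * exp \<sigma> ^ n))"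
        by (rule sums_split_initial_segment)
      have 2: "(\<lambda>n. M * (?t / s) ^ N * (1 / 2) ^ n) sums (M * (?t / s) ^ N * 2)"
        using sums_mult[OF geometric_sums[of "1/2::real"], of "M * (?t / s) ^ N"] by simp
      have le: "cmod (b (n + N) z * exp \<sigma> ^ (n + N)) \<le> M * (?t / s) ^ N * (1 / 2) ^ n" for n
      proof -
        have "cmod (b (n + N) z * exp \<sigma> ^ (n + N)) \<le> M / s ^ (n + N) * ?t ^ (n + N)"
          unfolding norm_mult norm_exp_power tN using M(2)[OF z] by (intro mult_right_mono) auto
        also have "\<dots> = M * (?t / s) ^ N * (?t / s) ^ n" by (simp add: power_add power_divide mult_ac)
        also have "\<dots> \<le> M * (?t / s) ^ N * (1 / 2) ^ n"
          using M(1) s True q by (intro mult_left_mono power_mono) (auto simp: field_simps)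
        finally show ?thesis .
      qed
      have "cmod (H \<sigma> z - (\<Sum>n<N. b n z * exp \<sigma> ^ n)) \<le> M * (?t / s) ^ N * 2"
        using norm_suminf_le[OF le sums_summable[OF 2]] sums_unique[OF 1] sums_unique[OF 2] by simp
      also have "\<dots> = 2 * M / s ^ N * ?t ^ N" by (simp add: power_divide)
      also have "\<dots> \<le> A' * (?t ^ N * ?E)"
        using far0 M(1) s E1 by (intro mult_mono) (auto simp: A'_def)
      finally show ?thesis by (simp only: tN)
    next
      case False
      have pow: "?t ^ n \<le> ?t ^ N / q ^ (N - n)" if "n \<le> N" for n
      proof -
        have "q ^ (N - n) * ?t ^ n \<le> ?t ^ (N - n) * ?t ^ n" using False q by (intro mult_right_mono power_mono) auto
        also have "\<dots> = ?t ^ N" using that by (simp flip: power_add)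
        finally show ?thesis using q by (simp add: field_simps)
      qed
      have "cmod (H \<sigma> z) \<le> A * ?E" by (rule AB[OF \<sigma> z])
      also have "\<dots> = A * (?t ^ 0 * ?E)" by simp
      also have "\<dots> \<le> A * (?t ^ N / q ^ N * ?E)" using pow[of 0] A by (intro mult_left_mono mult_right_mono) auto
      finally have h1: "cmod (H \<sigma> z) \<le> A / q ^ N * (?t ^ N * ?E)" by simp
      have "cmod (\<Sum>n<N. b n z * exp \<sigma> ^ n) \<le> (\<Sum>n<N. M / s ^ n / q ^ (N - n) * (?t ^ N * ?E))"
      proof (rule sum_norm_le)
        fix n assume "n \<in> {..<N}"
        then have "cmod (b n z * exp \<sigma> ^ n) \<le> M / s ^ n * (?t ^ N / q ^ (N - n))"
          unfolding norm_mult norm_exp_power tN using M s by (intro mult_mono M(2)[OF z] pow) auto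
        also have "\<dots> = M / s ^ n / q ^ (N - n) * (?t ^ N * 1)" by simp
        also have "\<dots> \<le> M / s ^ n / q ^ (N - n) * (?t ^ N * ?E)"
          using E1 M s q by (intro mult_left_mono) auto
        finally show "cmod (b n z * exp \<sigma> ^ n) \<le> M / s ^ n / q ^ (N - n) * (?t ^ N * ?E)" .
      qed
      then have "cmod (H \<sigma> z - (\<Sum>n<N. b n z * exp \<sigma> ^ n)) \<le> (A / q ^ N + (\<Sum>n<N. M / s ^ n / q ^ (N - n))) * (?t ^ N * ?E)"
        using h1 norm_triangle_ineq4[of "H \<sigma> z" "\<Sum>n<N. b n z * exp \<sigma> ^ n"]
        unfolding distrib_right sum_distrib_right by linarith
      also have "\<dots> \<le> A' * (?t ^ N * ?E)"
        using M s by (intro mult_right_mono) (auto simp: A'_def)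
      finally show ?thesis by (simp only: tN)
    qed
  qed
  moreover have "0 \<le> A'" using far0 M(1) s by (simp add: A'_def)
  ultimately show ?thesis by blast
qed

context
  fixes k L R :: real
  assumes k: "0 < k" and LR: "L < R"
begin

lemma half_width_pos: "0 < half_width k L R" "(R - L) / 2 < half_width k L R"
  using k LR by (simp_all add: half_width_def add_pos_pos)

lemma radius_pos: "0 < (R - L) / 2"
  using LR by simp

lemma dir_bounds:
  assumes "\<bar>x - mid L R\<bar> < y"
  shows "\<bar>dir k L R x - mid L R\<bar> < (R - L) / 2 / half_width k L R * y"
    and "\<bar>k * (dir k L R x - x)\<bar> < pi / 2 / half_width k L R * y"
proof -
  define q where "q = (R - L) / 2 / half_width k L R"
  have q: "0 < q" using half_width_pos LR by (simp add: q_def)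
  have "\<bar>dir k L R x - mid L R\<bar> = q * \<bar>x - mid L R\<bar>" using q unfolding dir_def q_def[symmetric] by (simp add: abs_mult)
  then show "\<bar>dir k L R x - mid L R\<bar> < (R - L) / 2 / half_width k L R * y"
    using assms q unfolding q_def[symmetric] by simp
  have "k * (1 - q) * half_width k L R = k * (half_width k L R - (R - L) / 2)"
    using half_width_pos(1) by (simp add: q_def field_simps)
  also have "\<dots> = pi / 2" using k by (simp add: half_width_def)
  finally have e: "k * (1 - q) = pi / 2 / half_width k L R" using half_width_pos(1) by (simp add: field_simps)
  have "k * (dir k L R x - x) = - (k * (1 - q)) * (x - mid L R)"
    unfolding dir_def q_def[symmetric] by (simp add: algebra_simps)
  also have "\<bar>\<dots>\<bar> = pi / 2 / half_width k L R * \<bar>x - mid L R\<bar>"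
    unfolding e abs_mult abs_minus_cancel using half_width_pos(1) by simp
  finally show "\<bar>k * (dir k L R x - x)\<bar> < pi / 2 / half_width k L R * y"
    using assms half_width_pos(1) by (simp add: mult_strict_left_mono del: times_divide_eq_left)
qed

text \<open>
  On a half strip that is narrower than the full opening, all directions of integration stay in a compact
  subinterval of \<open>(L, R)\<close> and at an angle bounded away from \<open>pi / (2 * k)\<close>; so one growth bound and one
  upper bound for \<open>\<bar>t\<bar>\<close> make all Laplace integrals converge.
\<close>

lemma half_strip_data:
  assumes H: "strip_sum r k L R b H" and r: "0 \<le> r" and y: "0 < y" "y < half_width k L R"
    and a0: "a0 < (R - L) / 2" and \<omega>0: "\<omega>0 < pi / 2"
  obtains \<rho> A B \<omega> v w where "0 \<le> A" "0 < B" "0 < \<omega>" "\<omega> < pi / 2" "\<omega>0 \<le> \<omega>" "L < v" "w < R" "v < mid L R - a0" "mid L R + a0 < w"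
    "\<And>\<theta>. \<theta> \<in> {v..w} \<Longrightarrow> ray_bounded r k \<theta> A B H"
    "\<And>\<tau>. \<tau> \<in> half_strip (mid L R) y \<rho> \<Longrightarrow> dir k L R (Im \<tau>) \<in> {v<..<w} \<and> \<bar>k * (dir k L R (Im \<tau>) - Im \<tau>)\<bar> < \<omega>"
    "\<And>\<tau>. Re \<tau> < \<rho> \<Longrightarrow> B * exp (k * Re \<tau>) < cos \<omega> / 2"
proof -
  define a1 where "a1 = max a0 ((R - L) / 2 / half_width k L R * y)"
  have "(R - L) / 2 * (y / half_width k L R) < (R - L) / 2 * 1"
    using y half_width_pos LR by (intro mult_strict_left_mono) auto
  then have "(R - L) / 2 / half_width k L R * y < (R - L) / 2" by simp
  then have a1: "a1 < (R - L) / 2" using a0 by (simp add: a1_def)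
  then obtain a where a: "a1 < a" "a < (R - L) / 2" using dense by blast
  define \<omega> where "\<omega> = max \<omega>0 (pi / 2 / half_width k L R * y)"
  have "pi / 2 * (y / half_width k L R) < pi / 2 * 1"
    using y half_width_pos by (intro mult_strict_left_mono) auto
  then have "pi / 2 / half_width k L R * y < pi / 2" by simp
  moreover have "0 < pi / 2 / half_width k L R * y" using y half_width_pos(1) by simp
  ultimately have \<omega>: "0 < \<omega>" "\<omega> < pi / 2" using \<omega>0 unfolding \<omega>_def by linarith+
  define v w where "v = mid L R - a" and "w = mid L R + a"
  have vw: "L < v" "w < R" using a by (auto simp: v_def w_def mid_def field_simps)
  from strip_sum_ray_bounded[OF H vw r] obtain A B where AB: "A > 0" "B > 0" "\<And>\<theta>. \<theta> \<in> {v..w} \<Longrightarrow> ray_bounded r k \<theta> A B H" by blast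
  have cos: "0 < cos \<omega>" using \<omega> by (intro cos_gt_zero_pi) auto
  define \<rho> where "\<rho> = ln (cos \<omega> / (2 * B)) / k"
  have "B * exp (k * Re \<tau>) < cos \<omega> / 2" if "Re \<tau> < \<rho>" for \<tau>
  proof -
    have "k * Re \<tau> < ln (cos \<omega> / (2 * B))" using that k by (simp add: \<rho>_def field_simps)
    then have "exp (k * Re \<tau>) < exp (ln (cos \<omega> / (2 * B)))" by simp
    also have "\<dots> = cos \<omega> / (2 * B)" using cos AB by simp
    finally show ?thesis using AB by (simp add: field_simps)
  qed
  moreover have "dir k L R (Im \<tau>) \<in> {v<..<w} \<and> \<bar>k * (dir k L R (Im \<tau>) - Im \<tau>)\<bar> < \<omega>" if "\<tau> \<in> half_strip (mid L R) y \<rho>" for \<tau>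
  proof -
    have "\<bar>Im \<tau> - mid L R\<bar> < y" using that by (simp add: half_strip_def)
    from dir_bounds[OF this] have "\<bar>dir k L R (Im \<tau>) - mid L R\<bar> < a" "\<bar>k * (dir k L R (Im \<tau>) - Im \<tau>)\<bar> < \<omega>"
      using a by (auto simp: a1_def \<omega>_def)
    then show ?thesis unfolding v_def w_def greaterThanLessThan_iff by linarith
  qed
  ultimately show thesis
    using that[of A B \<omega> v w \<rho>] AB \<omega> vw a by (auto simp: \<omega>_def v_def w_def a1_def intro: less_imp_le)
qed

lemma ksum_eholomorphic:
  assumes H: "strip_sum r k L R b H" and r: "0 < r" and y: "0 < y" "y < half_width k L R"
  shows "\<exists>\<rho>. eholomorphic (O_space r) (half_strip (mid L R) y \<rho>) (ksum k L R H) \<and>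
     (\<forall>\<tau>\<in>half_strip (mid L R) y \<rho>. \<forall>n. has_ray_integral (dir k L R (Im \<tau>))
        (\<lambda>\<sigma>. (deriv ^^ n) (H \<sigma>) 0 * laplace_kernel k \<tau> \<sigma>) ((deriv ^^ n) (ksum k L R H \<tau>) 0))"
proof -
  obtain \<rho> A B \<omega> v w where A: "0 \<le> A" "0 < B" "0 < \<omega>" and \<omega>: "\<omega> < pi / 2" and "0 \<le> \<omega>" and vw: "L < v" "w < R"
    and "v < mid L R - 0" "mid L R + 0 < w"
    and AB: "\<And>\<theta>. \<theta> \<in> {v..w} \<Longrightarrow> ray_bounded r k \<theta> A B H"
    and dir: "\<And>\<tau>. \<tau> \<in> half_strip (mid L R) y \<rho> \<Longrightarrow> dir k L R (Im \<tau>) \<in> {v<..<w} \<and> \<bar>k * (dir k L R (Im \<tau>) - Im \<tau>)\<bar> < \<omega>"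
    and small: "\<And>\<tau>. Re \<tau> < \<rho> \<Longrightarrow> B * exp (k * Re \<tau>) < cos \<omega> / 2"
    by (rule half_strip_data[OF H less_imp_le[OF r] y radius_pos pi_half_gt_zero]) (rule that)
  let ?S = "half_strip (mid L R) y \<rho>"
  have conv: "\<tau> \<in> conv_region k (dir k L R (Im \<tau>)) B \<omega>" if "\<tau> \<in> ?S" for \<tau>
    using dir[OF that] small[of \<tau>] that by (auto simp: conv_region_def half_strip_def)
  have "eholomorphic (O_space r) ?S (ksum k L R H)"
  proof (rule eholomorphic_local)
    fix \<tau> assume \<tau>: "\<tau> \<in> ?S"
    let ?\<theta> = "dir k L R (Im \<tau>)"
    let ?V = "?S \<inter> conv_region k ?\<theta> B \<omega>"
    have \<theta>: "?\<theta> \<in> {v<..<w}" using dir[OF \<tau>] by blast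
    then have "eholomorphic (O_space r) (conv_region k ?\<theta> B \<omega>) (laplace k ?\<theta> H)"
      by (intro laplace_eholomorphic[OF r k A(1) AB \<omega>]) auto
    then have "eholomorphic (O_space r) ?V (laplace k ?\<theta> H)" by (rule eholomorphic_subset) auto
    moreover have "ksum k L R H s = laplace k ?\<theta> H s" if s: "s \<in> ?V" for s
      unfolding ksum_def
      using dir[of s] s \<theta> small[of s]
      by (intro laplace_independent[OF H r k \<omega> vw A(1) AB]) (auto simp: conv_region_def half_strip_def)
    moreover have "open ?V" by (intro open_Int open_half_strip open_conv_region)
    moreover have "\<tau> \<in> ?V" using \<tau> conv by blast
    ultimately show "\<exists>V g. open V \<and> \<tau> \<in> V \<and> eholomorphic (O_space r) V g \<and> (\<forall>s\<in>V. ksum k L R H s = g s)" by blast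
  qed
  moreover have "has_ray_integral (dir k L R (Im \<tau>)) (\<lambda>\<sigma>. (deriv ^^ n) (H \<sigma>) 0 * laplace_kernel k \<tau> \<sigma>) ((deriv ^^ n) (ksum k L R H \<tau>) 0)"
    if \<tau>: "\<tau> \<in> ?S" for \<tau> n
  proof -
    have "ray_bounded r k (dir k L R (Im \<tau>)) A B H" using dir[OF \<tau>] by (intro AB) auto
    from laplace_taylor[OF r k A(1) this \<omega> conv[OF \<tau>]] show ?thesis by (simp add: ksum_def[abs_def])
  qed
  ultimately show ?thesis by blast
qed

text \<open>
  For a fixed regular direction \<open>\<theta>\<close> the moving ray may be replaced by \<open>arg s = \<theta>\<close> as long as \<open>\<bar>arg t - \<theta>\<bar> < pi / (2 * k)\<close>.
\<close>

lemma ksum_direction: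
  assumes H: "strip_sum r k L R b H" and r: "0 < r" and \<theta>: "\<theta> \<in> {L<..<R}" and \<beta>: "0 < \<beta>" "\<beta> < pi / k"
  shows "\<exists>\<rho>. \<forall>\<tau>. \<bar>Im \<tau> - \<theta>\<bar> < \<beta> / 2 \<and> Re \<tau> < \<rho> \<longrightarrow>
     (\<forall>z\<in>cball 0 r. has_ray_integral \<theta> (\<lambda>\<sigma>. H \<sigma> z * laplace_kernel k \<tau> \<sigma>) (ksum k L R H \<tau> z))"
proof -
  define y where "y = \<bar>\<theta> - mid L R\<bar> + \<beta> / 2"
  have \<theta>': "\<bar>\<theta> - mid L R\<bar> < (R - L) / 2" using \<theta> by (auto simp: mid_def abs_less_iff field_simps)
  then have y: "0 < y" "y < half_width k L R" using \<beta> by (auto simp: y_def half_width_def intro!: add_strict_mono simp flip: divide_divide_eq_left)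
  have kb: "k * \<beta> / 2 < pi / 2" using \<beta> k by (simp add: field_simps)
  obtain \<rho> A B \<omega> v w where A: "0 \<le> A" "0 < B" "0 < \<omega>" and \<omega>: "\<omega> < pi / 2" "k * \<beta> / 2 \<le> \<omega>" and vw: "L < v" "w < R"
    and \<theta>vw: "v < mid L R - \<bar>\<theta> - mid L R\<bar>" "mid L R + \<bar>\<theta> - mid L R\<bar> < w"
    and AB: "\<And>\<theta>. \<theta> \<in> {v..w} \<Longrightarrow> ray_bounded r k \<theta> A B H"
    and dir: "\<And>\<tau>. \<tau> \<in> half_strip (mid L R) y \<rho> \<Longrightarrow> dir k L R (Im \<tau>) \<in> {v<..<w} \<and> \<bar>k * (dir k L R (Im \<tau>) - Im \<tau>)\<bar> < \<omega>"
    and small: "\<And>\<tau>. Re \<tau> < \<rho> \<Longrightarrow> B * exp (k * Re \<tau>) < cos \<omega> / 2"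
    by (rule half_strip_data[OF H less_imp_le[OF r] y \<theta>' kb]) (rule that)
  have "has_ray_integral \<theta> (\<lambda>\<sigma>. H \<sigma> z * laplace_kernel k \<tau> \<sigma>) (ksum k L R H \<tau> z)"
    if \<tau>: "\<bar>Im \<tau> - \<theta>\<bar> < \<beta> / 2" "Re \<tau> < \<rho>" and z: "z \<in> cball 0 r" for \<tau> z
  proof -
    have "\<bar>Im \<tau> - mid L R\<bar> \<le> \<bar>Im \<tau> - \<theta>\<bar> + \<bar>\<theta> - mid L R\<bar>" by arith
    then have \<tau>S: "\<tau> \<in> half_strip (mid L R) y \<rho>" using \<tau> by (simp add: half_strip_def y_def)
    have \<theta>2: "\<theta> \<in> {v<..<w}" using \<theta>vw unfolding greaterThanLessThan_iff by linarith
    have "\<bar>k * (\<theta> - Im \<tau>)\<bar> = k * \<bar>Im \<tau> - \<theta>\<bar>" using k by (simp add: abs_mult abs_minus_commute)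
    also have "\<dots> < k * (\<beta> / 2)" using \<tau>(1) k by (rule mult_strict_left_mono)
    finally have ang: "\<bar>k * (\<theta> - Im \<tau>)\<bar> < \<omega>" using \<omega>(2) by simp
    have eq: "ksum k L R H \<tau> = laplace k \<theta> H \<tau>"
      unfolding ksum_def
      using dir[OF \<tau>S] \<theta>2 small[OF \<tau>(2)] ang
      by (intro laplace_independent[OF H r k \<omega>(1) vw A(1) AB]) auto
    show ?thesis unfolding eq
      by (rule laplace_has_ray_integral(1)[OF r k A(1) AB \<omega>(1) _ z])
         (use \<theta>2 ang small[OF \<tau>(2)] in \<open>auto simp: conv_region_def\<close>)
  qed
  then show ?thesis by blast
qed

text \<open>The series is the asymptotic expansion of the sum; Laplace and Borel transform cancel termwise.\<close>

lemma ksum_asymptotic: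
  assumes H: "strip_sum r k L R b H" and r: "0 < r" and y: "0 < y" "y < half_width k L R"
  shows "\<exists>\<rho>. \<exists>C\<ge>0. \<forall>\<tau>\<in>half_strip (mid L R) y \<rho>. \<forall>z\<in>cball 0 r.
     cmod (ksum k L R H \<tau> z - (\<Sum>n<N. b n z * (of_real (Gamma (1 + real n / k)) * exp \<tau> ^ n))) \<le> C * exp (real N * Re \<tau>)"
proof -
  obtain \<rho> A B \<omega> v w where A: "0 \<le> A" "0 < B" "0 < \<omega>" and \<omega>: "\<omega> < pi / 2" and "0 \<le> \<omega>" and vw: "L < v" "w < R"
    and "v < mid L R - 0" "mid L R + 0 < w"
    and AB: "\<And>\<theta>. \<theta> \<in> {v..w} \<Longrightarrow> ray_bounded r k \<theta> A B H"
    and dir: "\<And>\<tau>. \<tau> \<in> half_strip (mid L R) y \<rho> \<Longrightarrow> dir k L R (Im \<tau>) \<in> {v<..<w} \<and> \<bar>k * (dir k L R (Im \<tau>) - Im \<tau>)\<bar> < \<omega>"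
    and small: "\<And>\<tau>. Re \<tau> < \<rho> \<Longrightarrow> B * exp (k * Re \<tau>) < cos \<omega> / 2"
    by (rule half_strip_data[OF H less_imp_le[OF r] y radius_pos pi_half_gt_zero]) (rule that)
  have cos: "0 < cos \<omega>" using A \<omega> by (intro cos_gt_zero_pi) auto
  obtain M where M: "M > 0" "\<And>x. exp (real N * x) \<le> M * exp (cos \<omega> / 4 * exp (k * x))"
    using exp_linear_le_exp_exp[OF k, of "cos \<omega> / 4" "real N"] cos by auto
  define P where "P \<sigma> z = H \<sigma> z - (\<Sum>n<N. b n z * exp \<sigma> ^ n)" for \<sigma> z
  have "\<exists>A'\<ge>0. \<forall>\<sigma> z. Im \<sigma> \<in> {v..w} \<longrightarrow> z \<in> cball 0 r \<longrightarrow>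
    cmod (P \<sigma> z) \<le> A' * (exp (real N * Re \<sigma>) * exp (B * exp (k * Re \<sigma>)))"
    unfolding P_def using r A AB by (intro strip_sum_remainder[OF H LR _ vw A(1)]) (auto simp: ray_bounded_def)
  then obtain A' where A': "A' \<ge> 0" "\<And>\<sigma> z. Im \<sigma> \<in> {v..w} \<Longrightarrow> z \<in> cball 0 r \<Longrightarrow>
    cmod (P \<sigma> z) \<le> A' * (exp (real N * Re \<sigma>) * exp (B * exp (k * Re \<sigma>)))" by blast
  have "cmod (ksum k L R H \<tau> z - (\<Sum>n<N. b n z * (of_real (Gamma (1 + real n / k)) * exp \<tau> ^ n))) \<le> 4 * A' * M / cos \<omega> * exp (real N * Re \<tau>)"
    if \<tau>: "\<tau> \<in> half_strip (mid L R) y \<rho>" and z: "z \<in> cball 0 r" for \<tau> z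
  proof -
    let ?\<theta> = "dir k L R (Im \<tau>)"
    let ?K = "laplace_kernel k \<tau>"
    have \<theta>: "?\<theta> \<in> {v<..<w}" "\<bar>k * (?\<theta> - Im \<tau>)\<bar> < \<omega>" using dir[OF \<tau>] by auto
    have sm: "B * exp (k * Re \<tau>) < cos \<omega> / 2" using \<tau> small by (simp add: half_strip_def)
    let ?a = "max v (Im \<tau> - \<omega> / k)" and ?b = "min w (Im \<tau> + \<omega> / k)"
    have int: "\<bar>k * (x - Im \<tau>)\<bar> < \<omega> \<longleftrightarrow> x \<in> {Im \<tau> - \<omega> / k<..<Im \<tau> + \<omega> / k}" for x
      using k by (auto simp: abs_less_iff abs_mult field_simps)
    have in_ab: "?\<theta> \<in> {?a<..<?b}" using \<theta> int[of ?\<theta>] by auto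
    have "\<exists>I. (\<forall>\<theta>\<in>{?a<..<?b}. has_ray_integral \<theta> (\<lambda>\<sigma>. P \<sigma> z * ?K \<sigma>) I) \<and>
             cmod I \<le> 4 * A' * M / cos \<omega> * exp (real N * Re \<tau>)"
    proof (rule laplace_integral_exists[OF k \<omega> _ _ _ M(2)])
      show "\<bar>k * (x - Im \<tau>)\<bar> \<le> \<omega>" if "x \<in> {?a<..<?b}" for x using int[of x] that by auto
      have "(\<lambda>\<sigma>. H \<sigma> z) holomorphic_on strip L R"
        using strip_sumD(1)[OF H] r by (intro eholomorphic_pointwise) (auto simp: strip_def open_strip_between)
      then have "(\<lambda>\<sigma>. H \<sigma> z) holomorphic_on strip ?a ?b"
        by (rule holomorphic_on_subset) (use vw in \<open>auto simp: strip_def\<close>)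
      then show "(\<lambda>\<sigma>. P \<sigma> z) holomorphic_on strip ?a ?b" unfolding P_def by (intro holomorphic_intros)
      show "cmod (P \<sigma> z) \<le> A' * (exp (real N * Re \<sigma>) * exp (B * exp (k * Re \<sigma>)))" if "\<sigma> \<in> strip ?a ?b" for \<sigma>
        using that by (intro A'(2)[OF _ z]) (auto simp: strip_def)
    qed (use in_ab sm A' in auto)
    then obtain I where I: "has_ray_integral ?\<theta> (\<lambda>\<sigma>. P \<sigma> z * ?K \<sigma>) I" "cmod I \<le> 4 * A' * M / cos \<omega> * exp (real N * Re \<tau>)"
      using in_ab by blast
    let ?S = "\<Sum>n<N. b n z * (of_real (Gamma (1 + real n / k)) * exp \<tau> ^ n)"
    have "has_ray_integral ?\<theta> (\<lambda>\<sigma>. P \<sigma> z * ?K \<sigma> + (\<Sum>n<N. b n z * (exp \<sigma> ^ n * ?K \<sigma>))) (I + ?S)"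
      using \<theta>(2) \<omega> by (intro has_ray_integral_add[OF I(1)] has_ray_integral_sum has_ray_integral_cmult laplace_moment k) simp
    moreover have "P \<sigma> z * ?K \<sigma> + (\<Sum>n<N. b n z * (exp \<sigma> ^ n * ?K \<sigma>)) = H \<sigma> z * ?K \<sigma>" for \<sigma>
      by (simp add: P_def left_diff_distrib sum_distrib_right mult.assoc)
    ultimately have "has_ray_integral ?\<theta> (\<lambda>\<sigma>. H \<sigma> z * ?K \<sigma>) (I + ?S)" by simp
    moreover have "has_ray_integral ?\<theta> (\<lambda>\<sigma>. H \<sigma> z * ?K \<sigma>) (ksum k L R H \<tau> z)"
      unfolding ksum_def
      by (rule laplace_has_ray_integral(1)[OF r k A(1) AB \<omega> _ z]) (use \<theta> sm in \<open>auto simp: conv_region_def\<close>)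
    ultimately have "ksum k L R H \<tau> z = I + ?S" using has_ray_integral_unique by blast
    with I(2) show ?thesis by simp
  qed
  moreover have "0 \<le> 4 * A' * M / cos \<omega>" using A' M cos by simp
  ultimately show ?thesis by blast
qed

text \<open>
  Differentiation of the asymptotic expansion up to order \<open>l\<close>: the polynomial part is differentiated exactly
  and the remainder \<open>O(\<bar>t\<bar> ^ (l + 1))\<close> by Cauchy's estimate on a slightly wider half strip.
\<close>

lemma ksum_derivatives:
  assumes H: "strip_sum r k L R b H" and r: "0 < r" and y: "0 < y" "y < half_width k L R"
  shows "\<exists>\<rho>. \<exists>C\<ge>0. \<forall>\<tau>\<in>half_strip (mid L R) y \<rho>. \<forall>z\<in>cball 0 r.
     cmod ((cover_deriv ^^ l) (\<lambda>\<tau>. ksum k L R H \<tau> z) \<tau> - fact l * (b l z * of_real (Gamma (1 + real l / k)))) \<le> C * exp (Re \<tau>)"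
proof -
  obtain y' where y': "y < y'" "y' < half_width k L R" using dense[OF y(2)] by blast
  then have y'0: "0 < y'" using y by simp
  obtain \<rho>1 where \<rho>1: "eholomorphic (O_space r) (half_strip (mid L R) y' \<rho>1) (ksum k L R H)"
    using ksum_eholomorphic[OF H r y'0 y'(2)] by blast
  obtain \<rho>2 C where C: "C \<ge> 0" and as: "\<And>\<tau> z. \<tau> \<in> half_strip (mid L R) y' \<rho>2 \<Longrightarrow> z \<in> cball 0 r \<Longrightarrow>
     cmod (ksum k L R H \<tau> z - (\<Sum>n<Suc l. b n z * (of_real (Gamma (1 + real n / k)) * exp \<tau> ^ n))) \<le> C * exp (real (Suc l) * Re \<tau>)"
    using ksum_asymptotic[OF H r y'0 y'(2), of "Suc l"] by blast
  define \<rho>' where "\<rho>' = min \<rho>1 \<rho>2"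
  let ?S = "half_strip (mid L R) y' \<rho>'" and ?T = "half_strip (mid L R) y (\<rho>' - 1)"
  have sub: "?S \<subseteq> half_strip (mid L R) y' \<rho>1" "?S \<subseteq> half_strip (mid L R) y' \<rho>2" "?T \<subseteq> ?S"
    using y' by (auto simp: half_strip_def \<rho>'_def)
  obtain C' where C': "C' \<ge> 0" and cd: "\<And>V. V holomorphic_on ?S \<Longrightarrow> (\<And>\<tau>. \<tau> \<in> ?S \<Longrightarrow> cmod (V \<tau>) \<le> C * exp (real (Suc l) * Re \<tau>)) \<Longrightarrow>
     (\<forall>\<tau>\<in>?T. cmod ((cover_deriv ^^ l) V \<tau>) \<le> C' * exp ((real (Suc l) - real l) * Re \<tau>))"
    using cover_deriv_bound[OF y'(1) _ C, of "\<rho>' - 1" \<rho>' "mid L R" "real (Suc l)" l] by auto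
  have "cmod ((cover_deriv ^^ l) (\<lambda>\<tau>. ksum k L R H \<tau> z) \<tau> - fact l * (b l z * of_real (Gamma (1 + real l / k)))) \<le> C' * exp (Re \<tau>)"
    if \<tau>: "\<tau> \<in> ?T" and z: "z \<in> cball 0 r" for \<tau> z
  proof -
    define p where "p = (\<Sum>n<Suc l. monom (b n z * of_real (Gamma (1 + real n / k))) n)"
    have poly: "poly p (exp s) = (\<Sum>n<Suc l. b n z * (of_real (Gamma (1 + real n / k)) * exp s ^ n))" for s
      by (simp add: p_def poly_sum poly_monom mult.assoc del: sum.lessThan_Suc)
    have deg: "degree p \<le> l" unfolding p_def by (intro degree_sum_le) (auto intro: order_trans[OF degree_monom_le])
    have co: "coeff p l = b l z * of_real (Gamma (1 + real l / k))"
      unfolding p_def coeff_sum by (simp add: sum.delta if_distrib cong: if_cong)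
    define V where "V s = ksum k L R H s z - poly p (exp s)" for s
    have hol: "(\<lambda>s. ksum k L R H s z) holomorphic_on ?S"
      by (rule holomorphic_on_subset[OF eholomorphic_pointwise[OF \<rho>1 _ open_half_strip] sub(1)]) (use r in simp)
    have hp: "(\<lambda>s. poly p (exp s)) holomorphic_on ?S" unfolding poly by (intro holomorphic_intros)
    have hV: "V holomorphic_on ?S" unfolding V_def[abs_def] by (intro holomorphic_on_diff hol hp)
    have "cmod (V s) \<le> C * exp (real (Suc l) * Re s)" if "s \<in> ?S" for s
      unfolding V_def poly using as[OF subsetD[OF sub(2) that] z] .
    from cd[OF hV this] \<tau> have "cmod ((cover_deriv ^^ l) V \<tau>) \<le> C' * exp (Re \<tau>)" by simp
    moreover have "(cover_deriv ^^ l) (\<lambda>\<tau>. ksum k L R H \<tau> z) \<tau> = (cover_deriv ^^ l) V \<tau> + (cover_deriv ^^ l) (\<lambda>s. poly p (exp s)) \<tau>"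
      by (rule cover_deriv_add[OF hV hp open_half_strip subsetD[OF sub(3) \<tau>]]) (simp add: V_def)
    ultimately show ?thesis unfolding cover_deriv_poly_degree_le[OF deg] co by simp
  qed
  with C' show ?thesis by blast
qed

end

section \<open>The equation\<close>

text \<open>
  The factor \<open>m (N + j) / m N\<close> of the \<open>j\<close>-th moment derivative in \<open>z\<close>, as the product in which it arises; in this
  form no \<open>m n\<close> has to be cancelled.
\<close>

primrec zcoef :: "(nat \<Rightarrow> real) \<Rightarrow> nat \<Rightarrow> nat \<Rightarrow> complex" where
  "zcoef m 0 N = 1"
| "zcoef m (Suc j) N = of_real (m (Suc N) / m N) * zcoef m j (Suc N)"

lemma moment_deriv_z_nth: "fps_nth ((moment_deriv_z m ^^ j) F) N = zcoef m j N * fps_nth F (N + j)"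
  by (induction j arbitrary: N) (simp_all add: moment_deriv_z_def)

lemma apply_P_nth:
  "fps_nth (apply_P P m2 w) N = (\<Sum>i\<le>degree P. \<Sum>j\<le>degree (coeff P i).
     coeff (coeff P i) j * zcoef m2 j N / fact (N + j) * (deriv ^^ (N + j)) (w i) 0)"
  unfolding apply_P_def fps_sum_nth by (simp add: moment_deriv_z_nth fps_expansion_def mult.assoc)

lemma higher_deriv_O_space_scale:
  assumes "0 < r" "f \<in> carr (O_space r)"
  shows "(deriv ^^ n) (\<lambda>z. c * f z) 0 = c * (deriv ^^ n) f 0"
  using assms by (intro higher_deriv_cmult[of _ "ball 0 r"]) (auto simp: carr_O_space)

lemma higher_deriv_O_space_diff:
  assumes "0 < r" "f \<in> carr (O_space r)" "g \<in> carr (O_space r)"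
  shows "(deriv ^^ n) (\<lambda>z. f z - g z) 0 = (deriv ^^ n) f 0 - (deriv ^^ n) g 0"
  using assms by (intro higher_deriv_diff[of _ "ball 0 r"]) (auto simp: carr_O_space)

lemma higher_deriv_O_space_sum:
  assumes "0 < r" "\<And>i. i \<in> I \<Longrightarrow> f i \<in> carr (O_space r)"
  shows "(deriv ^^ n) (\<lambda>z. \<Sum>i\<in>I. f i z) 0 = (\<Sum>i\<in>I. (deriv ^^ n) (f i) 0)"
  using assms(2)
proof (induction I rule: infinite_finite_induct)
  case (insert x F)
  have "(deriv ^^ n) (\<lambda>z. f x z + (\<Sum>i\<in>F. f i z)) 0 = (deriv ^^ n) (f x) 0 + (deriv ^^ n) (\<lambda>z. \<Sum>i\<in>F. f i z) 0"
    using assms(1) insert.prems O_space_sum[of F f r]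
    by (intro higher_deriv_add[of _ "ball 0 r"]) (auto simp: carr_O_space)
  with insert show ?case by simp
qed (induction n, auto)

lemma higher_deriv_O_space_bound:
  assumes "0 < r" "f \<in> carr (O_space r)"
  shows "cmod ((deriv ^^ n) f 0) \<le> fact n / r ^ n * nrm (O_space r) f"
proof -
  have "cmod ((deriv ^^ n) f 0) \<le> fact n * nrm (O_space r) f / r ^ n"
    using assms by (intro Cauchy_inequality) (auto simp: carr_O_space norm_le_nrm_O_space[OF assms(2)])
  then show ?thesis by simp
qed

lemma apply_P_scale:
  assumes "0 < r" "\<And>i. w i \<in> carr (O_space r)"
  shows "apply_P P m2 (\<lambda>i z. c * w i z) = fps_const c * apply_P P m2 w"
  by (rule fps_ext) (simp add: apply_P_nth higher_deriv_O_space_scale[OF assms] sum_distrib_left mult_ac)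

lemma moment_deriv_t_carr:
  "(\<And>n. u n \<in> carr (O_space r)) \<Longrightarrow> (moment_deriv_t m ^^ i) u n \<in> carr (O_space r)"
proof (induction i arbitrary: n)
  case (Suc i)
  have "(moment_deriv_t m ^^ Suc i) u n = (\<lambda>z. of_real (m (Suc n) / m n) * (moment_deriv_t m ^^ i) u (Suc n) z)"
    by (simp add: moment_deriv_t_def)
  then show ?case using O_space_scale[OF Suc.IH[OF Suc.prems]] by metis
qed simp

lemma moment_deriv_t_borel_transform:
  assumes "\<And>n. m n \<noteq> 0"
  shows "(moment_deriv_t (\<lambda>n. m n * m1 n) ^^ i) (borel_transform m u) = borel_transform m ((moment_deriv_t m1 ^^ i) u)"
proof (induction i)
  case (Suc i)
  have "moment_deriv_t (\<lambda>n. m n * m1 n) (borel_transform m v) = borel_transform m (moment_deriv_t m1 v)" for v :: "nat \<Rightarrow> 'a \<Rightarrow> complex"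
    using assms by (simp add: moment_deriv_t_def borel_transform_def fun_eq_iff)
  with Suc show ?case by simp
qed simp

lemma formal_solution_borel_transform:
  assumes u: "formal_solution r P m1 m2 \<phi> u" and r: "0 < r" and m: "\<And>n. m n \<noteq> 0" "m 0 = 1"
  shows "formal_solution r P (\<lambda>n. m n * m1 n) m2 \<phi> (borel_transform m u)"
proof -
  have uc: "u n \<in> carr (O_space r)" for n using u by (simp add: formal_solution_def)
  have b: "borel_transform m w n = (\<lambda>z. inverse (of_real (m n)) * w n z)" for w n
    by (simp add: borel_transform_def divide_inverse mult.commute)
  have "apply_P P m2 (\<lambda>i. (moment_deriv_t (\<lambda>n. m n * m1 n) ^^ i) (borel_transform m u) n)
     = fps_const (inverse (of_real (m n))) * apply_P P m2 (\<lambda>i. (moment_deriv_t m1 ^^ i) u n)" for n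
    unfolding moment_deriv_t_borel_transform[where m = m and u = u, OF m(1)] b
    by (rule apply_P_scale[OF r moment_deriv_t_carr[OF uc]])
  then show ?thesis
    using u unfolding formal_solution_def moment_deriv_t_borel_transform[where m = m and u = u, OF m(1)]
    by (auto simp: b m(2) intro!: O_space_scale)
qed

lemma moment_deriv_t_at_0: "m 0 = 1 \<Longrightarrow> (\<And>n. m n \<noteq> 0) \<Longrightarrow> (moment_deriv_t m ^^ l) u 0 z = of_real (m l) * u l z"
proof -
  assume m: "m 0 = 1" "\<And>n. m n \<noteq> 0"
  have "(moment_deriv_t m ^^ l) u n z = of_real (m (n + l) / m n) * u (n + l) z" for n
    using m(2) by (induction l arbitrary: n) (simp_all add: moment_deriv_t_def)
  with m(1) show ?thesis by simp
qed

text \<open>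
  The power series in \<open>t\<close> converges in the norm of the space, so it may be read off for each Taylor coefficient in
  \<open>z\<close>, with one radius for all of them.
\<close>

lemma strip_sum_taylor_sums:
  assumes H: "strip_sum r k L R b H" and LR: "L < R" and r: "0 < r" and b: "\<And>n. b n \<in> carr (O_space r)"
  shows "\<exists>\<delta>>0. \<forall>\<sigma>\<in>strip L R. \<bar>Im \<sigma> - mid L R\<bar> < \<delta> \<and> exp (Re \<sigma>) < \<delta> \<longrightarrow>
     (\<forall>n. (\<lambda>m. (deriv ^^ n) (b m) 0 * exp \<sigma> ^ m) sums (deriv ^^ n) (H \<sigma>) 0)"
proof -
  have "mid L R \<in> {L<..<R}" using LR by (auto simp: mid_def)
  from strip_sumD(4)[OF H this] obtain \<alpha> \<rho> g where g: "sectorial_sum r k (mid L R) \<alpha> \<rho> b g"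
    and Hg: "\<And>\<sigma>. \<sigma> \<in> strip L R \<Longrightarrow> \<bar>Im \<sigma> - mid L R\<bar> < \<alpha> / 2 \<Longrightarrow> H \<sigma> = g (exp \<sigma>)" by blast
  have pos: "0 < \<alpha>" "0 < \<rho>" using g by (auto simp: sectorial_sum_def)
  define \<delta> where "\<delta> = min (\<alpha> / 2) (\<rho> / 4)"
  have "(\<lambda>m. (deriv ^^ n) (b m) 0 * exp \<sigma> ^ m) sums (deriv ^^ n) (H \<sigma>) 0"
    if \<sigma>: "\<sigma> \<in> strip L R" "\<bar>Im \<sigma> - mid L R\<bar> < \<delta>" "exp (Re \<sigma>) < \<delta>" for \<sigma> n
  proof -
    let ?t = "exp \<sigma>"
    have t: "?t \<in> ball 0 (\<rho> / 4)" using \<sigma> by (simp add: \<delta>_def)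
    have eq: "H \<sigma> = g ?t" using Hg[OF \<sigma>(1)] \<sigma>(2) by (simp add: \<delta>_def)
    have gc: "g ?t \<in> carr (O_space r)" using t pos by (intro sectorial_sum_carr_near_0[OF g]) auto
    have sc: "(\<lambda>z. \<Sum>m<N. ?t ^ m * b m z) \<in> carr (O_space r)" for N by (intro O_space_sum O_space_scale b)
    have lim: "(\<lambda>N. nrm (O_space r) (\<lambda>z. (\<Sum>m<N. ?t ^ m * b m z) - g ?t z)) \<longlonglongrightarrow> 0"
      using sectorial_sum_uniform_limit[OF g less_imp_le[OF r] t] by (intro tendsto_nrm_O_space sc gc less_imp_le r)
    have T: "(deriv ^^ n) (\<lambda>z. \<Sum>m<N. ?t ^ m * b m z) 0 = (\<Sum>m<N. (deriv ^^ n) (b m) 0 * ?t ^ m)" for N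
      unfolding higher_deriv_O_space_sum[OF r O_space_scale[OF b]] higher_deriv_O_space_scale[OF r b] by (simp only: mult.commute)
    show ?thesis
      unfolding sums_def eq
    proof (rule Lim_transform_bound[THEN LIM_zero_cancel])
      show "(\<lambda>N. fact n / r ^ n * nrm (O_space r) (\<lambda>z. (\<Sum>m<N. ?t ^ m * b m z) - g ?t z)) \<longlonglongrightarrow> 0"
        using tendsto_mult_right_zero[OF lim] .
      have "norm ((\<Sum>m<N. (deriv ^^ n) (b m) 0 * ?t ^ m) - (deriv ^^ n) (g ?t) 0)
          \<le> norm (fact n / r ^ n * nrm (O_space r) (\<lambda>z. (\<Sum>m<N. ?t ^ m * b m z) - g ?t z))" for N
        using order_trans[OF higher_deriv_O_space_bound[OF r O_space_diff[OF sc gc], of n N] abs_ge_self]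
        by (simp only: higher_deriv_O_space_diff[OF r sc gc] T real_norm_def)
      then show "\<forall>\<^sub>F N in sequentially. norm ((\<Sum>m<N. (deriv ^^ n) (b m) 0 * ?t ^ m) - (deriv ^^ n) (g ?t) 0)
          \<le> norm (fact n / r ^ n * nrm (O_space r) (\<lambda>z. (\<Sum>m<N. ?t ^ m * b m z) - g ?t z))"
        by (intro always_eventually allI)
    qed
  qed
  moreover have "\<delta> > 0" using pos by (simp add: \<delta>_def)
  ultimately show ?thesis by blast
qed

text \<open>
  Each Taylor coefficient in \<open>z\<close> of the left-hand side is holomorphic on the strip, and it vanishes near
  \<open>t = 0\<close>, where the series converge; so it vanishes everywhere.
\<close>

lemma strip_equation:
  assumes H: "\<And>i. i \<le> degree P \<Longrightarrow> strip_sum r k L R (\<lambda>n z. f i n z / of_real (c n)) (H i)"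
    and LR: "L < R" and r: "0 < r" and f: "\<And>i n. f i n \<in> carr (O_space r)"
    and eq: "\<And>n. apply_P P m2 (\<lambda>i. f i n) = 0" and \<sigma>: "\<sigma> \<in> strip L R"
  shows "apply_P P m2 (\<lambda>i. H i \<sigma>) = 0"
proof (rule fps_ext)
  fix N
  let ?S = "strip L R"
  define Q where "Q \<sigma> = fps_nth (apply_P P m2 (\<lambda>i. H i \<sigma>)) N" for \<sigma>
  have fc: "(\<lambda>z. f i n z / of_real (c n)) \<in> carr (O_space r)" for i n
    using O_space_scale[OF f[of i n], of "inverse (of_real (c n))"] by (simp add: inverse_mult_eq_divide)
  have S: "open ?S" "connected ?S"
    unfolding strip_def by (auto intro!: open_strip_between convex_connected convex_strip_between)
  have "(\<lambda>\<sigma>. (deriv ^^ n) (H i \<sigma>) 0) holomorphic_on ?S" if "i \<le> degree P" for i n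
    by (rule eholomorphic_functional_holomorphic[OF strip_sumD(1)[OF H[OF that]] less_imp_le[OF r] S(1),
          where T = "\<lambda>h. (deriv ^^ n) h 0" and C = "fact n / r ^ n"])
       (use higher_deriv_O_space_diff[OF r] higher_deriv_O_space_scale[OF r] higher_deriv_O_space_bound[OF r] in blast)+
  then have Qhol: "Q holomorphic_on ?S"
    unfolding Q_def apply_P_nth by (intro holomorphic_intros) auto
  have "\<forall>i\<in>{..degree P}. \<exists>\<delta>>0. \<forall>\<sigma>\<in>?S. \<bar>Im \<sigma> - mid L R\<bar> < \<delta> \<and> exp (Re \<sigma>) < \<delta> \<longrightarrow>
     (\<forall>n. (\<lambda>m. (deriv ^^ n) (\<lambda>z. f i m z / of_real (c m)) 0 * exp \<sigma> ^ m) sums (deriv ^^ n) (H i \<sigma>) 0)"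
    using strip_sum_taylor_sums[OF H LR r fc] by blast
  then obtain \<delta> where \<delta>: "\<And>i. i \<le> degree P \<Longrightarrow> \<delta> i > 0"
    and sums: "\<And>i \<sigma> n. i \<le> degree P \<Longrightarrow> \<sigma> \<in> ?S \<Longrightarrow> \<bar>Im \<sigma> - mid L R\<bar> < \<delta> i \<Longrightarrow> exp (Re \<sigma>) < \<delta> i \<Longrightarrow>
     (\<lambda>m. (deriv ^^ n) (\<lambda>z. f i m z / of_real (c m)) 0 * exp \<sigma> ^ m) sums (deriv ^^ n) (H i \<sigma>) 0"
    by (auto simp: bchoice_iff)
  define e where "e = Min (\<delta> ` {..degree P})"
  have e: "e > 0" "\<And>i. i \<le> degree P \<Longrightarrow> e \<le> \<delta> i" using \<delta> by (auto simp: e_def Min_gr_iff)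
  let ?X = "?S \<inter> {\<sigma>. \<bar>Im \<sigma> - mid L R\<bar> < e \<and> exp (Re \<sigma>) < e}"
  have Q0: "Q \<sigma> = 0" if \<sigma>: "\<sigma> \<in> ?X" for \<sigma>
  proof -
    have "(\<lambda>m. (\<Sum>i\<le>degree P. \<Sum>j\<le>degree (coeff P i). coeff (coeff P i) j * zcoef m2 j N / fact (N + j) *
         ((deriv ^^ (N + j)) (\<lambda>z. f i m z / of_real (c m)) 0 * exp \<sigma> ^ m))) sums Q \<sigma>"
      unfolding Q_def apply_P_nth using \<sigma> e(2)
      by (intro sums_sum sums_mult sums) (auto intro: less_le_trans)
    moreover have "(\<Sum>i\<le>degree P. \<Sum>j\<le>degree (coeff P i). coeff (coeff P i) j * zcoef m2 j N / fact (N + j) *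
         ((deriv ^^ (N + j)) (\<lambda>z. f i m z / of_real (c m)) 0 * exp \<sigma> ^ m)) = 0" for m
    proof -
      have "(deriv ^^ n) (\<lambda>z. f i m z / of_real (c m)) 0 = inverse (of_real (c m)) * (deriv ^^ n) (f i m) 0" for i n
        using higher_deriv_O_space_scale[OF r f, of n "inverse (of_real (c m))" i m] by (simp add: inverse_mult_eq_divide)
      then have "(\<Sum>i\<le>degree P. \<Sum>j\<le>degree (coeff P i). coeff (coeff P i) j * zcoef m2 j N / fact (N + j) *
         ((deriv ^^ (N + j)) (\<lambda>z. f i m z / of_real (c m)) 0 * exp \<sigma> ^ m)) = fps_nth (apply_P P m2 (\<lambda>i. f i m)) N * (inverse (of_real (c m)) * exp \<sigma> ^ m)"
        unfolding apply_P_nth sum_distrib_right by (simp add: mult_ac)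
      then show ?thesis using eq[of m] by simp
    qed
    ultimately show ?thesis using sums_unique2[OF _ sums_zero] by simp
  qed
  have "open ?X" by (intro open_Int S(1) open_Collect_conj open_Collect_less continuous_intros)
  moreover
  have "Complex (ln (e / 2)) (mid L R) \<in> ?X" using e(1) LR by (simp add: strip_def mid_def)
  then have "?X \<noteq> {}" by blast
  ultimately have "Q \<sigma> = 0"
    by (rule analytic_continuation_open[OF _ S(1) _ S(2), of ?X Q "\<lambda>_. 0" \<sigma>]) (use Qhol Q0 \<sigma> in auto)
  then show "fps_nth (apply_P P m2 (\<lambda>i. H i \<sigma>)) N = fps_nth 0 N" by (simp add: Q_def)
qed

lemma ksum_equation:
  assumes eq: "\<And>\<sigma>. \<sigma> \<in> strip L R \<Longrightarrow> apply_P P m2 (\<lambda>i. H i \<sigma>) = 0"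
    and \<theta>: "\<theta> \<in> {L<..<R}"
    and I: "\<And>i n. i \<le> degree P \<Longrightarrow> has_ray_integral \<theta>
        (\<lambda>\<sigma>. (deriv ^^ n) (H i \<sigma>) 0 * laplace_kernel k \<tau> \<sigma>) ((deriv ^^ n) (U i) 0)"
  shows "apply_P P m2 U = 0"
proof (rule fps_ext)
  fix N
  have "has_ray_integral \<theta> (\<lambda>\<sigma>. \<Sum>i\<le>degree P. \<Sum>j\<le>degree (coeff P i). coeff (coeff P i) j * zcoef m2 j N / fact (N + j) *
      ((deriv ^^ (N + j)) (H i \<sigma>) 0 * laplace_kernel k \<tau> \<sigma>)) (fps_nth (apply_P P m2 U) N)"
    unfolding apply_P_nth by (intro has_ray_integral_sum has_ray_integral_cmult I) auto
  moreover have "(\<Sum>i\<le>degree P. \<Sum>j\<le>degree (coeff P i). coeff (coeff P i) j * zcoef m2 j N / fact (N + j) *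
      ((deriv ^^ (N + j)) (H i \<sigma>) 0 * laplace_kernel k \<tau> \<sigma>)) = 0" if "Im \<sigma> = \<theta>" for \<sigma>
  proof -
    have "(\<Sum>i\<le>degree P. \<Sum>j\<le>degree (coeff P i). coeff (coeff P i) j * zcoef m2 j N / fact (N + j) *
      ((deriv ^^ (N + j)) (H i \<sigma>) 0 * laplace_kernel k \<tau> \<sigma>)) = fps_nth (apply_P P m2 (\<lambda>i. H i \<sigma>)) N * laplace_kernel k \<tau> \<sigma>"
      unfolding apply_P_nth sum_distrib_right by (simp add: mult.assoc)
    then show ?thesis using eq[of \<sigma>] that \<theta> by (simp add: strip_def)
  qed
  ultimately have "has_ray_integral \<theta> (\<lambda>\<sigma>. 0) (fps_nth (apply_P P m2 U) N)"
    by (subst (asm) has_ray_integral_cong[where G = "\<lambda>\<sigma>. 0"]) auto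
  then show "fps_nth (apply_P P m2 U) N = fps_nth 0 N"
    using has_ray_integral_unique has_ray_integral_0 by (metis fps_zero_nth)
qed

section \<open>Actual solutions\<close>

text \<open>
  The half strips exhaust the strip \<open>\<bar>Im \<tau> - c\<bar> < Y\<close>; the bounds \<open>\<rho> n\<close> on \<open>Re \<tau>\<close> are free, so the
  region can be made as thin as needed towards its boundary directions.
\<close>

definition width :: "real \<Rightarrow> nat \<Rightarrow> real" where
  "width Y n = Y * (1 - 1 / (real n + 2))"

definition region :: "real \<Rightarrow> real \<Rightarrow> (nat \<Rightarrow> real) \<Rightarrow> complex set" where
  "region c Y \<rho> = (\<Union>n. half_strip c (width Y n) (\<rho> n))"

lemma width_bounds: "0 < Y \<Longrightarrow> 0 < width Y n" "0 < Y \<Longrightarrow> width Y n < Y"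
  by (simp_all add: width_def field_simps add_pos_nonneg)

lemma width_exhausts:
  assumes "y < Y" "0 < Y"
  shows "\<exists>n. y < width Y n"
proof -
  have "width Y \<longlonglongrightarrow> Y" unfolding width_def by real_asymp
  from order_tendstoD(1)[OF this assms(1)] show ?thesis by (auto simp: eventually_sequentially)
qed

lemma sectorial_region_region:
  assumes Y: "0 < Y"
  shows "sectorial_region c (2 * Y) (region c Y \<rho>)"
  unfolding sectorial_region_def
proof (intro conjI ballI)
  show "open (region c Y \<rho>)" unfolding region_def by (intro open_UN ballI open_half_strip)
  have conv: "convex (half_strip c y \<rho>)" for y \<rho>
  proof -
    have "half_strip c y \<rho> = {\<tau>. Im \<tau> > c - y} \<inter> {\<tau>. Im \<tau> < c + y} \<inter> {\<tau>. Re \<tau> < \<rho>}"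
      by (auto simp: half_strip_def)
    then show ?thesis by (simp add: convex_Int convex_halfspace_Im_gt convex_halfspace_Im_lt convex_halfspace_Re_lt)
  qed
  show "connected (region c Y \<rho>)"
    unfolding connected_iff_connected_component
  proof (intro ballI)
    fix s t assume "s \<in> region c Y \<rho>" "t \<in> region c Y \<rho>"
    then obtain n m where nm: "s \<in> half_strip c (width Y n) (\<rho> n)" "t \<in> half_strip c (width Y m) (\<rho> m)"
      by (auto simp: region_def)
    let ?A = "half_strip c (width Y n) (\<rho> n)" and ?B = "half_strip c (width Y m) (\<rho> m)"
    \<comment> \<open>Any two of the half strips share a half-line.\<close>
    have "Complex (min (\<rho> n) (\<rho> m) - 1) c \<in> ?A \<inter> ?B"
      using width_bounds(1)[OF Y] by (auto simp: half_strip_def)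
    then have "connected (?A \<union> ?B)" using conv by (intro connected_Un convex_connected) auto
    then show "connected_component (region c Y \<rho>) s t"
      using nm unfolding connected_component_def by (intro exI[of _ "?A \<union> ?B"]) (auto simp: region_def)
  qed
  show "region c Y \<rho> \<subseteq> {\<tau>. \<bar>Im \<tau> - c\<bar> < 2 * Y / 2}"
    using width_bounds(2)[OF Y] by (auto simp: region_def half_strip_def intro: less_trans)
  fix \<beta> assume "\<beta> \<in> {0<..<2 * Y}"
  then obtain n where n: "\<beta> / 2 < width Y n" using width_exhausts[of "\<beta> / 2" Y] by auto
  have "small_sector c \<beta> (exp (\<rho> n)) \<subseteq> half_strip c (width Y n) (\<rho> n)"
    using n by (auto simp: small_sector_def half_strip_def)
  then show "\<exists>\<rho>'>0. small_sector c \<beta> \<rho>' \<subseteq> region c Y \<rho>"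
    by (intro exI[of _ "exp (\<rho> n)"]) (auto simp: region_def)
qed

lemma generalized_moments_pos:
  assumes "generalized_moments s m"
  shows "0 < m n" "m 0 = 1"
proof -
  from assms obtain m' where "0 \<le> s" "preserves_summability m'" "m = (\<lambda>n. m' n * Gamma_seq s n)"
    unfolding generalized_moments_def by blast
  then show "0 < m n" "m 0 = 1"
    using Gamma_seq_pos[of s n] by (auto simp: preserves_summability_def intro!: mult_pos_pos)
qed

lemma strip_sum_has_k_sum:
  assumes H: "strip_sum r k L R (borel_transform (Gamma_seq (1 / k)) u) H" and \<theta>: "\<theta> \<in> {L<..<R}"
    and r: "0 \<le> r" and k: "0 < k" and u: "\<And>n. u n \<in> carr (O_space r)"
    and I: "has_ray_integral \<theta> (\<lambda>\<sigma>. H \<sigma> z * laplace_kernel k \<tau> \<sigma>) I"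
  shows "has_k_sum r k \<theta> u \<tau> z I"
proof -
  from strip_sumD(4)[OF H \<theta>] obtain \<alpha> \<rho> g where g: "sectorial_sum r k \<theta> \<alpha> \<rho> (borel_transform (Gamma_seq (1 / k)) u) g"
    and Hg: "\<And>\<sigma>. \<sigma> \<in> strip L R \<Longrightarrow> \<bar>Im \<sigma> - \<theta>\<bar> < \<alpha> / 2 \<Longrightarrow> H \<sigma> = g (exp \<sigma>)" by blast
  have \<alpha>: "0 < \<alpha>" using g by (simp add: sectorial_sum_def)
  have "borel_transform (Gamma_seq (1 / k)) u n \<in> carr (O_space r)" for n by (rule borel_transform_carr[OF u])
  then have "sector_cont_Ok (O_space r) k \<theta> (borel_transform (Gamma_seq (1 / k)) u) g"
    by (intro sectorial_sum_imp_sector_cont_Ok[OF g r k])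
  moreover have "has_ray_integral \<theta> (\<lambda>\<sigma>. g (exp \<sigma>) z * laplace_kernel k \<tau> \<sigma>) I"
    using I \<theta> \<alpha> by (subst has_ray_integral_cong[where G = "\<lambda>\<sigma>. H \<sigma> z * laplace_kernel k \<tau> \<sigma>"]) (auto simp: Hg strip_def)
  ultimately show ?thesis unfolding has_k_sum_def by blast
qed

lemma eventually_at_botI:
  assumes "\<And>\<rho>. \<rho> \<le> \<rho>0 \<Longrightarrow> P \<rho>"
  shows "eventually P (at_bot :: real filter)"
  unfolding eventually_at_bot_linorder using assms by blast

text \<open>
  The \<open>k\<close>-sums of \<open>u\<close> and of its moment derivatives solve the problem on a common region. It is chosen so
  thin that the error in the initial conditions is at most \<open>\<bar>t\<bar>\<^sup>1\<^sup>/\<^sup>2\<close> on all of it: the constants in the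
  asymptotic expansions blow up towards the boundary directions.
\<close>

lemma actual_solution_between:
  assumes r: "0 < r" and k: "0 < k" and LR: "L < R"
    and m1: "generalized_moments s1 m1" and u: "formal_solution r P m1 m2 \<phi> u"
    and summable: "\<And>\<theta>. \<theta> \<in> {L<..<R} \<Longrightarrow> k_summable (O_space r) k \<theta> u"
  shows "\<exists>G U. sectorial_region ((L + R) / 2) (pi / k + R - L) G \<and>
     holomorphic2_on (\<lambda>(\<tau>, z). U \<tau> z) (G \<times> ball 0 r) \<and>
     actual_solution r k {L<..<R} P m1 m2 \<phi> G U \<and>
     (\<forall>\<theta>\<in>{L<..<R}. \<forall>\<beta>\<in>{0<..<pi / k}. \<exists>\<rho>>0. \<forall>\<tau>\<in>small_sector \<theta> \<beta> \<rho>.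
        \<tau> \<in> G \<and> (\<forall>z\<in>cball 0 r. has_k_sum r k \<theta> u \<tau> z (U \<tau> z)))"
proof -
  let ?p = "degree P"
  let ?Gs = "Gamma_seq (1 / k)"
  let ?c = "mid L R" and ?Y = "half_width k L R"
  have Y: "0 < ?Y" using half_width_pos[OF k LR] by blast
  have uc: "u n \<in> carr (O_space r)" for n using u by (simp add: formal_solution_def)
  define f where "f i = (moment_deriv_t m1 ^^ i) u" for i
  have fc: "f i n \<in> carr (O_space r)" for i n unfolding f_def by (rule moment_deriv_t_carr[OF uc])
  have fS: "moment_deriv_t m1 (f i) = f (Suc i)" for i by (simp add: f_def)
  have f_summable: "k_summable (O_space r) k \<theta> (f i)" if "\<theta> \<in> {L<..<R}" for \<theta> i
  proof (induction i)
    case 0 show ?case using summable[OF that] by (simp add: f_def)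
  next
    case (Suc i) from k_summable_moment_deriv[OF m1 Suc r k] show ?case by (simp only: fS)
  qed
  have "\<exists>H. strip_sum r k L R (borel_transform ?Gs (f i)) H" for i
    using f_summable k_summable_iff_sectorial_sum[where u = "f i", OF less_imp_le[OF r] k fc]
    by (intro strip_sum_exists[OF less_imp_le[OF r] k _ LR]) blast
  then obtain H where H: "\<And>i. strip_sum r k L R (borel_transform ?Gs (f i)) (H i)" by metis
  define U where "U i = ksum k L R (H i)" for i
  have eq: "apply_P P m2 (\<lambda>i. H i \<sigma>) = 0" if "\<sigma> \<in> strip L R" for \<sigma>
  proof (rule strip_equation[OF _ LR r fc _ that, where c = ?Gs])
    show "strip_sum r k L R (\<lambda>n z. f i n z / of_real (?Gs n)) (H i)" for i
      using H[of i] unfolding borel_transform_def .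
    show "apply_P P m2 (\<lambda>i. f i n) = 0" for n using u unfolding formal_solution_def f_def by blast
  qed
  define Q1 where "Q1 n i \<rho> \<longleftrightarrow> eholomorphic (O_space r) (half_strip ?c (width ?Y n) \<rho>) (U i) \<and>
     (\<forall>\<tau>\<in>half_strip ?c (width ?Y n) \<rho>. \<forall>N. has_ray_integral (dir k L R (Im \<tau>))
        (\<lambda>\<sigma>. (deriv ^^ N) (H i \<sigma>) 0 * laplace_kernel k \<tau> \<sigma>) ((deriv ^^ N) (U i \<tau>) 0))" for n i \<rho>
  define Q2 where "Q2 n l \<rho> \<longleftrightarrow> (\<forall>\<tau>\<in>half_strip ?c (width ?Y n) \<rho>. \<forall>z\<in>cball 0 r.
     cmod ((cover_deriv ^^ l) (\<lambda>\<tau>. U 0 \<tau> z) \<tau> - fact l * u l z) \<le> exp (Re \<tau> / 2))" for n l \<rho>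
  have ev1: "eventually (Q1 n i) at_bot" for n i
  proof -
    obtain \<rho>0 where \<rho>0: "Q1 n i \<rho>0"
      using ksum_eholomorphic[OF k LR H r width_bounds(1)[OF Y] width_bounds(2)[OF Y]] unfolding Q1_def U_def by blast
    show ?thesis
    proof (rule eventually_at_botI)
      fix \<rho> assume "\<rho> \<le> \<rho>0"
      then have "half_strip ?c (width ?Y n) \<rho> \<subseteq> half_strip ?c (width ?Y n) \<rho>0" by (intro half_strip_mono) auto
      with \<rho>0 show "Q1 n i \<rho>" unfolding Q1_def by (meson eholomorphic_subset subsetD)
    qed
  qed
  have ev2: "eventually (Q2 n l) at_bot" for n l
  proof -
    obtain \<rho>0 C where C: "C \<ge> 0" and b: "\<And>\<tau> z. \<tau> \<in> half_strip ?c (width ?Y n) \<rho>0 \<Longrightarrow> z \<in> cball 0 r \<Longrightarrow>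
      cmod ((cover_deriv ^^ l) (\<lambda>\<tau>. U 0 \<tau> z) \<tau> - fact l * (borel_transform ?Gs (f 0) l z * of_real (Gamma (1 + real l / k)))) \<le> C * exp (Re \<tau>)"
      using ksum_derivatives[OF k LR H r width_bounds(1)[OF Y] width_bounds(2)[OF Y]] unfolding U_def by blast
    have ul: "borel_transform ?Gs (f 0) l z * of_real (Gamma (1 + real l / k)) = u l z" for z
      using Gamma_seq_pos[of "1/k" l] k by (simp add: borel_transform_def f_def Gamma_seq_def)
    show ?thesis
    proof (rule eventually_at_botI)
      \<comment> \<open>For such \<open>Re \<tau>\<close> half of the exponent absorbs the constant: \<open>C * exp (Re \<tau> / 2) \<le> 1\<close>.\<close>
      fix \<rho> assume \<rho>: "\<rho> \<le> min \<rho>0 (- 2 * ln (C + 1))"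
      show "Q2 n l \<rho>"
        unfolding Q2_def
      proof (intro ballI)
        fix \<tau> z assume \<tau>: "\<tau> \<in> half_strip ?c (width ?Y n) \<rho>" and z: "z \<in> cball (0::complex) r"
        have "\<tau> \<in> half_strip ?c (width ?Y n) \<rho>0" using \<tau> \<rho> by (auto simp: half_strip_def)
        from b[OF this z] have le: "cmod ((cover_deriv ^^ l) (\<lambda>\<tau>. U 0 \<tau> z) \<tau> - fact l * u l z) \<le> C * exp (Re \<tau>)"
          by (simp only: ul)
        have "Re \<tau> / 2 \<le> - ln (C + 1)" using \<tau> \<rho> by (simp add: half_strip_def)
        then have "exp (Re \<tau> / 2) \<le> exp (- ln (C + 1))" by simp
        also have "\<dots> = 1 / (C + 1)" using C by (simp add: exp_minus divide_inverse)
        finally have "C * exp (Re \<tau> / 2) \<le> C * (1 / (C + 1))" using C by (rule mult_left_mono)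
        also have "\<dots> \<le> 1" using C by simp
        finally have "C * exp (Re \<tau> / 2) * exp (Re \<tau> / 2) \<le> 1 * exp (Re \<tau> / 2)" by (intro mult_right_mono) auto
        moreover have "C * exp (Re \<tau>) = C * exp (Re \<tau> / 2) * exp (Re \<tau> / 2)" by (simp add: mult.assoc flip: exp_add)
        ultimately show "cmod ((cover_deriv ^^ l) (\<lambda>\<tau>. U 0 \<tau> z) \<tau> - fact l * u l z) \<le> exp (Re \<tau> / 2)"
          using le by linarith
      qed
    qed
  qed
  have "eventually (\<lambda>\<rho>. (\<forall>i\<in>{..?p}. Q1 n i \<rho>) \<and> (\<forall>l\<in>{..<?p}. Q2 n l \<rho>)) at_bot" for n
    using ev1 ev2 by (intro eventually_conj eventually_ball_finite) auto
  then have "\<exists>\<rho>. (\<forall>i\<in>{..?p}. Q1 n i \<rho>) \<and> (\<forall>l\<in>{..<?p}. Q2 n l \<rho>)" for n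
    using eventually_happens'[OF trivial_limit_at_bot_linorder] by blast
  then obtain \<rho> where Q1: "\<And>n i. i \<le> ?p \<Longrightarrow> Q1 n i (\<rho> n)" and Q2: "\<And>n l. l < ?p \<Longrightarrow> Q2 n l (\<rho> n)"
    by (metis atMost_iff lessThan_iff)
  define G where "G = region ?c ?Y \<rho>"
  have in_G: "\<exists>n. \<tau> \<in> half_strip ?c (width ?Y n) (\<rho> n)" if "\<tau> \<in> G" for \<tau> using that by (auto simp: G_def region_def)
  have region: "sectorial_region ?c (2 * ?Y) G" unfolding G_def by (rule sectorial_region_region[OF Y])
  have U_hol: "eholomorphic (O_space r) G (U i)" if "i \<le> ?p" for i
    unfolding eholomorphic_def
  proof
    fix \<tau> assume "\<tau> \<in> G"
    with in_G obtain n where "\<tau> \<in> half_strip ?c (width ?Y n) (\<rho> n)" by blast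
    with Q1[OF that, of n] show "U i \<tau> \<in> carr (O_space r) \<and> (\<exists>D\<in>carr (O_space r).
       ((\<lambda>h. nrm (O_space r) (\<lambda>ia. (U i (\<tau> + h) ia - U i \<tau> ia) / h - D ia)) \<longlongrightarrow> 0) (at 0))"
      unfolding Q1_def eholomorphic_def by blast
  qed
  have k_sum: "\<exists>\<rho>>0. \<forall>\<tau>\<in>small_sector \<theta> \<beta> \<rho>. \<tau> \<in> G \<and> (\<forall>z\<in>cball 0 r. has_k_sum r k \<theta> (f i) \<tau> z (U i \<tau> z))"
    if \<theta>: "\<theta> \<in> {L<..<R}" and \<beta>: "\<beta> \<in> {0<..<pi / k}" for \<theta> \<beta> i
  proof -
    obtain \<rho>1 where \<rho>1: "\<And>\<tau> z. \<bar>Im \<tau> - \<theta>\<bar> < \<beta> / 2 \<Longrightarrow> Re \<tau> < \<rho>1 \<Longrightarrow> z \<in> cball 0 r \<Longrightarrow>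
        has_ray_integral \<theta> (\<lambda>\<sigma>. H i \<sigma> z * laplace_kernel k \<tau> \<sigma>) (U i \<tau> z)"
      using ksum_direction[OF k LR H[of i] r \<theta>, of \<beta>] \<beta> unfolding U_def greaterThanLessThan_iff by blast
    \<comment> \<open>The opening of a sector bisected by \<open>?c\<close> that contains the sector of opening \<open>\<beta>\<close> around \<open>\<theta>\<close>.\<close>
    define \<beta>' where "\<beta>' = 2 * (\<bar>\<theta> - ?c\<bar> + \<beta> / 2)"
    have "\<bar>\<theta> - ?c\<bar> < (R - L) / 2" using \<theta> by (auto simp: mid_def abs_less_iff field_simps)
    moreover have "\<beta> / 2 < pi / (2 * k)" using \<beta> by (simp flip: divide_divide_eq_left)
    ultimately have "\<bar>\<theta> - ?c\<bar> + \<beta> / 2 < ?Y" unfolding half_width_def by (rule add_strict_mono)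
    moreover have "0 < \<bar>\<theta> - ?c\<bar> + \<beta> / 2" using \<beta> by (intro add_nonneg_pos) auto
    ultimately have "\<beta>' \<in> {0<..<2 * ?Y}" unfolding \<beta>'_def greaterThanLessThan_iff by (intro conjI; simp)
    with region obtain \<rho>2 where \<rho>2: "\<rho>2 > 0" "small_sector ?c \<beta>' \<rho>2 \<subseteq> G" unfolding sectorial_region_def by blast
    show ?thesis
    proof (intro exI[of _ "min (exp \<rho>1) \<rho>2"] conjI ballI)
      fix \<tau> assume \<tau>: "\<tau> \<in> small_sector \<theta> \<beta> (min (exp \<rho>1) \<rho>2)"
      then have \<tau>': "\<bar>Im \<tau> - \<theta>\<bar> < \<beta> / 2" "Re \<tau> < \<rho>1" "exp (Re \<tau>) < \<rho>2" by (auto simp: small_sector_def)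
      have "\<bar>Im \<tau> - ?c\<bar> \<le> \<bar>Im \<tau> - \<theta>\<bar> + \<bar>\<theta> - ?c\<bar>" by arith
      then have "\<tau> \<in> small_sector ?c \<beta>' \<rho>2" using \<tau>' by (simp add: small_sector_def \<beta>'_def)
      then show "\<tau> \<in> G" using \<rho>2 by blast
      fix z :: complex assume "z \<in> cball 0 r"
      from strip_sum_has_k_sum[where u = "f i", OF H \<theta> less_imp_le[OF r] k fc \<rho>1[OF \<tau>'(1,2) this]]
      show "has_k_sum r k \<theta> (f i) \<tau> z (U i \<tau> z)" .
    qed (use \<rho>2 in auto)
  qed
  have is_k_sum: "is_k_sum_on r k {L<..<R} G (f i) (U i)" if "i \<le> ?p" for i
    unfolding is_k_sum_on_def using fc U_hol[OF that] k_sum by blast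
  have "actual_solution r k {L<..<R} P m1 m2 \<phi> G (U 0)"
    unfolding actual_solution_def
  proof (intro conjI exI[of _ U] allI impI ballI U_hol refl)
    show "k_sum_moment_deriv r k {L<..<R} G m1 (U i) (U (Suc i))" if "i < ?p" for i
      unfolding k_sum_moment_deriv_def using is_k_sum[of i] is_k_sum[of "Suc i"] that fS[of i]
      by (intro exI[of _ "f i"]) simp
    show "apply_P P m2 (\<lambda>i. U i \<tau>) = 0" if \<tau>: "\<tau> \<in> G" for \<tau>
    proof -
      obtain n where n: "\<tau> \<in> half_strip ?c (width ?Y n) (\<rho> n)" using in_G[OF \<tau>] by blast
      have "\<bar>Im \<tau> - ?c\<bar> < ?Y" using n width_bounds(2)[OF Y, of n] by (simp add: half_strip_def)
      from dir_bounds(1)[OF k LR this] have dir_in: "dir k L R (Im \<tau>) \<in> {L<..<R}"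
        using Y by (auto simp: mid_def abs_less_iff field_simps)
      show ?thesis
        by (rule ksum_equation[where H = H and k = k and \<tau> = \<tau>, OF eq dir_in]) (use Q1 n in \<open>auto simp: Q1_def\<close>)
    qed
    fix l assume l: "l < ?p"
    show "uniform_limit (ball 0 r) (\<lambda>\<tau> z. (cover_deriv ^^ l) (\<lambda>\<tau>'. U 0 \<tau>' z) \<tau>)
          (\<lambda>z. of_real (fact l / m1 l) * \<phi> l z) (inf (filtercomap Re at_bot) (principal G))"
      unfolding uniform_limit_iff
    proof (intro allI impI)
      fix e :: real assume e: "e > 0"
      have "dist ((cover_deriv ^^ l) (\<lambda>\<tau>'. U 0 \<tau>' z) \<tau>) (of_real (fact l / m1 l) * \<phi> l z) < e"
        if \<tau>: "Re \<tau> < 2 * ln e" "\<tau> \<in> G" and z: "z \<in> ball 0 r" for \<tau> z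
      proof -
        obtain n where n: "\<tau> \<in> half_strip ?c (width ?Y n) (\<rho> n)" using in_G[OF \<tau>(2)] by blast
        have m1': "m1 0 = 1" "\<And>n. m1 n \<noteq> 0" using generalized_moments_pos[OF m1] by (auto simp: less_le)
        have "\<phi> l z = of_real (m1 l) * u l z"
          using u l z moment_deriv_t_at_0[where m = m1 and l = l and u = u and z = z, OF m1'] by (simp add: formal_solution_def)
        then have "of_real (fact l / m1 l) * \<phi> l z = fact l * u l z" using m1'(2)[of l] by simp
        moreover have "cmod ((cover_deriv ^^ l) (\<lambda>\<tau>. U 0 \<tau> z) \<tau> - fact l * u l z) \<le> exp (Re \<tau> / 2)"
          using Q2[OF l, of n] n z unfolding Q2_def by simp
        moreover have "exp (Re \<tau> / 2) < exp (ln e)" using \<tau>(1) by (subst exp_less_cancel_iff) simp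
        ultimately show ?thesis using e by (simp add: dist_norm)
      qed
      then show "\<forall>\<^sub>F \<tau> in inf (filtercomap Re at_bot) (principal G). \<forall>z\<in>ball 0 r.
          dist ((cover_deriv ^^ l) (\<lambda>\<tau>'. U 0 \<tau>' z) \<tau>) (of_real (fact l / m1 l) * \<phi> l z) < e"
        unfolding eventually_inf_principal eventually_filtercomap
        by (intro exI[of _ "\<lambda>x. x < 2 * ln e"] conjI allI impI ballI eventually_gt_at_bot) auto
    qed
  qed simp
  moreover have "holomorphic2_on (\<lambda>(\<tau>, z). U 0 \<tau> z) (G \<times> ball 0 r)"
    using region r by (intro eholomorphic_imp_holomorphic2[OF U_hol[of 0]]) (auto simp: sectorial_region_def)
  moreover have "f 0 = u" by (simp add: f_def)
  moreover have "2 * ?Y = pi / k + R - L" using k by (simp add: half_width_def field_simps)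
  ultimately show ?thesis
    using region k_sum[where i = 0] unfolding mid_def by (intro exI[of _ G] exI[of _ "U 0"]) simp
qed

section \<open>Contours around a segment\<close>

text \<open>A thin ellipse with the segment on its major axis.\<close>

lemma exists_surrounding_contour:
  assumes U: "open U" and sub: "closed_segment 0 (of_real A * s) \<subseteq> U"
  shows "\<exists>\<gamma>. surrounding_contour U A s \<gamma>"
proof -
  define q where "q = of_real A * s"
  define e where "e = (if q = 0 then 1 else q / of_real (cmod q))"
  define l where "l = cmod q / 2"
  have e: "cmod e = 1" "q = of_real (2 * l) * e" by (auto simp: e_def l_def norm_divide)
  then have e0: "e \<noteq> 0" by auto
  have l: "0 \<le> l" by (simp add: l_def)
  define c where "c = of_real l * e"
  have seg: "w \<in> closed_segment 0 q \<longleftrightarrow> (\<exists>v. \<bar>v\<bar> \<le> l \<and> w = c + of_real v * e)" for w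
  proof
    assume "w \<in> closed_segment 0 q"
    then obtain x where x: "0 \<le> x" "x \<le> 1" "w = of_real x * q" by (auto simp: closed_segment_def scaleR_conv_of_real)
    have "\<bar>x * (2 * l) - l\<bar> \<le> l"
      using mult_right_mono[OF x(2), of "2 * l"] mult_nonneg_nonneg[OF x(1), of "2 * l"] l by (simp add: abs_le_iff)
    moreover have "w = c + of_real (x * (2 * l) - l) * e" using x(3) e(2) by (simp add: c_def algebra_simps)
    ultimately show "\<exists>v. \<bar>v\<bar> \<le> l \<and> w = c + of_real v * e" by blast
  next
    assume "\<exists>v. \<bar>v\<bar> \<le> l \<and> w = c + of_real v * e"
    then obtain v where v: "\<bar>v\<bar> \<le> l" "w = c + of_real v * e" by blast
    show "w \<in> closed_segment 0 q"
    proof (cases "l = 0")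
      case True then show ?thesis using v e by (simp add: c_def)
    next
      case False
      then have "w = of_real ((v + l) / (2 * l)) * q" using v(2) e(2) by (simp add: c_def algebra_simps add_divide_distrib)
      moreover have "0 \<le> (v + l) / (2 * l)" "(v + l) / (2 * l) \<le> 1" using v(1) l False by (auto simp: field_simps)
      ultimately show ?thesis
        unfolding closed_segment_def by (intro CollectI exI[of _ "(v + l) / (2 * l)"]) (simp add: scaleR_conv_of_real)
    qed
  qed
  obtain \<epsilon>' where \<epsilon>': "\<epsilon>' > 0" "(\<Union>x\<in>closed_segment 0 q. ball x \<epsilon>') \<subseteq> U"
    using compact_subset_open_imp_ball_epsilon_subset[OF compact_segment U sub[folded q_def]] by blast
  define \<epsilon> where "\<epsilon> = \<epsilon>' / 2"
  have \<epsilon>: "\<epsilon> > 0" using \<epsilon>' by (simp add: \<epsilon>_def)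
  \<comment> \<open>In \<open>exp w\<close> this is a Joukowski map; it takes the unit circle to the ellipse with half axes \<open>l + \<epsilon>\<close> and \<open>\<epsilon>\<close>.\<close>
  define f where "f w = c + e * (of_real (l / 2 + \<epsilon>) * exp w + of_real (l / 2) * exp (- w))" for w
  define \<gamma> where "\<gamma> = f \<circ> linepath 0 (2 * of_real pi * \<i>)"
  have g: "\<gamma> t = c + e * Complex ((l + \<epsilon>) * cos (2 * pi * t)) (\<epsilon> * sin (2 * pi * t))" for t
  proof -
    have "exp (linepath 0 (2 * of_real pi * \<i>) t) = cis (2 * pi * t)"
      by (simp add: linepath_def scaleR_conv_of_real cis_conv_exp mult_ac)
    moreover have "exp (- linepath 0 (2 * of_real pi * \<i>) t) = cis (- (2 * pi * t))"
      by (simp add: linepath_def scaleR_conv_of_real cis_conv_exp mult_ac)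
    moreover have "of_real (l / 2 + \<epsilon>) * cis y + of_real (l / 2) * cis (- y) = Complex ((l + \<epsilon>) * cos y) (\<epsilon> * sin y)" for y
      by (simp add: complex_eq_iff algebra_simps)
    ultimately show ?thesis by (simp add: \<gamma>_def f_def)
  qed
  have valid: "valid_path \<gamma>"
    unfolding \<gamma>_def f_def
    by (rule valid_path_compose_holomorphic[of _ _ UNIV]) (auto intro!: holomorphic_intros)
  have loop: "pathfinish \<gamma> = pathstart \<gamma>" by (simp add: pathfinish_def pathstart_def g)
  have "loop_free \<gamma>"
    unfolding loop_free_def
  proof (intro ballI impI)
    fix x y :: real assume xy: "x \<in> {0..1}" "y \<in> {0..1}" and eq: "\<gamma> x = \<gamma> y"
    from eq have "Complex ((l + \<epsilon>) * cos (2 * pi * x)) (\<epsilon> * sin (2 * pi * x)) = Complex ((l + \<epsilon>) * cos (2 * pi * y)) (\<epsilon> * sin (2 * pi * y))"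
      using e0 by (simp add: g)
    then have "sin (2 * pi * x) = sin (2 * pi * y) \<and> cos (2 * pi * x) = cos (2 * pi * y)" using \<epsilon> l by auto
    then obtain n :: int where "2 * pi * x = 2 * pi * y + 2 * pi * of_int n" by (auto simp: sin_cos_eq_iff)
    then have "2 * pi * x = 2 * pi * (y + of_int n)" by (simp add: distrib_left)
    then have n: "x = y + of_int n" by simp
    with xy have "-1 \<le> (of_int n :: real)" "(of_int n :: real) \<le> 1" by auto
    then have "n = -1 \<or> n = 0 \<or> n = 1" by linarith
    then show "x = y \<or> x = 0 \<and> y = 1 \<or> x = 1 \<and> y = 0" using n xy by auto
  qed
  then have simple: "simple_path \<gamma>" using valid_path_imp_path[OF valid] by (simp add: simple_path_def)
  have on_axis: "\<epsilon> * sin y = 0 \<Longrightarrow> cos y = 1 \<or> cos y = - 1" for y :: real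
    using \<epsilon> sin_cos_squared_add[of y] by (simp add: power2_eq_1_iff)
  have image: "path_image \<gamma> \<subseteq> U - closed_segment 0 q"
  proof
    fix w assume "w \<in> path_image \<gamma>"
    then obtain y where y: "w = c + e * Complex ((l + \<epsilon>) * cos y) (\<epsilon> * sin y)" by (auto simp: path_image_def g)
    have "w \<notin> closed_segment 0 q"
    proof
      assume w: "w \<in> closed_segment 0 q"
      obtain v where v: "\<bar>v\<bar> \<le> l" "w = c + of_real v * e" using iffD1[OF seg w] by (elim exE conjE)
      then have "Complex ((l + \<epsilon>) * cos y) (\<epsilon> * sin y) = of_real v" using y e0 by (simp add: mult.commute)
      then have "\<epsilon> * sin y = 0" "(l + \<epsilon>) * cos y = v" by (simp_all add: complex_eq_iff)
      with on_axis[of y] v(1) \<epsilon> l show False by auto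
    qed
    moreover have "w \<in> U"
    proof -
      have "c + of_real (l * cos y) * e \<in> closed_segment 0 q"
        using seg l by (auto simp: abs_mult intro!: exI[of _ "l * cos y"] mult_left_le)
      moreover have "w - (c + of_real (l * cos y) * e) = of_real \<epsilon> * (e * cis y)"
        unfolding y by (simp add: complex_eq_iff algebra_simps)
      then have "cmod (w - (c + of_real (l * cos y) * e)) = \<epsilon>" using e(1) \<epsilon> by (simp add: norm_mult)
      ultimately have "w \<in> (\<Union>x\<in>closed_segment 0 q. ball x \<epsilon>')"
        using \<epsilon> by (intro UN_I[of "c + of_real (l * cos y) * e"]) (auto simp: dist_norm norm_minus_commute \<epsilon>_def)
      then show ?thesis using \<epsilon>' by blast
    qed
    ultimately show "w \<in> U - closed_segment 0 q" by blast
  qed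
  have wind: "winding_number \<gamma> w = 1" if w: "w \<in> closed_segment 0 q" for w
  proof -
    obtain v where v: "\<bar>v\<bar> \<le> l" "w = c + of_real v * e" using iffD1[OF seg w] by (elim exE conjE)
    \<comment> \<open>A circle around \<open>w\<close> into which the ellipse deforms along straight segments avoiding \<open>w\<close>.\<close>
    define h where "h t = w + e * cis (2 * pi * t)" for t
    have hd: "(h has_vector_derivative e * cis (2 * pi * t) * (2 * of_real pi * \<i>)) (at t)" for t
    proof -
      have "((\<lambda>z. w + e * exp (\<i> * (2 * of_real pi * z))) has_field_derivative
          e * exp (\<i> * (2 * of_real pi * of_real t)) * (2 * of_real pi * \<i>)) (at (of_real t))"
        by (auto intro!: derivative_eq_intros simp: mult_ac)
      from has_vector_derivative_real_field[OF this] show ?thesis by (simp add: h_def[abs_def] cis_conv_exp)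
    qed
    have hv: "valid_path h"
      unfolding valid_path_def
      by (intro C1_differentiable_imp_piecewise, unfold C1_differentiable_on_def)
         (use hd in \<open>auto intro!: exI[of _ "\<lambda>t. e * cis (2 * pi * t) * (2 * of_real pi * \<i>)"] continuous_intros simp: cis_conv_exp\<close>)
    have hl: "pathfinish h = pathstart h" by (simp add: pathfinish_def pathstart_def h_def)
    have wh: "w \<notin> path_image h" using e0 by (auto simp: path_image_def h_def)
    have "1 / (h t - w) * vector_derivative h (at t) = 2 * of_real pi * \<i>" for t
      using e0 by (simp add: vector_derivative_at[OF hd]) (simp add: h_def)
    then have "contour_integral h (\<lambda>z. 1 / (z - w)) = 2 * of_real pi * \<i>"
      unfolding contour_integral_integral by simp
    then have h1: "winding_number h w = 1" using winding_number_valid_path[OF hv wh] by simp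
    have "homotopic_loops (- {w}) \<gamma> h"
    proof (rule homotopic_loops_linear[OF valid_path_imp_path[OF valid] valid_path_imp_path[OF hv] loop hl])
      fix t :: real
      let ?y = "2 * pi * t"
      show "closed_segment (\<gamma> t) (h t) \<subseteq> - {w}"
      proof
        fix x assume "x \<in> closed_segment (\<gamma> t) (h t)"
        then obtain u where u: "0 \<le> u" "u \<le> 1" "x = (1 - u) *\<^sub>R \<gamma> t + u *\<^sub>R h t" by (auto simp: closed_segment_def)
        have "x - w = (1 - u) *\<^sub>R (\<gamma> t - w) + u *\<^sub>R (h t - w)" unfolding u(3) by (simp add: algebra_simps)
        also have "\<gamma> t - w = e * Complex ((l + \<epsilon>) * cos ?y - v) (\<epsilon> * sin ?y)"
          by (simp add: g v(2) complex_eq_iff algebra_simps)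
        also have "h t - w = e * Complex (cos ?y) (sin ?y)" by (simp add: h_def cis.code)
        finally have xw: "x - w = e * Complex ((1 - u) * ((l + \<epsilon>) * cos ?y - v) + u * cos ?y) (((1 - u) * \<epsilon> + u) * sin ?y)"
          by (simp add: complex_eq_iff algebra_simps scaleR_conv_of_real)
        show "x \<in> - {w}"
        proof (rule ccontr)
          assume "\<not> x \<in> - {w}"
          then have "Complex ((1 - u) * ((l + \<epsilon>) * cos ?y - v) + u * cos ?y) (((1 - u) * \<epsilon> + u) * sin ?y) = 0" using xw e0 by simp
          then have z: "(1 - u) * ((l + \<epsilon>) * cos ?y - v) + u * cos ?y = 0" "((1 - u) * \<epsilon> + u) * sin ?y = 0"
            by (simp_all add: complex_eq_iff)
          have "0 < (1 - u) * \<epsilon> + u" using u(1,2) \<epsilon> by (cases "u = 0") (auto intro: add_nonneg_pos)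
          with z(2) have "\<epsilon> * sin ?y = 0" by simp
          then consider "cos ?y = 1" | "cos ?y = -1" using on_axis by blast
          then show False
          proof cases
            case 1
            have "0 < (1 - u) * (l + \<epsilon> - v) + u" using u(1,2) \<epsilon> v(1)
              by (cases "u = 0") (auto intro: add_nonneg_pos)
            then show False using z(1) unfolding 1 by simp
          next
            case 2
            have "0 < (1 - u) * (l + \<epsilon> + v) + u" using u(1,2) \<epsilon> v(1)
              by (cases "u = 0") (auto intro: add_nonneg_pos)
            moreover have "(1 - u) * ((l + \<epsilon>) * -1 - v) + u * -1 = - ((1 - u) * (l + \<epsilon> + v) + u)" by (simp add: algebra_simps)
            ultimately show False using z(1) unfolding 2 by simp
          qed
        qed
      qed
    qed
    then show ?thesis using winding_number_homotopic_loops h1 by metis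
  qed
  show ?thesis
    unfolding surrounding_contour_def q_def[symmetric] using valid simple loop image wind by blast
qed

section \<open>The contour integral multiplies the coefficients\<close>

text \<open>
  For \<open>0 \<le> x \<le> 1\<close> the contour around \<open>[0, A * s]\<close> also surrounds \<open>[0, A * x * s]\<close>. So with the contour fixed the
  integral is a holomorphic function of \<open>x\<close> near \<open>[0, 1]\<close>. For small \<open>x\<close> the kernel may be expanded, and
  residues at \<open>0\<close> give the series with coefficients \<open>m n * \<beta> n\<close>; the identity theorem carries the equality
  to \<open>x = 1\<close>.
\<close>

lemma contour_integral_multiplier:
  fixes m :: "nat \<Rightarrow> real"
  assumes U: "open U" "radial U" and V: "V holomorphic_on U" "V has_fps_expansion Abs_fps \<beta>"
    and A: "0 < A" and e: "e holomorphic_on kernel_dom A" "\<And>z. z \<in> ball 0 (1 / A) \<Longrightarrow> (\<lambda>n. of_real (m n) * z ^ n) sums e z"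
    and mA: "\<And>n. \<bar>m n\<bar> \<le> A ^ n"
    and U': "open U'" "radial U'" and W: "W holomorphic_on U'" "W has_fps_expansion Abs_fps (\<lambda>n. of_real (m n) * \<beta> n)"
    and s: "s \<in> U'" "of_real A * s \<in> U" and \<gamma>: "surrounding_contour U A s \<gamma>"
  shows "1 / (2 * of_real pi * \<i>) * contour_integral \<gamma> (\<lambda>\<zeta>. V \<zeta> / \<zeta> * e (s / \<zeta>)) = W s"
proof -
  let ?K = "closed_segment 0 (of_real A * s)"
  have 0: "0 \<in> U" "0 \<in> U'"
    using U(2) U'(2) s unfolding radial_def by (metis atLeastAtMost_iff mult_zero_left of_real_0 order_refl zero_le_one)+
  have g: "valid_path \<gamma>" "pathfinish \<gamma> = pathstart \<gamma>" "path_image \<gamma> \<subseteq> U" "path_image \<gamma> \<inter> ?K = {}"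
    and w0: "winding_number \<gamma> 0 = 1"
    using \<gamma> unfolding surrounding_contour_def by auto
  obtain \<eta>1 where \<eta>1: "\<eta>1 > 0" "\<And>x y. x \<in> path_image \<gamma> \<Longrightarrow> y \<in> ?K \<Longrightarrow> \<eta>1 \<le> dist x y"
    using separate_compact_closed[OF compact_path_image[OF valid_path_imp_path[OF g(1)]] closed_segment g(4)] by blast
  define \<eta>' where "\<eta>' = \<eta>1 / 2"
  have \<eta>': "\<eta>' > 0" using \<eta>1 by (simp add: \<eta>'_def)
  have K0: "0 \<in> ?K" "?K \<noteq> {}" by auto
  define S where "S = U \<inter> {\<zeta>. \<eta>' < infdist \<zeta> ?K}"
  have S: "open S" unfolding S_def by (intro open_Int U open_Collect_less continuous_intros)
  have gS: "path_image \<gamma> \<subseteq> S"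
  proof
    fix \<zeta> assume \<zeta>: "\<zeta> \<in> path_image \<gamma>"
    have "\<eta>1 \<le> infdist \<zeta> ?K" unfolding infdist_notempty[OF K0(2)] by (intro cINF_greatest K0 \<eta>1(2)[OF \<zeta>])
    then show "\<zeta> \<in> S" using \<zeta> g(3) \<eta>1(1) by (auto simp: S_def \<eta>'_def)
  qed
  have S0: "\<zeta> \<noteq> 0" if "\<zeta> \<in> S" for \<zeta> using that K0(1) \<eta>' by (auto simp: S_def)
  have segU': "closed_segment 0 s \<subseteq> U'"
    using U'(2) s(1) by (auto simp: radial_def closed_segment_def scaleR_conv_of_real)
  obtain \<epsilon>1 where \<epsilon>1: "\<epsilon>1 > 0" "(\<Union>x\<in>closed_segment 0 s. ball x \<epsilon>1) \<subseteq> U'"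
    using compact_subset_open_imp_ball_epsilon_subset[OF compact_segment U'(1) segU'] by blast
  define \<eta> where "\<eta> = min (\<eta>' / (A * cmod s + 1)) (\<epsilon>1 / (cmod s + 1))"
  have \<eta>: "\<eta> > 0" "\<eta> * (A * cmod s) < \<eta>'" "\<eta> * cmod s < \<epsilon>1"
  proof -
    have p: "0 < A * cmod s + 1" "0 < cmod s + 1" using A by (simp_all add: add_nonneg_pos)
    show \<eta>: "\<eta> > 0" using p \<eta>' \<epsilon>1 by (simp add: \<eta>_def)
    have "\<eta> * (A * cmod s + 1) \<le> \<eta>'" "\<eta> * (cmod s + 1) \<le> \<epsilon>1"
      using p by (simp_all add: \<eta>_def pos_le_divide_eq[symmetric])
    then show "\<eta> * (A * cmod s) < \<eta>'" "\<eta> * cmod s < \<epsilon>1" using \<eta> by (simp_all add: distrib_left)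
  qed
  \<comment> \<open>The parameter \<open>x\<close> ranges over a convex neighbourhood of \<open>[0, 1]\<close>.\<close>
  define X where "X = (\<Union>y\<in>closed_segment 0 1. \<Union>h\<in>ball (0::complex) \<eta>. {y + h})"
  have X: "open X" "convex X"
    unfolding X_def by (intro open_sums convex_sums disjI2 open_ball convex_closed_segment convex_ball)+
  have XE: "\<exists>y h. y \<in> {0..1} \<and> cmod h < \<eta> \<and> x = of_real y + h" if "x \<in> X" for x
    using that by (fastforce simp: X_def closed_segment_def scaleR_conv_of_real)
  have XI: "of_real y + h \<in> X" if "y \<in> {0..1}" "cmod h < \<eta>" for y h
    using that by (auto simp: X_def closed_segment_def scaleR_conv_of_real)
  have X01: "0 \<in> X" "1 \<in> X" using XI[of 0 0] XI[of 1 0] \<eta>(1) by auto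
  have XU': "x * s \<in> U'" if x: "x \<in> X" for x
  proof -
    from XE[OF x] obtain y h where y: "y \<in> {0..1}" "cmod h < \<eta>" "x = of_real y + h" by blast
    have "cmod (h * s) \<le> \<eta> * cmod s" unfolding norm_mult using y(2) by (intro mult_right_mono) auto
    then have "x * s \<in> ball (of_real y * s) \<epsilon>1" using \<eta>(3) y(3) by (simp add: dist_norm algebra_simps)
    moreover have "of_real y * s \<in> closed_segment 0 s" using y(1) by (auto simp: closed_segment_def scaleR_conv_of_real)
    ultimately show ?thesis using \<epsilon>1(2) by blast
  qed
  have dom: "x * s / \<zeta> \<in> kernel_dom A" if x: "x \<in> X" and \<zeta>: "\<zeta> \<in> S" for x \<zeta>
  proof (rule ccontr)
    assume "x * s / \<zeta> \<notin> kernel_dom A"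
    then obtain \<rho> where \<rho>: "x * s / \<zeta> = of_real \<rho>" "1 / A \<le> \<rho>"
      by (auto simp: kernel_dom_def elim!: nonneg_Reals_cases)
    have \<rho>0: "0 < \<rho>" using \<rho>(2) A by (meson less_le_trans zero_less_divide_1_iff)
    define c where "c = 1 / (A * \<rho>)"
    have c: "0 \<le> c" "c \<le> 1" using \<rho>(2) A \<rho>0 by (auto simp: c_def field_simps)
    have "of_real \<rho> * \<zeta> = x * s" using \<rho>(1) S0[OF \<zeta>] by (simp add: field_simps)
    then have z: "\<zeta> = of_real c * (x * (of_real A * s))"
      using \<rho>0 A by (simp add: c_def field_simps)
    from XE[OF x] obtain y h where y: "y \<in> {0..1}" "cmod h < \<eta>" "x = of_real y + h" by blast
    have "of_real (c * y) * (of_real A * s) \<in> ?K"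
      using y(1) c by (auto simp: closed_segment_def scaleR_conv_of_real intro!: exI[of _ "c * y"] mult_le_one)
    then have "infdist \<zeta> ?K \<le> dist \<zeta> (of_real (c * y) * (of_real A * s))" by (rule infdist_le)
    also have "\<dots> = cmod (of_real c * (h * (of_real A * s)))" unfolding z y(3) by (simp add: dist_norm algebra_simps)
    also have "\<dots> = c * (cmod h * (A * cmod s))" using c A by (simp add: norm_mult)
    also have "\<dots> \<le> 1 * (\<eta> * (A * cmod s))" using c y(2) A \<eta>(1) by (intro mult_mono) auto
    finally have "infdist \<zeta> ?K < \<eta>'" using \<eta>(2) by simp
    with \<zeta> show False by (simp add: S_def)
  qed
  have K_open: "open (kernel_dom A)" unfolding kernel_dom_def by (intro open_Un open_ball open_Compl closed_nonneg_Reals_complex)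
  define F where "F x \<zeta> = V \<zeta> / \<zeta> * e (x * s / \<zeta>)" for x \<zeta>
  have VS: "V holomorphic_on S" using V(1) by (rule holomorphic_on_subset) (auto simp: S_def)
  have Fhol: "F x holomorphic_on S" if x: "x \<in> X" for x
    unfolding F_def
    by (intro holomorphic_intros VS holomorphic_on_compose_gen[OF _ e(1), unfolded comp_def])
       (use dom[OF x] S0 in auto)
  \<comment> \<open>A piecewise \<open>C\<^sup>1\<close> path may have unbounded speed near its corners; a polynomial path has not.\<close>
  obtain \<delta> where \<delta>: "\<delta> > 0" "\<And>g h. valid_path g \<Longrightarrow> valid_path h \<Longrightarrow>
      (\<And>t. t \<in> {0..1} \<Longrightarrow> norm (g t - \<gamma> t) < \<delta> \<and> norm (h t - \<gamma> t) < \<delta>) \<Longrightarrow>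
      pathfinish g = pathstart g \<Longrightarrow> pathfinish h = pathstart h \<Longrightarrow>
      path_image g \<subseteq> S \<and> path_image h \<subseteq> S \<and> (\<forall>f. f holomorphic_on S \<longrightarrow> contour_integral h f = contour_integral g f)"
    using contour_integral_nearby_loops[OF S valid_path_imp_path[OF g(1)] gS] by metis
  obtain p where p: "polynomial_function p" "pathstart p = pathstart \<gamma>" "pathfinish p = pathfinish \<gamma>"
      "\<And>t. t \<in> {0..1} \<Longrightarrow> norm (p t - \<gamma> t) < \<delta>"
    using path_approx_polynomial_function[OF valid_path_imp_path[OF g(1)] \<delta>(1)] by blast
  have pv: "valid_path p" by (rule valid_path_polynomial_function[OF p(1)])
  have pS: "path_image p \<subseteq> S" and p_eq: "\<And>f. f holomorphic_on S \<Longrightarrow> contour_integral p f = contour_integral \<gamma> f"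
    using \<delta>(2)[OF g(1) pv] p g(2) \<delta>(1) by auto
  obtain p' where p': "polynomial_function p'" "\<And>t. (p has_vector_derivative p' t) (at t)"
    using has_vector_derivative_polynomial_function[OF p(1)] by blast
  have pc: "continuous_on T p" "continuous_on T p'" for T
    using continuous_on_polymonial_function[OF p(1)] continuous_on_polymonial_function[OF p'(1)] by auto
  have pt: "p t \<in> S" if "t \<in> {0..1}" for t using pS that by (auto simp: path_image_def)
  define \<Psi> where "\<Psi> x = contour_integral p (F x)" for x
  have \<Psi>_int: "\<Psi> x = integral (cbox 0 1) (\<lambda>t. F x (p t) * p' t)" for x
    unfolding \<Psi>_def contour_integral_integral cbox_interval by (simp add: vector_derivative_at[OF p'(2)])
  define Fx where "Fx x t = V (p t) / p t * (deriv e (x * s / p t) * (s / p t)) * p' t" for x t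
  have "(\<lambda>x. integral (cbox 0 1) (\<lambda>t. F x (p t) * p' t)) holomorphic_on X"
  proof (rule leibniz_rule_holomorphic[OF _ _ _ X(2)])
    fix x and t :: real assume x: "x \<in> X" and t: "t \<in> cbox 0 1"
    then have t': "p t \<in> S" using pt by simp
    have "(e has_field_derivative deriv e (x * s / p t)) (at (x * s / p t))"
      by (rule holomorphic_derivI[OF e(1) K_open dom[OF x t']])
    then have "((\<lambda>x. e (x * s / p t)) has_field_derivative deriv e (x * s / p t) * (s / p t)) (at x within X)"
      by (rule DERIV_chain2) (use S0[OF t'] in \<open>auto intro!: derivative_eq_intros\<close>)
    then show "((\<lambda>x. F x (p t) * p' t) has_field_derivative Fx x t) (at x within X)"
      using S0[OF t'] unfolding F_def Fx_def by (auto intro!: derivative_eq_intros)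
  next
    fix x assume x: "x \<in> X"
    have "continuous_on {0..1} (\<lambda>t. F x (p t) * p' t)"
      by (intro continuous_intros pc continuous_on_compose2[OF holomorphic_on_imp_continuous_on[OF Fhol[OF x]]]) (use pt in auto)
    then show "(\<lambda>t. F x (p t) * p' t) integrable_on cbox 0 1" unfolding cbox_interval by (rule integrable_continuous_interval)
  next
    have "continuous_on (X \<times> cbox 0 1) (\<lambda>z. V (p (snd z)) / p (snd z) * (deriv e (fst z * s / p (snd z)) * (s / p (snd z))) * p' (snd z))"
      using pt S0 dom
      by (intro continuous_intros continuous_on_compose2[OF pc(1)] continuous_on_compose2[OF pc(2)]
          continuous_on_compose2[OF holomorphic_on_imp_continuous_on[OF VS]]
          continuous_on_compose2[OF holomorphic_on_imp_continuous_on[OF holomorphic_deriv[OF e(1) K_open]]]) (auto simp: cbox_interval)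
    then show "continuous_on (X \<times> cbox 0 1) (\<lambda>(x, t). Fx x t)" by (simp add: Fx_def case_prod_beta)
  qed
  then have \<Psi>_hol: "\<Psi> holomorphic_on X" unfolding \<Psi>_int .
  have residue: "contour_integral p (\<lambda>\<zeta>. V \<zeta> / \<zeta> ^ Suc n) = 2 * of_real pi * \<i> * \<beta> n" for n
  proof -
    have "contour_integral p (\<lambda>\<zeta>. V \<zeta> / \<zeta> ^ Suc n) = contour_integral \<gamma> (\<lambda>\<zeta>. V \<zeta> / \<zeta> ^ Suc n)"
      by (intro p_eq holomorphic_intros VS) (use S0 in auto)
    also have "\<dots> = 2 * pi * \<i> * (\<Sum>q\<in>{0}. winding_number \<gamma> q * residue (\<lambda>\<zeta>. V \<zeta> / \<zeta> ^ Suc n) q)"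
    proof (rule Residue_theorem[OF U(1) radial_connected[OF U(2)]])
      show "(\<lambda>\<zeta>. V \<zeta> / \<zeta> ^ Suc n) holomorphic_on U - {0}"
        by (intro holomorphic_intros holomorphic_on_subset[OF V(1)]) auto
      show "\<forall>z. z \<notin> U \<longrightarrow> winding_number \<gamma> z = 0"
      proof (intro allI impI)
        fix z assume "z \<notin> U"
        have "starlike U" unfolding starlike_def
          using 0(1) U(2) by (intro bexI[of _ 0]) (auto simp: radial_def closed_segment_def scaleR_conv_of_real)
        then show "winding_number \<gamma> z = 0"
          using \<open>z \<notin> U\<close> g by (intro simply_connected_imp_winding_number_zero[OF starlike_imp_simply_connected valid_path_imp_path])
      qed
    qed (use g gS S0 in auto)
    also have "\<dots> = 2 * of_real pi * \<i> * \<beta> n"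
      using w0 residue_fps_expansion_over_power_at_0[OF V(2), of n] by simp
    finally show ?thesis .
  qed
  obtain \<mu> where \<mu>: "\<mu> > 0" "\<And>\<zeta>. \<zeta> \<in> path_image p \<Longrightarrow> \<mu> \<le> cmod \<zeta>"
  proof -
    have "{0} \<inter> path_image p = {}" using pS S0 by auto
    then obtain \<mu> where "\<mu> > 0" "\<forall>x\<in>{0}. \<forall>\<zeta>\<in>path_image p. \<mu> \<le> dist x \<zeta>"
      using separate_compact_closed[of "{0}" "path_image p"] closed_path_image[OF valid_path_imp_path[OF pv]] by auto
    then show thesis using that by simp
  qed
  have "bounded (p' ` {0..1})" by (intro compact_imp_bounded compact_continuous_image pc compact_Icc)
  then obtain B where B: "\<And>t. t \<in> {0..1} \<Longrightarrow> norm (p' t) \<le> B" unfolding bounded_iff by blast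
  have VSc: "continuous_on (path_image p) V" by (rule continuous_on_subset[OF holomorphic_on_imp_continuous_on[OF VS] pS])
  have "bounded (V ` path_image p)"
    by (intro compact_imp_bounded compact_continuous_image VSc compact_path_image valid_path_imp_path pv)
  then obtain C where C: "\<And>\<zeta>. \<zeta> \<in> path_image p \<Longrightarrow> cmod (V \<zeta>) \<le> C" unfolding bounded_iff by blast
  define \<epsilon> where "\<epsilon> = min \<eta> (\<mu> / (2 * A * (cmod s + 1)))"
  have \<epsilon>: "\<epsilon> > 0" "\<epsilon> \<le> \<eta>" "\<epsilon> * (2 * A * (cmod s + 1)) \<le> \<mu>"
  proof -
    have "0 < 2 * A * (cmod s + 1)" using A by (simp add: add_nonneg_pos)
    then show "\<epsilon> > 0" "\<epsilon> \<le> \<eta>" "\<epsilon> * (2 * A * (cmod s + 1)) \<le> \<mu>"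
      using \<eta>(1) \<mu>(1) by (simp_all add: \<epsilon>_def pos_le_divide_eq[symmetric])
  qed
  have series: "(\<lambda>n. of_real (m n) * \<beta> n * (x * s) ^ n) sums (\<Psi> x / (2 * of_real pi * \<i>))" if x: "cmod x < \<epsilon>" for x
  proof -
    have xX: "x \<in> X" using XI[of 0 x] x \<epsilon>(2) by simp
    have small: "A * cmod (x * s / \<zeta>) \<le> 1 / 2" if \<zeta>: "\<zeta> \<in> path_image p" for \<zeta>
    proof -
      have "2 * A * cmod (x * s) \<le> \<epsilon> * (2 * A * (cmod s + 1))"
        unfolding norm_mult using x A \<epsilon>(1) mult_mono[of "cmod x" \<epsilon> "2 * A * cmod s" "2 * A * (cmod s + 1)"] by (simp add: mult_ac)
      also have "\<dots> \<le> cmod \<zeta>" using \<epsilon>(3) \<mu>(2)[OF \<zeta>] by linarith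
      finally show ?thesis using S0 pS \<zeta> by (auto simp: norm_divide field_simps)
    qed
    define f where "f N \<zeta> = (\<Sum>n<N. of_real (m n) * (x * s) ^ n * (V \<zeta> / \<zeta> ^ Suc n))" for N \<zeta>
    have term_eq: "of_real (m n) * (x * s) ^ n * (V \<zeta> / \<zeta> ^ Suc n) = V \<zeta> / \<zeta> * (of_real (m n) * (x * s / \<zeta>) ^ n)" for n \<zeta>
      by (simp add: power_divide)
    have vn_int: "(\<lambda>\<zeta>. V \<zeta> / \<zeta> ^ Suc n) contour_integrable_on p" for n
      by (rule contour_integrable_holomorphic_simple[OF _ S pv pS]) (use S0 in \<open>auto intro!: holomorphic_intros VS\<close>)
    have "(\<lambda>N. contour_integral p (f N)) \<longlonglongrightarrow> contour_integral p (F x)"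
    proof (rule contour_integral_uniform_limit(2)[OF _ _ _ pv])
      show "\<forall>\<^sub>F N in sequentially. f N contour_integrable_on p"
        unfolding f_def by (intro always_eventually allI contour_integrable_sum contour_integrable_lmul vn_int) auto
      show "norm (vector_derivative p (at t)) \<le> B" if "t \<in> {0..1}" for t
        using B[OF that] by (simp add: vector_derivative_at[OF p'(2)])
      have "uniform_limit (path_image p) (\<lambda>N \<zeta>. \<Sum>n<N. of_real (m n) * (x * s) ^ n * (V \<zeta> / \<zeta> ^ Suc n))
          (\<lambda>\<zeta>. suminf (\<lambda>n. of_real (m n) * (x * s) ^ n * (V \<zeta> / \<zeta> ^ Suc n))) sequentially"
      proof (rule Weierstrass_m_test)
        show "summable (\<lambda>n. C / \<mu> * (1 / 2) ^ n)" by (intro summable_mult summable_geometric) auto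
        fix n \<zeta> assume \<zeta>: "\<zeta> \<in> path_image p"
        have "cmod (of_real (m n) * (x * s / \<zeta>) ^ n) \<le> A ^ n * cmod (x * s / \<zeta>) ^ n"
          unfolding norm_mult norm_power using mA[of n] by (intro mult_right_mono) auto
        also have "\<dots> = (A * cmod (x * s / \<zeta>)) ^ n" by (simp add: power_mult_distrib)
        also have "\<dots> \<le> (1 / 2) ^ n" using small[OF \<zeta>] A by (intro power_mono) auto
        finally have 1: "cmod (of_real (m n) * (x * s / \<zeta>) ^ n) \<le> (1 / 2) ^ n" .
        have "cmod (V \<zeta> / \<zeta>) \<le> C / \<mu>" unfolding norm_divide
          using C[OF \<zeta>] \<mu>(1) \<mu>(2)[OF \<zeta>] by (intro frac_le) (auto intro: order_trans[OF norm_ge_zero])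
        with 1 show "cmod (of_real (m n) * (x * s) ^ n * (V \<zeta> / \<zeta> ^ Suc n)) \<le> C / \<mu> * (1 / 2) ^ n"
          unfolding term_eq norm_mult[of "V \<zeta> / \<zeta>"] by (intro mult_mono) (auto intro: order_trans[OF norm_ge_zero])
      qed
      moreover have "suminf (\<lambda>n. of_real (m n) * (x * s) ^ n * (V \<zeta> / \<zeta> ^ Suc n)) = F x \<zeta>" if \<zeta>: "\<zeta> \<in> path_image p" for \<zeta>
      proof -
        have "cmod (x * s / \<zeta>) < 1 / A" using small[OF \<zeta>] A by (simp add: field_simps)
        then have "(\<lambda>n. V \<zeta> / \<zeta> * (of_real (m n) * (x * s / \<zeta>) ^ n)) sums (V \<zeta> / \<zeta> * e (x * s / \<zeta>))"
          by (intro sums_mult e(2)) simp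
        then show ?thesis unfolding term_eq F_def by (simp add: sums_iff)
      qed
      ultimately show "uniform_limit (path_image p) f (F x) sequentially"
        unfolding f_def[abs_def] by (subst (asm) uniform_limit_cong'[where g = "\<lambda>N \<zeta>. \<Sum>n<N. of_real (m n) * (x * s) ^ n * (V \<zeta> / \<zeta> ^ Suc n)"]) auto
    qed simp
    moreover have "contour_integral p (f N) = (\<Sum>n<N. of_real (m n) * \<beta> n * (x * s) ^ n) * (2 * of_real pi * \<i>)" for N
    proof -
      have "contour_integral p (f N) = (\<Sum>n<N. contour_integral p (\<lambda>\<zeta>. of_real (m n) * (x * s) ^ n * (V \<zeta> / \<zeta> ^ Suc n)))"
        unfolding f_def by (intro contour_integral_sum contour_integrable_lmul vn_int) auto
      also have "\<dots> = (\<Sum>n<N. of_real (m n) * \<beta> n * (x * s) ^ n) * (2 * of_real pi * \<i>)"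
        unfolding sum_distrib_right
        by (intro sum.cong refl) (simp only: contour_integral_lmul[OF vn_int] residue, simp only: mult_ac)
      finally show ?thesis .
    qed
    ultimately have "(\<lambda>N. (\<Sum>n<N. of_real (m n) * \<beta> n * (x * s) ^ n) * (2 * of_real pi * \<i>)) \<longlonglongrightarrow> \<Psi> x"
      by (simp add: \<Psi>_def)
    from tendsto_divide[OF this tendsto_const[of "2 * of_real pi * \<i>"]] show ?thesis unfolding sums_def by simp
  qed
  have "\<forall>\<^sub>F u in nhds 0. (\<lambda>n. of_real (m n) * \<beta> n * u ^ n) sums W u"
  proof -
    from U'(1) 0(2) obtain R where R: "R > 0" "ball 0 R \<subseteq> U'" by (meson open_contains_ball)
    have "W holomorphic_on eball 0 (ereal R)" using W(1) by (rule holomorphic_on_subset) (use R in auto)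
    from has_fps_expansion_imp_sums_complex[OF W(2) this]
    have "(\<lambda>n. of_real (m n) * \<beta> n * u ^ n) sums W u" if "u \<in> ball 0 R" for u using that by simp
    moreover have "\<forall>\<^sub>F u in nhds 0. u \<in> ball 0 R" using R by (intro eventually_nhds_in_open) auto
    ultimately show ?thesis by (auto elim: eventually_mono)
  qed
  moreover have "filterlim (\<lambda>x. x * s) (nhds 0) (nhds (0::complex))"
    by (rule tendsto_eq_intros filterlim_ident | simp)+
  ultimately have "\<forall>\<^sub>F x in nhds 0. (\<lambda>n. of_real (m n) * \<beta> n * (x * s) ^ n) sums W (x * s)"
    by (rule eventually_compose_filterlim)
  moreover have "\<forall>\<^sub>F x in nhds 0. x \<in> ball 0 \<epsilon> \<inter> X"
    using \<epsilon>(1) X(1) X01 by (intro eventually_nhds_in_open) auto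
  ultimately have "\<forall>\<^sub>F x in nhds 0. x \<in> X \<and> \<Psi> x / (2 * of_real pi * \<i>) = W (x * s)"
    by eventually_elim (use series sums_unique2 in auto)
  then obtain T where T: "open T" "0 \<in> T" "T \<subseteq> X" "\<And>x. x \<in> T \<Longrightarrow> \<Psi> x / (2 * of_real pi * \<i>) = W (x * s)"
    unfolding eventually_nhds by blast
  have "\<Psi> 1 / (2 * of_real pi * \<i>) = W (1 * s)"
  proof (rule analytic_continuation_open[OF T(1) X(1) _ convex_connected[OF X(2)] T(3) _ _ T(4) X01(2)])
    show "(\<lambda>x. \<Psi> x / (2 * of_real pi * \<i>)) holomorphic_on X" by (intro holomorphic_intros \<Psi>_hol) auto
    show "(\<lambda>x. W (x * s)) holomorphic_on X"
      by (rule holomorphic_on_compose_gen[OF _ W(1), unfolded comp_def]) (use XU' in \<open>auto intro!: holomorphic_intros\<close>)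
  qed (use T in auto)
  moreover have "\<Psi> 1 = contour_integral \<gamma> (\<lambda>\<zeta>. V \<zeta> / \<zeta> * e (s / \<zeta>))"
    unfolding \<Psi>_def p_eq[OF Fhol[OF X01(2)]] by (simp add: F_def[abs_def])
  ultimately show ?thesis by simp
qed

section \<open>Functions on a slit domain\<close>

lemma open_strip: "open (strip a b)"
  unfolding strip_def by (rule open_strip_between)

lemma strip_beside:
  assumes "\<bar>Im \<sigma> - d\<bar> < a" "Im \<sigma> \<noteq> d"
  shows "\<sigma> \<in> strip d (d + a) \<union> strip (d - a) d"
proof -
  have "d - a < Im \<sigma>" "Im \<sigma> < d + a" using assms(1) unfolding abs_less_iff by linarith+
  with assms(2) show ?thesis by (auto simp: strip_def)
qed

text \<open>
  The radius \<open>\<rho>\<close> of convergence at a single \<open>z\<close> may exceed the one built into \<open>strip_sum\<close>; the identity theorem on a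
  half strip bridges the gap.
\<close>

lemma strip_sum_power_series:
  assumes H: "strip_sum r k L R b H" and LR: "L < R" and r: "0 \<le> r" and z: "z \<in> cball 0 r"
    and conv: "0 < \<rho>" "\<And>t. t \<in> ball 0 \<rho> \<Longrightarrow> summable (\<lambda>n. b n z * t ^ n)"
    and \<sigma>: "\<sigma> \<in> strip L R" "exp (Re \<sigma>) < \<rho>"
  shows "(\<lambda>n. b n z * exp \<sigma> ^ n) sums H \<sigma> z"
proof -
  define F where "F t = suminf (\<lambda>n. b n z * t ^ n)" for t
  have F: "(\<lambda>n. b n z * t ^ n) sums F t" if "t \<in> ball 0 \<rho>" for t
    using conv(2)[OF that] by (simp add: F_def summable_sums)
  have Fhol: "F holomorphic_on ball 0 \<rho>" using F by (intro power_series_holomorphic[where a = "\<lambda>n. b n z"]) simp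
  let ?D = "strip L R \<inter> {\<sigma>. Re \<sigma> < ln \<rho>}"
  have D: "open ?D" "convex ?D"
    by (intro open_Int open_strip open_halfspace_Re_lt)
      (intro convex_Int convex_halfspace_Re_lt, simp add: strip_def convex_strip_between)
  obtain \<rho>0 where \<rho>0: "\<rho>0 > 0" "\<And>\<sigma>. \<sigma> \<in> strip L R \<Longrightarrow> exp (Re \<sigma>) < \<rho>0 \<Longrightarrow> (\<lambda>n. b n z * exp \<sigma> ^ n) sums H \<sigma> z"
    using strip_sumD(3)[OF H] z by blast
  have in_D: "exp s \<in> ball 0 \<rho>" if "s \<in> ?D" for s
  proof -
    have "exp (Re s) < exp (ln \<rho>)" using that by (subst exp_less_cancel_iff) simp
    then show ?thesis using conv(1) by simp
  qed
  have "F (exp \<sigma>) = H \<sigma> z"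
  proof (rule analytic_continuation_open[of "?D \<inter> {s. Re s < ln \<rho>0}" ?D "\<lambda>s. F (exp s)" "\<lambda>s. H s z"])
    show "open (?D \<inter> {s. Re s < ln \<rho>0})" by (intro open_Int[OF D(1)] open_halfspace_Re_lt)
    have "Complex (min (ln \<rho>) (ln \<rho>0) - 1) ((L + R) / 2) \<in> ?D \<inter> {s. Re s < ln \<rho>0}" using LR by (simp add: strip_def min_def)
    then show "?D \<inter> {s. Re s < ln \<rho>0} \<noteq> {}" by blast
    show "(\<lambda>s. F (exp s)) holomorphic_on ?D"
      by (rule holomorphic_on_compose_gen[OF holomorphic_on_exp Fhol, unfolded comp_def]) (use in_D in auto)
    show "(\<lambda>s. H s z) holomorphic_on ?D"
      by (rule holomorphic_on_subset[OF eholomorphic_pointwise[OF strip_sumD(1)[OF H] r]])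
         (auto intro: open_strip)
    show "\<sigma> \<in> ?D" using \<sigma> conv(1) by (metis IntI mem_Collect_eq exp_gt_zero ln_exp ln_less_cancel_iff)
    fix s assume s: "s \<in> ?D \<inter> {s. Re s < ln \<rho>0}"
    then have "exp (Re s) < exp (ln \<rho>0)" by (subst exp_less_cancel_iff) simp
    then have "(\<lambda>n. b n z * exp s ^ n) sums H s z" using \<rho>0 s by (intro \<rho>0(2)) auto
    with F[OF in_D, of s] s show "F (exp s) = H s z" using sums_unique2 by blast
  qed (rule D(1) convex_connected[OF D(2)] Int_lower1)+
  moreover have "exp \<sigma> \<in> ball 0 \<rho>" using \<sigma>(2) by simp
  ultimately show ?thesis using F by metis
qed

lemma of_real_mult_cis: "0 < x \<Longrightarrow> of_real x * cis \<phi> = exp (Complex (ln x) \<phi>)"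
  by (simp add: exp_eq_polar exp_of_real[symmetric])

text \<open>
  The logarithm with imaginary part between \<open>d - pi\<close> and \<open>d + pi\<close>.
\<close>

definition log_branch :: "real \<Rightarrow> complex \<Rightarrow> complex" where
  "log_branch d t = Ln (t * exp (- (\<i> * of_real d))) + \<i> * of_real d"

lemma log_branch_exp: "\<bar>Im \<sigma> - d\<bar> < pi \<Longrightarrow> log_branch d (exp \<sigma>) = \<sigma>"
  unfolding log_branch_def mult_exp_exp by (subst Ln_exp) auto

lemma log_branch_holomorphic: "log_branch d holomorphic_on exp ` {\<sigma>. \<bar>Im \<sigma> - d\<bar> < pi}"
proof -
  have "exp \<sigma> * exp (- (\<i> * of_real d)) \<notin> \<real>\<^sub>\<le>\<^sub>0" if "\<bar>Im \<sigma> - d\<bar> < pi" for \<sigma>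
  proof
    assume "exp \<sigma> * exp (- (\<i> * of_real d)) \<in> \<real>\<^sub>\<le>\<^sub>0"
    then have "exp (\<sigma> - \<i> * of_real d) \<in> \<real>\<^sub>\<le>\<^sub>0" by (simp add: mult_exp_exp)
    then have *: "Re (exp (\<sigma> - \<i> * of_real d)) \<le> 0" "Im (exp (\<sigma> - \<i> * of_real d)) = 0" by (simp_all add: complex_nonpos_Reals_iff)
    from *(2) have "sin (Im \<sigma> - d) = 0" by (simp add: Im_exp)
    moreover have "- pi < Im \<sigma> - d" "Im \<sigma> - d < pi" using that unfolding abs_less_iff by linarith+
    ultimately have "Im \<sigma> - d = 0" using sin_eq_0_pi by blast
    with *(1) show False by (simp add: Re_exp)
  qed
  then show ?thesis unfolding log_branch_def[abs_def] by (intro holomorphic_intros) auto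
qed

lemma slit_domain_eq:
  assumes "0 < \<alpha>" "\<alpha> \<le> 2 * pi"
  shows "slit_domain d \<alpha> R = ball 0 R \<union> (exp ` strip d (d + \<alpha> / 2) \<union> exp ` strip (d - \<alpha> / 2) d)"
proof -
  have ray: "(exp \<sigma> \<in> {of_real x * cis d | x. 0 < x}) \<longleftrightarrow> Im \<sigma> = d" if \<sigma>: "\<bar>Im \<sigma> - d\<bar> < \<alpha> / 2" for \<sigma>
  proof
    assume "exp \<sigma> \<in> {of_real x * cis d | x. 0 < x}"
    then obtain x where x: "0 < x" "exp \<sigma> = of_real x * cis d" by blast
    then have e: "exp \<sigma> = exp (Complex (ln x) d)" by (simp add: of_real_mult_cis)
    have "\<sigma> = log_branch d (exp \<sigma>)" using \<sigma> assms(2) by (intro log_branch_exp[symmetric]) linarith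
    also have "\<dots> = Complex (ln x) d" unfolding e by (rule log_branch_exp) simp
    finally have "\<sigma> = Complex (ln x) d" .
    then show "Im \<sigma> = d" by simp
  qed (auto simp: exp_eq_polar)
  have "sector d \<alpha> - {of_real x * cis d | x. 0 < x} = exp ` strip d (d + \<alpha> / 2) \<union> exp ` strip (d - \<alpha> / 2) d"
  proof (intro equalityI subsetI)
    fix t assume t: "t \<in> sector d \<alpha> - {of_real x * cis d | x. 0 < x}"
    then obtain \<sigma> where \<sigma>: "t = exp \<sigma>" "\<bar>Im \<sigma> - d\<bar> < \<alpha> / 2" by (auto simp: sector_eq_exp)
    then have "Im \<sigma> \<noteq> d" using t ray by blast
    then have "\<sigma> \<in> strip d (d + \<alpha> / 2) \<union> strip (d - \<alpha> / 2) d" using \<sigma>(2) by (intro strip_beside)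
    then show "t \<in> exp ` strip d (d + \<alpha> / 2) \<union> exp ` strip (d - \<alpha> / 2) d" using \<sigma>(1) by blast
  next
    fix t assume "t \<in> exp ` strip d (d + \<alpha> / 2) \<union> exp ` strip (d - \<alpha> / 2) d"
    then obtain \<sigma> where \<sigma>: "t = exp \<sigma>" "\<bar>Im \<sigma> - d\<bar> < \<alpha> / 2" "Im \<sigma> \<noteq> d" by (auto simp: strip_def)
    then have "t \<in> sector d \<alpha>" unfolding sector_eq_exp by (intro image_eqI) auto
    moreover have "t \<notin> {of_real x * cis d | x. 0 < x}" using ray[OF \<sigma>(2)] \<sigma>(1,3) by metis
    ultimately show "t \<in> sector d \<alpha> - {of_real x * cis d | x. 0 < x}" by blast
  qed
  then show ?thesis by (simp add: slit_domain_def)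
qed

lemma open_slit_domain: "0 < \<alpha> \<Longrightarrow> \<alpha> \<le> 2 * pi \<Longrightarrow> open (slit_domain d \<alpha> R)"
  unfolding slit_domain_eq by (intro open_Un open_ball open_exp_image open_strip)

lemma exp_in_slit_domain: "0 < \<alpha> \<Longrightarrow> \<alpha> \<le> 2 * pi \<Longrightarrow> \<bar>Im \<sigma> - d\<bar> < \<alpha> / 2 \<Longrightarrow> Im \<sigma> \<noteq> d \<Longrightarrow> exp \<sigma> \<in> slit_domain d \<alpha> R"
  using strip_beside[of \<sigma> d "\<alpha> / 2"] slit_domain_eq[of \<alpha> d R] by blast

lemma slit_domain_scale:
  assumes "s \<in> slit_domain d \<alpha> R" "0 < c" "c * R \<le> R'"
  shows "of_real c * s \<in> slit_domain d \<alpha> R'"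
proof (cases "s \<in> ball 0 R")
  case True
  then have "c * cmod s < c * R" using assms(2) by simp
  then have "c * cmod s < R'" using assms(3) by (rule less_le_trans)
  then show ?thesis using assms(2) by (simp add: slit_domain_def norm_mult)
next
  case False
  with assms(1) obtain x \<phi> where s: "s = of_real x * cis \<phi>" "0 < x" "\<bar>\<phi> - d\<bar> < \<alpha> / 2" "s \<notin> {of_real x * cis d | x. 0 < x}"
    by (auto simp: slit_domain_def sector_def)
  have "of_real c * s \<in> sector d \<alpha>" unfolding sector_def using s assms(2)
    by (intro CollectI exI[of _ "c * x"] exI[of _ \<phi>]) simp
  moreover have "of_real c * s \<notin> {of_real x * cis d | x. 0 < x}"
  proof
    assume "of_real c * s \<in> {of_real x * cis d | x. 0 < x}"
    then obtain y where "0 < y" "of_real c * s = of_real y * cis d" by blast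
    then have "0 < y / c" "s = of_real (y / c) * cis d" using assms(2) by (simp_all add: field_simps)
    with s(4) show False by blast
  qed
  ultimately show ?thesis by (simp add: slit_domain_def)
qed

lemma radial_slit_domain: "0 < R \<Longrightarrow> radial (slit_domain d \<alpha> R)"
  unfolding radial_def
proof (intro ballI)
  fix t c assume R: "0 < R" and t: "t \<in> slit_domain d \<alpha> R" and c: "c \<in> {0..1::real}"
  show "of_real c * t \<in> slit_domain d \<alpha> R"
  proof (cases "c = 0")
    case True then show ?thesis using R by (simp add: slit_domain_def)
  next
    case False
    then show ?thesis using c R by (intro slit_domain_scale[OF t]) (auto simp: mult_left_le_one_le)
  qed
qed

lemma slit_Ok_cong:
  assumes f: "slit_Ok k d \<alpha> R f" and \<alpha>: "0 < \<alpha>" "\<alpha> \<le> 2 * pi" and eq: "\<And>s. s \<in> slit_domain d \<alpha> R \<Longrightarrow> g s = f s"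
  shows "slit_Ok k d \<alpha> R g"
proof -
  have ge: "g (of_real x * cis \<phi>) = f (of_real x * cis \<phi>)"
    if "{a..b} \<subseteq> {d - \<alpha> / 2<..<d + \<alpha> / 2} - {d}" "\<phi> \<in> {a..b}" "0 < x" for a b \<phi> x
  proof -
    have \<phi>: "d - \<alpha> / 2 < \<phi>" "\<phi> < d + \<alpha> / 2" "\<phi> \<noteq> d" using subsetD[OF that(1,2)] by auto
    then have "\<bar>\<phi> - d\<bar> < \<alpha> / 2" unfolding abs_less_iff by linarith
    with \<phi>(3) have "exp (Complex (ln x) \<phi>) \<in> slit_domain d \<alpha> R" by (intro exp_in_slit_domain[OF \<alpha>]) simp_all
    from eq[OF this] show ?thesis unfolding of_real_mult_cis[OF that(3)] .
  qed
  have "g holomorphic_on slit_domain d \<alpha> R"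
  proof (rule holomorphic_transform[of f])
    show "f holomorphic_on slit_domain d \<alpha> R" using f unfolding slit_Ok_def by blast
  qed (rule eq[symmetric])
  moreover have "\<exists>A>0. \<exists>B>0. \<forall>\<phi>\<in>{a..b}. \<forall>x>0. cmod (g (of_real x * cis \<phi>)) < A * exp (B * x powr k)"
    if ab: "a \<le> b \<and> {a..b} \<subseteq> {d - \<alpha> / 2<..<d + \<alpha> / 2} - {d}" for a b
  proof -
    from f ab obtain A B where "A > 0" "B > 0" "\<forall>\<phi>\<in>{a..b}. \<forall>x>0. cmod (f (of_real x * cis \<phi>)) < A * exp (B * x powr k)"
      unfolding slit_Ok_def by blast
    then show ?thesis using ge[OF conjunct2[OF ab]] by (intro exI[of _ A] conjI exI[of _ B]) auto
  qed
  ultimately show ?thesis unfolding slit_Ok_def by blast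
qed

text \<open>
  The sums on both sides of the slit and the power series in the disc are restrictions of one function.
  The bound \<open>\<alpha> \<le> 2 * pi\<close> keeps the two sides from overlapping behind the origin.
\<close>

lemma slit_function_exists:
  assumes r: "0 \<le> r" and H1: "strip_sum r k L d b H1" and H2: "strip_sum r k d R b H2" and d: "L < d" "d < R"
    and \<alpha>: "0 < \<alpha>" "\<alpha> \<le> 2 * pi" "\<alpha> / 2 \<le> d - L" "\<alpha> / 2 \<le> R - d"
    and conv: "0 < \<rho>" "\<And>t. t \<in> ball 0 \<rho> \<Longrightarrow> summable (\<lambda>n. b n 0 * t ^ n)"
  shows "\<exists>V. slit_Ok k d \<alpha> \<rho> V \<and> (\<forall>t\<in>ball 0 \<rho>. (\<lambda>n. b n 0 * t ^ n) sums V t) \<and>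
     (\<forall>\<sigma>. d < Im \<sigma> \<and> Im \<sigma> < d + \<alpha> / 2 \<longrightarrow> V (exp \<sigma>) = H2 \<sigma> 0) \<and>
     (\<forall>\<sigma>. d - \<alpha> / 2 < Im \<sigma> \<and> Im \<sigma> < d \<longrightarrow> V (exp \<sigma>) = H1 \<sigma> 0)"
proof -
  have z0: "0 \<in> cball (0::complex) r" using r by simp
  define F where "F t = suminf (\<lambda>n. b n 0 * t ^ n)" for t
  have F: "(\<lambda>n. b n 0 * t ^ n) sums F t" if "t \<in> ball 0 \<rho>" for t
    using conv(2)[OF that] by (simp add: F_def summable_sums)
  have Fhol: "F holomorphic_on ball 0 \<rho>" using F by (intro power_series_holomorphic[where a = "\<lambda>n. b n 0"]) simp
  let ?P = "exp ` strip d (d + \<alpha> / 2)" and ?M = "exp ` strip (d - \<alpha> / 2) d"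
  have lgP: "log_branch d (exp \<sigma>) = \<sigma>" if "\<sigma> \<in> strip d (d + \<alpha> / 2) \<union> strip (d - \<alpha> / 2) d" for \<sigma>
    using that \<alpha>(2) by (intro log_branch_exp) (auto simp: strip_def abs_less_iff)
  have disj: "t \<notin> ?M" if "t \<in> ?P" for t
  proof
    assume "t \<in> ?M"
    then obtain \<sigma>' where \<sigma>': "\<sigma>' \<in> strip (d - \<alpha> / 2) d" "t = exp \<sigma>'" by blast
    from that obtain \<sigma> where \<sigma>: "\<sigma> \<in> strip d (d + \<alpha> / 2)" "t = exp \<sigma>" by blast
    have "\<sigma> = \<sigma>'" using lgP[of \<sigma>] lgP[of \<sigma>'] \<sigma> \<sigma>' by simp
    with \<sigma>(1) \<sigma>'(1) show False by (simp add: strip_def)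
  qed
  have lg_hol: "log_branch d holomorphic_on ?P" "log_branch d holomorphic_on ?M"
    by (rule holomorphic_on_subset[OF log_branch_holomorphic]; use \<alpha>(2) in \<open>auto simp: strip_def abs_less_iff\<close>)+
  have Hhol: "(\<lambda>\<sigma>. H2 \<sigma> 0) holomorphic_on strip d R" "(\<lambda>\<sigma>. H1 \<sigma> 0) holomorphic_on strip L d"
    by (rule eholomorphic_pointwise[OF strip_sumD(1)[OF H2] r open_strip] eholomorphic_pointwise[OF strip_sumD(1)[OF H1] r open_strip])+
  have hol2: "(\<lambda>t. H2 (log_branch d t) 0) holomorphic_on ?P"
    by (rule holomorphic_on_compose_gen[OF lg_hol(1) Hhol(1), unfolded comp_def]) (use lgP \<alpha> in \<open>auto simp: strip_def\<close>)
  have hol1: "(\<lambda>t. H1 (log_branch d t) 0) holomorphic_on ?M"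
    by (rule holomorphic_on_compose_gen[OF lg_hol(2) Hhol(2), unfolded comp_def]) (use lgP \<alpha> in \<open>auto simp: strip_def\<close>)
  define V where "V t = (if t \<in> ball 0 \<rho> then F t else if t \<in> ?P then H2 (log_branch d t) 0 else H1 (log_branch d t) 0)" for t
  have FH2: "F (exp \<sigma>) = H2 \<sigma> 0" if "\<sigma> \<in> strip d (d + \<alpha> / 2)" "exp \<sigma> \<in> ball 0 \<rho>" for \<sigma>
  proof -
    have "(\<lambda>n. b n 0 * exp \<sigma> ^ n) sums H2 \<sigma> 0"
      using that \<alpha> by (intro strip_sum_power_series[OF H2 d(2) r z0 conv]) (auto simp: strip_def)
    then show ?thesis using F[OF that(2)] sums_unique2 by blast
  qed
  have FH1: "F (exp \<sigma>) = H1 \<sigma> 0" if "\<sigma> \<in> strip (d - \<alpha> / 2) d" "exp \<sigma> \<in> ball 0 \<rho>" for \<sigma>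
  proof -
    have "(\<lambda>n. b n 0 * exp \<sigma> ^ n) sums H1 \<sigma> 0"
      using that \<alpha> by (intro strip_sum_power_series[OF H1 d(1) r z0 conv]) (auto simp: strip_def)
    then show ?thesis using F[OF that(2)] sums_unique2 by blast
  qed
  have V2: "V (exp \<sigma>) = H2 \<sigma> 0" if "\<sigma> \<in> strip d (d + \<alpha> / 2)" for \<sigma>
    using FH2[OF that] lgP[of \<sigma>] that by (simp add: V_def)
  have V1: "V (exp \<sigma>) = H1 \<sigma> 0" if "\<sigma> \<in> strip (d - \<alpha> / 2) d" for \<sigma>
  proof -
    have "exp \<sigma> \<notin> ?P" using disj that by blast
    then show ?thesis using FH1[OF that] lgP[of \<sigma>] that unfolding V_def by simp
  qed
  have "V holomorphic_on ball 0 \<rho> \<union> (?P \<union> ?M)"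
    unfolding V_def
  proof (intro holomorphic_on_If_Un Fhol hol2 hol1 open_ball open_exp_image open_strip open_Un)
    fix t assume "t \<in> ball 0 \<rho>" "t \<in> ?P \<union> ?M"
    then show "F t = (if t \<in> ?P then H2 (log_branch d t) 0 else H1 (log_branch d t) 0)"
      using FH1 FH2 lgP disj by (auto simp del: mem_ball_0)
  qed (use disj in blast)
  then have hol: "V holomorphic_on slit_domain d \<alpha> \<rho>" using slit_domain_eq[OF \<alpha>(1,2)] by simp
  have growth: "\<exists>A>0. \<exists>B>0. \<forall>\<phi>\<in>{x..y}. \<forall>\<rho>>0. cmod (V (of_real \<rho> * cis \<phi>)) < A * exp (B * \<rho> powr k)"
    if xy: "x \<le> y" "{x..y} \<subseteq> {d - \<alpha> / 2<..<d + \<alpha> / 2} - {d}" for x y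
  proof -
    have "x \<in> {d - \<alpha> / 2<..<d + \<alpha> / 2} - {d}" "y \<in> {d - \<alpha> / 2<..<d + \<alpha> / 2} - {d}" "d \<notin> {x..y}" using xy by auto
    then have "(d < x \<and> y < d + \<alpha> / 2) \<or> (d - \<alpha> / 2 < x \<and> y < d)" by auto
    then obtain H where H: "(strip_sum r k d R b H \<and> d < x \<and> y < R) \<or> (strip_sum r k L d b H \<and> L < x \<and> y < d)"
      "\<And>\<sigma>. Im \<sigma> \<in> {x..y} \<Longrightarrow> V (exp \<sigma>) = H \<sigma> 0"
    proof
      assume "d < x \<and> y < d + \<alpha> / 2"
      then show thesis using that[of H2] H2 \<alpha>(4) V2 by (simp add: strip_def)
    next
      assume "d - \<alpha> / 2 < x \<and> y < d"
      then show thesis using that[of H1] H1 \<alpha>(3) V1 by (simp add: strip_def)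
    qed
    obtain A B where AB: "A > 0" "B > 0" "\<And>\<sigma>. Im \<sigma> \<in> {x..y} \<Longrightarrow> cmod (H \<sigma> 0) \<le> A * exp (B * exp (k * Re \<sigma>))"
      using H(1) strip_sumD(2) z0 by meson
    have "cmod (V (of_real p * cis \<phi>)) < (A + 1) * exp (B * p powr k)" if "\<phi> \<in> {x..y}" "p > 0" for \<phi> p
    proof -
      have e: "of_real p * cis \<phi> = exp (Complex (ln p) \<phi>)" using that by (simp add: of_real_mult_cis)
      have "cmod (V (of_real p * cis \<phi>)) \<le> A * exp (B * p powr k)"
        unfolding e using H(2)[of "Complex (ln p) \<phi>"] AB(3)[of "Complex (ln p) \<phi>"] that by (simp add: powr_def)
      also have "\<dots> < (A + 1) * exp (B * p powr k)" by (simp add: algebra_simps)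
      finally show ?thesis .
    qed
    then show ?thesis using AB by (intro exI[of _ "A + 1"] conjI exI[of _ B]) auto
  qed
  have "slit_Ok k d \<alpha> \<rho> V" unfolding slit_Ok_def using hol growth by blast
  moreover have "(\<lambda>n. b n 0 * t ^ n) sums V t" if "t \<in> ball 0 \<rho>" for t using F[OF that] that by (simp add: V_def)
  moreover have "V (exp \<sigma>) = H2 \<sigma> 0" if "d < Im \<sigma>" "Im \<sigma> < d + \<alpha> / 2" for \<sigma> using V2[of \<sigma>] that by (simp add: strip_def)
  moreover have "V (exp \<sigma>) = H1 \<sigma> 0" if "d - \<alpha> / 2 < Im \<sigma>" "Im \<sigma> < d" for \<sigma> using V1[of \<sigma>] that by (simp add: strip_def)
  ultimately show ?thesis by blast
qed

section \<open>The kernel of a sequence preserving summability\<close>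

text \<open>
  In every direction but \<open>0\<close> the pole at \<open>1\<close> stays at a positive distance from a disc-sector. The constants are
  cut off outside the closed unit disc in \<open>z\<close> in order to lie in the space.
\<close>

lemma geometric_sectorial_sum:
  assumes \<theta>: "\<theta> \<in> {0<..<2 * pi}"
  shows "\<exists>\<alpha> R g. sectorial_sum 1 1 \<theta> \<alpha> R (\<lambda>n z. if z \<in> cball 0 1 then 1 else 0) g"
proof -
  define \<delta> where "\<delta> = min \<theta> (2 * pi - \<theta>) / 2"
  have \<delta>: "0 < \<delta>" "\<delta> \<le> pi / 2" "2 * \<delta> \<le> \<theta>" "\<theta> \<le> 2 * pi - 2 * \<delta>" using \<theta> by (auto simp: \<delta>_def min_def)
  define \<kappa> where "\<kappa> = min (1 / 2) (sin \<delta>)"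
  have \<kappa>: "0 < \<kappa>" using \<delta> by (auto simp: \<kappa>_def intro!: sin_gt_zero)
  let ?DS = "disc_sector \<theta> (2 * \<delta>) (1 / 2)"
  define g where "g t z = (if z \<in> cball 0 1 then 1 / (1 - t) else 0)" for t z :: complex
  have away: "\<kappa> \<le> cmod (1 - t)" if t: "t \<in> ?DS" for t
  proof (cases "t \<in> ball 0 (1 / 2)")
    case True
    then have "1 / 2 \<le> cmod (1 - t)" using norm_triangle_ineq2[of 1 t] by simp
    then show ?thesis by (simp add: \<kappa>_def)
  next
    case False
    with t obtain x \<phi> where x: "t = of_real x * cis \<phi>" "0 < x" "\<bar>\<phi> - \<theta>\<bar> < \<delta>" by (auto simp: disc_sector_def sector_def)
    have "cos \<phi> \<le> cos \<delta>"
    proof (cases "\<phi> \<le> pi")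
      case True
      then show ?thesis using x(3) \<delta> by (intro cos_monotone_0_pi_le) auto
    next
      case False
      then have "cos (2 * pi - \<phi>) \<le> cos \<delta>" using x(3) \<delta> by (intro cos_monotone_0_pi_le) auto
      then show ?thesis by simp
    qed
    then have "x * cos \<phi> \<le> x * cos \<delta>" using x(2) by (intro mult_left_mono) auto
    have "(sin \<delta>)\<^sup>2 \<le> (x - cos \<delta>)\<^sup>2 + (sin \<delta>)\<^sup>2" by simp
    also have "\<dots> = x\<^sup>2 - 2 * (x * cos \<delta>) + 1" by (simp add: power2_diff sin_squared_eq)
    also have "\<dots> \<le> x\<^sup>2 - 2 * (x * cos \<phi>) + 1" using \<open>x * cos \<phi> \<le> x * cos \<delta>\<close> by simp
    also have "\<dots> = (cmod (1 - t))\<^sup>2"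
    proof -
      have "x\<^sup>2 = x\<^sup>2 * (cos \<phi>)\<^sup>2 + x\<^sup>2 * (sin \<phi>)\<^sup>2" by (simp flip: distrib_left)
      then show ?thesis unfolding cmod_power2 x(1) by (simp add: power2_diff power_mult_distrib)
    qed
    finally have "sin \<delta> \<le> cmod (1 - t)" by (rule power2_le_imp_le) simp
    then show ?thesis by (simp add: \<kappa>_def)
  qed
  have "sectorial_sum 1 1 \<theta> (2 * \<delta>) (1 / 2) (\<lambda>n z. if z \<in> cball 0 1 then 1 else 0) g"
  proof (rule sectorial_sumI[where A = "1 / \<kappa>" and B = 1])
    show "g t \<in> carr (O_space 1)" for t
      unfolding carr_O_space g_def
      by (auto intro: continuous_on_eq[OF continuous_on_const] holomorphic_transform[OF holomorphic_on_const])
    show "(\<lambda>t. g t z) holomorphic_on ?DS" for z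
    proof -
      have "1 - t \<noteq> 0" if "t \<in> ?DS" for t using away[OF that] \<kappa> by auto
      then have "(\<lambda>t. 1 / (1 - t)) holomorphic_on ?DS" by (intro holomorphic_intros)
      then show ?thesis by (cases "z \<in> cball 0 1") (simp_all add: g_def)
    qed
    show "cmod (g t z) \<le> 1 / \<kappa> * exp (1 * cmod t powr 1)" if "t \<in> ?DS" for t z
    proof -
      have "cmod (g t z) \<le> 1 / cmod (1 - t)" by (simp add: g_def norm_divide)
      also have "\<dots> \<le> 1 / \<kappa>" using away[OF that] \<kappa> by (intro divide_left_mono mult_pos_pos) auto
      also have "\<dots> \<le> 1 / \<kappa> * exp (1 * cmod t powr 1)"
        using mult_left_mono[of 1 "exp (1 * cmod t powr 1)" "1 / \<kappa>"] \<kappa> by simp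
      finally show ?thesis .
    qed
    show "(\<lambda>t. g t z) has_fps_expansion Abs_fps (\<lambda>n. if z \<in> cball 0 1 then 1 else 0)" if "z \<in> cball 0 1" for z
    proof (rule has_fps_expansionI)
      have "\<forall>\<^sub>F u in nhds (0::complex). u \<in> ball 0 1" by (intro eventually_nhds_in_open) auto
      then show "\<forall>\<^sub>F u in nhds 0. (\<lambda>n. fps_nth (Abs_fps (\<lambda>n. if z \<in> cball 0 1 then 1 else 0)) n * u ^ n) sums g u z"
        using that by (auto elim!: eventually_mono simp: g_def intro!: geometric_sums)
    qed
  qed (use \<delta> \<kappa> in auto)
  then show ?thesis by blast
qed

text \<open>
  The geometric series is the Borel transform of order \<open>1\<close> of the series with coefficients \<open>n!\<close>, which is therefore
  summable in every direction except \<open>0\<close>. As \<open>m\<close> preserves summability, so is the series with coefficients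
  \<open>m n * n!\<close>, whose Borel transform is the kernel; the directions between \<open>0\<close> and \<open>2 * pi\<close> glue to the
  plane slit along the nonnegative reals.
\<close>

lemma e_kernel_continuation:
  assumes m: "preserves_summability m" and A: "0 < A" and mA: "\<And>i. m i \<le> A ^ i"
  shows "e_kernel m A holomorphic_on kernel_dom A \<and>
    (\<forall>z\<in>ball 0 (1 / A). (\<lambda>n. of_real (m n) * z ^ n) sums e_kernel m A z)"
proof -
  have mpos: "0 < m n" for n using m by (simp add: preserves_summability_def)
  have pres: "k_summable (O_space 1) 1 d u \<longleftrightarrow> k_summable (O_space 1) 1 d (borel_transform m u)"
    if "\<And>n. u n \<in> carr (O_space 1)" for u :: "nat \<Rightarrow> complex \<Rightarrow> complex" and d
    using m that complex_banach_O_space[of 1] unfolding preserves_summability_def by (metis zero_less_one)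
  let ?G = "Gamma_seq (1 / 1)"
  have G: "0 < ?G n" for n by (rule Gamma_seq_pos) simp
  define u :: "nat \<Rightarrow> complex \<Rightarrow> complex" where "u n z = (if z \<in> cball 0 1 then of_real (?G n) else 0)" for n z
  define u' where "u' n z = of_real (m n) * u n z" for n z
  have uc: "u n \<in> carr (O_space 1)" for n
    unfolding carr_O_space u_def
    by (auto intro: continuous_on_eq[OF continuous_on_const] holomorphic_transform[OF holomorphic_on_const])
  have u'c: "u' n \<in> carr (O_space 1)" for n unfolding u'_def by (intro O_space_scale uc)
  have bu: "borel_transform ?G u = (\<lambda>n z. if z \<in> cball 0 1 then 1 else 0)"
    using G by (auto simp: borel_transform_def u_def fun_eq_iff less_le)
  have bu': "borel_transform ?G u' = (\<lambda>n z. if z \<in> cball 0 1 then of_real (m n) else 0)"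
    using G by (auto simp: borel_transform_def u'_def u_def fun_eq_iff less_le)
  have mu': "borel_transform m u' = u"
    using mpos by (auto simp: borel_transform_def u'_def fun_eq_iff less_le)
  have "\<exists>\<alpha> R g. sectorial_sum 1 1 \<theta> \<alpha> R (borel_transform ?G u') g" if "\<theta> \<in> {0<..<2 * pi}" for \<theta>
  proof -
    have "k_summable (O_space 1) 1 \<theta> u"
      using geometric_sectorial_sum[OF that] k_summable_iff_sectorial_sum[of 1 1 u \<theta>, OF _ _ uc] unfolding bu by simp
    then have "k_summable (O_space 1) 1 \<theta> u'" using pres[of u', OF u'c] mu' by simp
    then show ?thesis using k_summable_iff_sectorial_sum[of 1 1 u' \<theta>, OF _ _ u'c] by simp
  qed
  then obtain H where H: "strip_sum 1 1 0 (2 * pi) (borel_transform ?G u') H"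
    using strip_sum_exists[of 1 1 0 "2 * pi"] by (metis pi_gt_zero zero_le_one zero_less_one zero_less_mult_iff zero_less_numeral)
  define F where "F z = suminf (\<lambda>n. of_real (m n) * z ^ n)" for z :: complex
  have summ: "summable (\<lambda>n. of_real (m n) * z ^ n)" if z: "z \<in> ball 0 (1 / A)" for z :: complex
  proof (rule summable_comparison_test')
    have "A * cmod z < 1" using z A by (simp add: field_simps)
    then show "summable (\<lambda>n. (A * cmod z) ^ n)" using A by (intro summable_geometric) simp
    show "cmod (of_real (m n) * z ^ n) \<le> (A * cmod z) ^ n" if "n \<ge> 0" for n
      using mA[of n] mpos[of n] by (simp add: norm_mult norm_power power_mult_distrib mult_right_mono)
  qed
  have F: "(\<lambda>n. of_real (m n) * z ^ n) sums F z" if "z \<in> ball 0 (1 / A)" for z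
    using summ[OF that] by (simp add: F_def summable_sums)
  have Fhol: "F holomorphic_on ball 0 (1 / A)"
    using F by (intro power_series_holomorphic[where a = "\<lambda>n. of_real (m n)"]) simp
  \<comment> \<open>\<open>Ln (- z) + \<i> * pi\<close> is the logarithm of \<open>z\<close> with argument between \<open>0\<close> and \<open>2 * pi\<close>.\<close>
  define E where "E z = (if z \<in> ball 0 (1 / A) then F z else H (Ln (- z) + \<i> * of_real pi) 0)" for z
  let ?N = "- \<real>\<^sub>\<ge>\<^sub>0 :: complex set"
  have logN: "Ln (- z) + \<i> * of_real pi \<in> strip 0 (2 * pi)" "exp (Ln (- z) + \<i> * of_real pi) = z" "- z \<notin> \<real>\<^sub>\<le>\<^sub>0" if "z \<in> ?N" for z
  proof -
    have z0: "z \<noteq> 0" using that by auto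
    show nz: "- z \<notin> \<real>\<^sub>\<le>\<^sub>0" using that by (auto simp: complex_nonpos_Reals_iff complex_nonneg_Reals_iff)
    then have "Im (Ln (- z)) \<noteq> pi" using z0 by (metis Im_Ln_eq_pi complex_nonpos_Reals_iff less_eq_real_def neg_equal_0_iff_equal)
    then show "Ln (- z) + \<i> * of_real pi \<in> strip 0 (2 * pi)"
      using mpi_less_Im_Ln[of "- z"] Im_Ln_le_pi[of "- z"] z0 by (simp add: strip_def less_le)
    show "exp (Ln (- z) + \<i> * of_real pi) = z" using z0 by (simp add: exp_add)
  qed
  have "E holomorphic_on ball 0 (1 / A) \<union> ?N"
    unfolding E_def
  proof (intro holomorphic_on_If_Un Fhol open_ball open_Compl closed_nonneg_Reals_complex)
    have "(\<lambda>\<sigma>. H \<sigma> 0) holomorphic_on strip 0 (2 * pi)"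
      by (rule eholomorphic_pointwise[OF strip_sumD(1)[OF H] _ open_strip]) simp
    then show "(\<lambda>z. H (Ln (- z) + \<i> * of_real pi) 0) holomorphic_on ?N"
      by (rule holomorphic_on_compose_gen[rotated, unfolded comp_def])
         (use logN in \<open>auto intro!: holomorphic_intros\<close>)
    fix z assume z: "z \<in> ball 0 (1 / A)" "z \<in> ?N"
    let ?\<sigma> = "Ln (- z) + \<i> * of_real pi"
    have "(\<lambda>n. borel_transform ?G u' n 0 * exp ?\<sigma> ^ n) sums H ?\<sigma> 0"
    proof (rule strip_sum_power_series[OF H, where \<rho> = "1 / A"])
      show "summable (\<lambda>n. borel_transform ?G u' n 0 * t ^ n)" if "t \<in> ball 0 (1 / A)" for t
        using summ[OF that] unfolding bu' by simp
      show "exp (Re ?\<sigma>) < 1 / A" using logN(2)[OF z(2)] z(1) by (metis norm_exp_eq_Re mem_ball_0)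
    qed (use A logN(1)[OF z(2)] in auto)
    then show "F z = H ?\<sigma> 0" unfolding bu' logN(2)[OF z(2)] using F[OF z(1)] sums_unique2 by simp
  qed
  then have "E holomorphic_on kernel_dom A \<and> (\<forall>z\<in>ball 0 (1 / A). (\<lambda>n. of_real (m n) * z ^ n) sums E z)"
    using F by (auto simp: kernel_dom_def E_def)
  then show ?thesis
    unfolding e_kernel_def
    by (rule someI[where P = "\<lambda>e. e holomorphic_on kernel_dom A \<and>
        (\<forall>z\<in>ball 0 (1 / A). (\<lambda>n. of_real (m n) * z ^ n) sums e z)"])
qed

section \<open>The jump across a singular direction\<close>

lemma exp_small:
  assumes "0 < k" "0 < B" "0 < (c::real)"
  shows "\<exists>\<rho>. \<forall>x<\<rho>. B * exp (k * x) < c"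
proof (intro exI[of _ "ln (c / B) / k"] allI impI)
  fix x assume "x < ln (c / B) / k"
  then have "k * x < ln (c / B)" using assms(1) by (simp add: pos_less_divide_eq mult.commute)
  then have "exp (k * x) < exp (ln (c / B))" by (subst exp_less_cancel_iff)
  also have "exp (ln (c / B)) = c / B" using assms by (intro exp_ln divide_pos_pos)
  finally show "B * exp (k * x) < c" using assms(2) by (simp add: pos_less_divide_eq mult.commute)
qed

lemma coefficients_summable:
  assumes S: "sectorial_sum r k d \<alpha> R b g" and r: "0 \<le> r" and c: "\<And>n. \<bar>c n\<bar> \<le> A ^ n" and A: "0 < A"
    and t: "cmod t < R / 2 / A"
  shows "summable (\<lambda>n. of_real (c n) * b n 0 * t ^ n)"
proof -
  have R: "0 < R" using S by (simp add: sectorial_sum_def)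
  obtain M where M: "M \<ge> 0" "\<And>n z. z \<in> cball 0 r \<Longrightarrow> cmod (b n z) \<le> M / (R / 2) ^ n"
    using sectorial_sum_coefficient_bound[OF S r] by blast
  define q where "q = A * cmod t / (R / 2)"
  have q: "0 \<le> q" "q < 1" using A R t by (simp_all add: q_def field_simps)
  show ?thesis
  proof (rule summable_comparison_test')
    show "summable (\<lambda>n. M * q ^ n)" using q by (intro summable_mult summable_geometric) simp
    show "norm (of_real (c n) * b n 0 * t ^ n) \<le> M * q ^ n" if "n \<ge> 0" for n
    proof -
      have "norm (of_real (c n) * b n 0 * t ^ n) \<le> A ^ n * (M / (R / 2) ^ n) * cmod t ^ n"
        unfolding norm_mult norm_power norm_of_real using c M(2)[of 0 n] r A
        by (intro mult_right_mono mult_mono) auto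
      also have "\<dots> = M * q ^ n" by (simp add: q_def power_divide power_mult_distrib)
      finally show ?thesis .
    qed
  qed
qed

text \<open>
  The contour integral recovers the continuation of the Borel transform of \<open>u\<close> on both sides of the slit.
  Replacing it by another representative of its class adds a function that is holomorphic across the
  slit, whose two Laplace integrals agree by rotation of the ray and cancel.
\<close>

lemma jump_formula:
  assumes r: "0 < r" and k: "0 < k" and d: "L < d" "d < R" and uc: "\<And>n. u n \<in> carr (O_space r)"
    and m: "preserves_summability m" and mt: "mt = (\<lambda>i. m i * Gamma_seq (1 / k) i)"
    and summable: "\<And>\<theta>. \<theta> \<in> {L<..<d} \<union> {d<..<R} \<Longrightarrow> k_summable (O_space r) k \<theta> u"
  shows "\<exists>\<alpha> r0 V. 0 < \<alpha> \<and> \<alpha> \<le> 2 * pi \<and> 0 < r0 \<and>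
        slit_Ok k d \<alpha> r0 V \<and>
        (\<forall>\<zeta>\<in>ball 0 r0. (\<lambda>i. borel_transform mt u i 0 * \<zeta> ^ i) sums V \<zeta>) \<and>
        (\<forall>A>0. (\<forall>i. m i \<le> A ^ i) \<longrightarrow>
           (\<forall>s\<in>slit_domain d \<alpha> (r0 / A). \<exists>\<gamma>. surrounding_contour (slit_domain d \<alpha> r0) A s \<gamma>) \<and>
           (\<forall>\<gamma>. (\<forall>s\<in>slit_domain d \<alpha> (r0 / A).
                     surrounding_contour (slit_domain d \<alpha> r0) A s (\<gamma> s)) \<longrightarrow>
              (let g = (\<lambda>s. 1 / (2 * of_real pi * \<i>) *
                          contour_integral (\<gamma> s) (\<lambda>\<zeta>. V \<zeta> / \<zeta> * e_kernel m A (s / \<zeta>)))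
               in slit_Ok k d \<alpha> (r0 / A) g \<and>
                  (\<forall>h\<in>hyper_class k d g. \<forall>\<beta>\<in>{0<..<pi / k}. \<exists>\<delta>>0.
                     \<forall>dm\<in>{d - \<delta><..<d}. \<forall>dp\<in>{d<..<d + \<delta>}. \<exists>\<rho>>0.
                       \<forall>\<tau>\<in>small_sector d \<beta> \<rho>.
                         \<exists>J. has_jump r k dm dp u \<tau> 0 J \<and>
                             has_hyper_action dm dp h (laplace_kernel k \<tau>) J))))"
proof -
  let ?Gs = "Gamma_seq (1 / k)"
  let ?a = "borel_transform ?Gs u" and ?b = "borel_transform mt u"
  have r0: "0 \<le> r" using r by simp
  have z0: "0 \<in> cball (0::complex) r" using r by simp
  have mpos: "0 < m n" for n using m by (simp add: preserves_summability_def)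
  have Gpos: "0 < ?Gs n" for n using k by (intro Gamma_seq_pos) simp
  have bc: "borel_transform m u n \<in> carr (O_space r)" for n by (rule borel_transform_carr[OF uc])
  have bb: "borel_transform ?Gs (borel_transform m u) = ?b"
    unfolding mt borel_transform_def by (simp add: mult.commute)
  have ab: "?a n z = of_real (m n) * ?b n z" for n z
    using mpos[of n] by (simp add: mt borel_transform_def)
  have sum_a: "\<exists>\<alpha> \<rho> g. sectorial_sum r k \<theta> \<alpha> \<rho> ?a g" if "\<theta> \<in> {L<..<d} \<union> {d<..<R}" for \<theta>
    using summable[OF that] k_summable_iff_sectorial_sum[of r k u \<theta>, OF r0 k uc] by simp
  have sum_b: "\<exists>\<alpha> \<rho> g. sectorial_sum r k \<theta> \<alpha> \<rho> ?b g" if "\<theta> \<in> {L<..<d} \<union> {d<..<R}" for \<theta>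
  proof -
    have "k_summable (O_space r) k \<theta> (borel_transform m u)"
      using m summable[OF that] complex_banach_O_space[OF r] k uc unfolding preserves_summability_def by blast
    then show ?thesis using k_summable_iff_sectorial_sum[of r k "borel_transform m u" \<theta>, OF r0 k bc] bb by simp
  qed
  obtain H1 where H1: "strip_sum r k L d ?b H1" using strip_sum_exists[OF r0 k _ d(1)] sum_b by blast
  obtain H2 where H2: "strip_sum r k d R ?b H2" using strip_sum_exists[OF r0 k _ d(2)] sum_b by blast
  obtain K1 where K1: "strip_sum r k L d ?a K1" using strip_sum_exists[OF r0 k _ d(1)] sum_a by blast
  obtain K2 where K2: "strip_sum r k d R ?a K2" using strip_sum_exists[OF r0 k _ d(2)] sum_a by blast
  define \<alpha> where "\<alpha> = min (2 * pi) (min (d - L) (R - d))"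
  have \<alpha>: "0 < \<alpha>" "\<alpha> \<le> 2 * pi" "\<alpha> / 2 \<le> d - L" "\<alpha> / 2 \<le> R - d" using d by (auto simp: \<alpha>_def min_def)
  obtain \<theta>0 where \<theta>0: "L < \<theta>0" "\<theta>0 < d" using dense[OF d(1)] by blast
  then obtain \<alpha>0 \<rho>0 g0 where g0: "sectorial_sum r k \<theta>0 \<alpha>0 \<rho>0 ?b g0" using sum_b[of \<theta>0] by auto
  define R0 where "R0 = \<rho>0 / 2"
  have R0: "0 < R0" using g0 by (simp add: R0_def sectorial_sum_def)
  obtain V where V: "slit_Ok k d \<alpha> R0 V" "\<And>t. t \<in> ball 0 R0 \<Longrightarrow> (\<lambda>n. ?b n 0 * t ^ n) sums V t"
  proof -
    have "summable (\<lambda>n. ?b n 0 * t ^ n)" if "t \<in> ball 0 R0" for t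
      using coefficients_summable[OF g0 r0, of "\<lambda>_. 1" 1 t] that by (simp add: R0_def)
    from slit_function_exists[OF r0 H1 H2 d \<alpha> R0 this] show thesis using that by blast
  qed
  have fpsI: "f has_fps_expansion Abs_fps c" if "0 < \<rho>" and f: "\<And>t. t \<in> ball 0 \<rho> \<Longrightarrow> (\<lambda>n. c n * t ^ n) sums f t" for f :: "complex \<Rightarrow> complex" and c and \<rho> :: real
  proof (rule has_fps_expansionI)
    have ev: "\<forall>\<^sub>F t in nhds (0::complex). t \<in> ball 0 \<rho>" using that(1) by (intro eventually_nhds_in_open) auto
    show "\<forall>\<^sub>F t in nhds 0. (\<lambda>n. fps_nth (Abs_fps c) n * t ^ n) sums f t"
      by (rule eventually_mono[OF ev]) (use f in simp)
  qed
  have main: "(\<forall>s\<in>slit_domain d \<alpha> (R0 / A). \<exists>\<gamma>. surrounding_contour (slit_domain d \<alpha> R0) A s \<gamma>) \<and>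
     (\<forall>\<gamma>. (\<forall>s\<in>slit_domain d \<alpha> (R0 / A). surrounding_contour (slit_domain d \<alpha> R0) A s (\<gamma> s)) \<longrightarrow>
        (let g = (\<lambda>s. 1 / (2 * of_real pi * \<i>) * contour_integral (\<gamma> s) (\<lambda>\<zeta>. V \<zeta> / \<zeta> * e_kernel m A (s / \<zeta>)))
         in slit_Ok k d \<alpha> (R0 / A) g \<and>
            (\<forall>h\<in>hyper_class k d g. \<forall>\<beta>\<in>{0<..<pi / k}. \<exists>\<delta>>0.
               \<forall>dm\<in>{d - \<delta><..<d}. \<forall>dp\<in>{d<..<d + \<delta>}. \<exists>\<rho>>0. \<forall>\<tau>\<in>small_sector d \<beta> \<rho>.
                 \<exists>J. has_jump r k dm dp u \<tau> 0 J \<and> has_hyper_action dm dp h (laplace_kernel k \<tau>) J)))"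
    if A: "0 < A" and mA: "\<forall>i. m i \<le> A ^ i" for A
  proof (intro conjI ballI allI impI)
    have RA: "0 < R0 / A" using R0 A by simp
    have scaled: "of_real A * s \<in> slit_domain d \<alpha> R0" if "s \<in> slit_domain d \<alpha> (R0 / A)" for s
      using A by (intro slit_domain_scale[OF that]) auto
    show "\<exists>\<gamma>. surrounding_contour (slit_domain d \<alpha> R0) A s \<gamma>" if s: "s \<in> slit_domain d \<alpha> (R0 / A)" for s
    proof (rule exists_surrounding_contour[OF open_slit_domain[OF \<alpha>(1,2)]])
      show "closed_segment 0 (of_real A * s) \<subseteq> slit_domain d \<alpha> R0"
        using radial_slit_domain[OF R0, of d \<alpha>] scaled[OF s] unfolding radial_def closed_segment_def
        by (auto simp: scaleR_conv_of_real)
    qed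
    fix \<gamma> assume \<gamma>: "\<forall>s\<in>slit_domain d \<alpha> (R0 / A). surrounding_contour (slit_domain d \<alpha> R0) A s (\<gamma> s)"
    define g where "g s = 1 / (2 * of_real pi * \<i>) * contour_integral (\<gamma> s) (\<lambda>\<zeta>. V \<zeta> / \<zeta> * e_kernel m A (s / \<zeta>))" for s
    have mA': "\<bar>m i\<bar> \<le> A ^ i" for i using mA mpos[of i] by (simp add: abs_of_pos)
    obtain W where W: "slit_Ok k d \<alpha> (R0 / A) W" "\<And>t. t \<in> ball 0 (R0 / A) \<Longrightarrow> (\<lambda>n. ?a n 0 * t ^ n) sums W t"
      and W2: "\<And>\<sigma>. d < Im \<sigma> \<Longrightarrow> Im \<sigma> < d + \<alpha> / 2 \<Longrightarrow> W (exp \<sigma>) = K2 \<sigma> 0"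
      and W1: "\<And>\<sigma>. d - \<alpha> / 2 < Im \<sigma> \<Longrightarrow> Im \<sigma> < d \<Longrightarrow> W (exp \<sigma>) = K1 \<sigma> 0"
    proof -
      have "summable (\<lambda>n. ?a n 0 * t ^ n)" if "t \<in> ball 0 (R0 / A)" for t
        unfolding ab using coefficients_summable[OF g0 r0 mA' A, of t] that by (simp add: R0_def)
      from slit_function_exists[OF r0 K1 K2 d \<alpha> RA this] show thesis using that by blast
    qed
    have gW: "g s = W s" if s: "s \<in> slit_domain d \<alpha> (R0 / A)" for s
      unfolding g_def
    proof (rule contour_integral_multiplier[where \<beta> = "\<lambda>n. ?b n 0" and m = m])
      show "open (slit_domain d \<alpha> R0)" "open (slit_domain d \<alpha> (R0 / A))" by (intro open_slit_domain \<alpha>)+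
      show "radial (slit_domain d \<alpha> R0)" "radial (slit_domain d \<alpha> (R0 / A))" by (intro radial_slit_domain R0 RA)+
      show "V holomorphic_on slit_domain d \<alpha> R0" using V(1) unfolding slit_Ok_def by blast
      show "W holomorphic_on slit_domain d \<alpha> (R0 / A)" using W(1) unfolding slit_Ok_def by blast
      show "V has_fps_expansion Abs_fps (\<lambda>n. ?b n 0)" by (rule fpsI[OF R0 V(2)])
      show "W has_fps_expansion Abs_fps (\<lambda>n. of_real (m n) * ?b n 0)" using fpsI[OF RA W(2)] unfolding ab .
      show "e_kernel m A holomorphic_on kernel_dom A"
        "\<And>z. z \<in> ball 0 (1 / A) \<Longrightarrow> (\<lambda>n. of_real (m n) * z ^ n) sums e_kernel m A z"
        using e_kernel_continuation[OF m A] mA by blast+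
      show "surrounding_contour (slit_domain d \<alpha> R0) A s (\<gamma> s)" using \<gamma> s by blast
    qed (use A mA' s scaled in auto)
    have g_Ok: "slit_Ok k d \<alpha> (R0 / A) g" by (rule slit_Ok_cong[OF W(1) \<alpha>(1,2) gW])
    have jump: "\<exists>\<delta>>0. \<forall>dm\<in>{d - \<delta><..<d}. \<forall>dp\<in>{d<..<d + \<delta>}. \<exists>\<rho>>0. \<forall>\<tau>\<in>small_sector d \<beta> \<rho>.
         \<exists>J. has_jump r k dm dp u \<tau> 0 J \<and> has_hyper_action dm dp h (laplace_kernel k \<tau>) J"
      if h: "h \<in> hyper_class k d g" and \<beta>: "\<beta> \<in> {0<..<pi / k}" for h \<beta>
    proof -
      from h obtain \<alpha>2 R2 f where \<alpha>2: "0 < \<alpha>2" "\<alpha>2 \<le> 2 * pi" "0 < R2" and f: "scalar_Ok k d \<alpha>2 R2 f"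
        and hf: "\<And>s. s \<in> slit_domain d \<alpha>2 R2 \<Longrightarrow> h s - g s = f s"
        unfolding hyper_class_def by blast
      from f have f_hol: "f holomorphic_on disc_sector d \<alpha>2 R2" by (simp add: scalar_Ok_def)
      have "\<alpha>2 / 2 \<in> {0<..<\<alpha>2}" "R2 / 2 \<in> {0<..<R2}" using \<alpha>2 by auto
      then obtain A3 B3 where AB3: "A3 > 0" "B3 > 0"
        "\<And>t. t \<in> disc_sector d (\<alpha>2 / 2) (R2 / 2) \<Longrightarrow> cmod (f t) < A3 * exp (B3 * cmod t powr k)"
        using f unfolding scalar_Ok_def by blast
      \<comment> \<open>Directions this close to \<open>d\<close> make an angle below \<open>pi / (2 * k)\<close> with every \<open>t\<close> in the sector of opening \<open>\<beta>\<close>.\<close>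
      define \<delta> where "\<delta> = Min {(pi / (2 * k) - \<beta> / 2) / 2, \<alpha> / 2, \<alpha>2 / 4}"
      have bk: "\<beta> / 2 < pi / (2 * k)" using \<beta> by (simp flip: divide_divide_eq_left)
      have \<delta>: "0 < \<delta>" "\<delta> \<le> (pi / (2 * k) - \<beta> / 2) / 2" "\<delta> \<le> \<alpha> / 2" "\<delta> \<le> \<alpha>2 / 4"
      proof -
        show "0 < \<delta>" using bk \<alpha>(1) \<alpha>2(1) by (simp add: \<delta>_def)
      qed (unfold \<delta>_def, (rule Min_le; simp only: finite.intros insert_iff simp_thms)+)
      define \<omega> where "\<omega> = k * (\<delta> + \<beta> / 2)"
      have "\<delta> + \<beta> / 2 < pi / (2 * k)" using \<delta>(2) bk by (simp add: field_simps)
      then have "k * (\<delta> + \<beta> / 2) < k * (pi / (2 * k))" using k by (rule mult_strict_left_mono)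
      then have \<omega>: "\<omega> < pi / 2" using k by (simp add: \<omega>_def)
      have "0 < \<omega>" using k \<delta>(1) \<beta> by (simp add: \<omega>_def add_pos_pos)
      then have cos: "0 < cos \<omega>" using \<omega> by (intro cos_gt_zero_pi) auto
      have "\<exists>\<rho>>0. \<forall>\<tau>\<in>small_sector d \<beta> \<rho>. \<exists>J. has_jump r k dm dp u \<tau> 0 J \<and> has_hyper_action dm dp h (laplace_kernel k \<tau>) J"
        if dm: "dm \<in> {d - \<delta><..<d}" and dp: "dp \<in> {d<..<d + \<delta>}" for dm dp
      proof -
        have dm': "dm \<in> {L<..<d}" and dp': "dp \<in> {d<..<R}" using dm dp \<delta>(3) \<alpha>(3,4) by auto
        obtain A1 B1 where AB1: "A1 > 0" "B1 > 0" "ray_bounded r k dm A1 B1 K1"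
          using strip_sum_ray_bounded[OF K1 _ _ r0, of dm dm] dm' by auto
        obtain A2 B2 where AB2: "A2 > 0" "B2 > 0" "ray_bounded r k dp A2 B2 K2"
          using strip_sum_ray_bounded[OF K2 _ _ r0, of dp dp] dp' by auto
        obtain \<rho>1 where \<rho>1: "\<And>x. x < \<rho>1 \<Longrightarrow> (B1 + B2 + B3) * exp (k * x) < cos \<omega> / 2"
          using exp_small[OF k, of "B1 + B2 + B3" "cos \<omega> / 2"] AB1 AB2 AB3 cos by auto
        have "\<exists>J. has_jump r k dm dp u \<tau> 0 J \<and> has_hyper_action dm dp h (laplace_kernel k \<tau>) J"
          if \<tau>: "\<tau> \<in> small_sector d \<beta> (exp \<rho>1)" for \<tau>
        proof -
          have \<tau>': "Re \<tau> < \<rho>1" "\<bar>Im \<tau> - d\<bar> < \<beta> / 2" using \<tau> by (auto simp: small_sector_def)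
          let ?x = "exp (k * Re \<tau>)"
          have "(B1 + B2 + B3) * ?x < cos \<omega> / 2" by (rule \<rho>1[OF \<tau>'(1)])
          moreover have "0 < B1 * ?x" "0 < B2 * ?x" "0 < B3 * ?x" using AB1 AB2 AB3 by auto
          ultimately have B: "B1 * ?x < cos \<omega> / 2" "B2 * ?x < cos \<omega> / 2" "B3 * ?x < cos \<omega> / 2"
            unfolding distrib_right by linarith+
          have ang: "\<bar>k * (\<theta> - Im \<tau>)\<bar> < \<omega>" if "\<theta> \<in> {d - \<delta><..<d + \<delta>}" for \<theta>
          proof -
            have "\<bar>\<theta> - d\<bar> < \<delta>" using that unfolding abs_less_iff by auto
            moreover have "\<bar>\<theta> - Im \<tau>\<bar> \<le> \<bar>\<theta> - d\<bar> + \<bar>Im \<tau> - d\<bar>" by arith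
            ultimately have "\<bar>\<theta> - Im \<tau>\<bar> < \<delta> + \<beta> / 2" using \<tau>'(2) by linarith
            then have "k * \<bar>\<theta> - Im \<tau>\<bar> < k * (\<delta> + \<beta> / 2)" using k by (rule mult_strict_left_mono)
            then show ?thesis using k by (simp add: \<omega>_def abs_mult)
          qed
          have dm_in: "dm \<in> {d - \<delta><..<d + \<delta>}" and dp_in: "dp \<in> {d - \<delta><..<d + \<delta>}" using dm dp \<delta>(1) by auto
          define am where "am = laplace k dm K1 \<tau> 0"
          define ap where "ap = laplace k dp K2 \<tau> 0"
          have am: "has_ray_integral dm (\<lambda>\<sigma>. K1 \<sigma> 0 * laplace_kernel k \<tau> \<sigma>) am"
            unfolding am_def using AB1 ang[OF dm_in] B(1)
            by (intro laplace_has_ray_integral(1)[OF r k _ _ \<omega> _ z0]) (auto simp: conv_region_def)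
          have ap: "has_ray_integral dp (\<lambda>\<sigma>. K2 \<sigma> 0 * laplace_kernel k \<tau> \<sigma>) ap"
            unfolding ap_def using AB2 ang[OF dp_in] B(2)
            by (intro laplace_has_ray_integral(1)[OF r k _ _ \<omega> _ z0]) (auto simp: conv_region_def)
          have "has_jump r k dm dp u \<tau> 0 (ap - am)"
            unfolding has_jump_def
            using strip_sum_has_k_sum[where u = u, OF K1 dm' r0 k uc am] strip_sum_has_k_sum[where u = u, OF K2 dp' r0 k uc ap] by blast
          moreover have "has_hyper_action dm dp h (laplace_kernel k \<tau>) (ap - am)"
          proof -
            have f_in: "exp \<sigma> \<in> disc_sector d (\<alpha>2 / 2) (R2 / 2)" if "\<sigma> \<in> strip (d - \<delta>) (d + \<delta>)" for \<sigma>
            proof (rule exp_in_disc_sector)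
              have "\<bar>Im \<sigma> - d\<bar> < \<delta>" using that unfolding strip_def abs_less_iff by auto
              then show "\<bar>Im \<sigma> - d\<bar> < \<alpha>2 / 2 / 2" using \<delta>(4) by simp
            qed
            have "\<exists>I. (\<forall>\<theta>\<in>{d - \<delta><..<d + \<delta>}. has_ray_integral \<theta> (\<lambda>\<sigma>. f (exp \<sigma>) * laplace_kernel k \<tau> \<sigma>) I) \<and>
                cmod I \<le> 4 * A3 * 1 / cos \<omega> * exp (0 * Re \<tau>)"
            proof (rule laplace_integral_exists[OF k \<omega>, where B = B3])
              show "\<bar>k * (\<theta> - Im \<tau>)\<bar> \<le> \<omega>" if "\<theta> \<in> {d - \<delta><..<d + \<delta>}" for \<theta> using ang[OF that] by simp
              show "exp (0 * x) \<le> 1 * exp (cos \<omega> / 4 * exp (k * x))" for x using cos by simp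
              have "disc_sector d (\<alpha>2 / 2) (R2 / 2) \<subseteq> disc_sector d \<alpha>2 R2" using \<alpha>2 by (intro disc_sector_mono) auto
              then show "(\<lambda>\<sigma>. f (exp \<sigma>)) holomorphic_on strip (d - \<delta>) (d + \<delta>)"
                using f_in by (intro holomorphic_on_compose_gen[OF holomorphic_on_exp f_hol, unfolded comp_def]) blast
              show "cmod (f (exp \<sigma>)) \<le> A3 * (exp (0 * Re \<sigma>) * exp (B3 * exp (k * Re \<sigma>)))" if "\<sigma> \<in> strip (d - \<delta>) (d + \<delta>)" for \<sigma>
                using AB3(3)[OF f_in[OF that]] unfolding exp_powr_norm by simp
            qed (use \<delta>(1) B(3) AB3 in auto)
            then obtain I where I: "\<And>\<theta>. \<theta> \<in> {d - \<delta><..<d + \<delta>} \<Longrightarrow> has_ray_integral \<theta> (\<lambda>\<sigma>. f (exp \<sigma>) * laplace_kernel k \<tau> \<sigma>) I" by blast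
            have h_eq: "h (exp \<sigma>) = W (exp \<sigma>) + f (exp \<sigma>)" if "Im \<sigma> \<in> {d - \<delta><..<d + \<delta>}" "Im \<sigma> \<noteq> d" for \<sigma>
            proof -
              have "\<bar>Im \<sigma> - d\<bar> < \<delta>" using that unfolding abs_less_iff by auto
              then have "\<bar>Im \<sigma> - d\<bar> < \<alpha> / 2" "\<bar>Im \<sigma> - d\<bar> < \<alpha>2 / 2" using \<delta>(3,4) \<alpha>2(1) by auto
              then have "exp \<sigma> \<in> slit_domain d \<alpha> (R0 / A)" "exp \<sigma> \<in> slit_domain d \<alpha>2 R2"
                using that(2) by (auto intro!: exp_in_slit_domain \<alpha>(1,2) \<alpha>2(1,2))
              from gW[OF this(1)] hf[OF this(2)] show ?thesis by (simp add: algebra_simps)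
            qed
            have "has_ray_integral dm (\<lambda>\<sigma>. h (exp \<sigma>) * laplace_kernel k \<tau> \<sigma>) (am + I)"
            proof (subst has_ray_integral_cong)
              show "has_ray_integral dm (\<lambda>\<sigma>. K1 \<sigma> 0 * laplace_kernel k \<tau> \<sigma> + f (exp \<sigma>) * laplace_kernel k \<tau> \<sigma>) (am + I)"
                by (rule has_ray_integral_add[OF am I[OF dm_in]])
              show "h (exp \<sigma>) * laplace_kernel k \<tau> \<sigma> = K1 \<sigma> 0 * laplace_kernel k \<tau> \<sigma> + f (exp \<sigma>) * laplace_kernel k \<tau> \<sigma>"
                if "Im \<sigma> = dm" for \<sigma>
                using h_eq[of \<sigma>] W1[of \<sigma>] that dm dm_in \<delta>(3) by (simp add: distrib_right)
            qed
            moreover have "has_ray_integral dp (\<lambda>\<sigma>. h (exp \<sigma>) * laplace_kernel k \<tau> \<sigma>) (ap + I)"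
            proof (subst has_ray_integral_cong)
              show "has_ray_integral dp (\<lambda>\<sigma>. K2 \<sigma> 0 * laplace_kernel k \<tau> \<sigma> + f (exp \<sigma>) * laplace_kernel k \<tau> \<sigma>) (ap + I)"
                by (rule has_ray_integral_add[OF ap I[OF dp_in]])
              show "h (exp \<sigma>) * laplace_kernel k \<tau> \<sigma> = K2 \<sigma> 0 * laplace_kernel k \<tau> \<sigma> + f (exp \<sigma>) * laplace_kernel k \<tau> \<sigma>"
                if "Im \<sigma> = dp" for \<sigma>
                using h_eq[of \<sigma>] W2[of \<sigma>] that dp dp_in \<delta>(3) by (simp add: distrib_right)
            qed
            ultimately show ?thesis unfolding has_hyper_action_def by (intro exI[of _ "am + I"] exI[of _ "ap + I"]) simp
          qed
          ultimately show ?thesis by blast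
        qed
        then show ?thesis by (intro exI[of _ "exp \<rho>1"]) auto
      qed
      then show ?thesis using \<delta>(1) by blast
    qed
    show "let g = (\<lambda>s. 1 / (2 * of_real pi * \<i>) * contour_integral (\<gamma> s) (\<lambda>\<zeta>. V \<zeta> / \<zeta> * e_kernel m A (s / \<zeta>)))
         in slit_Ok k d \<alpha> (R0 / A) g \<and>
            (\<forall>h\<in>hyper_class k d g. \<forall>\<beta>\<in>{0<..<pi / k}. \<exists>\<delta>>0.
               \<forall>dm\<in>{d - \<delta><..<d}. \<forall>dp\<in>{d<..<d + \<delta>}. \<exists>\<rho>>0. \<forall>\<tau>\<in>small_sector d \<beta> \<rho>.
                 \<exists>J. has_jump r k dm dp u \<tau> 0 J \<and> has_hyper_action dm dp h (laplace_kernel k \<tau>) J)"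
      unfolding g_def[symmetric, abs_def] Let_def by (intro conjI ballI g_Ok jump)
  qed
  show ?thesis
  proof (rule exI[of _ \<alpha>], rule exI[of _ R0], rule exI[of _ V], intro conjI \<alpha>(1,2) R0 V(1))
    show "\<forall>\<zeta>\<in>ball 0 R0. (\<lambda>i. ?b i 0 * \<zeta> ^ i) sums V \<zeta>" using V(2) by blast
  qed (intro allI impI, (rule main; assumption))
qed

section \<open>The family of actual solutions\<close>

text \<open>
  The singular directions are given in one period only, while \<open>d 0\<close> lies in the preceding one; so \<open>\<theta>\<close> could differ
  from a singular direction by \<open>0\<close> or \<open>- 2 * pi\<close>, and monotonicity excludes both.
\<close>

lemma nonsingular_between:
  fixes d :: "nat \<Rightarrow> real"
  assumes range: "\<forall>j\<in>{1..n}. 0 \<le> d j \<and> d j < 2 * pi" and mono: "strict_mono_on {1..n} d"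
    and d0: "d 0 = d n - 2 * pi" and j: "j \<in> {1..n}" and \<theta>: "d (j - 1) < \<theta>" "\<theta> < d j"
  shows "\<not> (\<exists>x\<in>d ` {1..n}. \<exists>q::int. \<theta> = x + 2 * pi * of_int q)"
proof
  assume "\<exists>x\<in>d ` {1..n}. \<exists>q::int. \<theta> = x + 2 * pi * of_int q"
  then obtain i and q :: int where i: "i \<in> {1..n}" and q: "\<theta> = d i + 2 * pi * of_int q" by blast
  have less: "d a < d b" if "a < b" "a \<in> {1..n}" "b \<in> {1..n}" for a b
    using strict_mono_onD[OF mono that(2,3,1)] .
  have le: "d a \<le> d b" if "a \<le> b" "a \<in> {1..n}" "b \<in> {1..n}" for a b
    using less[OF le_neq_implies_less[OF that(1)] that(2,3)] by (cases "a = b") auto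
  have n: "n \<in> {1..n}" using j by simp
  have di: "0 \<le> d i" "d i < 2 * pi" and dj: "d j < 2 * pi" and dn: "0 \<le> d n" using range i j n by blast+
  have low: "- (2 * pi) < \<theta>"
  proof (cases "j = 1")
    case True then show ?thesis using \<theta>(1) d0 dn by simp
  next
    case False
    then have "j - 1 \<in> {1..n}" using j by auto
    then have "0 \<le> d (j - 1)" using range by blast
    moreover have "d (j - 1) < \<theta>" using \<theta>(1) .
    ultimately show ?thesis using pi_gt_zero by linarith
  qed
  have "2 * pi * of_int q < 2 * pi * 1" using q \<theta>(2) dj di by linarith
  then have "q < 1" by (subst (asm) mult_less_cancel_left_pos) auto
  have "2 * pi * (- 2) < 2 * pi * of_int q" using q low di by linarith
  then have "- 2 < real_of_int q" by (subst (asm) mult_less_cancel_left_pos) auto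
  then have "- 2 < q" by linarith
  with \<open>q < 1\<close> consider "q = 0" | "q = - 1" by linarith
  then show False
  proof cases
    case 1
    then have less_j: "d i < d j" "d (j - 1) < d i" using q \<theta> by simp_all
    then have "\<not> j \<le> i" using le[of j i] i j by auto
    then have "i \<le> j - 1" "j - 1 \<in> {1..n}" using i j by auto
    then show False using le[of i "j - 1"] i less_j by auto
  next
    case 2
    then have "d i - 2 * pi > d (j - 1)" using q \<theta>(1) by simp
    moreover have "d i \<le> d n" using le[of i n] i n by auto
    ultimately have "j - 1 \<noteq> 0" using d0 by (metis diff_less_eq diff_add_cancel not_less)
    then have "j - 1 \<in> {1..n}" using j by auto
    then have "0 \<le> d (j - 1)" using range by blast
    then show False using \<open>d i - 2 * pi > d (j - 1)\<close> di by linarith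
  qed
qed

theorem theorem5:
  fixes k r s1 s2 :: real
    and m m1 m2 mt :: "nat \<Rightarrow> real"
    and P :: "complex poly poly"
    and p n :: nat
    and \<phi> u :: "nat \<Rightarrow> complex \<Rightarrow> complex"
    and d :: "nat \<Rightarrow> real"
  assumes k: "0 < k"
    and moments1: "generalized_moments s1 m1"
    and moments2: "generalized_moments s2 m2"
    and order: "degree P = p"
    and r: "0 < r"
    and initial: "\<forall>l<p. \<phi> l holomorphic_on ball 0 r"
    and solution: "formal_solution r P m1 m2 \<phi> u"
    and n: "1 \<le> n"
    and d_range: "\<forall>j\<in>{1..n}. 0 \<le> d j \<and> d j < 2 * pi"
    and d_mono: "strict_mono_on {1..n} d"
    and d_zero: "d 0 = d n - 2 * pi"
    and summable: "k_summable_singular (O_space r) k (d ` {1..n}) u"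
    and m: "preserves_summability m"
    and mt: "mt = (\<lambda>i. m i * Gamma_seq (1 / k) i)"
  shows
    "(\<exists>\<rho>>0. \<exists>v. holomorphic2_on v (ball 0 \<rho> \<times> ball 0 r) \<and>
        (\<forall>t\<in>ball 0 \<rho>. \<forall>z\<in>ball 0 r. (\<lambda>i. borel_transform mt u i z * t ^ i) sums v (t, z))) \<and>
     formal_solution r P (\<lambda>i. mt i * m1 i) m2 \<phi> (borel_transform mt u) \<and>
     (\<forall>j\<in>{1..n}.
        0 < pi / k + d j - d (j - 1) \<and>
        (\<exists>G U. sectorial_region ((d (j - 1) + d j) / 2) (pi / k + d j - d (j - 1)) G \<and>
           holomorphic2_on (\<lambda>(\<tau>, z). U \<tau> z) (G \<times> ball 0 r) \<and>
           actual_solution r k {d (j - 1)<..<d j} P m1 m2 \<phi> G U \<and>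
           (\<forall>\<theta>\<in>{d (j - 1)<..<d j}. \<forall>\<beta>\<in>{0<..<pi / k}. \<exists>\<rho>>0.
              \<forall>\<tau>\<in>small_sector \<theta> \<beta> \<rho>. \<tau> \<in> G \<and>
                (\<forall>z\<in>ball 0 r. has_k_sum r k \<theta> u \<tau> z (U \<tau> z) \<and>
                   has_laplace_like r k m \<theta> (borel_transform mt u) \<tau> z (U \<tau> z))))) \<and>
     (\<forall>j\<in>{1..n}. \<exists>\<alpha> r0 V. 0 < \<alpha> \<and> \<alpha> \<le> 2 * pi \<and> 0 < r0 \<and>
        slit_Ok k (d j) \<alpha> r0 V \<and>
        (\<forall>\<zeta>\<in>ball 0 r0. (\<lambda>i. borel_transform mt u i 0 * \<zeta> ^ i) sums V \<zeta>) \<and>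
        (\<forall>A>0. (\<forall>i. m i \<le> A ^ i) \<longrightarrow>
           (\<forall>s\<in>slit_domain (d j) \<alpha> (r0 / A). \<exists>\<gamma>. surrounding_contour (slit_domain (d j) \<alpha> r0) A s \<gamma>) \<and>
           (\<forall>\<gamma>. (\<forall>s\<in>slit_domain (d j) \<alpha> (r0 / A).
                     surrounding_contour (slit_domain (d j) \<alpha> r0) A s (\<gamma> s)) \<longrightarrow>
              (let g = (\<lambda>s. 1 / (2 * of_real pi * \<i>) *
                          contour_integral (\<gamma> s) (\<lambda>\<zeta>. V \<zeta> / \<zeta> * e_kernel m A (s / \<zeta>)))
               in slit_Ok k (d j) \<alpha> (r0 / A) g \<and>
                  (\<forall>h\<in>hyper_class k (d j) g. \<forall>\<beta>\<in>{0<..<pi / k}. \<exists>\<delta>>0.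
                     \<forall>dm\<in>{d j - \<delta><..<d j}. \<forall>dp\<in>{d j<..<d j + \<delta>}. \<exists>\<rho>>0.
                       \<forall>\<tau>\<in>small_sector (d j) \<beta> \<rho>.
                         \<exists>J. has_jump r k dm dp u \<tau> 0 J \<and>
                             has_hyper_action dm dp h (laplace_kernel k \<tau>) J)))))"
proof (intro conjI ballI)
  let ?b = "borel_transform mt u" and ?Gs = "Gamma_seq (1 / k)"
  have r0: "0 \<le> r" using r by simp
  have uc: "u i \<in> carr (O_space r)" for i using solution by (simp add: formal_solution_def)
  have mpos: "0 < m i" for i using m by (simp add: preserves_summability_def)
  have Gpos: "0 < ?Gs i" for i using k by (intro Gamma_seq_pos) simp
  have mt0: "mt i \<noteq> 0" "mt 0 = 1" for i
    using m less_imp_neq[OF mpos[of i]] less_imp_neq[OF Gpos[of i]] by (simp_all add: mt preserves_summability_def)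
  have bb: "borel_transform ?Gs (borel_transform m u) = ?b"
    unfolding mt borel_transform_def by (simp add: mult.commute)
  have unscale: "(\<lambda>i x. of_real (m i) * ?b i x) = borel_transform ?Gs u"
  proof (intro ext)
    fix i x show "of_real (m i) * ?b i x = borel_transform ?Gs u i x"
      using mpos[of i] by (simp add: mt borel_transform_def)
  qed
  have ksumm: "k_summable (O_space r) k \<theta> u" if "j \<in> {1..n}" "\<theta> \<in> {d (j - 1)<..<d j}" for j \<theta>
    using summable nonsingular_between[OF d_range d_mono d_zero that(1), of \<theta>] that(2)
    unfolding k_summable_singular_def greaterThanLessThan_iff by (simp only: simp_thms)
  have period: "k_summable (O_space r) k \<theta> u" if "k_summable (O_space r) k (\<theta> - 2 * pi) u" for \<theta>
  proof -
    have "\<not> (\<exists>x\<in>d ` {1..n}. \<exists>q::int. \<theta> - 2 * pi = x + 2 * pi * of_int q)"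
      using that summable unfolding k_summable_singular_def by (simp only: simp_thms)
    moreover have "\<theta> - 2 * pi = x + 2 * pi * of_int (q - 1)" if "\<theta> = x + 2 * pi * of_int q" for x and q :: int
      using that by (simp add: algebra_simps)
    ultimately have "\<not> (\<exists>x\<in>d ` {1..n}. \<exists>q::int. \<theta> = x + 2 * pi * of_int q)" by blast
    then show ?thesis using summable unfolding k_summable_singular_def by (simp only: simp_thms)
  qed
  have transform_summable: "k_summable (O_space r) k \<theta> (borel_transform m u)" if "k_summable (O_space r) k \<theta> u" for \<theta>
    using m that complex_banach_O_space[OF r] k uc unfolding preserves_summability_def by blast
  have dlt: "d (j - 1) < d j" if "j \<in> {1..n}" for j
  proof (cases "j = 1")
    case True
    have "0 \<le> d 1" "d n < 2 * pi" using d_range n by auto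
    then show ?thesis using True d_zero by simp
  next
    case False
    then have "j - 1 \<in> {1..n}" "j - 1 < j" using that by auto
    then show ?thesis using strict_mono_onD[OF d_mono _ that] by blast
  qed
  show "\<exists>\<rho>>0. \<exists>v. holomorphic2_on v (ball 0 \<rho> \<times> ball 0 r) \<and>
        (\<forall>t\<in>ball 0 \<rho>. \<forall>z\<in>ball 0 r. (\<lambda>i. ?b i z * t ^ i) sums v (t, z))"
  proof -
    have one: "1 \<in> {1..n}" using n by simp
    obtain \<theta> where \<theta>: "d (1 - 1) < \<theta>" "\<theta> < d 1" using dense[OF dlt[OF one]] by blast
    have "k_summable (O_space r) k \<theta> (borel_transform m u)"
      using \<theta> by (intro transform_summable ksumm[OF one]) simp
    then obtain \<alpha> R g where g: "sectorial_sum r k \<theta> \<alpha> R ?b g"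
      using k_summable_iff_sectorial_sum[of r k "borel_transform m u" \<theta>, OF r0 k borel_transform_carr[where u = u, OF uc]] bb
      by auto
    have R: "0 < R" and hol: "eholomorphic (O_space r) (disc_sector \<theta> \<alpha> R) g"
      using g by (simp_all add: sectorial_sum_def)
    have "eholomorphic (O_space r) (ball 0 R) g"
      by (rule eholomorphic_subset[OF hol]) (simp add: disc_sector_def)
    then have "holomorphic2_on (\<lambda>(t, z). g t z) (ball 0 R \<times> ball 0 r)"
      by (intro eholomorphic_imp_holomorphic2 r0 open_ball)
    moreover have "(\<lambda>i. ?b i z * t ^ i) sums g t z" if "t \<in> ball 0 R" "z \<in> ball 0 r" for t z
      using that by (intro sectorial_sum_sums[OF g r0]) auto
    ultimately show ?thesis using R
      by (intro exI[of _ R] conjI exI[of _ "\<lambda>(t, z). g t z"]) auto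
  qed
  show "formal_solution r P (\<lambda>i. mt i * m1 i) m2 \<phi> ?b"
    by (rule formal_solution_borel_transform[where m = mt and u = u, OF solution r mt0])
  fix j assume j: "j \<in> {1..n}"
  show "0 < pi / k + d j - d (j - 1)" using dlt[OF j] divide_pos_pos[OF pi_gt_zero k] by linarith
  have like: "has_laplace_like r k m \<theta> ?b \<tau> z I"
    if I: "has_k_sum r k \<theta> u \<tau> z I" and \<theta>: "\<theta> \<in> {d (j - 1)<..<d j}" for \<theta> \<tau> z I
  proof -
    obtain f where f: "sector_cont_Ok (O_space r) k \<theta> (borel_transform ?Gs u) f"
      "has_ray_integral \<theta> (\<lambda>\<sigma>. f (exp \<sigma>) z * laplace_kernel k \<tau> \<sigma>) I"
      using I unfolding has_k_sum_def by blast
    have "sector_cont (O_space r) \<theta> (borel_transform ?Gs u) f"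
      using f(1) unfolding sector_cont_Ok_def sector_cont_def Ok_def by blast
    moreover have "\<exists>g. sector_cont_Ok (O_space r) k \<theta> ?b g"
      using transform_summable[OF ksumm[OF j \<theta>]] unfolding k_summable_def bb by blast
    ultimately show ?thesis using f(2) unfolding has_laplace_like_def unscale by blast
  qed
  obtain G U where GU: "sectorial_region ((d (j - 1) + d j) / 2) (pi / k + d j - d (j - 1)) G"
     "holomorphic2_on (\<lambda>(\<tau>, z). U \<tau> z) (G \<times> ball 0 r)"
     "actual_solution r k {d (j - 1)<..<d j} P m1 m2 \<phi> G U"
     and sums: "\<forall>\<theta>\<in>{d (j - 1)<..<d j}. \<forall>\<beta>\<in>{0<..<pi / k}. \<exists>\<rho>>0. \<forall>\<tau>\<in>small_sector \<theta> \<beta> \<rho>.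
        \<tau> \<in> G \<and> (\<forall>z\<in>cball 0 r. has_k_sum r k \<theta> u \<tau> z (U \<tau> z))"
    using actual_solution_between[OF r k dlt[OF j] moments1 solution ksumm[OF j]] by blast
  have laplace: "\<forall>\<theta>\<in>{d (j - 1)<..<d j}. \<forall>\<beta>\<in>{0<..<pi / k}. \<exists>\<rho>>0. \<forall>\<tau>\<in>small_sector \<theta> \<beta> \<rho>. \<tau> \<in> G \<and>
      (\<forall>z\<in>ball 0 r. has_k_sum r k \<theta> u \<tau> z (U \<tau> z) \<and> has_laplace_like r k m \<theta> ?b \<tau> z (U \<tau> z))"
  proof (intro ballI)
    fix \<theta> \<beta> assume \<theta>: "\<theta> \<in> {d (j - 1)<..<d j}" and \<beta>: "\<beta> \<in> {0<..<pi / k}"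
    obtain \<rho> where \<rho>: "\<rho> > 0" "\<forall>\<tau>\<in>small_sector \<theta> \<beta> \<rho>. \<tau> \<in> G \<and> (\<forall>z\<in>cball 0 r. has_k_sum r k \<theta> u \<tau> z (U \<tau> z))"
      using sums \<theta> \<beta> by blast
    show "\<exists>\<rho>>0. \<forall>\<tau>\<in>small_sector \<theta> \<beta> \<rho>. \<tau> \<in> G \<and>
      (\<forall>z\<in>ball 0 r. has_k_sum r k \<theta> u \<tau> z (U \<tau> z) \<and> has_laplace_like r k m \<theta> ?b \<tau> z (U \<tau> z))"
    proof (intro exI[of _ \<rho>] conjI ballI \<rho>(1))
      fix \<tau> assume \<tau>: "\<tau> \<in> small_sector \<theta> \<beta> \<rho>"
      show "\<tau> \<in> G" using \<rho>(2) \<tau> by blast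
      fix z assume "z \<in> ball (0::complex) r"
      then show sum: "has_k_sum r k \<theta> u \<tau> z (U \<tau> z)" using \<rho>(2) \<tau> ball_subset_cball by blast
      show "has_laplace_like r k m \<theta> ?b \<tau> z (U \<tau> z)" by (rule like[OF sum \<theta>])
    qed
  qed
  show "\<exists>G U. sectorial_region ((d (j - 1) + d j) / 2) (pi / k + d j - d (j - 1)) G \<and>
           holomorphic2_on (\<lambda>(\<tau>, z). U \<tau> z) (G \<times> ball 0 r) \<and>
           actual_solution r k {d (j - 1)<..<d j} P m1 m2 \<phi> G U \<and>
           (\<forall>\<theta>\<in>{d (j - 1)<..<d j}. \<forall>\<beta>\<in>{0<..<pi / k}. \<exists>\<rho>>0.
              \<forall>\<tau>\<in>small_sector \<theta> \<beta> \<rho>. \<tau> \<in> G \<and>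
                (\<forall>z\<in>ball 0 r. has_k_sum r k \<theta> u \<tau> z (U \<tau> z) \<and>
                   has_laplace_like r k m \<theta> ?b \<tau> z (U \<tau> z)))"
    by (intro exI[of _ G] exI[of _ U] conjI GU laplace)
  \<comment> \<open>The next singular direction after \<open>d n\<close> is \<open>d 1 + 2 * pi\<close>.\<close>
  define R where "R = (if j < n then d (j + 1) else d 1 + 2 * pi)"
  have dR: "d j < R \<and> (\<forall>\<theta>\<in>{d j<..<R}. k_summable (O_space r) k \<theta> u)"
  proof (cases "j < n")
    case True
    then have "j + 1 \<in> {1..n}" by simp
    from dlt[OF this] ksumm[OF this] show ?thesis using True by (simp add: R_def)
  next
    case False
    then have "j = n" using j by simp
    have one: "1 \<in> {1..n}" using n by simp
    have zero: "d (1 - 1) = d j - 2 * pi" unfolding \<open>j = n\<close> using d_zero by simp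
    have R: "R = d 1 + 2 * pi" using False by (simp add: R_def)
    have "k_summable (O_space r) k \<theta> u" if \<theta>: "\<theta> \<in> {d j<..<R}" for \<theta>
    proof (rule period[OF ksumm[OF one]])
      show "\<theta> - 2 * pi \<in> {d (1 - 1)<..<d 1}" unfolding zero using \<theta> unfolding R by simp
    qed
    moreover have "d j < R" using dlt[OF one] unfolding zero R by linarith
    ultimately show ?thesis by blast
  qed
  show "\<exists>\<alpha> r0 V. 0 < \<alpha> \<and> \<alpha> \<le> 2 * pi \<and> 0 < r0 \<and>
        slit_Ok k (d j) \<alpha> r0 V \<and>
        (\<forall>\<zeta>\<in>ball 0 r0. (\<lambda>i. borel_transform mt u i 0 * \<zeta> ^ i) sums V \<zeta>) \<and>
        (\<forall>A>0. (\<forall>i. m i \<le> A ^ i) \<longrightarrow>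
           (\<forall>s\<in>slit_domain (d j) \<alpha> (r0 / A). \<exists>\<gamma>. surrounding_contour (slit_domain (d j) \<alpha> r0) A s \<gamma>) \<and>
           (\<forall>\<gamma>. (\<forall>s\<in>slit_domain (d j) \<alpha> (r0 / A).
                     surrounding_contour (slit_domain (d j) \<alpha> r0) A s (\<gamma> s)) \<longrightarrow>
              (let g = (\<lambda>s. 1 / (2 * of_real pi * \<i>) *
                          contour_integral (\<gamma> s) (\<lambda>\<zeta>. V \<zeta> / \<zeta> * e_kernel m A (s / \<zeta>)))
               in slit_Ok k (d j) \<alpha> (r0 / A) g \<and>
                  (\<forall>h\<in>hyper_class k (d j) g. \<forall>\<beta>\<in>{0<..<pi / k}. \<exists>\<delta>>0.
                     \<forall>dm\<in>{d j - \<delta><..<d j}. \<forall>dp\<in>{d j<..<d j + \<delta>}. \<exists>\<rho>>0.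
                       \<forall>\<tau>\<in>small_sector (d j) \<beta> \<rho>.
                         \<exists>J. has_jump r k dm dp u \<tau> 0 J \<and>
                             has_hyper_action dm dp h (laplace_kernel k \<tau>) J))))"
    by (rule jump_formula[OF r k dlt[OF j] conjunct1[OF dR] uc m mt]) (use dR ksumm[OF j] in blast)
qed

end
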